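(* Let $\mathcal S=\{S_j\}_{j=1}^N$ be an IFS on $\mathbb R^d$ possessing skeletons and satisfying the open set condition, with invariant set $K$. Then $K$ admits space-filling curves. More precisely, either a rearrangement of $\{S_j\}_{j=1}^N$ is a self-similar zipper, or $K$ admits space-filling curves constructed by the Euler-tour method.
   Context: An IFS is a finite family $\mathcal S=\{S_j\}_{j=1}^N$, $N\ge 2$, of contractive similitudes of $\mathbb R^d$; its invariant set $K$ is the unique nonempty compact set with $K=\bigcup_jS_j(K)$. Put $\Sigma=\{1,\dots,N\}$, $S_I=S_{i_1}\circ\dots\circ S_{i_n}$ for $I=i_1\dots i_n\in\Sigma^n$, and $\mathcal S^n=\{S_I:I\in\Sigma^n\}$ (an IFS indexed by $\Sigma^n$ with the same invariant set). Open set condition: there is a nonempty open $U$ with $\bigcup_iS_i(U)\subset U$ and the $S_i(U)$ pairwise disjoint. Skeleton. For finite $A\subset K$, the Hata graph $H(\mathcal S,A)$ is the undirected graph with vertices $S_1,\dots,S_N$ in which $S_i,S_j$ ($i\neq j$) are adjacent iff $S_i(A)\cap S_j(A)\ne\emptyset$. If $K$ is connected, a finite $A\subset K$ is a skeleton if $A\subset\bigcup_jS_j(A)$ and $H(\mathcal S,A)$ is connected. (So an IFS possessing a skeleton has connected $K$.) A skeleton of $\mathcal S$ is also a skeleton of $\mathcal S^n$. Space-filling curve means optimal parametrization: for a compact $F$ with $0<\mathcal H^s(F)<\infty$, an onto map $\psi:[0,1]\to F$ is an optimal parametrization if (i) there are full-measure $F'\subset F$, $I'\subset[0,1]$ with $\psi:I'\to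 F'$ bijective; (ii) with $c=\mathcal H^s(F)$, $\mathcal H^s(\psi(X))=c\,\mathcal L(X)$ for Borel $X\subset[0,1]$ and $\mathcal L(\psi^{-1}(B))=c^{-1}\mathcal H^s(B)$ for Borel $B\subset F$; (iii) $|\psi(x)-\psi(y)|\le c'|x-y|^{1/s}$ for some $c'>0$ and all $x,y$. Here $s=\dim_HK$. Self-similar zipper. An ordered IFS $(S_j)_{j=1}^N$ is a self-similar zipper if there are points $x_0,\dots,x_N$ and signs $\beta_j\in\{-1,1\}$ such that for each $j$: $S_j(x_0)=x_{j-1}$, $S_j(x_N)=x_j$ if $\beta_j=1$; and $S_j(x_0)=x_j$, $S_j(x_N)=x_{j-1}$ if $\beta_j=-1$. A rearrangement of $\{S_j\}$ is $(S_{\sigma(j)})_{j=1}^N$ for a permutation $\sigma$. Euler-tour method. Walks are written $e_1+\dots+e_k$; a trail is a walk with distinct edges; an Euler tour is a closed trail containing all edges of the graph. For a skeleton with a chosen enumeration $A=\{a_1,\dots,a_m\}$, let $v_j=\overrightarrow{a_ja_{j+1}}$ ($a_{m+1}=a_1$), $v_j^{-1}$ its reverse, $\Lambda=v_1+\dots+v_m$, $\Lambda^{-1}=v_m^{-1}+\dots+v_1^{-1}$, $V^+=\{v_1,\dots,v_m\}$, $V=V^+\cup\{v_1^{-1},\dots,v_m^{-1}\}$ ($2m$ distinct formal edges), $(v^{-1})^{-1}=v$. For $n\ge1$ and $\beta\in\{-1,1\}^{\Sigma^n}$ let $G(\mathcal S^n,A,\beta)=\bigcup_{I\in\Sigma^n}S_I(\Lambda^{\beta_I})$: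 the directed multigraph with an edge $S_I(e)=(e,S_I)$ from $S_I(x)$ to $S_I(y)$ for every $I$ and every edge $e$ of $\Lambda^{\beta_I}$ from $x$ to $y$ (edges with different pairs are different; vertices are points of $\mathbb R^d$). A consistent Euler-partition of it is an Euler tour $P$ written as a concatenation $P=P_1+\dots+P_m$ of trails such that $P_j$ has the same origin and terminus as $v_j$ for every $j$. It induces the edge-to-trail substitution $\tau: v_j\mapsto P_j,\ v_j^{-1}\mapsto P_j^{-1}$, where the reverse of $S_{I_1}(u_1)+\dots+S_{I_\ell}(u_\ell)$ is $S_{I_\ell}(u_\ell^{-1})+\dots+S_{I_1}(u_1^{-1})$. Let $(E_u)_{u\in V}$ be the unique nonempty compact sets with $E_u=\bigcup_{i=1}^{\ell}S_{I_i}(E_{u_i})$ whenever $\tau(u)=S_{I_1}(u_1)+\dots+S_{I_\ell}(u_\ell)$. We say $\tau$ leads to a space-filling curve of $K$ if there is a trail $w_1+\dots+w_k$ of edges of $V$ such that $K=\bigcup_iE_{w_i}$, $\mathcal H^s(E_{w_i}\cap E_{w_j})=0$ for $i\ne j$, each $E_{w_i}$ has an optimal parametrization $\varphi_i$ with $\varphi_i(0),\varphi_i(1)$ the origin and terminus of $w_i$, and the concatenation of $\varphi_1,\dots,\varphi_k$ (with $\varphi_i$ run on an interval of length $\mathcal H^s(E_{w_i})/\mathcal H^s(K)$) is an optimal parametrization of $K$. "$K$ admits space-filling curves constructed by the Euler-tour method" means: there exist a skeleton of $\mathcal S$ with an enumeration $A$, an $n\ge1$, a $\beta\in\{-1,1\}^{\Sigma^n}$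 and a consistent Euler-partition of $G(\mathcal S^n,A,\beta)$ whose induced edge-to-trail substitution leads to a space-filling curve of $K$. *)

theory Defs
  imports
    "HOL-Analysis.Analysis"
    "HOL-Combinatorics.Permutations"
    "Graph_Theory.Graph_Theory"
begin

section \<open>Hausdorff measure and dimension\<close>

text \<open>The case distinction gives points gauge \<open>1\<close> for \<open>s = 0\<close> (counting measure), whereas
  \<open>0 powr 0 = 0\<close>.\<close>

definition diam_power :: "real \<Rightarrow> 'a::metric_space set \<Rightarrow> real" where
  "diam_power s U = (if U = {} then 0 else if s = 0 then 1 else diameter U powr s)"

text \<open>Boundedness is needed because \<^const>\<open>diameter\<close> is a real number, which is unspecified on
  unbounded sets.\<close>

definition hausdorff_premeasure :: "real \<Rightarrow> real \<Rightarrow> 'a::metric_space set \<Rightarrow> ennreal" where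
  "hausdorff_premeasure s \<delta> X =
     (INF U\<in>{U :: nat \<Rightarrow> 'a set.
              X \<subseteq> (\<Union>i. U i) \<and> (\<forall>i. bounded (U i) \<and> diameter (U i) \<le> \<delta>)}.
        \<Sum>i. ennreal (diam_power s (U i)))"

text \<open>As an outer measure, without normalising constant.\<close>

definition hausdorff_measure :: "real \<Rightarrow> 'a::metric_space set \<Rightarrow> ennreal" where
  "hausdorff_measure s X = (SUP \<delta>\<in>{0<..}. hausdorff_premeasure s \<delta> X)"

definition hausdorff_dim :: "'a::metric_space set \<Rightarrow> real" where
  "hausdorff_dim X = Inf {s. 0 \<le> s \<and> hausdorff_measure s X = 0}"

section \<open>Optimal parametrizations\<close>

definition optimal_parametrization ::
    "real \<Rightarrow> 'a::euclidean_space set \<Rightarrow> (real \<Rightarrow> 'a) \<Rightarrow> bool" where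
  "optimal_parametrization s F \<psi> \<longleftrightarrow>
     compact F \<and> 0 < hausdorff_measure s F \<and> hausdorff_measure s F < \<infinity> \<and>
     \<psi> ` {0..1} = F \<and>
     (\<exists>F' I'. F' \<subseteq> F \<and> hausdorff_measure s (F - F') = 0 \<and>
              I' \<subseteq> {0..1} \<and> {0..1} - I' \<in> null_sets lebesgue \<and> bij_betw \<psi> I' F') \<and>
     (\<forall>X\<in>sets borel. X \<subseteq> {0..1} \<longrightarrow>
        hausdorff_measure s (\<psi> ` X) = hausdorff_measure s F * emeasure lebesgue X) \<and>
     (\<forall>B\<in>sets borel. B \<subseteq> F \<longrightarrow>
        emeasure lebesgue {t \<in> {0..1}. \<psi> t \<in> B} = hausdorff_measure s B / hausdorff_measure s F) \<and>
     (\<exists>c'>0. \<forall>x\<in>{0..1}. \<forall>y\<in>{0..1}. norm (\<psi> x - \<psi> y) \<le> c' * \<bar>x - y\<bar> powr (1 / s))"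

section \<open>Iterated function systems\<close>

definition contractive_similitude :: "('a::metric_space \<Rightarrow> 'a) \<Rightarrow> bool" where
  "contractive_similitude f \<longleftrightarrow> (\<exists>r. 0 < r \<and> r < 1 \<and> (\<forall>x y. dist (f x) (f y) = r * dist x y))"

text \<open>The family is \<open>S 1, \<dots>, S N\<close>; values of \<open>S\<close> outside \<open>{1..N}\<close> are irrelevant.\<close>

definition ifs :: "nat \<Rightarrow> (nat \<Rightarrow> 'a::euclidean_space \<Rightarrow> 'a) \<Rightarrow> bool" where
  "ifs N S \<longleftrightarrow> N \<ge> 2 \<and> (\<forall>j\<in>{1..N}. contractive_similitude (S j))"

definition invariant_set ::
    "nat \<Rightarrow> (nat \<Rightarrow> 'a::euclidean_space \<Rightarrow> 'a) \<Rightarrow> 'a set \<Rightarrow> bool" where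
  "invariant_set N S K \<longleftrightarrow> compact K \<and> K \<noteq> {} \<and> K = (\<Union>j\<in>{1..N}. S j ` K)"

definition open_set_condition :: "nat \<Rightarrow> (nat \<Rightarrow> 'a::euclidean_space \<Rightarrow> 'a) \<Rightarrow> bool" where
  "open_set_condition N S \<longleftrightarrow>
     (\<exists>U. open U \<and> U \<noteq> {} \<and> (\<Union>i\<in>{1..N}. S i ` U) \<subseteq> U \<and>
          disjoint_family_on (\<lambda>i. S i ` U) {1..N})"

definition words :: "nat \<Rightarrow> nat \<Rightarrow> nat list set" where
  "words N n = {I. length I = n \<and> set I \<subseteq> {1..N}}"

definition word_map :: "(nat \<Rightarrow> 'a \<Rightarrow> 'a) \<Rightarrow> nat list \<Rightarrow> 'a \<Rightarrow> 'a" where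
  "word_map S I = foldr (\<circ>) (map S I) id"

text \<open>The Hata graph is undirected; it is represented by its symmetric arc relation, with the
  indices of the maps as vertices.\<close>

definition hata_graph ::
    "nat \<Rightarrow> (nat \<Rightarrow> 'a \<Rightarrow> 'a) \<Rightarrow> 'a set \<Rightarrow> nat pair_pre_digraph" where
  "hata_graph N S A =
     \<lparr> pverts = {1..N},
       parcs = {(i, j). i \<in> {1..N} \<and> j \<in> {1..N} \<and> i \<noteq> j \<and> S i ` A \<inter> S j ` A \<noteq> {}} \<rparr>"

text \<open>The first connectedness is topological, the second one graph-theoretic.\<close>

definition skeleton ::
    "nat \<Rightarrow> (nat \<Rightarrow> 'a::euclidean_space \<Rightarrow> 'a) \<Rightarrow> 'a set \<Rightarrow> 'a set \<Rightarrow> bool" where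
  "skeleton N S K A \<longleftrightarrow>
     topological_space_class.connected K \<and> finite A \<and> A \<subseteq> K \<and> A \<subseteq> (\<Union>j\<in>{1..N}. S j ` A) \<and>
     Digraph_Component.connected (with_proj (hata_graph N S A))"

definition self_similar_zipper :: "nat \<Rightarrow> (nat \<Rightarrow> 'a \<Rightarrow> 'a) \<Rightarrow> bool" where
  "self_similar_zipper N S \<longleftrightarrow>
     (\<exists>(x :: nat \<Rightarrow> 'a) (\<beta> :: nat \<Rightarrow> int). \<forall>j\<in>{1..N}.
        \<beta> j \<in> {-1, 1} \<and>
        (\<beta> j = 1 \<longrightarrow> S j (x 0) = x (j - 1) \<and> S j (x N) = x j) \<and>
        (\<beta> j = -1 \<longrightarrow> S j (x 0) = x j \<and> S j (x N) = x (j - 1)))"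

section \<open>The Euler-tour method\<close>

text \<open>An enumeration of a skeleton is a distinct list \<open>as\<close>, indexed from \<open>0\<close>. The edge \<open>Fwd j\<close>
  goes from \<open>as ! j\<close> to its cyclic successor, and \<open>Bwd j\<close> is its formal reverse.\<close>

datatype fedge = Fwd nat | Bwd nat

primrec rev_edge :: "fedge \<Rightarrow> fedge" where
  "rev_edge (Fwd j) = Bwd j"
| "rev_edge (Bwd j) = Fwd j"

primrec origin :: "'a list \<Rightarrow> fedge \<Rightarrow> 'a" where
  "origin as (Fwd j) = as ! j"
| "origin as (Bwd j) = as ! (Suc j mod length as)"

definition terminus :: "'a list \<Rightarrow> fedge \<Rightarrow> 'a" where
  "terminus as e = origin as (rev_edge e)"

definition edge_graph :: "'a list \<Rightarrow> ('a, fedge) pre_digraph" where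
  "edge_graph as =
     \<lparr> verts = set as, arcs = Fwd ` {..<length as} \<union> Bwd ` {..<length as},
       tail = origin as, head = terminus as \<rparr>"

definition Lambda :: "'a list \<Rightarrow> fedge list" where
  "Lambda as = map Fwd [0..<length as]"

definition Lambda_pow :: "'a list \<Rightarrow> int \<Rightarrow> fedge list" where
  "Lambda_pow as b = (if b = 1 then Lambda as else map rev_edge (rev (Lambda as)))"

text \<open>The arc \<open>(e, I)\<close> is the edge \<open>S_I(e)\<close> of the directed multigraph \<open>G(S^n, A, \<beta>)\<close>.\<close>

definition euler_graph ::
    "nat \<Rightarrow> (nat \<Rightarrow> 'a \<Rightarrow> 'a) \<Rightarrow> nat \<Rightarrow> 'a list \<Rightarrow> (nat list \<Rightarrow> int)
       \<Rightarrow> ('a, fedge \<times> nat list) pre_digraph" where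
  "euler_graph N S n as \<beta> =
     \<lparr> verts = (\<Union>I\<in>words N n. word_map S I ` set as),
       arcs = {(e, I). I \<in> words N n \<and> e \<in> set (Lambda_pow as (\<beta> I))},
       tail = (\<lambda>(e, I). word_map S I (origin as e)),
       head = (\<lambda>(e, I). word_map S I (terminus as e)) \<rparr>"

text \<open>\<open>Ps\<close> is the list of the trails \<open>P_1, \<dots>, P_m\<close>. Every vertex of the graph is an endpoint
  of some arc, so an Euler tour, as a closed trail through all arcs, is the same as a closed
  \<^const>\<open>pre_digraph.euler_trail\<close>.\<close>

definition consistent_euler_partition ::
    "nat \<Rightarrow> (nat \<Rightarrow> 'a \<Rightarrow> 'a) \<Rightarrow> nat \<Rightarrow> 'a list \<Rightarrow> (nat list \<Rightarrow> int)
       \<Rightarrow> (fedge \<times> nat list) list list \<Rightarrow> bool" where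
  "consistent_euler_partition N S n as \<beta> Ps \<longleftrightarrow>
     length Ps = length as \<and>
     (\<exists>x. pre_digraph.euler_trail (euler_graph N S n as \<beta>) x (concat Ps) x) \<and>
     (\<forall>j<length as.
        pre_digraph.trail (euler_graph N S n as \<beta>)
          (origin as (Fwd j)) (Ps ! j) (terminus as (Fwd j)))"

primrec edge_to_trail ::
    "(fedge \<times> nat list) list list \<Rightarrow> fedge \<Rightarrow> (fedge \<times> nat list) list" where
  "edge_to_trail Ps (Fwd j) = Ps ! j"
| "edge_to_trail Ps (Bwd j) = map (\<lambda>(e, I). (rev_edge e, I)) (rev (Ps ! j))"

definition invariant_sets ::
    "(nat \<Rightarrow> 'a::euclidean_space \<Rightarrow> 'a) \<Rightarrow> fedge set \<Rightarrow> (fedge \<Rightarrow> (fedge \<times> nat list) list)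
       \<Rightarrow> (fedge \<Rightarrow> 'a set) \<Rightarrow> bool" where
  "invariant_sets S V \<tau> E \<longleftrightarrow>
     (\<forall>u\<in>V. compact (E u) \<and> E u \<noteq> {} \<and> E u = (\<Union>(e, I)\<in>set (\<tau> u). word_map S I ` E e))"

text \<open>Concatenation of curves \<open>\<phi>\<close> on \<open>{0..1}\<close>, each run on an interval of the given length \<open>l\<close>.\<close>

primrec concat_curves :: "(real \<times> (real \<Rightarrow> 'a)) list \<Rightarrow> real \<Rightarrow> 'a" where
  "concat_curves [] t = undefined"
| "concat_curves (p # ps) t =
     (case p of (l, \<phi>) \<Rightarrow> if t \<le> l then \<phi> (t / l) else concat_curves ps (t - l))"

text \<open>The family \<open>E\<close> is uniquely determined on the edges, so quantifying it existentially
  amounts to naming it.\<close>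

definition leads_to_space_filling_curve ::
    "(nat \<Rightarrow> 'a::euclidean_space \<Rightarrow> 'a) \<Rightarrow> 'a set \<Rightarrow> 'a list
       \<Rightarrow> (fedge \<Rightarrow> (fedge \<times> nat list) list) \<Rightarrow> bool" where
  "leads_to_space_filling_curve S K as \<tau> \<longleftrightarrow>
     (\<exists>E ws x y (\<phi> :: nat \<Rightarrow> real \<Rightarrow> 'a). let s = hausdorff_dim K; k = length ws in
        invariant_sets S (arcs (edge_graph as)) \<tau> E \<and>
        pre_digraph.trail (edge_graph as) x ws y \<and>
        K = (\<Union>i<k. E (ws ! i)) \<and>
        (\<forall>i<k. \<forall>j<k. i \<noteq> j \<longrightarrow> hausdorff_measure s (E (ws ! i) \<inter> E (ws ! j)) = 0) \<and>
        (\<forall>i<k. optimal_parametrization s (E (ws ! i)) (\<phi> i) \<and>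
               \<phi> i 0 = origin as (ws ! i) \<and> \<phi> i 1 = terminus as (ws ! i)) \<and>
        optimal_parametrization s K
          (concat_curves
             (map (\<lambda>i. (enn2real (hausdorff_measure s (E (ws ! i)) / hausdorff_measure s K), \<phi> i))
                  [0..<k])))"

definition euler_tour_space_filling ::
    "nat \<Rightarrow> (nat \<Rightarrow> 'a::euclidean_space \<Rightarrow> 'a) \<Rightarrow> 'a set \<Rightarrow> bool" where
  "euler_tour_space_filling N S K \<longleftrightarrow>
     (\<exists>as n \<beta> Ps.
        distinct as \<and> skeleton N S K (set as) \<and> n \<ge> 1 \<and> (\<forall>I\<in>words N n. \<beta> I \<in> {-1, 1}) \<and>
        consistent_euler_partition N S n as \<beta> Ps \<and>
        leads_to_space_filling_curve S K as (edge_to_trail Ps))"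

end

theory Submission
  imports Defs "HOL-Library.Sublist"
begin

text \<open>
  The theorem rests on an alternative for the Hata graphs of the systems \<open>S^n\<close> with respect to a
  skeleton \<open>A\<close>. Call a cell of level \<open>n\<close> removable if the other cells of level \<open>n\<close> are still
  connected and still contain all points of \<open>A\<close>. A skeleton with at most one point consists of a
  common fixed point of all maps, which is a degenerate zipper; let \<open>A\<close> have at least two points.

  Suppose that no level has a removable cell. A cell whose removal leaves the others connected (a
  leaf) then owns a point of \<open>A\<close> that no other cell of its level contains, so no level has more than
  \<open>card A\<close> leaves. On the other hand, if levels \<open>k\<close> and \<open>n\<close> have \<open>t\<close> and \<open>t'\<close> leaves, then level
  \<open>k + n\<close> has at least \<open>t * (t' - 1)\<close> of them (\<open>card_leaves_mult\<close>), so three leaves at one level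
  would produce unboundedly many. Hence every level has exactly two leaves, and a finite connected
  graph with exactly two non-cut vertices is a path (\<open>path_order\<close>). Comparing the paths of the
  levels \<open>1\<close> and \<open>1 + n\<close>, for cells of level \<open>n\<close> that contain at most one point of \<open>A\<close> each, shows
  that consecutive maps meet only in images of two points of \<open>A\<close>: the path is a zipper
  (\<open>zipper_of_no_removable\<close>).

  Suppose that some cell is removable. Then there are removable cells at all deeper levels. Since the
  remaining cells connect all points of \<open>A\<close>, a closed walk through all of \<open>A\<close> can be composed of
  chains of cells, each of them traversed out and back (\<open>tour_through\<close>); the unused cells, the
  removable one among them, are inserted as loops. Cutting this tour at the points of \<open>A\<close> yields
  another enumeration of \<open>A\<close>, and one trail for each of its edges. The freedom of orienting the cells
  is used to meet a prescribed edge \<open>v_l\<close> in every trail: alternating the orientation along a chain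
  bounds the gaps between the occurrences of \<open>v_l\<close>, whereas the trails, which join different points
  of \<open>A\<close> by small cells, are long (\<open>hitting_partition\<close>). Two such partitions are composed: the trail
  in which the first one has a complete cell occurs in every trail of the second one. So every trail
  of the composition contains a complete cell (\<open>pure_step_exists\<close>). The resulting relation between
  enumerations, from the one used in the cells to the one that is subdivided, is transitive and
  relates every enumeration to some other one. There are finitely many enumerations, so one of them is
  related to itself (\<open>self_pure_step_exists\<close>), and this is a consistent Euler-partition.

  It remains to construct the curves. By Moran's argument the open set condition gives
  \<open>0 < H^s(K) < \<infinity>\<close> for the similarity dimension \<open>s\<close>. The masses \<open>h u = H^s(E_u)\<close> of the sets of
  the substitution are at most the sums of the masses of their pieces, but these inequalities add up
  to an equality, because a cell contains every edge exactly once; so none of them is strict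
  (\<open>h_eq_Fwd\<close>). Since every trail contains a complete cell, every \<open>E_u\<close> contains a copy of \<open>K\<close>, so
  its mass is positive, and different \<open>E_u\<close>, of which copies are pieces of a single curve, overlap in
  null sets. Subdividing \<open>[0, 1]\<close> proportionally to the masses gives curves \<open>\<phi>\<close> onto \<open>E_u\<close> that are
  Hoelder continuous with exponent \<open>1 / s\<close> and satisfy \<open>H^s(\<phi>[a, b]) \<le> h u * (b - a)\<close>
  (\<open>curve_hoelder\<close>, \<open>curve_measure_le\<close>). The last inequality, together with the value of the total
  mass, already implies all measure-theoretic properties of an optimal parametrization (locale
  \<open>unit_speed_curve\<close>). A zipper is parametrized in the same way by a substitution with two states.
\<close>

section \<open>Hausdorff measure\<close>

lemma diam_power_empty [simp]: "diam_power s {} = 0"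
  by (simp add: diam_power_def)

lemma hausdorff_premeasure_le:
  assumes "X \<subseteq> (\<Union>i. U i)" "\<And>i::nat. bounded (U i)" "\<And>i. diameter (U i) \<le> \<delta>"
  shows "hausdorff_premeasure s \<delta> X \<le> (\<Sum>i. ennreal (diam_power s (U i)))"
  unfolding hausdorff_premeasure_def by (rule INF_lower) (use assms in auto)

lemma hausdorff_premeasure_lessE:
  assumes "hausdorff_premeasure s \<delta> X < c"
  obtains U where "X \<subseteq> (\<Union>i::nat. U i)" "\<And>i. bounded (U i)" "\<And>i. diameter (U i) \<le> \<delta>"
    "(\<Sum>i. ennreal (diam_power s (U i))) < c"
  using assms unfolding hausdorff_premeasure_def INF_less_iff by auto

lemma hausdorff_premeasure_mono:
  "X \<subseteq> Y \<Longrightarrow> hausdorff_premeasure s \<delta> X \<le> hausdorff_premeasure s \<delta> Y"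
  unfolding hausdorff_premeasure_def by (rule INF_superset_mono) auto

lemma hausdorff_premeasure_antimono:
  "\<delta> \<le> \<delta>' \<Longrightarrow> hausdorff_premeasure s \<delta>' X \<le> hausdorff_premeasure s \<delta> X"
  unfolding hausdorff_premeasure_def by (rule INF_superset_mono) (auto intro: order_trans)

lemma hausdorff_premeasure_le_measure:
  "0 < \<delta> \<Longrightarrow> hausdorff_premeasure s \<delta> X \<le> hausdorff_measure s X"
  unfolding hausdorff_measure_def by (rule SUP_upper) auto

lemma hausdorff_measure_mono: "X \<subseteq> Y \<Longrightarrow> hausdorff_measure s X \<le> hausdorff_measure s Y"
  unfolding hausdorff_measure_def by (intro SUP_mono) (auto intro!: hausdorff_premeasure_mono)

lemma hausdorff_premeasure_empty [simp]: "0 < \<delta> \<Longrightarrow> hausdorff_premeasure s \<delta> {} = 0"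
  using hausdorff_premeasure_le[of "{}" "\<lambda>_. {}" \<delta> s] by auto

lemma hausdorff_measure_empty [simp]: "hausdorff_measure s {} = 0"
  unfolding hausdorff_measure_def by (auto intro!: SUP_eq_const)

lemma hausdorff_premeasure_countable_subadditive:
  fixes X :: "nat \<Rightarrow> 'a::metric_space set"
  shows "hausdorff_premeasure s \<delta> (\<Union>i. X i) \<le> (\<Sum>i. hausdorff_premeasure s \<delta> (X i))"
proof (rule ennreal_le_epsilon)
  fix e :: real assume e: "0 < e" and fin: "(\<Sum>i. hausdorff_premeasure s \<delta> (X i)) < top"
  have finite_term: "hausdorff_premeasure s \<delta> (X i) < top" for i
  proof (rule ccontr)
    assume "\<not> ?thesis"
    then have "hausdorff_premeasure s \<delta> (X i) = top" by (simp add: not_less top_unique)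
    moreover have "hausdorff_premeasure s \<delta> (X i) \<le> (\<Sum>i. hausdorff_premeasure s \<delta> (X i))"
      using sum_le_suminf[of "\<lambda>i. hausdorff_premeasure s \<delta> (X i)" "{i}"] by (simp add: summableI)
    ultimately show False using fin by simp
  qed
  have "\<exists>U. X i \<subseteq> (\<Union>j::nat. U j) \<and> (\<forall>j. bounded (U j) \<and> diameter (U j) \<le> \<delta>) \<and>
      (\<Sum>j. ennreal (diam_power s (U j))) \<le> hausdorff_premeasure s \<delta> (X i) + ennreal (e * (1/2) ^ Suc i)" for i
  proof -
    have pos: "0 < ennreal (e * (1/2) ^ Suc i)" using e by simp
    have "hausdorff_premeasure s \<delta> (X i) < hausdorff_premeasure s \<delta> (X i) + ennreal (e * (1/2) ^ Suc i)"
      using ennreal_add_left_cancel_less[of "hausdorff_premeasure s \<delta> (X i)" 0] finite_term[of i] pos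
      by (simp add: less_top)
    then obtain U where "X i \<subseteq> (\<Union>j::nat. U j)" "\<And>j. bounded (U j)" "\<And>j. diameter (U j) \<le> \<delta>"
        "(\<Sum>j. ennreal (diam_power s (U j))) < hausdorff_premeasure s \<delta> (X i) + ennreal (e * (1/2) ^ Suc i)"
      using hausdorff_premeasure_lessE by blast
    then show ?thesis by (intro exI[of _ U]) auto
  qed
  then obtain U where U: "\<And>i. X i \<subseteq> (\<Union>j::nat. U i j)" "\<And>i j. bounded (U i j)" "\<And>i j. diameter (U i j) \<le> \<delta>"
      "\<And>i. (\<Sum>j. ennreal (diam_power s (U i j))) \<le> hausdorff_premeasure s \<delta> (X i) + ennreal (e * (1/2) ^ Suc i)"
    by metis
  define V where "V k = (case prod_decode k of (i, j) \<Rightarrow> U i j)" for k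
  have "(\<Union>i. X i) \<subseteq> (\<Union>k. V k)"
  proof
    fix x assume "x \<in> (\<Union>i. X i)"
    then obtain i j where "x \<in> U i j" using U(1) by blast
    then have "x \<in> V (prod_encode (i, j))" by (simp add: V_def)
    then show "x \<in> (\<Union>k. V k)" by blast
  qed
  then have "hausdorff_premeasure s \<delta> (\<Union>i. X i) \<le> (\<Sum>k. ennreal (diam_power s (V k)))"
    by (rule hausdorff_premeasure_le) (auto simp: V_def U split: prod.split)
  also have "\<dots> = (\<Sum>k. (\<lambda>(i, j). ennreal (diam_power s (U i j))) (prod_decode k))"
    by (rule suminf_cong) (auto simp: V_def split: prod.split)
  also have "\<dots> = (\<Sum>i. \<Sum>j. ennreal (diam_power s (U i j)))"
    by (rule suminf_ennreal_2dimen) simp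
  also have "\<dots> \<le> (\<Sum>i. hausdorff_premeasure s \<delta> (X i) + ennreal (e * (1/2) ^ Suc i))"
    by (intro suminf_le U summableI)
  also have "\<dots> = (\<Sum>i. hausdorff_premeasure s \<delta> (X i)) + (\<Sum>i. ennreal (e * (1/2) ^ Suc i))"
    by (rule suminf_add[symmetric]) (auto intro: summableI)
  also have "(\<Sum>i. ennreal (e * (1/2) ^ Suc i)) = ennreal e"
    using e sums_mult[OF power_half_series, of e] by (intro suminf_ennreal_eq) auto
  finally show "hausdorff_premeasure s \<delta> (\<Union>i. X i) \<le> (\<Sum>i. hausdorff_premeasure s \<delta> (X i)) + ennreal e" .
qed

lemma hausdorff_measure_countable_subadditive:
  fixes X :: "nat \<Rightarrow> 'a::metric_space set"
  shows "hausdorff_measure s (\<Union>i. X i) \<le> (\<Sum>i. hausdorff_measure s (X i))"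
  unfolding hausdorff_measure_def[of s "\<Union>i. X i"]
proof (rule SUP_least)
  fix \<delta> :: real assume "\<delta> \<in> {0<..}"
  then have "hausdorff_premeasure s \<delta> (X i) \<le> hausdorff_measure s (X i)" for i
    by (simp add: hausdorff_premeasure_le_measure)
  then have "(\<Sum>i. hausdorff_premeasure s \<delta> (X i)) \<le> (\<Sum>i. hausdorff_measure s (X i))"
    by (intro suminf_le summableI)
  then show "hausdorff_premeasure s \<delta> (\<Union>i. X i) \<le> (\<Sum>i. hausdorff_measure s (X i))"
    using hausdorff_premeasure_countable_subadditive order_trans by blast
qed

lemma hausdorff_measure_Un_le:
  "hausdorff_measure s (A \<union> B) \<le> hausdorff_measure s A + hausdorff_measure s B"
proof -
  define X where "X i = (if i = 0 then A else if i = Suc 0 then B else {})" for i :: nat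
  have "A \<union> B = (\<Union>i. X i)" by (force simp: X_def split: if_splits)
  moreover have "(\<Sum>i. hausdorff_measure s (X i)) = (\<Sum>i<2. hausdorff_measure s (X i))"
    by (rule suminf_finite) (auto simp: X_def)
  ultimately show ?thesis
    using hausdorff_measure_countable_subadditive[of s X] by (simp add: X_def numeral_2_eq_2)
qed

lemma hausdorff_measure_finite_UN_le:
  "finite I \<Longrightarrow> hausdorff_measure s (\<Union>i\<in>I. X i) \<le> (\<Sum>i\<in>I. hausdorff_measure s (X i))"
proof (induction I rule: finite_induct)
  case (insert i I)
  have "hausdorff_measure s (\<Union>j\<in>insert i I. X j) \<le> hausdorff_measure s (X i) + hausdorff_measure s (\<Union>j\<in>I. X j)"
    using hausdorff_measure_Un_le by simp
  also have "\<dots> \<le> hausdorff_measure s (X i) + (\<Sum>i\<in>I. hausdorff_measure s (X i))"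
    using insert.IH by (rule add_left_mono)
  finally show ?case using insert.hyps by simp
qed simp

lemma hausdorff_measure_list_UN_le:
  "hausdorff_measure s (\<Union>x\<in>set xs. X x) \<le> (\<Sum>x\<leftarrow>xs. hausdorff_measure s (X x))"
proof (induction xs)
  case (Cons x xs)
  have "hausdorff_measure s (\<Union>y\<in>set (x # xs). X y) \<le> hausdorff_measure s (X x) + hausdorff_measure s (\<Union>y\<in>set xs. X y)"
    using hausdorff_measure_Un_le by simp
  also have "\<dots> \<le> hausdorff_measure s (X x) + (\<Sum>x\<leftarrow>xs. hausdorff_measure s (X x))"
    using Cons.IH by (rule add_left_mono)
  finally show ?case by simp
qed simp

text \<open>The sum is an integral against the counting measure, like the sum in
  \<open>emeasure_UN_countable\<close>, with which it is combined below.\<close>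

lemma hausdorff_measure_countable_family_le:
  assumes "countable D"
  shows "hausdorff_measure s (\<Union>A\<in>D. X A) \<le> (\<integral>\<^sup>+A. hausdorff_measure s (X A) \<partial>count_space D)"
proof (cases "finite D")
  case True
  then show ?thesis using hausdorff_measure_finite_UN_le[OF True] by (simp add: nn_integral_count_space_finite)
next
  case False
  then have bij: "bij_betw (from_nat_into D) UNIV D" using assms by (rule bij_betw_from_nat_into[rotated])
  then have "(\<Union>A\<in>D. X A) = (\<Union>i. X (from_nat_into D i))" by (metis bij_betw_imp_surj_on image_image)
  also have "hausdorff_measure s \<dots> \<le> (\<Sum>i. hausdorff_measure s (X (from_nat_into D i)))"
    by (rule hausdorff_measure_countable_subadditive)
  also have "\<dots> = (\<integral>\<^sup>+i. hausdorff_measure s (X (from_nat_into D i)) \<partial>count_space UNIV)"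
    by (rule nn_integral_count_space_nat[symmetric])
  also have "\<dots> = (\<integral>\<^sup>+A. hausdorff_measure s (X A) \<partial>count_space D)"
    using bij by (rule nn_integral_bij_count_space)
  finally show ?thesis .
qed

lemma diameter_image_le:
  fixes f :: "'a::metric_space \<Rightarrow> 'b::metric_space"
  assumes "bounded U" "0 \<le> L" "\<And>x y. x \<in> U \<Longrightarrow> y \<in> U \<Longrightarrow> dist (f x) (f y) \<le> L * dist x y"
  shows "bounded (f ` U)" "diameter (f ` U) \<le> L * diameter U"
proof -
  have *: "dist (f x) (f y) \<le> L * diameter U" if "x \<in> U" "y \<in> U" for x y
    using assms(3)[OF that] diameter_bounded_bound[OF assms(1) that] assms(2)
    by (meson mult_left_mono order_trans)
  show "bounded (f ` U)"
  proof (cases "U = {}")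
    case False
    then obtain x where "x \<in> U" by blast
    then show ?thesis unfolding bounded_def using * by (intro exI[of _ "f x"] exI[of _ "L * diameter U"]) auto
  qed auto
  show "diameter (f ` U) \<le> L * diameter U"
    using diameter_ge_0[OF assms(1)] assms(2) * unfolding diameter_def[of "f ` U"]
    by (auto intro!: cSUP_least)
qed

text \<open>The sets of a cover are intersected with \<open>X\<close> first, because \<open>f\<close> need not be Lipschitz
  outside \<open>X\<close>.\<close>

lemma hausdorff_measure_lipschitz_image:
  fixes f :: "'a::metric_space \<Rightarrow> 'b::metric_space"
  assumes L: "0 < L" and s: "0 \<le> s"
    and lip: "\<And>x y. x \<in> X \<Longrightarrow> y \<in> X \<Longrightarrow> dist (f x) (f y) \<le> L * dist x y"
  shows "hausdorff_measure s (f ` X) \<le> ennreal (L powr s) * hausdorff_measure s X"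
  unfolding hausdorff_measure_def[of s "f ` X"]
proof (rule SUP_least)
  fix \<delta> :: real assume "\<delta> \<in> {0<..}"
  then have \<delta>: "0 < \<delta>" by simp
  define k where "k = L powr s"
  have k: "0 < k" using L by (simp add: k_def)
  have bound: "hausdorff_premeasure s \<delta> (f ` X) \<le> ennreal k * c" if c: "hausdorff_premeasure s (\<delta> / L) X < c" for c
  proof -
    obtain U where U: "X \<subseteq> (\<Union>i::nat. U i)" "\<And>i. bounded (U i)" "\<And>i. diameter (U i) \<le> \<delta> / L"
        "(\<Sum>i. ennreal (diam_power s (U i))) < c"
      using hausdorff_premeasure_lessE[OF c] by metis
    have bd: "bounded (U i \<inter> X)" for i by (rule bounded_subset[OF U(2)[of i]]) auto
    have dm: "diameter (U i \<inter> X) \<le> diameter (U i)" for i by (rule diameter_subset) (auto simp: U)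
    note im = diameter_image_le[of "U i \<inter> X" L f for i, OF bd less_imp_le[OF L] lip]
    have im2: "diameter (f ` (U i \<inter> X)) \<le> L * diameter (U i)" for i
      using im(2)[of i] dm[of i] L by (meson IntD2 mult_left_mono less_imp_le order_trans)
    have "hausdorff_premeasure s \<delta> (f ` X) \<le> (\<Sum>i. ennreal (diam_power s (f ` (U i \<inter> X))))"
    proof (rule hausdorff_premeasure_le)
      show "diameter (f ` (U i \<inter> X)) \<le> \<delta>" for i
        using im2[of i] U(3)[of i] L by (simp add: field_simps)
      show "f ` X \<subseteq> (\<Union>i. f ` (U i \<inter> X))" using U(1) by blast
      show "bounded (f ` (U i \<inter> X))" for i by (rule im(1)) auto
    qed
    also have "\<dots> \<le> (\<Sum>i. ennreal k * ennreal (diam_power s (U i)))"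
    proof (intro suminf_le summableI)
      fix i
      have "diam_power s (f ` (U i \<inter> X)) \<le> k * diam_power s (U i)"
      proof -
        have "0 \<le> diameter (f ` (U i \<inter> X))" by (intro diameter_ge_0 im(1)) auto
        then have "diameter (f ` (U i \<inter> X)) powr s \<le> (L * diameter (U i)) powr s"
          using im2[of i] s by (intro powr_mono2)
        also have "\<dots> = k * diameter (U i) powr s"
          using L by (simp add: k_def powr_mult diameter_ge_0 U)
        finally show ?thesis using L k by (auto simp: diam_power_def k_def)
      qed
      then show "ennreal (diam_power s (f ` (U i \<inter> X))) \<le> ennreal k * ennreal (diam_power s (U i))"
        using k ennreal_leI by (simp add: ennreal_mult'[symmetric])
    qed
    also have "\<dots> = ennreal k * (\<Sum>i. ennreal (diam_power s (U i)))"
      by (rule ennreal_suminf_cmult)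
    also have "\<dots> \<le> ennreal k * c" using U(4) by (intro mult_left_mono) auto
    finally show ?thesis .
  qed
  have "ennreal (1 / k) * hausdorff_premeasure s \<delta> (f ` X) \<le> hausdorff_premeasure s (\<delta> / L) X"
  proof (rule dense_ge)
    fix c assume "hausdorff_premeasure s (\<delta> / L) X < c"
    from bound[OF this] have "ennreal (1 / k) * hausdorff_premeasure s \<delta> (f ` X) \<le> ennreal (1 / k) * (ennreal k * c)"
      by (rule mult_left_mono) auto
    also have "\<dots> = c" using k by (simp add: mult.assoc[symmetric] ennreal_mult'[symmetric])
    finally show "ennreal (1 / k) * hausdorff_premeasure s \<delta> (f ` X) \<le> c" .
  qed
  then have "ennreal k * (ennreal (1 / k) * hausdorff_premeasure s \<delta> (f ` X)) \<le> ennreal k * hausdorff_premeasure s (\<delta> / L) X"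
    by (rule mult_left_mono) auto
  moreover have "ennreal k * (ennreal (1 / k) * hausdorff_premeasure s \<delta> (f ` X)) = hausdorff_premeasure s \<delta> (f ` X)"
    using k by (simp add: mult.assoc[symmetric] ennreal_mult'[symmetric])
  moreover have "hausdorff_premeasure s (\<delta> / L) X \<le> hausdorff_measure s X"
    using \<delta> L by (intro hausdorff_premeasure_le_measure) auto
  ultimately show "hausdorff_premeasure s \<delta> (f ` X) \<le> ennreal (L powr s) * hausdorff_measure s X"
    unfolding k_def by (metis mult_left_mono order_trans zero_le)
qed

text \<open>One inequality is the Lipschitz bound for \<open>f\<close>, the other one that for its inverse on
  \<open>f ` X\<close>.\<close>

lemma hausdorff_measure_similar_image:
  fixes f :: "'a::metric_space \<Rightarrow> 'b::metric_space"
  assumes r: "0 < r" and s: "0 \<le> s"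
    and sim: "\<And>x y. x \<in> X \<Longrightarrow> y \<in> X \<Longrightarrow> dist (f x) (f y) = r * dist x y"
  shows "hausdorff_measure s (f ` X) = ennreal (r powr s) * hausdorff_measure s X"
proof (rule antisym)
  show "hausdorff_measure s (f ` X) \<le> ennreal (r powr s) * hausdorff_measure s X"
    by (rule hausdorff_measure_lipschitz_image) (use assms in auto)
  have inj: "inj_on f X" by (rule inj_onI) (metis assms(3) dist_eq_0_iff mult_eq_0_iff r less_irrefl)
  let ?g = "inv_into X f"
  have gX: "?g ` f ` X = X" using inj by (force simp: image_image inv_into_f_f image_iff)
  have "hausdorff_measure s (?g ` f ` X) \<le> ennreal ((1/r) powr s) * hausdorff_measure s (f ` X)"
  proof (rule hausdorff_measure_lipschitz_image)
    fix x y assume "x \<in> f ` X" "y \<in> f ` X"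
    then show "dist (?g x) (?g y) \<le> 1 / r * dist x y" using r inj sim by (auto simp: inv_into_f_f)
  qed (use r s in auto)
  then have "ennreal (r powr s) * hausdorff_measure s X
      \<le> ennreal (r powr s) * (ennreal ((1/r) powr s) * hausdorff_measure s (f ` X))"
    unfolding gX by (rule mult_left_mono) auto
  also have "\<dots> = hausdorff_measure s (f ` X)"
    using r by (simp add: mult.assoc[symmetric] ennreal_mult'[symmetric] powr_divide)
  finally show "ennreal (r powr s) * hausdorff_measure s X \<le> hausdorff_measure s (f ` X)" .
qed

section \<open>Curves of unit speed\<close>

text \<open>An open superset of \<open>X\<close> of almost the same measure contains countably many nonoverlapping
  intervals that cover \<open>X\<close>, and the bound for intervals applies to each of them.\<close>

lemma hausdorff_measure_image_le_lebesgue: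
  fixes \<psi> :: "real \<Rightarrow> 'a::metric_space"
  assumes c: "0 \<le> c"
    and bound: "\<And>a b. 0 \<le> a \<Longrightarrow> a \<le> b \<Longrightarrow> b \<le> 1 \<Longrightarrow> hausdorff_measure s (\<psi> ` {a..b}) \<le> ennreal (c * (b - a))"
    and X: "X \<in> sets lebesgue" "X \<subseteq> {0..1}"
  shows "hausdorff_measure s (\<psi> ` X) \<le> ennreal c * emeasure lebesgue X"
proof (rule ennreal_le_epsilon)
  fix e :: real assume e: "0 < e"
  \<comment> \<open>The summand \<open>1\<close> allows for \<open>c = 0\<close>.\<close>
  define e' where "e' = e / (c + 1)"
  have e': "0 < e'" "c * e' \<le> e" using e c by (auto simp: e'_def field_simps)
  obtain T where T: "open T" "X \<subseteq> T" "T - X \<in> lmeasurable" "emeasure lebesgue (T - X) < ennreal e'"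
    using sets_lebesgue_outer_open[OF X(1) e'(1)] by blast
  have "gauge (\<lambda>x. if x \<in> T then T else UNIV)" using T(1) by (auto simp: gauge_def)
  moreover have "X \<subseteq> cbox 0 1" "box (0::real) 1 \<noteq> {}" using X by auto
  ultimately obtain D where D: "countable D" "\<Union>D \<subseteq> cbox 0 (1::real)"
      "\<And>A. A \<in> D \<Longrightarrow> interior A \<noteq> {} \<and> (\<exists>a b. A = cbox a b)"
      "pairwise (\<lambda>A B. interior A \<inter> interior B = {}) D"
      "\<And>A. A \<in> D \<Longrightarrow> \<exists>x\<in>X \<inter> A. A \<subseteq> (if x \<in> T then T else UNIV)"
      "X \<subseteq> \<Union>D"
    using covering_lemma[of X 0 1 "\<lambda>x. if x \<in> T then T else UNIV"] by metis
  have DT: "A \<subseteq> T" if "A \<in> D" for A using D(5)[OF that] T(2) by (auto split: if_splits)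
  have "hausdorff_measure s (\<psi> ` X) \<le> hausdorff_measure s (\<Union>A\<in>D. \<psi> ` A)"
    using D(6) by (intro hausdorff_measure_mono) auto
  also have "\<dots> \<le> (\<integral>\<^sup>+A. hausdorff_measure s (\<psi> ` A) \<partial>count_space D)"
    by (rule hausdorff_measure_countable_family_le[OF D(1)])
  also have "\<dots> \<le> (\<integral>\<^sup>+A. ennreal c * emeasure lebesgue (interior A) \<partial>count_space D)"
  proof (rule nn_integral_mono)
    fix A assume "A \<in> space (count_space D)"
    then have A: "A \<in> D" by simp
    obtain a b where Aab: "A = cbox a b" using D(3)[OF A] by blast
    have "interior A \<noteq> {}" using D(3)[OF A] by blast
    then have "{a<..<b} \<noteq> {}" unfolding Aab interior_cbox box_real(1) .
    then have "a < b" by (metis greaterThanLessThan_empty linorder_not_less)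
    then have ab: "A = {a..b}" "a < b" using Aab by (simp_all only: box_real(2))
    have "A \<subseteq> cbox 0 1" using D(2) A by blast
    then have "0 \<le> a" "b \<le> 1" using ab by auto
    then have "hausdorff_measure s (\<psi> ` A) \<le> ennreal (c * (b - a))" using bound ab by simp
    also have "\<dots> = ennreal c * emeasure lebesgue (interior A)" using ab c by (simp add: ennreal_mult')
    finally show "hausdorff_measure s (\<psi> ` A) \<le> ennreal c * emeasure lebesgue (interior A)" .
  qed
  also have "\<dots> = ennreal c * (\<integral>\<^sup>+A. emeasure lebesgue (interior A) \<partial>count_space D)"
    by (rule nn_integral_cmult) simp
  also have "(\<integral>\<^sup>+A. emeasure lebesgue (interior A) \<partial>count_space D) = emeasure lebesgue (\<Union>A\<in>D. interior A)"
    using D(1,4) by (intro emeasure_UN_countable[symmetric])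
      (auto simp: disjoint_family_on_def pairwise_def)
  also have "\<dots> \<le> emeasure lebesgue T"
    using DT interior_subset T(1) by (intro emeasure_mono) (blast, auto)
  also have "T = X \<union> (T - X)" using T(2) by auto
  also have "emeasure lebesgue (X \<union> (T - X)) \<le> emeasure lebesgue X + emeasure lebesgue (T - X)"
    using X(1) T(3) by (intro emeasure_subadditive) auto
  also have "\<dots> \<le> emeasure lebesgue X + ennreal e'"
    using T(4) by (intro add_left_mono less_imp_le)
  finally have "hausdorff_measure s (\<psi> ` X) \<le> ennreal c * (emeasure lebesgue X + ennreal e')"
    by (simp add: mult_left_mono)
  also have "\<dots> = ennreal c * emeasure lebesgue X + ennreal (c * e')"
    using c e' by (simp add: distrib_left ennreal_mult')
  also have "\<dots> \<le> ennreal c * emeasure lebesgue X + ennreal e"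
    using e'(2) by (intro add_left_mono ennreal_leI)
  finally show "hausdorff_measure s (\<psi> ` X) \<le> ennreal c * emeasure lebesgue X + ennreal e" .
qed

text \<open>Only an upper bound for the mass of arcs is assumed. Since the whole curve has mass \<open>c\<close>, no
  arc can fall short of its share, and the measure-theoretic conditions of an optimal
  parametrization follow without any additivity of the Hausdorff measure.\<close>

locale unit_speed_curve =
  fixes s :: real and F :: "'a::euclidean_space set" and \<psi> :: "real \<Rightarrow> 'a" and c :: real
  assumes c: "0 < c" and HF: "hausdorff_measure s F = ennreal c"
    and cont: "continuous_on {0..1} \<psi>" and onto: "\<psi> ` {0..1} = F"
    and bound: "\<And>a b. 0 \<le> a \<Longrightarrow> a \<le> b \<Longrightarrow> b \<le> 1 \<Longrightarrow> hausdorff_measure s (\<psi> ` {a..b}) \<le> ennreal (c * (b - a))"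
begin

lemma image_le: "X \<in> sets lebesgue \<Longrightarrow> X \<subseteq> {0..1} \<Longrightarrow> hausdorff_measure s (\<psi> ` X) \<le> ennreal c * emeasure lebesgue X"
  using c bound by (intro hausdorff_measure_image_le_lebesgue) auto

lemma vimage_borel:
  assumes "B \<in> sets borel" shows "{t\<in>{0..1}. \<psi> t \<in> B} \<in> sets borel"
proof -
  have "\<psi> \<in> borel_measurable (restrict_space borel {0..1})"
    by (rule borel_measurable_continuous_on_restrict[OF cont])
  from measurable_sets[OF this assms]
  have "\<psi> -` B \<inter> {0..1} \<in> sets borel"
    by (auto simp: sets_restrict_space_iff space_restrict_space)
  also have "\<psi> -` B \<inter> {0..1} = {t\<in>{0..1}. \<psi> t \<in> B}" by auto
  finally show ?thesis .
qed

lemma lmeasurable_unit: "X \<in> sets borel \<Longrightarrow> X \<subseteq> {0..1::real} \<Longrightarrow> X \<in> lmeasurable"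
  by (rule bounded_set_imp_lmeasurable) (auto intro: bounded_subset[OF bounded_closed_interval])

text \<open>The masses of \<open>B\<close> and \<open>F - B\<close> are bounded by the measures of the times spent there, which
  add up to \<open>c\<close>; by subadditivity the masses add up to at least \<open>c\<close>. So both bounds are attained.\<close>

lemma hausdorff_measure_borel:
  assumes B: "B \<in> sets borel" "B \<subseteq> F"
  shows "hausdorff_measure s B = ennreal (c * measure lebesgue {t\<in>{0..1}. \<psi> t \<in> B})"
proof (rule antisym)
  define Y where "Y = {t\<in>{0..1}. \<psi> t \<in> B}"
  define Z where "Z = {0..1} - Y"
  have Y: "Y \<in> sets borel" "Y \<subseteq> {0..1}" unfolding Y_def using vimage_borel[OF B(1)] by auto
  then have Z: "Z \<in> sets borel" "Z \<subseteq> {0..1}" unfolding Z_def by auto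
  have YZ: "Y \<in> lmeasurable" "Z \<in> lmeasurable" using Y Z lmeasurable_unit by auto
  have m1: "measure lebesgue Y + measure lebesgue Z = 1"
  proof -
    have "measure lebesgue Z = measure lebesgue {0..1::real} - measure lebesgue Y"
      unfolding Z_def using YZ Y by (intro measurable_measure_Diff) auto
    then show ?thesis by simp
  qed
  have "\<psi> ` Y = B" "\<psi> ` Z = F - B" using B(2) onto unfolding Y_def Z_def by auto
  then have le: "hausdorff_measure s B \<le> ennreal (c * measure lebesgue Y)"
      "hausdorff_measure s (F - B) \<le> ennreal (c * measure lebesgue Z)"
    using image_le[of Y] image_le[of Z] Y Z YZ c by (auto simp: emeasure_eq_measure2 ennreal_mult')
  from le(1) show "hausdorff_measure s B \<le> ennreal (c * measure lebesgue {t\<in>{0..1}. \<psi> t \<in> B})"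
    unfolding Y_def .
  obtain h where h: "hausdorff_measure s B = ennreal h" "0 \<le> h"
    using le(1) by (metis ennreal_cases ennreal_less_top linorder_not_less top_unique order_le_less_trans order_less_irrefl)
  have "ennreal c \<le> hausdorff_measure s B + hausdorff_measure s (F - B)"
    using hausdorff_measure_Un_le[of s B "F - B"] B(2) HF by (simp add: Un_absorb1)
  also have "\<dots> \<le> ennreal h + ennreal (c * measure lebesgue Z)"
    using le(2) h by (intro add_mono) auto
  also have "\<dots> = ennreal (h + c * measure lebesgue Z)"
    using h c by (intro ennreal_plus[symmetric]) auto
  finally have "c \<le> h + c * measure lebesgue Z" using h c by (subst (asm) ennreal_le_iff) auto
  moreover have "c * measure lebesgue Y = c - c * measure lebesgue Z" using m1 by (simp add: algebra_simps flip: distrib_left)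
  ultimately have "c * measure lebesgue Y \<le> h" by linarith
  then show "ennreal (c * measure lebesgue {t\<in>{0..1}. \<psi> t \<in> B}) \<le> hausdorff_measure s B"
    unfolding h Y_def[symmetric] by (rule ennreal_leI)
qed

text \<open>The image of a Borel set need not be Borel. The lower bound comes from compact subsets of
  \<open>X\<close>, whose images are compact.\<close>

lemma hausdorff_measure_image_borel:
  assumes X: "X \<in> sets borel" "X \<subseteq> {0..1}"
  shows "hausdorff_measure s (\<psi> ` X) = ennreal c * emeasure lebesgue X"
proof (rule antisym)
  show "hausdorff_measure s (\<psi> ` X) \<le> ennreal c * emeasure lebesgue X" using X by (intro image_le) auto
  show "ennreal c * emeasure lebesgue X \<le> hausdorff_measure s (\<psi> ` X)"
  proof (rule ennreal_le_epsilon)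
    fix e :: real assume e: "0 < e"
    have Xs: "X \<in> sets lebesgue" using X by auto
    obtain T where T: "closed T" "T \<subseteq> X" "X - T \<in> lmeasurable" "emeasure lebesgue (X - T) < ennreal (e / c)"
      using sets_lebesgue_inner_closed[OF Xs, of "e / c"] e c by (metis divide_pos_pos)
    have cT: "compact T" using T X by (meson bounded_closed_interval bounded_subset compact_eq_bounded_closed subset_trans)
    then have "compact (\<psi> ` T)" using cont T X by (meson compact_continuous_image continuous_on_subset subset_trans)
    then have psiT: "\<psi> ` T \<in> sets borel" "\<psi> ` T \<subseteq> F" using T X onto by (auto simp: borel_compact)
    have Tm: "T \<in> lmeasurable" using cT by (rule lmeasurable_compact)
    have "emeasure lebesgue T = ennreal (measure lebesgue T)" using Tm by (simp add: emeasure_eq_measure2)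
    also have "\<dots> \<le> ennreal (measure lebesgue {t\<in>{0..1}. \<psi> t \<in> \<psi> ` T})"
      using T X Tm by (intro ennreal_leI measure_mono_fmeasurable lmeasurable_unit vimage_borel psiT) auto
    finally have "ennreal c * emeasure lebesgue T \<le> hausdorff_measure s (\<psi> ` T)"
      unfolding hausdorff_measure_borel[OF psiT] using c by (simp add: ennreal_mult' mult_left_mono)
    also have "\<dots> \<le> hausdorff_measure s (\<psi> ` X)" using T by (intro hausdorff_measure_mono) auto
    finally have *: "ennreal c * emeasure lebesgue T \<le> hausdorff_measure s (\<psi> ` X)" .
    have "X = T \<union> (X - T)" using T by auto
    then have "emeasure lebesgue X \<le> emeasure lebesgue T + emeasure lebesgue (X - T)"
      using emeasure_subadditive[of T lebesgue "X - T"] T Tm by auto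
    also have "\<dots> \<le> emeasure lebesgue T + ennreal (e / c)" using T(4) by (intro add_left_mono) auto
    finally have "ennreal c * emeasure lebesgue X \<le> ennreal c * (emeasure lebesgue T + ennreal (e / c))"
      by (rule mult_left_mono) auto
    also have "\<dots> = ennreal c * emeasure lebesgue T + ennreal e"
      using c e by (simp add: distrib_left ennreal_mult'[symmetric])
    finally show "ennreal c * emeasure lebesgue X \<le> hausdorff_measure s (\<psi> ` X) + ennreal e"
      using * by (meson add_right_mono order_trans)
  qed
qed

text \<open>The arc over \<open>[0, a]\<close> has mass at most \<open>c * a\<close>, so the curve spends time at most \<open>a\<close> in it.
  This time is used up by \<open>[0, a]\<close> itself.\<close>

lemma revisited_times_null:
  assumes ab: "0 \<le> a" "a < b" "b \<le> 1"
  shows "{t\<in>{b..1}. \<psi> t \<in> \<psi> ` {0..a}} \<in> null_sets lebesgue"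
proof -
  define B where "B = \<psi> ` {0..a}"
  have sub: "{0..a} \<subseteq> {0..1}" using ab by auto
  have "compact B" unfolding B_def using cont sub by (meson compact_continuous_image compact_Icc continuous_on_subset)
  then have B: "B \<in> sets borel" "B \<subseteq> F" using onto sub by (auto simp: B_def borel_compact)
  define Y where "Y = {t\<in>{0..1}. \<psi> t \<in> B}"
  have Y: "Y \<in> lmeasurable" unfolding Y_def by (intro lmeasurable_unit vimage_borel B) auto
  have "ennreal (c * measure lebesgue Y) \<le> ennreal (c * (a - 0))"
    using bound[of 0 a] hausdorff_measure_borel[OF B] ab by (simp add: Y_def B_def)
  then have le: "measure lebesgue Y \<le> a" using c ab by (simp add: ennreal_le_iff)
  have sub2: "{0..a} \<subseteq> Y" using sub by (auto simp: Y_def B_def)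
  have "measure lebesgue (Y - {0..a}) = measure lebesgue Y - measure lebesgue {0..a}"
    using Y sub2 by (intro measurable_measure_Diff) auto
  also have "\<dots> \<le> 0" using le ab by simp
  finally have "measure lebesgue (Y - {0..a}) = 0" by (simp add: antisym)
  then have null: "Y - {0..a} \<in> null_sets lebesgue"
    using Y by (simp add: null_sets_def emeasure_eq_measure2 fmeasurable_Diff fmeasurableD)
  have sub3: "{t\<in>{b..1}. \<psi> t \<in> \<psi> ` {0..a}} \<subseteq> Y - {0..a}" using ab by (auto simp: Y_def B_def)
  show ?thesis
    by (rule completion.complete2[OF sub3 null])
qed

text \<open>If a point is visited at two times, rational numbers \<open>a < b\<close> separate them, and the later
  time lies in one of countably many null sets.\<close>

lemma bijective_almost_everywhere:
  "\<exists>F' I'. F' \<subseteq> F \<and> hausdorff_measure s (F - F') = 0 \<and> I' \<subseteq> {0..1} \<and> {0..1} - I' \<in> null_sets lebesgue \<and> bij_betw \<psi> I' F'"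
proof -
  define Q where "Q = {(a, b). a \<in> \<rat> \<and> b \<in> \<rat> \<and> 0 \<le> a \<and> a < b \<and> b \<le> (1::real)}"
  define N where "N = (\<Union>(a, b)\<in>Q. {t\<in>{b..1}. \<psi> t \<in> \<psi> ` {0..a}})"
  have "Q \<subseteq> \<rat> \<times> \<rat>" by (auto simp: Q_def)
  then have "countable Q" by (meson countable_SIGMA countable_rat countable_subset)
  moreover have "(case p of (a, b) \<Rightarrow> {t\<in>{b..1}. \<psi> t \<in> \<psi> ` {0..a}}) \<in> null_sets lebesgue" if "p \<in> Q" for p
  proof -
    obtain a b where p: "p = (a, b)" by (cases p)
    with that have "0 \<le> a" "a < b" "b \<le> 1" by (auto simp: Q_def)
    from revisited_times_null[OF this] show ?thesis unfolding p by simp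
  qed
  ultimately have N: "N \<in> null_sets lebesgue" unfolding N_def by (intro null_sets_UN')
  have N01: "N \<subseteq> {0..1}" by (force simp: N_def Q_def)
  define I' where "I' = {0..1} - N"
  have inj: "inj_on \<psi> I'"
  proof (rule linorder_inj_onI')
    fix t t' assume t: "t \<in> I'" "t' \<in> I'" "t < t'"
    show "\<psi> t \<noteq> \<psi> t'"
    proof
      assume eq: "\<psi> t = \<psi> t'"
      obtain a where a: "a \<in> \<rat>" "t < a" "a < t'" using Rats_dense_in_real[OF t(3)] by blast
      obtain b where b: "b \<in> \<rat>" "a < b" "b < t'" using Rats_dense_in_real[OF a(3)] by blast
      have "(a, b) \<in> Q" using a b t by (auto simp: Q_def I'_def)
      moreover have "t' \<in> {t\<in>{b..1}. \<psi> t \<in> \<psi> ` {0..a}}"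
        using t a b eq by (auto simp: I'_def intro!: image_eqI[of _ _ t])
      ultimately have "t' \<in> N" unfolding N_def by blast
      then show False using t by (simp add: I'_def)
    qed
  qed
  have "F - \<psi> ` I' \<subseteq> \<psi> ` N" using onto by (auto simp: I'_def)
  then have "hausdorff_measure s (F - \<psi> ` I') \<le> hausdorff_measure s (\<psi> ` N)" by (rule hausdorff_measure_mono)
  also have "\<dots> \<le> ennreal c * emeasure lebesgue N" using N N01 by (intro image_le) auto
  also have "\<dots> = 0" using N by auto
  finally have 0: "hausdorff_measure s (F - \<psi> ` I') = 0" by simp
  have "{0..1} - I' = N" using N01 by (auto simp: I'_def)
  then show ?thesis using 0 inj N onto
    by (intro exI[of _ "\<psi> ` I'"] exI[of _ I']) (auto simp: I'_def bij_betw_def)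
qed

lemma optimal_parametrization_of_hoelder:
  assumes "c' > 0" "\<And>x y. x \<in> {0..1} \<Longrightarrow> y \<in> {0..1} \<Longrightarrow> norm (\<psi> x - \<psi> y) \<le> c' * \<bar>x - y\<bar> powr (1 / s)"
  shows "optimal_parametrization s F \<psi>"
  unfolding optimal_parametrization_def
proof (intro conjI)
  show "compact F" using cont onto by (metis compact_Icc compact_continuous_image)
  show "0 < hausdorff_measure s F" "hausdorff_measure s F < \<infinity>" using HF c by auto
  show "\<forall>B\<in>sets borel. B \<subseteq> F \<longrightarrow>
      emeasure lebesgue {t \<in> {0..1}. \<psi> t \<in> B} = hausdorff_measure s B / hausdorff_measure s F"
  proof (intro ballI impI)
    fix B assume B: "B \<in> sets borel" "B \<subseteq> F"
    have "{t \<in> {0..1}. \<psi> t \<in> B} \<in> lmeasurable" by (intro lmeasurable_unit vimage_borel B) auto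
    then show "emeasure lebesgue {t \<in> {0..1}. \<psi> t \<in> B} = hausdorff_measure s B / hausdorff_measure s F"
      unfolding hausdorff_measure_borel[OF B] HF using c
      by (simp add: divide_ennreal emeasure_eq_measure2)
  qed
qed (use onto bijective_almost_everywhere hausdorff_measure_image_borel HF assms in auto)

end

section \<open>Scaling exponents, finite covers and similitudes\<close>

text \<open>It suffices to consider covers by sets of diameter at most \<open>1\<close>, for which the gauge
  decreases with the exponent.\<close>

lemma hausdorff_measure_antimono:
  assumes "0 \<le> t" "t \<le> s"
  shows "hausdorff_measure s X \<le> hausdorff_measure t X"
  unfolding hausdorff_measure_def[of s]
proof (rule SUP_least)
  fix \<delta> :: real assume "\<delta> \<in> {0<..}"
  define \<epsilon> where "\<epsilon> = min \<delta> 1"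
  have \<epsilon>: "0 < \<epsilon>" "\<epsilon> \<le> \<delta>" "\<epsilon> \<le> 1" using \<open>\<delta> \<in> {0<..}\<close> by (auto simp: \<epsilon>_def)
  have "hausdorff_premeasure s \<epsilon> X \<le> hausdorff_premeasure t \<epsilon> X"
    unfolding hausdorff_premeasure_def[of t]
  proof (rule INF_greatest)
    fix U assume "U \<in> {U :: nat \<Rightarrow> 'a set. X \<subseteq> (\<Union>i. U i) \<and> (\<forall>i. bounded (U i) \<and> diameter (U i) \<le> \<epsilon>)}"
    then have U: "X \<subseteq> (\<Union>i. U i)" "\<And>i. bounded (U i)" "\<And>i. diameter (U i) \<le> \<epsilon>" by auto
    have "diam_power s (U i) \<le> diam_power t (U i)" for i
      using diameter_ge_0[OF U(2)[of i]] U(3)[of i] \<epsilon>(3) assms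
      by (cases "diameter (U i) = 0") (auto simp: diam_power_def powr_mono' intro!: powr_le1)
    then have "(\<Sum>i. ennreal (diam_power s (U i))) \<le> (\<Sum>i. ennreal (diam_power t (U i)))"
      by (intro suminf_le summableI ennreal_leI)
    then show "hausdorff_premeasure s \<epsilon> X \<le> (\<Sum>i. ennreal (diam_power t (U i)))"
      using hausdorff_premeasure_le[OF U] order_trans by blast
  qed
  then show "hausdorff_premeasure s \<delta> X \<le> hausdorff_measure t X"
    using hausdorff_premeasure_antimono[OF \<epsilon>(2)] hausdorff_premeasure_le_measure[OF \<epsilon>(1)]
    by (meson order_trans)
qed

lemma hausdorff_premeasure_le_diam_power:
  assumes "bounded U" "diameter U \<le> \<delta>" "0 \<le> \<delta>"
  shows "hausdorff_premeasure s \<delta> U \<le> ennreal (diam_power s U)"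
proof -
  define V where "V i = (if i = 0 then U else {})" for i :: nat
  have "hausdorff_premeasure s \<delta> U \<le> (\<Sum>i. ennreal (diam_power s (V i)))"
    by (rule hausdorff_premeasure_le) (use assms in \<open>auto simp: V_def split: if_splits\<close>)
  also have "\<dots> = (\<Sum>i\<in>{0}. ennreal (diam_power s (V i)))"
    by (rule suminf_finite) (auto simp: V_def)
  finally show ?thesis by (simp add: V_def)
qed

lemma hausdorff_premeasure_finite_cover_le:
  assumes "finite I" "\<And>i. i \<in> I \<Longrightarrow> bounded (U i)" "\<And>i. i \<in> I \<Longrightarrow> diameter (U i) \<le> \<delta>" "0 < \<delta>"
  shows "hausdorff_premeasure s \<delta> (\<Union>i\<in>I. U i) \<le> (\<Sum>i\<in>I. ennreal (diam_power s (U i)))"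
  using assms(1-3)
proof (induction I rule: finite_induct)
  case empty
  then show ?case using assms(4) by simp
next
  case (insert i I)
  define X where "X k = (if k = 0 then U i else if k = Suc 0 then (\<Union>j\<in>I. U j) else {})" for k :: nat
  have "(\<Union>j\<in>insert i I. U j) = (\<Union>k. X k)" by (force simp: X_def split: if_splits)
  moreover have "(\<Sum>k. hausdorff_premeasure s \<delta> (X k)) = (\<Sum>k<2. hausdorff_premeasure s \<delta> (X k))"
    by (rule suminf_finite) (use assms(4) in \<open>auto simp: X_def\<close>)
  ultimately have "hausdorff_premeasure s \<delta> (\<Union>j\<in>insert i I. U j)
      \<le> hausdorff_premeasure s \<delta> (U i) + hausdorff_premeasure s \<delta> (\<Union>j\<in>I. U j)"
    using hausdorff_premeasure_countable_subadditive[of s \<delta> X] by (simp add: X_def numeral_2_eq_2)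
  also have "\<dots> \<le> ennreal (diam_power s (U i)) + (\<Sum>i\<in>I. ennreal (diam_power s (U i)))"
    using insert assms(4) by (intro add_mono hausdorff_premeasure_le_diam_power insert.IH) auto
  finally show ?case using insert.hyps by simp
qed

text \<open>After rescaling and a translation, the map is an isometry that fixes the origin, hence an
  orthogonal transformation.\<close>

lemma similitude_surj:
  fixes f :: "'a::euclidean_space \<Rightarrow> 'a"
  assumes "0 < r" "\<And>x y. dist (f x) (f y) = r * dist x y"
  shows "surj f"
proof -
  define g where "g x = (1 / r) *\<^sub>R (f x - f 0)" for x
  have "dist (g x) (g y) = dist x y" for x y
  proof -
    have "g x - g y = (1 / r) *\<^sub>R (f x - f y)" by (simp add: g_def algebra_simps)
    then show ?thesis using assms(1) assms(2)[of x y] by (simp add: dist_norm)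
  qed
  then have "orthogonal_transformation g" by (simp add: orthogonal_transformation_isometry g_def)
  then have "surj g" by (rule orthogonal_transformation_surj)
  show ?thesis
  proof (rule surjI)
    fix y
    show "f (inv g ((1 / r) *\<^sub>R (y - f 0))) = y"
      using surj_f_inv_f[OF \<open>surj g\<close>, of "(1 / r) *\<^sub>R (y - f 0)"] assms(1) by (simp add: g_def)
  qed
qed

section \<open>Words\<close>

lemma word_map_Nil [simp]: "word_map S [] = id" by (simp add: word_map_def)
lemma word_map_Cons [simp]: "word_map S (i # I) = S i \<circ> word_map S I" by (simp add: word_map_def)
lemma word_map_append: "word_map S (I @ J) = word_map S I \<circ> word_map S J"
  by (induction I) (auto simp: fun_eq_iff)

lemma words_0 [simp]: "words N 0 = {[]}" by (auto simp: words_def)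

lemma words_Suc: "words N (Suc n) = (\<Union>i\<in>{1..N}. (#) i ` words N n)"
  by (auto simp: words_def length_Suc_conv)

lemma finite_words [simp]: "finite (words N n)"
  by (induction n) (auto simp: words_Suc)

lemma words_append: "words N (k + n) = (\<lambda>(I, J). I @ J) ` (words N k \<times> words N n)"
proof (rule set_eqI)
  fix x
  have "\<exists>I J. x = I @ J \<and> I \<in> words N k \<and> J \<in> words N n" if "x \<in> words N (k + n)"
  proof (intro exI conjI)
    show "x = take k x @ drop k x" by simp
    show "take k x \<in> words N k" "drop k x \<in> words N n"
      using that set_take_subset[of k x] set_drop_subset[of k x] by (auto simp: words_def)
  qed
  moreover have "I @ J \<in> words N (k + n)" if "I \<in> words N k" "J \<in> words N n" for I J
    using that by (simp add: words_def)
  ultimately show "x \<in> words N (k + n) \<longleftrightarrow> x \<in> (\<lambda>(I, J). I @ J) ` (words N k \<times> words N n)"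
    by fastforce
qed

lemma sum_words_prod_list:
  fixes p :: "nat \<Rightarrow> 'b::comm_semiring_1"
  shows "(\<Sum>I\<in>words N n. prod_list (map p I)) = (\<Sum>i=1..N. p i) ^ n"
proof (induction n)
  case (Suc n)
  have "(\<Sum>I\<in>words N (Suc n). prod_list (map p I)) = (\<Sum>i=1..N. \<Sum>I\<in>(#) i ` words N n. prod_list (map p I))"
    unfolding words_Suc by (rule sum.UNION_disjoint) auto
  also have "\<dots> = (\<Sum>i=1..N. \<Sum>I\<in>words N n. p i * prod_list (map p I))"
    by (simp add: sum.reindex)
  also have "\<dots> = (\<Sum>i=1..N. p i) * (\<Sum>I\<in>words N n. prod_list (map p I))"
    by (simp add: sum_distrib_left[symmetric] sum_distrib_right)
  finally show ?case using Suc by simp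
qed simp

locale contracting_ifs =
  fixes N :: nat and S :: "nat \<Rightarrow> 'a::euclidean_space \<Rightarrow> 'a"
  assumes ifs: "ifs N S"
begin

definition ratio :: "nat \<Rightarrow> real" where
  "ratio i = (SOME r. 0 < r \<and> r < 1 \<and> (\<forall>x y. dist (S i x) (S i y) = r * dist x y))"

lemma N_ge_2: "2 \<le> N" using ifs by (simp add: ifs_def)

lemma ratio: assumes "i \<in> {1..N}"
  shows "0 < ratio i" "ratio i < 1" "dist (S i x) (S i y) = ratio i * dist x y"
proof -
  have "\<exists>r. 0 < r \<and> r < 1 \<and> (\<forall>x y. dist (S i x) (S i y) = r * dist x y)"
    using ifs assms by (auto simp: ifs_def contractive_similitude_def)
  from someI_ex[OF this, folded ratio_def]
  show "0 < ratio i" "ratio i < 1" "dist (S i x) (S i y) = ratio i * dist x y" by auto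
qed

definition wratio :: "nat list \<Rightarrow> real" where
  "wratio I = prod_list (map ratio I)"

lemma wratio_Nil [simp]: "wratio [] = 1" by (simp add: wratio_def)
lemma wratio_Cons [simp]: "wratio (i # I) = ratio i * wratio I" by (simp add: wratio_def)
lemma wratio_append: "wratio (I @ J) = wratio I * wratio J" by (simp add: wratio_def)

lemma wratio_pos: "set I \<subseteq> {1..N} \<Longrightarrow> 0 < wratio I"
  by (induction I) (auto simp: ratio)

lemma wratio_le_1: "set I \<subseteq> {1..N} \<Longrightarrow> wratio I \<le> 1"
proof (induction I)
  case (Cons i I)
  then show ?case using ratio(1,2)[of i] wratio_pos[of I] by (auto intro!: mult_le_one)
qed simp

lemma dist_word_map: "set I \<subseteq> {1..N} \<Longrightarrow> dist (word_map S I x) (word_map S I y) = wratio I * dist x y"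
  by (induction I) (auto simp: ratio)

lemma word_map_eq_iff: "set I \<subseteq> {1..N} \<Longrightarrow> word_map S I x = word_map S I y \<longleftrightarrow> x = y"
  using dist_word_map[of I x y] wratio_pos[of I] by (metis dist_eq_0_iff mult_eq_0_iff less_irrefl)

lemma inj_word_map: "set I \<subseteq> {1..N} \<Longrightarrow> inj (word_map S I)"
  by (rule injI) (simp add: word_map_eq_iff)

lemma S_eq_iff: "i \<in> {1..N} \<Longrightarrow> S i x = S i y \<longleftrightarrow> x = y"
  using word_map_eq_iff[of "[i]"] by simp

lemma continuous_word_map: "set I \<subseteq> {1..N} \<Longrightarrow> continuous_on X (word_map S I)"
  unfolding continuous_on_iff
proof (intro ballI allI impI)
  fix x and e :: real assume I: "set I \<subseteq> {1..N}" and e: "0 < e"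
  have "dist (word_map S I y) (word_map S I x) < e" if "dist y x < e" for y
    using that dist_word_map[OF I, of y x] wratio_le_1[OF I] mult_right_mono[of "wratio I" 1 "dist y x"] by auto
  then show "\<exists>d>0. \<forall>x'\<in>X. dist x' x < d \<longrightarrow> dist (word_map S I x') (word_map S I x) < e"
    using e by blast
qed

definition max_ratio :: real where "max_ratio = Max (ratio ` {1..N})"
definition min_ratio :: real where "min_ratio = Min (ratio ` {1..N})"

lemma ratio_le_max: "i \<in> {1..N} \<Longrightarrow> ratio i \<le> max_ratio" by (simp add: max_ratio_def)
lemma ratio_ge_min: "i \<in> {1..N} \<Longrightarrow> min_ratio \<le> ratio i" by (simp add: min_ratio_def)
lemma max_ratio: "0 < max_ratio" "max_ratio < 1"
proof -
  have ne: "ratio ` {1..N} \<noteq> {}" "finite (ratio ` {1..N})" using N_ge_2 by auto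
  show "max_ratio < 1" using ne ratio by (auto simp: max_ratio_def)
  show "0 < max_ratio" using ratio(1)[of 1] ratio_le_max[of 1] N_ge_2 by auto
qed
lemma min_ratio: "0 < min_ratio" "min_ratio \<le> 1"
proof -
  have ne: "ratio ` {1..N} \<noteq> {}" "finite (ratio ` {1..N})" using N_ge_2 by auto
  show "0 < min_ratio" using ne ratio by (auto simp: min_ratio_def)
  show "min_ratio \<le> 1" using ratio(2)[of 1] ratio_ge_min[of 1] N_ge_2 by auto
qed

lemma wratio_le_power: "set I \<subseteq> {1..N} \<Longrightarrow> wratio I \<le> max_ratio ^ length I"
proof (induction I)
  case (Cons i I)
  then show ?case using ratio(1)[of i] ratio_le_max[of i] wratio_pos[of I]
    by (auto intro!: mult_mono simp: max_ratio(1) less_imp_le)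
qed simp

lemma max_ratio_power_less:
  assumes "0 < e" shows "\<exists>n0. \<forall>n\<ge>n0. max_ratio ^ n * D < e"
proof -
  have "(\<lambda>n. max_ratio ^ n * D) \<longlonglongrightarrow> 0 * D"
    using max_ratio by (intro tendsto_mult LIMSEQ_realpow_zero tendsto_const) auto
  then have "eventually (\<lambda>n. max_ratio ^ n * D < e) sequentially"
    using assms by (intro order_tendstoD) auto
  then show ?thesis by (simp add: eventually_sequentially)
qed

lemma sum_wratio_powr: "(\<Sum>I\<in>words N n. wratio I powr t) = (\<Sum>i=1..N. ratio i powr t) ^ n"
proof -
  have "(\<Sum>I\<in>words N n. wratio I powr t) = (\<Sum>I\<in>words N n. prod_list (map (\<lambda>i. ratio i powr t) I))"
  proof (intro sum.cong refl)
    fix I assume "I \<in> words N n"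
    then have "set I \<subseteq> {1..N}" by (simp add: words_def)
    then show "wratio I powr t = prod_list (map (\<lambda>i. ratio i powr t) I)"
      by (induction I) (auto simp: powr_mult wratio_pos ratio less_imp_le)
  qed
  then show ?thesis by (simp add: sum_words_prod_list)
qed

lemma similarity_dimension_exists: "\<exists>s>0. (\<Sum>i=1..N. ratio i powr s) = 1"
proof -
  define f where "f t = (\<Sum>i=1..N. ratio i powr t)" for t
  have f0: "1 < f 0"
  proof -
    have "f 0 = (\<Sum>i=1..N. 1)" unfolding f_def by (intro sum.cong refl) (use ratio in fastforce)
    then show ?thesis using N_ge_2 by simp
  qed
  obtain n where n: "max_ratio ^ n * real N < 1" using max_ratio_power_less[of 1 "real N"] by auto
  have "f (real n) \<le> (\<Sum>i=1..N. max_ratio ^ n)" unfolding f_def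
  proof (rule sum_mono)
    fix i assume i: "i \<in> {1..N}"
    show "ratio i powr real n \<le> max_ratio ^ n"
      using ratio[OF i] ratio_le_max[OF i] by (simp add: powr_realpow power_mono)
  qed
  then have fn: "f (real n) \<le> 1" using n by (simp add: mult.commute)
  have "continuous_on {0..real n} f" unfolding f_def
    by (intro continuous_intros) (use ratio in force)
  then obtain t where t: "0 \<le> t" "t \<le> real n" "f t = 1"
    using IVT2'[of f "real n" 1 0] fn f0 by auto
  then have "t \<noteq> 0" using f0 by auto
  then show ?thesis using t by (auto simp: f_def intro!: exI[of _ t])
qed

text \<open>The similarity dimension.\<close>

definition sdim :: real where "sdim = (SOME s. s > 0 \<and> (\<Sum>i=1..N. ratio i powr s) = 1)"

lemma sdim: "0 < sdim" "(\<Sum>i=1..N. ratio i powr sdim) = 1"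
  using someI_ex[OF similarity_dimension_exists, folded sdim_def] by auto

lemma sum_wratio_sdim: "(\<Sum>I\<in>words N n. wratio I powr sdim) = 1"
  unfolding sum_wratio_powr sdim(2) by simp

lemma hausdorff_measure_word_image:
  "set I \<subseteq> {1..N} \<Longrightarrow> 0 \<le> t \<Longrightarrow> hausdorff_measure t (word_map S I ` X) = ennreal (wratio I powr t) * hausdorff_measure t X"
  by (rule hausdorff_measure_similar_image) (auto simp: wratio_pos dist_word_map)

end

section \<open>Invariant families of sets\<close>

lemma sum_UN_le:
  fixes f :: "'b \<Rightarrow> real"
  assumes "finite I" "\<And>i. i \<in> I \<Longrightarrow> finite (A i)" "\<And>x. 0 \<le> f x"
  shows "sum f (\<Union>i\<in>I. A i) \<le> (\<Sum>i\<in>I. sum f (A i))"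
  using assms(1,2)
proof (induction I rule: finite_induct)
  case (insert i I)
  have "sum f (A i \<union> (\<Union>j\<in>I. A j)) + sum f (A i \<inter> (\<Union>j\<in>I. A j)) = sum f (A i) + sum f (\<Union>j\<in>I. A j)"
    using insert by (intro sum.union_inter) auto
  moreover have "0 \<le> sum f (A i \<inter> (\<Union>j\<in>I. A j))" using assms(3) by (rule sum_nonneg)
  moreover have "sum f (\<Union>j\<in>I. A j) \<le> (\<Sum>j\<in>I. sum f (A j))" using insert by auto
  ultimately show ?case using insert.hyps by simp
qed simp

context contracting_ifs
begin

text \<open>Substituting \<open>n\<close> times shows that every point of \<open>F u\<close> has distance at most
  \<open>max_ratio ^ n * D\<close> from \<open>E u\<close>. The inclusions in the hypotheses go in opposite directions, so
  the lemma also compares an invariant family with a family for which only one inclusion is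
  known.\<close>

lemma fixed_family_subset:
  fixes V :: "'u set" and \<tau> :: "'u \<Rightarrow> ('u \<times> nat list) set"
  assumes V: "finite V"
    and \<tau>: "\<And>u v I. u \<in> V \<Longrightarrow> (v, I) \<in> \<tau> u \<Longrightarrow> v \<in> V \<and> I \<noteq> [] \<and> set I \<subseteq> {1..N}"
    and F: "\<And>u. u \<in> V \<Longrightarrow> bounded (F u) \<and> F u \<subseteq> (\<Union>(v, I)\<in>\<tau> u. word_map S I ` F v)"
    and E: "\<And>u. u \<in> V \<Longrightarrow> compact (E u) \<and> E u \<noteq> {} \<and> (\<Union>(v, I)\<in>\<tau> u. word_map S I ` E v) \<subseteq> E u"
    and u: "u \<in> V"
  shows "F u \<subseteq> E u"
proof -
  have "bounded (\<Union>u\<in>V. F u \<union> E u)"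
    using V F E by (intro bounded_UN) (auto simp: compact_imp_bounded)
  then obtain D where D: "\<And>x y. x \<in> (\<Union>u\<in>V. F u \<union> E u) \<Longrightarrow> y \<in> (\<Union>u\<in>V. F u \<union> E u) \<Longrightarrow> dist x y \<le> D"
    unfolding bounded_two_points by blast
  have *: "\<exists>y\<in>E u. dist x y \<le> max_ratio ^ n * D" if "u \<in> V" "x \<in> F u" for n u x
    using that
  proof (induction n arbitrary: u x)
    case 0
    obtain y where y: "y \<in> E u" using E[OF 0(1)] by auto
    then have "dist x y \<le> D" using 0 by (intro D) auto
    then show ?case using y by (intro bexI[of _ y]) auto
  next
    case (Suc n)
    from F[OF Suc.prems(1)] Suc.prems(2) obtain v I x' where
      v: "(v, I) \<in> \<tau> u" "x' \<in> F v" "x = word_map S I x'" by auto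
    have I: "v \<in> V" "I \<noteq> []" "set I \<subseteq> {1..N}" using \<tau>[OF Suc.prems(1) v(1)] by auto
    obtain y' where y': "y' \<in> E v" "dist x' y' \<le> max_ratio ^ n * D" using Suc.IH[OF I(1) v(2)] by auto
    have "max_ratio ^ length I \<le> max_ratio ^ 1"
      using max_ratio I(2) by (intro power_decreasing) (auto simp: Suc_le_eq)
    then have "wratio I \<le> max_ratio" using wratio_le_power[OF I(3)] by simp
    then have "dist x (word_map S I y') \<le> max_ratio * (max_ratio ^ n * D)"
      unfolding v(3) dist_word_map[OF I(3)] using y' max_ratio by (intro mult_mono) auto
    moreover have "word_map S I y' \<in> E u" using E[OF Suc.prems(1)] v(1) y'(1) by blast
    ultimately show ?case by (auto simp: mult.assoc)
  qed
  show ?thesis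
  proof
    fix x assume x: "x \<in> F u"
    have "\<exists>y\<in>E u. dist y x < e" if "e > 0" for e
    proof -
      obtain n where "max_ratio ^ n * D < e" using max_ratio_power_less[OF \<open>e > 0\<close>, of D] by auto
      then show ?thesis using *[OF u x, of n] by (auto simp: dist_commute intro: le_less_trans)
    qed
    then have "x \<in> closure (E u)" by (simp add: closure_approachable)
    then show "x \<in> E u" using E[OF u] by (simp add: compact_imp_closed closure_closed)
  qed
qed

end

locale ifs_attractor = contracting_ifs +
  fixes K :: "'a set"
  assumes invariant: "invariant_set N S K"
begin

lemma K: "compact K" "K \<noteq> {}" "K = (\<Union>j\<in>{1..N}. S j ` K)"
  using invariant by (simp_all add: invariant_set_def)

lemma K_words: "K = (\<Union>I\<in>words N n. word_map S I ` K)"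
proof (induction n)
  case (Suc n)
  have "(\<Union>I\<in>words N (Suc n). word_map S I ` K) = (\<Union>i\<in>{1..N}. S i ` (\<Union>I\<in>words N n. word_map S I ` K))"
    by (auto simp: words_Suc)
  then show ?case using Suc K(3) by simp
qed simp

lemma word_map_K_subset: "set I \<subseteq> {1..N} \<Longrightarrow> word_map S I ` K \<subseteq> K"
proof -
  assume "set I \<subseteq> {1..N}"
  then have "I \<in> words N (length I)" by (simp add: words_def)
  then show ?thesis using K_words[of "length I"] by blast
qed

lemma bounded_word_image: "set I \<subseteq> {1..N} \<Longrightarrow> bounded (word_map S I ` K)"
  using word_map_K_subset K(1) by (meson bounded_subset compact_imp_bounded)

lemma diameter_word_image: "set I \<subseteq> {1..N} \<Longrightarrow> diameter (word_map S I ` K) \<le> wratio I * diameter K"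
  by (rule diameter_image_le) (auto simp: compact_imp_bounded K(1) dist_word_map wratio_pos less_imp_le)

lemma hausdorff_premeasure_K_le:
  assumes "0 < \<delta>" "0 < t" "max_ratio ^ n * diameter K \<le> \<delta>"
  shows "hausdorff_premeasure t \<delta> K \<le> ennreal ((\<Sum>i=1..N. ratio i powr t) ^ n * diameter K powr t)"
proof -
  have dK: "0 \<le> diameter K" by (simp add: diameter_ge_0 compact_imp_bounded K(1))
  have I: "set I \<subseteq> {1..N}" "length I = n" if "I \<in> words N n" for I using that by (auto simp: words_def)
  have "hausdorff_premeasure t \<delta> K = hausdorff_premeasure t \<delta> (\<Union>I\<in>words N n. word_map S I ` K)"
    using K_words[of n] by simp
  also have "\<dots> \<le> (\<Sum>I\<in>words N n. ennreal (diam_power t (word_map S I ` K)))"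
  proof (rule hausdorff_premeasure_finite_cover_le)
    fix J assume J: "J \<in> words N n"
    show "bounded (word_map S J ` K)" using bounded_word_image I[OF J] by simp
    have "wratio J * diameter K \<le> max_ratio ^ n * diameter K"
      using wratio_le_power[OF I(1)[OF J]] I(2)[OF J] dK by (intro mult_right_mono) auto
    then show "diameter (word_map S J ` K) \<le> \<delta>"
      using diameter_word_image[OF I(1)[OF J]] assms(3) by linarith
  qed (use assms in auto)
  also have "\<dots> \<le> (\<Sum>I\<in>words N n. ennreal (wratio I powr t * diameter K powr t))"
  proof (intro sum_mono ennreal_leI)
    fix J assume J: "J \<in> words N n"
    have "diam_power t (word_map S J ` K) = diameter (word_map S J ` K) powr t"
      using K(2) assms(2) by (simp add: diam_power_def)
    also have "\<dots> \<le> (wratio J * diameter K) powr t"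
      using diameter_word_image[OF I(1)[OF J]] bounded_word_image[OF I(1)[OF J]] assms(2)
      by (intro powr_mono2) (auto simp: diameter_ge_0)
    also have "\<dots> = wratio J powr t * diameter K powr t"
      using wratio_pos[OF I(1)[OF J]] dK by (simp add: powr_mult)
    finally show "diam_power t (word_map S J ` K) \<le> wratio J powr t * diameter K powr t" .
  qed
  also have "\<dots> = ennreal (\<Sum>I\<in>words N n. wratio I powr t * diameter K powr t)"
    by (rule sum_ennreal) auto
  also have "(\<Sum>I\<in>words N n. wratio I powr t * diameter K powr t) = (\<Sum>i=1..N. ratio i powr t) ^ n * diameter K powr t"
    by (simp add: sum_distrib_right[symmetric] sum_wratio_powr)
  finally show ?thesis .
qed

lemma hausdorff_measure_K_finite: "hausdorff_measure sdim K < \<infinity>"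
proof -
  have "hausdorff_measure sdim K \<le> ennreal (diameter K powr sdim)"
    unfolding hausdorff_measure_def
  proof (rule SUP_least)
    fix \<delta> :: real assume "\<delta> \<in> {0<..}"
    then have \<delta>: "0 < \<delta>" by simp
    obtain n where "max_ratio ^ n * diameter K < \<delta>" using max_ratio_power_less[OF \<delta>] by auto
    then show "hausdorff_premeasure sdim \<delta> K \<le> ennreal (diameter K powr sdim)"
      using hausdorff_premeasure_K_le[OF \<delta> sdim(1), of n] unfolding sdim(2) by simp
  qed
  then show ?thesis using ennreal_less_top le_less_trans by (metis infinity_ennreal_def)
qed

lemma hausdorff_measure_K_eq_0:
  assumes "sdim < t" shows "hausdorff_measure t K = 0"
proof -
  define q where "q = (\<Sum>i=1..N. ratio i powr t)"
  have t: "0 < t" using assms sdim(1) by simp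
  have "q < (\<Sum>i=1..N. ratio i powr sdim)" unfolding q_def
    using ratio assms N_ge_2 by (intro sum_strict_mono) (auto intro!: powr_less_mono')
  then have q: "0 \<le> q" "q < 1" unfolding sdim(2) by (auto simp: q_def intro!: sum_nonneg)
  have "hausdorff_premeasure t \<delta> K = 0" if \<delta>: "0 < \<delta>" for \<delta>
  proof -
    obtain n0 where n0: "\<And>n. n0 \<le> n \<Longrightarrow> max_ratio ^ n * diameter K < \<delta>" using max_ratio_power_less[OF \<delta>] by metis
    have "hausdorff_premeasure t \<delta> K \<le> ennreal e" if e: "0 < e" for e
    proof -
      have "(\<lambda>n. q ^ n * diameter K powr t) \<longlonglongrightarrow> 0 * diameter K powr t"
        using q by (intro tendsto_mult LIMSEQ_realpow_zero tendsto_const)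
      then have "eventually (\<lambda>n. q ^ n * diameter K powr t < e) sequentially"
        using e by (intro order_tendstoD) auto
      then obtain n1 where n1: "\<And>n. n1 \<le> n \<Longrightarrow> q ^ n * diameter K powr t < e" by (auto simp: eventually_sequentially)
      have "hausdorff_premeasure t \<delta> K \<le> ennreal (q ^ max n0 n1 * diameter K powr t)"
        unfolding q_def using n0[of "max n0 n1"] by (intro hausdorff_premeasure_K_le[OF \<delta> t]) auto
      also have "\<dots> \<le> ennreal e" using n1[of "max n0 n1"] by (intro ennreal_leI) auto
      finally show ?thesis .
    qed
    then show ?thesis
      using ennreal_le_epsilon[of 0 "hausdorff_premeasure t \<delta> K"] by (simp add: antisym)
  qed
  then show ?thesis unfolding hausdorff_measure_def by (auto intro!: SUP_eq_const)
qed

lemma hausdorff_dim_K: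
  assumes "0 < hausdorff_measure sdim K"
  shows "hausdorff_dim K = sdim"
  unfolding hausdorff_dim_def
proof (rule antisym)
  let ?A = "{s. 0 \<le> s \<and> hausdorff_measure s K = 0}"
  have bdd: "bdd_below ?A" by (rule bdd_belowI[of _ 0]) auto
  have mem: "sdim + e \<in> ?A" if "0 < e" for e using that hausdorff_measure_K_eq_0[of "sdim + e"] sdim(1) by auto
  show "Inf ?A \<le> sdim"
    by (rule field_le_epsilon, rule cInf_lower, rule mem, assumption, rule bdd)
  show "sdim \<le> Inf ?A"
  proof (rule cInf_greatest)
    show "?A \<noteq> {}" using mem[of 1] by auto
    fix t assume "t \<in> ?A"
    then have "0 \<le> t" "hausdorff_measure t K = 0" by auto
    then show "sdim \<le> t" using hausdorff_measure_antimono[of t sdim K] assms by (metis linorder_le_cases le_zero_eq less_irrefl)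
  qed
qed

end

section \<open>Positive measure under the open set condition\<close>

locale osc_attractor = ifs_attractor +
  assumes osc: "open_set_condition N S"
begin

text \<open>The two words differ at some first letter, where the open set condition separates the
  images.\<close>

lemma incomparable_disjoint:
  assumes "open U" "(\<Union>i\<in>{1..N}. S i ` U) \<subseteq> U" "disjoint_family_on (\<lambda>i. S i ` U) {1..N}"
    and IJ: "set I \<subseteq> {1..N}" "set J \<subseteq> {1..N}" "\<not> prefix I J" "\<not> prefix J I"
  shows "word_map S I ` U \<inter> word_map S J ` U = {}"
  using IJ
proof (induction I arbitrary: J)
  case Nil then show ?case by simp
next
  case (Cons i I)
  obtain j J' where J: "J = j # J'" using Cons.prems by (cases J) auto
  have sub: "word_map S L ` U \<subseteq> U" if "set L \<subseteq> {1..N}" for L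
    using that
  proof (induction L)
    case (Cons l L)
    then have "word_map S L ` U \<subseteq> U" "l \<in> {1..N}" by auto
    moreover from this have "S l ` U \<subseteq> U" using assms(2) by blast
    ultimately show ?case by (force simp: image_subset_iff)
  qed auto
  show ?case
  proof (cases "i = j")
    case True
    then have "word_map S I ` U \<inter> word_map S J' ` U = {}" using Cons J by auto
    then show ?thesis using Cons.prems True J S_eq_iff[of i] by fastforce
  next
    case False
    have "S i ` U \<inter> S j ` U = {}" using assms(3) False Cons.prems J by (auto simp: disjoint_family_on_def)
    moreover have "word_map S I ` U \<subseteq> U" "word_map S J' ` U \<subseteq> U" using sub Cons.prems J by auto
    ultimately show ?thesis unfolding J word_map_Cons image_comp[symmetric] by blast
  qed
qed

text \<open>The words whose ratio drops to \<open>\<rho>\<close> or below with the last letter; their cells have sizes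
  comparable to \<open>\<rho>\<close>.\<close>

definition stopping :: "real \<Rightarrow> nat list set" where
  "stopping \<rho> = {I. I \<noteq> [] \<and> set I \<subseteq> {1..N} \<and> wratio I \<le> \<rho> \<and> \<rho> < wratio (butlast I)}"

lemma wratio_antimono_prefix: "prefix I J \<Longrightarrow> set J \<subseteq> {1..N} \<Longrightarrow> wratio J \<le> wratio I"
proof -
  assume "prefix I J" and J: "set J \<subseteq> {1..N}"
  then obtain L where L: "J = I @ L" by (auto simp: prefix_def)
  then show ?thesis using J wratio_le_1[of L] wratio_pos[of I] by (simp add: wratio_append mult_le_cancel_left2)
qed

lemma stopping_incomparable:
  assumes "I \<in> stopping \<rho>" "J \<in> stopping \<rho>" "I \<noteq> J" shows "\<not> prefix I J"
proof
  assume "prefix I J"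
  have J: "J \<noteq> []" "set J \<subseteq> {1..N}" using assms by (auto simp: stopping_def)
  have "prefix I (butlast J @ [last J])" using \<open>prefix I J\<close> J by simp
  then have "prefix I (butlast J)" using assms(3) J unfolding prefix_snoc by simp
  moreover have "set (butlast J) \<subseteq> {1..N}" using J by (meson in_set_butlastD subset_iff)
  ultimately have "wratio (butlast J) \<le> wratio I" by (rule wratio_antimono_prefix)
  then show False using assms by (auto simp: stopping_def)
qed

lemma stopping_lower:
  assumes "I \<in> stopping \<rho>" shows "min_ratio * \<rho> \<le> wratio I"
proof -
  have I: "I \<noteq> []" "set I \<subseteq> {1..N}" "\<rho> < wratio (butlast I)" using assms by (auto simp: stopping_def)
  have "wratio I = wratio (butlast I @ [last I])" using I by simp
  also have "\<dots> = wratio (butlast I) * ratio (last I)" by (simp add: wratio_append del: append_butlast_last_id)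
  finally have eq: "wratio I = wratio (butlast I) * ratio (last I)" .
  have l: "last I \<in> {1..N}" using I last_in_set by blast
  have pos: "0 < wratio (butlast I)" using I by (intro wratio_pos) (meson in_set_butlastD subset_iff)
  have "min_ratio * \<rho> \<le> min_ratio * wratio (butlast I)" using I min_ratio by simp
  also have "\<dots> \<le> ratio (last I) * wratio (butlast I)" using ratio_ge_min[OF l] pos by simp
  finally show ?thesis by (simp add: eq mult.commute)
qed

lemma stopping_prefix_exists:
  assumes "set J \<subseteq> {1..N}" "wratio J \<le> \<rho>" "\<rho> < 1"
  shows "\<exists>I\<in>stopping \<rho>. prefix I J"
  using assms
proof (induction J rule: rev_induct)
  case (snoc j J)
  show ?case
  proof (cases "wratio J \<le> \<rho>")
    case True
    then obtain I where "I \<in> stopping \<rho>" "prefix I J" using snoc by auto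
    then show ?thesis by (auto intro: prefix_prefix)
  next
    case False
    then have "J @ [j] \<in> stopping \<rho>" using snoc.prems by (auto simp: stopping_def)
    then show ?thesis by blast
  qed
qed auto

text \<open>Moran's argument: the map of a stopping word takes a fixed ball inside \<open>U\<close> to a ball with
  radius comparable to \<open>\<rho>\<close>, and for different stopping words these balls are disjoint. So the
  images of the centre \<open>x0\<close> are separated at scale \<open>\<rho>\<close>, while those belonging to cells that meet
  \<open>O'\<close> lie in a ball of radius comparable to \<open>\<rho>\<close>.\<close>

lemma stopping_hits_bounded:
  "\<exists>q. 1 \<le> q \<and> (\<forall>\<rho> O'. 0 < \<rho> \<longrightarrow> (\<forall>y\<in>O'. \<forall>z\<in>O'. dist y z \<le> \<rho>) \<longrightarrow>
     finite {I \<in> stopping \<rho>. word_map S I ` K \<inter> O' \<noteq> {}} \<and>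
     card {I \<in> stopping \<rho>. word_map S I ` K \<inter> O' \<noteq> {}} \<le> q)"
proof -
  obtain U where U: "open U" "U \<noteq> {}" "(\<Union>i\<in>{1..N}. S i ` U) \<subseteq> U" "disjoint_family_on (\<lambda>i. S i ` U) {1..N}"
    using osc by (auto simp: open_set_condition_def)
  obtain x0 where x0: "x0 \<in> U" using U by blast
  obtain \<epsilon> where \<epsilon>: "0 < \<epsilon>" "ball x0 \<epsilon> \<subseteq> U" using U(1) x0 by (meson openE)
  have "bounded (insert x0 K)" using K(1) by (simp add: compact_imp_bounded)
  then obtain D where D: "\<And>x y. x \<in> insert x0 K \<Longrightarrow> y \<in> insert x0 K \<Longrightarrow> dist x y \<le> D"
    unfolding bounded_two_points by blast
  have D0: "0 \<le> D" using D[of x0 x0] by simp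
  define \<sigma> where "\<sigma> = \<epsilon> * min_ratio"
  have \<sigma>: "0 < \<sigma>" using \<epsilon> min_ratio by (simp add: \<sigma>_def)
  have "compact (cball (0::'a) (D + 1))" by simp
  \<comment> \<open>Two separated points do not fit into the same ball of radius \<open>\<sigma> / 2\<close>.\<close>
  then obtain C where C: "finite C" "cball (0::'a) (D + 1) \<subseteq> (\<Union>c\<in>C. ball c (\<sigma> / 2))"
    unfolding compact_eq_totally_bounded using \<sigma> by (metis half_gt_zero)
  have separated: "\<sigma> * \<rho> \<le> dist (word_map S I x0) (word_map S J x0)"
    if IJ: "I \<in> stopping \<rho>" "J \<in> stopping \<rho>" "I \<noteq> J" for I J \<rho>
  proof (rule ccontr)
    assume "\<not> ?thesis"
    then have less: "dist (word_map S I x0) (word_map S J x0) < \<sigma> * \<rho>" by simp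
    have I: "set I \<subseteq> {1..N}" and J: "set J \<subseteq> {1..N}" using IJ by (auto simp: stopping_def)
    have "\<sigma> * \<rho> \<le> \<epsilon> * wratio I" using stopping_lower[OF IJ(1)] \<epsilon> by (simp add: \<sigma>_def mult.assoc)
    then have less2: "dist (word_map S I x0) (word_map S J x0) < \<epsilon> * wratio I" using less by simp
    have "surj (word_map S I)"
      using similitude_surj[of "wratio I" "word_map S I"] wratio_pos[OF I] dist_word_map[OF I] by blast
    then obtain y where y: "word_map S J x0 = word_map S I y" by (metis surjD)
    have "wratio I * dist x0 y < wratio I * \<epsilon>" using less2 unfolding y dist_word_map[OF I] by (simp add: mult.commute)
    then have "y \<in> U" using wratio_pos[OF I] \<epsilon> by auto
    then have "word_map S J x0 \<in> word_map S I ` U" unfolding y by (rule imageI)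
    moreover have "word_map S J x0 \<in> word_map S J ` U" using x0 by (rule imageI)
    moreover have "word_map S I ` U \<inter> word_map S J ` U = {}"
      using IJ stopping_incomparable by (intro incomparable_disjoint[OF U(1,3,4) I J]) auto
    ultimately show False by blast
  qed
  show ?thesis
  proof (intro exI[of _ "Suc (card C)"] conjI allI impI)
    fix \<rho> :: real and O' :: "'a set"
    assume \<rho>: "0 < \<rho>" and O': "\<forall>y\<in>O'. \<forall>z\<in>O'. dist y z \<le> \<rho>"
    define H where "H = {I \<in> stopping \<rho>. word_map S I ` K \<inter> O' \<noteq> {}}"
    have "finite H \<and> card H \<le> card C"
    proof (cases "O' = {}")
      case False
      then obtain z where z: "z \<in> O'" by blast
      define g where "g I = (1 / \<rho>) *\<^sub>R (word_map S I x0 - z)" for I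
      have "\<exists>c\<in>C. g I \<in> ball c (\<sigma> / 2)" if "I \<in> H" for I
      proof -
        have I: "I \<in> stopping \<rho>" "set I \<subseteq> {1..N}" "wratio I \<le> \<rho>" using that by (auto simp: H_def stopping_def)
        obtain k where k: "k \<in> K" "word_map S I k \<in> O'" using \<open>I \<in> H\<close> by (auto simp: H_def)
        have "dist (word_map S I x0) z \<le> dist (word_map S I x0) (word_map S I k) + dist (word_map S I k) z"
          by (rule dist_triangle)
        also have "\<dots> \<le> \<rho> * D + \<rho>"
          unfolding dist_word_map[OF I(2)] using D[of x0 k] k O' z I(3) \<rho> D0 by (intro add_mono mult_mono) auto
        finally have "norm (word_map S I x0 - z) \<le> (D + 1) * \<rho>" by (simp add: dist_norm algebra_simps)
        then have "norm (g I) \<le> D + 1" using \<rho> unfolding g_def norm_scaleR by (simp add: field_simps)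
        then have "g I \<in> cball 0 (D + 1)" by simp
        then show ?thesis using C(2) by blast
      qed
      then obtain h where h: "\<And>I. I \<in> H \<Longrightarrow> h I \<in> C \<and> g I \<in> ball (h I) (\<sigma> / 2)" by metis
      have inj: "inj_on h H"
      proof (rule inj_onI, rule ccontr)
        fix I J assume IJ: "I \<in> H" "J \<in> H" "h I = h J" "I \<noteq> J"
        have "dist (h I) (g I) < \<sigma> / 2" "dist (h I) (g J) < \<sigma> / 2" using h[OF IJ(1)] h[OF IJ(2)] IJ(3) by auto
        then have "dist (g I) (g J) < \<sigma>"
          using dist_triangle_half_r by blast
        moreover have "g I - g J = (1 / \<rho>) *\<^sub>R (word_map S I x0 - word_map S J x0)" by (simp add: g_def algebra_simps)
        then have "dist (g I) (g J) = (1 / \<rho>) * dist (word_map S I x0) (word_map S J x0)"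
          unfolding dist_norm using \<rho> by (metis abs_of_pos norm_scaleR zero_less_divide_1_iff)
        ultimately have "dist (word_map S I x0) (word_map S J x0) < \<sigma> * \<rho>" using \<rho> by (simp add: field_simps)
        then show False using separated[of I \<rho> J] IJ by (auto simp: H_def)
      qed
      have "h ` H \<subseteq> C" using h by blast
      then show ?thesis using C(1) inj by (metis card_inj_on_le finite_imageD finite_subset)
    qed (simp add: H_def)
    then show "finite {I \<in> stopping \<rho>. word_map S I ` K \<inter> O' \<noteq> {}}"
      "card {I \<in> stopping \<rho>. word_map S I ` K \<inter> O' \<noteq> {}} \<le> Suc (card C)"
      unfolding H_def by auto
  qed simp
qed

lemma sum_wratio_extensions_le:
  assumes "set I \<subseteq> {1..N}"
  shows "(\<Sum>J\<in>{J \<in> words N n. prefix I J}. wratio J powr sdim) \<le> wratio I powr sdim"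
proof (cases "length I \<le> n")
  case True
  have "{J \<in> words N n. prefix I J} = (\<lambda>L. I @ L) ` words N (n - length I)"
  proof (intro equalityI subsetI)
    fix J assume "J \<in> {J \<in> words N n. prefix I J}"
    then obtain L where L: "J = I @ L" "J \<in> words N n" by (auto simp: prefix_def)
    then have "L \<in> words N (n - length I)" by (auto simp: words_def)
    then show "J \<in> (\<lambda>L. I @ L) ` words N (n - length I)" using L by blast
  next
    fix J assume "J \<in> (\<lambda>L. I @ L) ` words N (n - length I)"
    then obtain L where "J = I @ L" "L \<in> words N (n - length I)" by blast
    then show "J \<in> {J \<in> words N n. prefix I J}" using True assms by (simp add: words_def)
  qed
  then have "(\<Sum>J\<in>{J \<in> words N n. prefix I J}. wratio J powr sdim) = (\<Sum>L\<in>words N (n - length I). wratio (I @ L) powr sdim)"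
    by (simp add: sum.reindex inj_on_def)
  also have "\<dots> = (\<Sum>L\<in>words N (n - length I). wratio I powr sdim * wratio L powr sdim)"
    using assms wratio_pos by (intro sum.cong refl) (auto simp: wratio_append powr_mult words_def less_imp_le)
  also have "\<dots> = wratio I powr sdim" by (simp add: sum_distrib_left[symmetric] sum_wratio_sdim)
  finally show ?thesis by simp
next
  case False
  then have "{J \<in> words N n. prefix I J} = {}" by (auto simp: words_def dest: prefix_length_le)
  then show ?thesis by (simp only:) simp
qed

text \<open>The weights \<open>wratio J powr sdim\<close> of the words of a deep level add up to \<open>1\<close>. Every such word
  has a prefix that stops at the scale \<open>\<rho> i\<close> of a set \<open>O' i\<close> met by the cell of the prefix. The
  words that extend a given prefix have together the weight of the prefix, which is at most
  \<open>\<rho> i powr sdim\<close>, and at most \<open>q\<close> prefixes belong to each \<open>i\<close>.\<close>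

lemma cover_sum_ge:
  assumes q: "1 \<le> q"
    and hits: "\<And>\<rho> O'. 0 < \<rho> \<Longrightarrow> (\<forall>y\<in>O'. \<forall>z\<in>O'. dist y z \<le> \<rho>) \<Longrightarrow>
     finite {I \<in> stopping \<rho>. word_map S I ` K \<inter> O' \<noteq> {}} \<and>
     card {I \<in> stopping \<rho>. word_map S I ` K \<inter> O' \<noteq> {}} \<le> q"
    and F: "finite F" "K \<subseteq> (\<Union>i\<in>F. O' i)"
    and \<rho>: "\<And>i. i \<in> F \<Longrightarrow> 0 < \<rho> i \<and> \<rho> i < 1" "\<And>i y z. i \<in> F \<Longrightarrow> y \<in> O' i \<Longrightarrow> z \<in> O' i \<Longrightarrow> dist y z \<le> \<rho> i"
  shows "1 \<le> real q * (\<Sum>i\<in>F. \<rho> i powr sdim)"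
proof -
  have Fne: "F \<noteq> {}" using F K(2) by auto
  have "0 < Min (\<rho> ` F)" using F Fne \<rho>(1) by simp
  then obtain n where n: "max_ratio ^ n * 1 < Min (\<rho> ` F)"
    using max_ratio_power_less[of "Min (\<rho> ` F)" 1] by blast
  define H where "H i = {I \<in> stopping (\<rho> i). word_map S I ` K \<inter> O' i \<noteq> {}}" for i
  have H: "finite (H i)" "card (H i) \<le> q" if "i \<in> F" for i
    using hits[of "\<rho> i" "O' i"] \<rho> that by (auto simp: H_def)
  have cover: "words N n \<subseteq> (\<Union>i\<in>F. \<Union>I\<in>H i. {J \<in> words N n. prefix I J})"
  proof
    fix J assume J: "J \<in> words N n"
    then have J': "set J \<subseteq> {1..N}" "length J = n" by (auto simp: words_def)
    obtain k where k: "k \<in> K" using K(2) by blast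
    then have "word_map S J k \<in> K" using word_map_K_subset[OF J'(1)] by blast
    then obtain i where i: "i \<in> F" "word_map S J k \<in> O' i" using F(2) by blast
    have "wratio J \<le> max_ratio ^ n" using wratio_le_power[OF J'(1)] J'(2) by simp
    also have "\<dots> \<le> \<rho> i"
    proof -
      have "Min (\<rho> ` F) \<le> \<rho> i" using F(1) i(1) by (intro Min_le) auto
      then show ?thesis using n by linarith
    qed
    finally obtain I where I: "I \<in> stopping (\<rho> i)" "prefix I J"
      using stopping_prefix_exists[OF J'(1)] \<rho>(1)[OF i(1)] by blast
    obtain L where L: "J = I @ L" using I by (auto simp: prefix_def)
    have "word_map S L k \<in> K" using word_map_K_subset[of L] k L J' by auto
    then have "word_map S J k \<in> word_map S I ` K" by (simp add: L word_map_append)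
    then have "I \<in> H i" using I i by (auto simp: H_def)
    then show "J \<in> (\<Union>i\<in>F. \<Union>I\<in>H i. {J \<in> words N n. prefix I J})" using i I J by blast
  qed
  have Hw: "set I \<subseteq> {1..N}" "wratio I \<le> \<rho> i" if "I \<in> H i" for I i
    using that by (auto simp: H_def stopping_def)
  have "1 = (\<Sum>J\<in>words N n. wratio J powr sdim)" by (simp add: sum_wratio_sdim)
  also have "\<dots> \<le> (\<Sum>J\<in>(\<Union>i\<in>F. \<Union>I\<in>H i. {J \<in> words N n. prefix I J}). wratio J powr sdim)"
    using cover F H by (intro sum_mono2) auto
  also have "\<dots> \<le> (\<Sum>i\<in>F. \<Sum>J\<in>(\<Union>I\<in>H i. {J \<in> words N n. prefix I J}). wratio J powr sdim)"
    using F H by (intro sum_UN_le) auto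
  also have "\<dots> \<le> (\<Sum>i\<in>F. \<Sum>I\<in>H i. \<Sum>J\<in>{J \<in> words N n. prefix I J}. wratio J powr sdim)"
    using H by (intro sum_mono sum_UN_le) auto
  also have "\<dots> \<le> (\<Sum>i\<in>F. \<Sum>I\<in>H i. wratio I powr sdim)"
    using Hw by (intro sum_mono sum_wratio_extensions_le) auto
  also have "\<dots> \<le> (\<Sum>i\<in>F. \<Sum>I\<in>H i. \<rho> i powr sdim)"
    using Hw sdim(1) wratio_pos by (intro sum_mono powr_mono2) (auto simp: less_imp_le)
  also have "\<dots> \<le> (\<Sum>i\<in>F. real q * \<rho> i powr sdim)"
    using H by (intro sum_mono) (auto intro!: mult_right_mono)
  also have "\<dots> = real q * (\<Sum>i\<in>F. \<rho> i powr sdim)" by (simp add: sum_distrib_left)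
  finally show ?thesis .
qed

text \<open>A cover of small gauge could be enlarged to an open cover of small gauge, of which finitely
  many sets suffice, against \<open>cover_sum_ge\<close>.\<close>

lemma hausdorff_measure_K_pos: "0 < hausdorff_measure sdim K"
proof (rule ccontr)
  assume "\<not> ?thesis"
  then have "hausdorff_premeasure sdim 1 K = 0"
    using hausdorff_premeasure_le_measure[of 1 sdim K] by simp
  moreover obtain q where q: "1 \<le> q" and hits: "\<And>\<rho> O'. 0 < \<rho> \<Longrightarrow> (\<forall>y\<in>O'. \<forall>z\<in>O'. dist y z \<le> \<rho>) \<Longrightarrow>
     finite {I \<in> stopping \<rho>. word_map S I ` K \<inter> O' \<noteq> {}} \<and>
     card {I \<in> stopping \<rho>. word_map S I ` K \<inter> O' \<noteq> {}} \<le> q"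
    using stopping_hits_bounded by blast
  moreover define e where "e = 1 / (2 * real q)"
  moreover have e: "0 < e" using q by (simp add: e_def)
  ultimately have "hausdorff_premeasure sdim 1 K < ennreal e" by simp
  then obtain V where V: "K \<subseteq> (\<Union>i::nat. V i)" "\<And>i. bounded (V i)" "\<And>i. diameter (V i) \<le> 1"
      "(\<Sum>i. ennreal (diam_power sdim (V i))) < ennreal e"
    using hausdorff_premeasure_lessE by blast
  define a where "a i = diam_power sdim (V i)" for i
  \<comment> \<open>The additional summand makes all radii \<open>\<rho> i\<close> positive and strictly larger than the diameters,
    which leaves room for an open neighbourhood of \<open>V i\<close>.\<close>
  define b where "b i = a i + e * (1/2) ^ Suc i" for i
  define \<rho> where "\<rho> i = b i powr (1 / sdim)" for i
  have a0: "0 \<le> a i" for i by (simp add: a_def diam_power_def)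
  have ab: "a i < b i" for i using e by (simp add: b_def)
  have b0: "0 < b i" for i using a0[of i] ab[of i] by linarith
  have \<rho>s: "\<rho> i powr sdim = b i" for i using b0[of i] sdim(1) by (simp add: \<rho>_def powr_powr)
  have \<rho>0: "0 < \<rho> i" for i using b0[of i] by (simp add: \<rho>_def)
  have sum_b: "(\<Sum>i\<in>F. b i) < 2 * e" if F: "finite F" for F
  proof -
    have "ennreal (\<Sum>i\<in>F. a i) = (\<Sum>i\<in>F. ennreal (a i))" using a0 by (simp add: sum_ennreal)
    also have "\<dots> \<le> (\<Sum>i. ennreal (a i))" using F by (intro sum_le_suminf summableI) auto
    also have "\<dots> < ennreal e" using V(4) by (simp add: a_def)
    finally have "(\<Sum>i\<in>F. a i) < e" using e by (simp add: ennreal_less_iff sum_nonneg a0)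
    moreover have "(\<Sum>i\<in>F. e * (1/2) ^ Suc i) \<le> e"
    proof -
      have sums: "(\<lambda>i. e * (1/2) ^ Suc i) sums e" using sums_mult[OF power_half_series, of e] by simp
      then have "(\<Sum>i\<in>F. e * (1/2) ^ Suc i) \<le> (\<Sum>i. e * (1/2) ^ Suc i)"
        using F e by (intro sum_le_suminf) (auto simp: sums_iff)
      then show ?thesis using sums by (simp add: sums_iff)
    qed
    ultimately show ?thesis by (simp add: b_def sum.distrib)
  qed
  have b1: "b i < 1" for i
  proof -
    have "2 * e \<le> 1" using q by (simp add: e_def)
    then show ?thesis using sum_b[of "{i}"] by simp
  qed
  have \<rho>1: "\<rho> i < 1" for i
    using b0[of i] b1[of i] sdim(1) powr_less_mono2[of "1 / sdim" "b i" 1] by (simp add: \<rho>_def)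
  have diam: "diameter (V i) < \<rho> i" if "V i \<noteq> {}" for i
  proof (rule ccontr)
    assume "\<not> ?thesis"
    then have "\<rho> i powr sdim \<le> diameter (V i) powr sdim" using \<rho>0[of i] sdim(1) by (intro powr_mono2) auto
    also have "\<dots> = a i" using that sdim(1) by (simp add: a_def diam_power_def)
    finally show False using ab[of i] by (simp add: \<rho>s)
  qed
  define O' where "O' i = (\<Union>x\<in>V i. ball x ((\<rho> i - diameter (V i)) / 2))" for i
  have VO: "V i \<subseteq> O' i" for i
  proof
    fix x assume x: "x \<in> V i"
    then have "diameter (V i) < \<rho> i" using diam[of i] by blast
    then show "x \<in> O' i" unfolding O'_def using x by (intro UN_I[of x]) auto
  qed
  have "K \<subseteq> (\<Union>i\<in>UNIV. O' i)" using V(1) UN_mono[OF subset_refl VO] by (rule subset_trans)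
  moreover have "open (O' i)" for i by (auto simp: O'_def)
  ultimately obtain F where F: "finite F" "K \<subseteq> (\<Union>i\<in>F. O' i)"
    using compactE_image[OF K(1), of UNIV O'] by metis
  have dist_O: "dist y z \<le> \<rho> i" if yz: "y \<in> O' i" "z \<in> O' i" for i y z
  proof -
    obtain x where x: "x \<in> V i" "dist x y < (\<rho> i - diameter (V i)) / 2" using yz(1) by (auto simp: O'_def)
    obtain x' where x': "x' \<in> V i" "dist x' z < (\<rho> i - diameter (V i)) / 2" using yz(2) by (auto simp: O'_def)
    have "dist x x' \<le> diameter (V i)" using x x' V(2) by (intro diameter_bounded_bound) auto
    moreover have "dist y z \<le> dist y x + dist x x' + dist x' z"
      using dist_triangle[of y z x] dist_triangle[of x z x'] by linarith
    ultimately show ?thesis using x x' by (simp add: dist_commute)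
  qed
  have "1 \<le> real q * (\<Sum>i\<in>F. \<rho> i powr sdim)"
  proof (rule cover_sum_ge[where O' = O'])
    show "1 \<le> q" "finite F" "K \<subseteq> (\<Union>i\<in>F. O' i)" by (fact q F)+
    show "0 < \<rho> i \<and> \<rho> i < 1" for i using \<rho>0 \<rho>1 by simp
    show "dist y z \<le> \<rho> i" if "y \<in> O' i" "z \<in> O' i" for i y z using that by (rule dist_O)
  qed (use hits in simp_all)
  also have "\<dots> < real q * (2 * e)" unfolding \<rho>s using sum_b[OF F(1)] q by (intro mult_strict_left_mono) auto
  also have "\<dots> = 1" using q by (simp add: e_def)
  finally show False by simp
qed

lemma hausdorff_dim_K_eq: "hausdorff_dim K = sdim"
  using hausdorff_measure_K_pos by (rule hausdorff_dim_K)

end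

section \<open>Curves generated by substitutions\<close>

context contracting_ifs
begin

lemma invariant_ball_exists: "\<exists>M\<ge>B. \<forall>I x. set I \<subseteq> {1..N} \<longrightarrow> norm x \<le> M \<longrightarrow> norm (word_map S I x) \<le> M"
proof -
  define c where "c = (\<Sum>i=1..N. norm (S i 0))"
  have c: "norm (S i 0) \<le> c" if "i \<in> {1..N}" for i
    unfolding c_def using that by (intro member_le_sum) auto
  have c0: "0 \<le> c" by (simp add: c_def sum_nonneg)
  define M where "M = max B (c / (1 - max_ratio))"
  have M: "c \<le> (1 - max_ratio) * M" "0 \<le> M"
  proof -
    have "c / (1 - max_ratio) \<le> M" by (simp add: M_def)
    then show "c \<le> (1 - max_ratio) * M" using max_ratio by (simp add: field_simps)
    show "0 \<le> M" using c0 max_ratio by (simp add: M_def le_max_iff_disj)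
  qed
  have "norm (S i x) \<le> M" if "i \<in> {1..N}" "norm x \<le> M" for i x
  proof -
    have "norm (S i x) \<le> norm (S i 0) + dist (S i x) (S i 0)"
      by (metis add.commute dist_norm norm_triangle_sub)
    also have "dist (S i x) (S i 0) = ratio i * norm x" using ratio(3)[OF that(1)] by (simp add: dist_norm)
    also have "norm (S i 0) + ratio i * norm x \<le> c + max_ratio * M"
      using c[OF that(1)] ratio_le_max[OF that(1)] that(2) max_ratio by (intro add_mono mult_mono) auto
    also have "\<dots> \<le> M" using M by (simp add: algebra_simps)
    finally show ?thesis .
  qed
  then have "norm (word_map S I x) \<le> M" if "set I \<subseteq> {1..N}" "norm x \<le> M" for I x
    using that by (induction I) auto
  then show ?thesis by (intro exI[of _ M]) (auto simp: M_def)
qed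

end

text \<open>A state \<open>u\<close> is replaced by a list of scaled states, the pieces of \<open>u\<close>, which lead from
  \<open>org u\<close> to \<open>ter u\<close> without gaps. By the assumption \<open>h_sum\<close> no mass is lost in overlaps of
  pieces, so that \<open>[0, 1]\<close> can be divided among the pieces proportionally to their masses.\<close>

locale curve_system = contracting_ifs +
  fixes s :: real and V :: "'u set" and \<tau> :: "'u \<Rightarrow> ('u \<times> nat list) list"
    and E :: "'u \<Rightarrow> 'a set" and h :: "'u \<Rightarrow> real" and org ter :: "'u \<Rightarrow> 'a"
  assumes s: "0 < s" and V: "finite V" "V \<noteq> {}"
    and subst: "u \<in> V \<Longrightarrow> (v, I) \<in> set (\<tau> u) \<Longrightarrow> v \<in> V \<and> I \<noteq> [] \<and> set I \<subseteq> {1..N}"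
    and len: "u \<in> V \<Longrightarrow> 2 \<le> length (\<tau> u)"
    and E: "u \<in> V \<Longrightarrow> compact (E u) \<and> E u \<noteq> {} \<and> E u = (\<Union>(v, I)\<in>set (\<tau> u). word_map S I ` E v)"
    and hE: "u \<in> V \<Longrightarrow> hausdorff_measure s (E u) = ennreal (h u)"
    and h_pos: "u \<in> V \<Longrightarrow> 0 < h u"
    and h_sum: "u \<in> V \<Longrightarrow> h u = (\<Sum>(v, I)\<leftarrow>\<tau> u. wratio I powr s * h v)"
    and org_hd: "u \<in> V \<Longrightarrow> word_map S (snd (hd (\<tau> u))) (org (fst (hd (\<tau> u)))) = org u"
    and ter_last: "u \<in> V \<Longrightarrow> word_map S (snd (last (\<tau> u))) (ter (fst (last (\<tau> u)))) = ter u"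
    and ter_org: "u \<in> V \<Longrightarrow> Suc i < length (\<tau> u) \<Longrightarrow>
      word_map S (snd (\<tau> u ! i)) (ter (fst (\<tau> u ! i))) = word_map S (snd (\<tau> u ! Suc i)) (org (fst (\<tau> u ! Suc i)))"
begin

definition state :: "'u \<Rightarrow> nat \<Rightarrow> 'u" where "state u i = fst (\<tau> u ! i)"
definition word :: "'u \<Rightarrow> nat \<Rightarrow> nat list" where "word u i = snd (\<tau> u ! i)"
definition wt :: "'u \<Rightarrow> nat \<Rightarrow> real" where "wt u i = wratio (word u i) powr s * h (state u i) / h u"
definition brk :: "'u \<Rightarrow> nat \<Rightarrow> real" where "brk u i = (\<Sum>k<i. wt u k)"

lemma piece: assumes "u \<in> V" "i < length (\<tau> u)"
  shows "state u i \<in> V" "word u i \<noteq> []" "set (word u i) \<subseteq> {1..N}"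
  using subst[OF assms(1), of "state u i" "word u i"] nth_mem[OF assms(2)] by (auto simp: state_def word_def)

lemma wt_pos: "u \<in> V \<Longrightarrow> i < length (\<tau> u) \<Longrightarrow> 0 < wt u i"
  using wratio_pos[OF piece(3)[of u i]] h_pos[OF piece(1)[of u i]] h_pos[of u] by (simp add: wt_def)

lemma wt_scale: "u \<in> V \<Longrightarrow> i < length (\<tau> u) \<Longrightarrow> wratio (word u i) powr s * h (state u i) = h u * wt u i"
  using h_pos[of u] by (simp add: wt_def)

lemma brk_0 [simp]: "brk u 0 = 0" by (simp add: brk_def)
lemma brk_Suc: "brk u (Suc i) = brk u i + wt u i" by (simp add: brk_def)

lemma brk_length: "u \<in> V \<Longrightarrow> brk u (length (\<tau> u)) = 1"
proof -
  assume u: "u \<in> V"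
  have "h u = (\<Sum>i<length (\<tau> u). wratio (word u i) powr s * h (state u i))"
    by (subst h_sum[OF u]) (simp add: sum_list_sum_nth atLeast0LessThan state_def word_def case_prod_beta)
  then show ?thesis using h_pos[OF u] by (simp add: brk_def wt_def sum_divide_distrib[symmetric])
qed

lemma brk_mono: "u \<in> V \<Longrightarrow> i \<le> j \<Longrightarrow> j \<le> length (\<tau> u) \<Longrightarrow> brk u i \<le> brk u j"
  unfolding brk_def by (rule sum_mono2) (auto intro!: less_imp_le[OF wt_pos])

lemma brk_strict: "u \<in> V \<Longrightarrow> i < j \<Longrightarrow> j \<le> length (\<tau> u) \<Longrightarrow> brk u i < brk u j"
  using brk_mono[of u "Suc i" j] wt_pos[of u i] by (auto simp: brk_Suc)

lemma wt_less_1: "u \<in> V \<Longrightarrow> i < length (\<tau> u) \<Longrightarrow> wt u i < 1"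
proof -
  assume u: "u \<in> V" and i: "i < length (\<tau> u)"
  obtain k where k: "k < length (\<tau> u)" "k \<noteq> i"
    using len[OF u] i by (cases "i = 0") (auto intro: that[of 1] that[of 0])
  have "wt u i + wt u k = (\<Sum>j\<in>{i, k}. wt u j)" using k by simp
  also have "\<dots> \<le> brk u (length (\<tau> u))"
    unfolding brk_def using i k u by (intro sum_mono2) (auto intro: less_imp_le wt_pos)
  finally show ?thesis using wt_pos[OF u k(1)] brk_length[OF u] by simp
qed

text \<open>At a breakpoint the earlier piece is chosen; the pieces agree there because consecutive ones
  are joined.\<close>

definition idx :: "'u \<Rightarrow> real \<Rightarrow> nat" where "idx u t = (LEAST i. t \<le> brk u (Suc i))"

lemma idx: assumes u: "u \<in> V" and t: "0 \<le> t" "t \<le> 1"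
  shows "idx u t < length (\<tau> u)" "brk u (idx u t) \<le> t" "t \<le> brk u (Suc (idx u t))"
proof -
  have "Suc (length (\<tau> u) - 1) = length (\<tau> u)" using len[OF u] by simp
  then have l: "t \<le> brk u (Suc (length (\<tau> u) - 1))" using brk_length[OF u] t by simp
  show 3: "t \<le> brk u (Suc (idx u t))" unfolding idx_def using l by (rule LeastI[where P = "\<lambda>i. t \<le> brk u (Suc i)"])
  have "idx u t \<le> length (\<tau> u) - 1" unfolding idx_def using l by (rule Least_le[where P = "\<lambda>i. t \<le> brk u (Suc i)"])
  then show 1: "idx u t < length (\<tau> u)" using len[OF u] by simp
  show "brk u (idx u t) \<le> t"
  proof (cases "idx u t")
    case (Suc k)
    then have "\<not> t \<le> brk u (Suc k)" unfolding idx_def using not_less_Least[of k "\<lambda>i. t \<le> brk u (Suc i)"] by simp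
    then show ?thesis using Suc by simp
  qed (use t in simp)
qed

lemma idx_eqI: assumes u: "u \<in> V" and i: "i < length (\<tau> u)" "t \<le> brk u (Suc i)" "i = 0 \<or> brk u i < t"
  shows "idx u t = i"
  unfolding idx_def
proof (rule Least_equality)
  fix k assume k: "t \<le> brk u (Suc k)"
  show "i \<le> k"
  proof (rule ccontr)
    assume "\<not> i \<le> k"
    then have "brk u (Suc k) \<le> brk u i" using i by (intro brk_mono[OF u]) auto
    then show False using k i \<open>\<not> i \<le> k\<close> by auto
  qed
qed (use i in auto)

lemma decompose: assumes u: "u \<in> V" and t: "0 \<le> t" "t \<le> 1"
  obtains i x where "i < length (\<tau> u)" "0 \<le> x" "x \<le> 1" "t = brk u i + wt u i * x"
proof (rule that[of "idx u t" "(t - brk u (idx u t)) / wt u (idx u t)"])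
  have w: "0 < wt u (idx u t)" using wt_pos u idx[OF u t] by blast
  show "0 \<le> (t - brk u (idx u t)) / wt u (idx u t)" "(t - brk u (idx u t)) / wt u (idx u t) \<le> 1"
    "t = brk u (idx u t) + wt u (idx u t) * ((t - brk u (idx u t)) / wt u (idx u t))"
    using idx[OF u t] w by (auto simp: brk_Suc)
qed (use idx[OF u t] in simp)

lemma piece_time: assumes "u \<in> V" "i < length (\<tau> u)" "0 \<le> x" "x \<le> 1"
  shows "brk u i \<le> brk u i + wt u i * x" "brk u i + wt u i * x \<le> brk u (Suc i)"
    "0 \<le> brk u i + wt u i * x" "brk u i + wt u i * x \<le> 1"
proof -
  show 1: "brk u i \<le> brk u i + wt u i * x" and 2: "brk u i + wt u i * x \<le> brk u (Suc i)"
    using wt_pos[OF assms(1,2)] assms by (auto simp: brk_Suc mult_left_le)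
  show "0 \<le> brk u i + wt u i * x" using 1 brk_mono[OF assms(1), of 0 i] assms by simp
  show "brk u i + wt u i * x \<le> 1"
    using 2 brk_mono[OF assms(1), of "Suc i" "length (\<tau> u)"] brk_length[OF assms(1)] assms by simp
qed

text \<open>The \<open>n\<close>-th approximation goes through \<open>n\<close> generations of pieces and jumps from the origin to
  the terminus at the end of each piece.\<close>

primrec approx :: "nat \<Rightarrow> 'u \<Rightarrow> real \<Rightarrow> 'a" where
  "approx 0 u t = (if t = 1 then ter u else org u)"
| "approx (Suc n) u t = word_map S (word u (idx u t))
     (approx n (state u (idx u t)) ((t - brk u (idx u t)) / wt u (idx u t)))"

definition radius :: real where
  "radius = (SOME M. 0 < M \<and> (\<forall>u\<in>V. norm (org u) \<le> M \<and> norm (ter u) \<le> M) \<and>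
     (\<forall>I x. set I \<subseteq> {1..N} \<longrightarrow> norm x \<le> M \<longrightarrow> norm (word_map S I x) \<le> M))"

lemma radius: "0 < radius" "u \<in> V \<Longrightarrow> norm (org u) \<le> radius" "u \<in> V \<Longrightarrow> norm (ter u) \<le> radius"
  "set I \<subseteq> {1..N} \<Longrightarrow> norm x \<le> radius \<Longrightarrow> norm (word_map S I x) \<le> radius"
proof -
  define B where "B = 1 + (\<Sum>u\<in>V. norm (org u) + norm (ter u))"
  obtain M where M: "B \<le> M" "\<forall>I x. set I \<subseteq> {1..N} \<longrightarrow> norm x \<le> M \<longrightarrow> norm (word_map S I x) \<le> M"
    using invariant_ball_exists by blast
  have "norm (org u) + norm (ter u) \<le> (\<Sum>u\<in>V. norm (org u) + norm (ter u))" if "u \<in> V" for u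
    using that V by (intro member_le_sum[where f = "\<lambda>u. norm (org u) + norm (ter u)"]) auto
  then have *: "norm (org u) \<le> M \<and> norm (ter u) \<le> M" if "u \<in> V" for u
    using M(1) that norm_ge_zero[of "org u"] norm_ge_zero[of "ter u"] unfolding B_def
    by (smt (verit))
  have "0 < M" using M(1) sum_nonneg[of V "\<lambda>u. norm (org u) + norm (ter u)"] by (simp add: B_def)
  then have "\<exists>M. 0 < M \<and> (\<forall>u\<in>V. norm (org u) \<le> M \<and> norm (ter u) \<le> M) \<and>
     (\<forall>I x. set I \<subseteq> {1..N} \<longrightarrow> norm x \<le> M \<longrightarrow> norm (word_map S I x) \<le> M)"
    using * M(2) by blast
  from someI_ex[OF this, folded radius_def]
  show "0 < radius" "u \<in> V \<Longrightarrow> norm (org u) \<le> radius" "u \<in> V \<Longrightarrow> norm (ter u) \<le> radius"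
    "set I \<subseteq> {1..N} \<Longrightarrow> norm x \<le> radius \<Longrightarrow> norm (word_map S I x) \<le> radius" by blast+
qed

lemma rescaled_time: assumes "u \<in> V" "0 \<le> t" "t \<le> 1"
  shows "state u (idx u t) \<in> V" "0 \<le> (t - brk u (idx u t)) / wt u (idx u t)" "(t - brk u (idx u t)) / wt u (idx u t) \<le> 1"
    "set (word u (idx u t)) \<subseteq> {1..N}" "word u (idx u t) \<noteq> []"
proof -
  note i = idx[OF assms]
  have w: "0 < wt u (idx u t)" using wt_pos assms(1) i by blast
  show "0 \<le> (t - brk u (idx u t)) / wt u (idx u t)" "(t - brk u (idx u t)) / wt u (idx u t) \<le> 1"
    using i w by (auto simp: brk_Suc)
qed (use piece[OF assms(1) idx(1)[OF assms]] in auto)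

lemma norm_approx: "u \<in> V \<Longrightarrow> 0 \<le> t \<Longrightarrow> t \<le> 1 \<Longrightarrow> norm (approx n u t) \<le> radius"
proof (induction n arbitrary: u t)
  case (Suc n)
  then show ?case using rescaled_time[OF Suc.prems] by (auto intro!: radius Suc.IH)
qed (auto simp: radius)

lemma approx_0 [simp]: "u \<in> V \<Longrightarrow> approx n u 0 = org u"
proof (induction n arbitrary: u)
  case (Suc n)
  have l: "0 < length (\<tau> u)" "\<tau> u \<noteq> []" using len[OF Suc.prems] by auto
  have i: "idx u 0 = 0" using l wt_pos[OF Suc.prems l(1)] by (intro idx_eqI[OF Suc.prems]) (auto simp: brk_Suc)
  have "approx n (state u 0) 0 = org (state u 0)" using Suc piece(1)[OF Suc.prems l(1)] by blast
  then show ?case using org_hd[OF Suc.prems] l by (simp add: i state_def word_def hd_conv_nth)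
qed simp

lemma approx_1 [simp]: "u \<in> V \<Longrightarrow> approx n u 1 = ter u"
proof (induction n arbitrary: u)
  case (Suc n)
  let ?l = "length (\<tau> u) - 1"
  have l: "?l < length (\<tau> u)" "Suc ?l = length (\<tau> u)" "\<tau> u \<noteq> []" using len[OF Suc.prems] by auto
  have b: "brk u (Suc ?l) = 1" using brk_length[OF Suc.prems] l by simp
  have i: "idx u 1 = ?l" using l b brk_strict[OF Suc.prems, of ?l "Suc ?l"] by (intro idx_eqI[OF Suc.prems]) auto
  have "(1 - brk u ?l) / wt u ?l = 1" using b wt_pos[OF Suc.prems l(1)] by (simp add: brk_Suc)
  moreover have "approx n (state u ?l) 1 = ter (state u ?l)" using Suc piece(1)[OF Suc.prems l(1)] by blast
  ultimately show ?case using ter_last[OF Suc.prems] l by (simp add: i state_def word_def last_conv_nth)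
qed simp

lemma wratio_nonempty_le: "set I \<subseteq> {1..N} \<Longrightarrow> I \<noteq> [] \<Longrightarrow> wratio I \<le> max_ratio"
proof -
  assume I: "set I \<subseteq> {1..N}" "I \<noteq> []"
  have "max_ratio ^ length I \<le> max_ratio ^ 1"
    using max_ratio I(2) by (intro power_decreasing) (auto simp: Suc_le_eq)
  then show ?thesis using wratio_le_power[OF I(1)] by simp
qed

lemma approx_Cauchy: "u \<in> V \<Longrightarrow> 0 \<le> t \<Longrightarrow> t \<le> 1 \<Longrightarrow> dist (approx (Suc n) u t) (approx n u t) \<le> max_ratio ^ n * (2 * radius)"
proof (induction n arbitrary: u t)
  case 0
  have "dist (approx (Suc 0) u t) (approx 0 u t) \<le> norm (approx (Suc 0) u t) + norm (approx 0 u t)"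
    by (simp add: dist_norm norm_triangle_ineq4)
  then show ?case using norm_approx[OF 0, of 0] norm_approx[OF 0, of "Suc 0"] by simp
next
  case (Suc n)
  note r = rescaled_time[OF Suc.prems]
  have "dist (approx (Suc (Suc n)) u t) (approx (Suc n) u t)
      = wratio (word u (idx u t)) * dist (approx (Suc n) (state u (idx u t)) ((t - brk u (idx u t)) / wt u (idx u t)))
          (approx n (state u (idx u t)) ((t - brk u (idx u t)) / wt u (idx u t)))"
    by (subst approx.simps(2), subst (2) approx.simps(2)) (rule dist_word_map[OF r(4)])
  also have "\<dots> \<le> max_ratio * (max_ratio ^ n * (2 * radius))"
    using wratio_nonempty_le[OF r(4,5)] max_ratio Suc.IH[OF r(1-3)] by (intro mult_mono) auto
  finally show ?case by (simp add: mult.assoc)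
qed

definition curve :: "'u \<Rightarrow> real \<Rightarrow> 'a" where "curve u t = lim (\<lambda>n. approx n u t)"

lemma approx_tendsto: assumes "u \<in> V" "0 \<le> t" "t \<le> 1" shows "(\<lambda>n. approx n u t) \<longlonglongrightarrow> curve u t"
proof -
  have "summable (\<lambda>n. approx (Suc n) u t - approx n u t)"
  proof (rule summable_comparison_test')
    show "summable (\<lambda>n. max_ratio ^ n * (2 * radius))"
      using max_ratio by (intro summable_mult2 summable_geometric) auto
    show "norm (approx (Suc n) u t - approx n u t) \<le> max_ratio ^ n * (2 * radius)" for n
      using approx_Cauchy[OF assms] by (simp only: dist_norm)
  qed
  then have "(\<lambda>n. \<Sum>k<n. approx (Suc k) u t - approx k u t) \<longlonglongrightarrow> (\<Sum>n. approx (Suc n) u t - approx n u t)"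
    by (rule summable_LIMSEQ)
  then have "(\<lambda>n. approx n u t - approx 0 u t) \<longlonglongrightarrow> (\<Sum>n. approx (Suc n) u t - approx n u t)"
    by (simp only: sum_lessThan_telescope[of "\<lambda>k. approx k u t"])
  from tendsto_add[OF this tendsto_const[of "approx 0 u t"]] have "convergent (\<lambda>n. approx n u t)"
    by (auto simp: convergent_def simp del: approx.simps)
  then show ?thesis unfolding curve_def by (simp add: convergent_LIMSEQ_iff)
qed

lemma norm_curve: "u \<in> V \<Longrightarrow> 0 \<le> t \<Longrightarrow> t \<le> 1 \<Longrightarrow> norm (curve u t) \<le> radius"
  using tendsto_norm[OF approx_tendsto] norm_approx by (intro LIMSEQ_le_const2[of "\<lambda>n. norm (approx n u t)"]) auto

lemma curve_0: "u \<in> V \<Longrightarrow> curve u 0 = org u"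
  using approx_tendsto[of u 0] by (simp add: LIMSEQ_const_iff)
lemma curve_1: "u \<in> V \<Longrightarrow> curve u 1 = ter u"
  using approx_tendsto[of u 1] by (simp add: LIMSEQ_const_iff)

lemma curve_idx: assumes "u \<in> V" "0 \<le> t" "t \<le> 1"
  shows "curve u t = word_map S (word u (idx u t)) (curve (state u (idx u t)) ((t - brk u (idx u t)) / wt u (idx u t)))"
proof -
  note r = rescaled_time[OF assms]
  have "continuous_on UNIV (word_map S (word u (idx u t)))" using r by (intro continuous_word_map) auto
  then have "isCont (word_map S (word u (idx u t))) y" for y by (simp add: continuous_on_eq_continuous_at)
  from isCont_tendsto_compose[OF this approx_tendsto[OF r(1-3)]]
  have "(\<lambda>n. approx (Suc n) u t) \<longlonglongrightarrow>
      word_map S (word u (idx u t)) (curve (state u (idx u t)) ((t - brk u (idx u t)) / wt u (idx u t)))" by simp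
  with LIMSEQ_Suc[OF approx_tendsto[OF assms]] show ?thesis by (rule LIMSEQ_unique)
qed

lemma curve_piece: assumes u: "u \<in> V" and i: "i < length (\<tau> u)" and x: "0 \<le> x" "x \<le> 1"
  shows "curve u (brk u i + wt u i * x) = word_map S (word u i) (curve (state u i) x)"
proof (cases "x = 0 \<and> i \<noteq> 0")
  case False
  let ?t = "brk u i + wt u i * x"
  have "idx u ?t = i" using piece_time[OF u i x] False x wt_pos[OF u i] by (intro idx_eqI[OF u i]) auto
  then show ?thesis using curve_idx[OF u piece_time(3,4)[OF u i x]] wt_pos[OF u i] by simp
next
  case True
  then obtain j where j: "i = Suc j" by (cases i) auto
  then have jl: "j < length (\<tau> u)" using i by simp
  have "idx u (brk u i) = j" unfolding j using brk_strict[OF u, of j "Suc j"] i j by (intro idx_eqI[OF u jl]) auto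
  then have "curve u (brk u i) = word_map S (word u j) (curve (state u j) 1)"
    using curve_idx[OF u piece_time(3,4)[OF u i x]] True wt_pos[OF u jl] by (simp add: j brk_Suc)
  also have "\<dots> = word_map S (word u i) (org (state u i))"
    using ter_org[OF u, of j] i j curve_1[OF piece(1)[OF u jl]] by (simp add: state_def word_def)
  finally show ?thesis using True curve_0[OF piece(1)[OF u i]] by simp
qed

lemma curve_in_E: assumes u: "u \<in> V" and t: "0 \<le> t" "t \<le> 1" shows "curve u t \<in> E u"
proof -
  have "curve u ` {0..1} \<subseteq> E u"
  proof (rule fixed_family_subset[where V = V and \<tau> = "\<lambda>u. set (\<tau> u)" and F = "\<lambda>u. curve u ` {0..1}"])
    fix v assume v: "v \<in> V"
    have "bounded (curve v ` {0..1})" unfolding bounded_iff using norm_curve[OF v] by (intro exI[of _ radius]) auto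
    moreover have "curve v ` {0..1} \<subseteq> (\<Union>(v, I)\<in>set (\<tau> v). word_map S I ` curve v ` {0..1})"
    proof
      fix y assume "y \<in> curve v ` {0..1}"
      then obtain r where r: "y = curve v r" "0 \<le> r" "r \<le> 1" by auto
      obtain i x where ix: "i < length (\<tau> v)" "0 \<le> x" "x \<le> 1" "r = brk v i + wt v i * x"
        using decompose[OF v r(2,3)] .
      have "y = word_map S (word v i) (curve (state v i) x)" using curve_piece[OF v ix(1-3)] ix r by simp
      moreover have "(state v i, word v i) \<in> set (\<tau> v)" using ix(1) by (simp add: state_def word_def)
      ultimately show "y \<in> (\<Union>(v, I)\<in>set (\<tau> v). word_map S I ` curve v ` {0..1})" using ix by fastforce
    qed
    ultimately show "bounded (curve v ` {0..1}) \<and> curve v ` {0..1} \<subseteq> (\<Union>(v, I)\<in>set (\<tau> v). word_map S I ` curve v ` {0..1})" ..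
    show "compact (E v) \<and> E v \<noteq> {} \<and> (\<Union>(v, I)\<in>set (\<tau> v). word_map S I ` E v) \<subseteq> E v" using E[OF v] by blast
  qed (use V u subst in auto)
  then show ?thesis using t by auto
qed

text \<open>A breakpoint is both the end of a piece and the beginning of the next one. If the two
  representations come out in the wrong order, then \<open>a = b\<close>, and the first one serves for both.\<close>

lemma decompose2:
  assumes u: "u \<in> V" and ab: "0 \<le> a" "a \<le> b" "b \<le> 1"
  obtains i x j y where "i < length (\<tau> u)" "0 \<le> x" "x \<le> 1" "a = brk u i + wt u i * x"
    "j < length (\<tau> u)" "0 \<le> y" "y \<le> 1" "b = brk u j + wt u j * y" "i = j \<and> x \<le> y \<or> i < j"
proof -
  obtain i x where ix: "i < length (\<tau> u)" "0 \<le> x" "x \<le> 1" "a = brk u i + wt u i * x"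
    using decompose[OF u, of a] ab by auto
  obtain j y where jy: "j < length (\<tau> u)" "0 \<le> y" "y \<le> 1" "b = brk u j + wt u j * y"
    using decompose[OF u, of b] ab by auto
  consider "i < j" | "i = j" | "j < i" by linarith
  then show ?thesis
  proof cases
    case 2
    then have "wt u i * x \<le> wt u i * y" using ix jy ab by simp
    then have "x \<le> y" using wt_pos[OF u ix(1)] by simp
    then show ?thesis using that ix jy 2 by blast
  next
    case 3
    then have "brk u (Suc j) \<le> brk u i" using ix by (intro brk_mono[OF u]) auto
    then have "a = b" using piece_time[OF u ix(1-3)] piece_time[OF u jy(1-3)] ix jy ab by linarith
    then show ?thesis using that[OF ix ix(1-3)] ix by auto
  qed (use that ix jy in blast)
qed

lemma last_piece: assumes "u \<in> V"
  shows "length (\<tau> u) - 1 < length (\<tau> u)" "1 = brk u (length (\<tau> u) - 1) + wt u (length (\<tau> u) - 1) * 1"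
proof -
  have "Suc (length (\<tau> u) - 1) = length (\<tau> u)" using len[OF assms] by simp
  then show "length (\<tau> u) - 1 < length (\<tau> u)" "1 = brk u (length (\<tau> u) - 1) + wt u (length (\<tau> u) - 1) * 1"
    using brk_length[OF assms] brk_Suc[of u "length (\<tau> u) - 1"] by auto
qed

lemma uniform_bounds:
  obtains \<kappa> q \<eta> where "0 < \<kappa>" "0 < q" "q < 1" "0 < \<eta>"
    "\<And>u i. u \<in> V \<Longrightarrow> i < length (\<tau> u) \<Longrightarrow> \<kappa> \<le> wt u i \<and> wt u i \<le> q" "\<And>u. u \<in> V \<Longrightarrow> \<eta> \<le> h u"
proof -
  have fin: "\<exists>\<kappa>>0. \<forall>a\<in>A. \<kappa> \<le> f a" if "finite A" "\<forall>a\<in>A. 0 < f a" for A and f :: "'b \<Rightarrow> real"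
    using that
  proof (induction A rule: finite_induct)
    case (insert a A)
    then obtain \<kappa> where "0 < \<kappa>" "\<forall>a\<in>A. \<kappa> \<le> f a" by auto
    then show ?case using insert by (intro exI[of _ "min \<kappa> (f a)"]) (auto simp: min_le_iff_disj)
  qed (auto intro: zero_less_one)
  define A where "A = (SIGMA u:V. {..<length (\<tau> u)})"
  have A: "finite A" using V by (auto simp: A_def)
  obtain \<kappa> where \<kappa>: "0 < \<kappa>" "\<forall>a\<in>A. \<kappa> \<le> (case a of (u, i) \<Rightarrow> wt u i)"
    using fin[OF A, of "\<lambda>(u, i). wt u i"] wt_pos by (auto simp: A_def)
  obtain \<kappa>' where \<kappa>': "0 < \<kappa>'" "\<forall>a\<in>A. \<kappa>' \<le> (case a of (u, i) \<Rightarrow> 1 - wt u i)"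
    using fin[OF A, of "\<lambda>(u, i). 1 - wt u i"] wt_less_1 by (auto simp: A_def)
  obtain \<eta> where \<eta>: "0 < \<eta>" "\<forall>u\<in>V. \<eta> \<le> h u" using fin[OF V(1), of h] h_pos by auto
  have w: "\<kappa> \<le> wt u i \<and> wt u i \<le> 1 - \<kappa>'" if "u \<in> V" "i < length (\<tau> u)" for u i
  proof -
    have "(u, i) \<in> A" using that by (simp add: A_def)
    then show ?thesis using \<kappa>(2) \<kappa>'(2) by fastforce
  qed
  obtain u where u: "u \<in> V" using V by blast
  have "0 < 1 - \<kappa>'" using w[OF u last_piece(1)[OF u]] \<kappa>(1) by linarith
  then show ?thesis using that[OF \<kappa>(1), of "1 - \<kappa>'" \<eta>] w \<kappa>' \<eta> by auto
qed

text \<open>Let the weights lie between \<open>\<kappa>\<close> and \<open>q < 1\<close>. If \<open>b - a\<close> is at least \<open>\<kappa>\<close>, boundedness of the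
  curves suffices. Otherwise \<open>[a, b]\<close> is contained in the interval of one piece, where the
  inequality follows from that of the smaller curve with the same constant, or it contains exactly
  one breakpoint and splits into an end of one piece and a beginning of another one. Therefore the
  cases \<open>a = 0\<close> and \<open>b = 1\<close> are treated first: for them only the first alternative occurs, and the
  constant does not grow. The splitting then happens only once, at the cost of a factor \<open>2\<close>. The
  inductions are on the number \<open>n\<close> of generations with \<open>q ^ n \<le> b - a\<close>.\<close>

lemma curve_hoelder:
  "\<exists>C>0. \<forall>u\<in>V. \<forall>a b. 0 \<le> a \<longrightarrow> a \<le> b \<longrightarrow> b \<le> 1 \<longrightarrow> dist (curve u a) (curve u b) \<le> C * (h u * (b - a)) powr (1 / s)"
proof -
  obtain \<kappa> q \<eta> where \<kappa>: "0 < \<kappa>" and q: "0 < q" "q < 1" and \<eta>: "0 < \<eta>"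
    and wt: "\<And>u i. u \<in> V \<Longrightarrow> i < length (\<tau> u) \<Longrightarrow> \<kappa> \<le> wt u i \<and> wt u i \<le> q" and h\<eta>: "\<And>u. u \<in> V \<Longrightarrow> \<eta> \<le> h u"
    using uniform_bounds by metis
  \<comment> \<open>This value makes the inequality hold for \<open>\<kappa> \<le> b - a\<close>, as \<open>h u * (b - a)\<close> is then at least
    \<open>\<eta> * \<kappa>\<close>.\<close>
  define C where "C = 2 * radius / (\<eta> * \<kappa>) powr (1 / s)"
  have C: "0 < C" using radius(1) \<kappa> \<eta> by (simp add: C_def)
  have far: "dist (curve u a) (curve u b) \<le> C * (h u * (b - a)) powr (1 / s)"
    if "u \<in> V" "0 \<le> a" "a \<le> 1" "0 \<le> b" "b \<le> 1" "\<kappa> \<le> b - a" for u a b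
  proof -
    have "dist (curve u a) (curve u b) \<le> norm (curve u a) + norm (curve u b)"
      by (simp add: dist_norm norm_triangle_ineq4)
    also have "\<dots> \<le> 2 * radius" using norm_curve[of u a] norm_curve[of u b] that by simp
    also have "\<dots> = C * (\<eta> * \<kappa>) powr (1 / s)" using \<kappa> \<eta> by (simp add: C_def)
    also have "\<dots> \<le> C * (h u * (b - a)) powr (1 / s)"
      using that h\<eta>[OF that(1)] \<kappa> \<eta> s C by (intro mult_left_mono powr_mono2 mult_mono) auto
    finally show ?thesis .
  qed
  have scale: "dist (curve u (brk u i + wt u i * x)) (curve u (brk u i + wt u i * y))
      \<le> C' * (h u * (wt u i * (y - x))) powr (1 / s)"
    if u: "u \<in> V" and i: "i < length (\<tau> u)" and xy: "0 \<le> x" "x \<le> y" "y \<le> 1"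
      and le: "dist (curve (state u i) x) (curve (state u i) y) \<le> C' * (h (state u i) * (y - x)) powr (1 / s)" for u i x y C'
  proof -
    note p = piece[OF u i]
    have w: "0 < wratio (word u i)" using wratio_pos[OF p(3)] .
    have "dist (curve u (brk u i + wt u i * x)) (curve u (brk u i + wt u i * y))
        = wratio (word u i) * dist (curve (state u i) x) (curve (state u i) y)"
      using xy by (simp add: curve_piece[OF u i] dist_word_map[OF p(3)])
    also have "\<dots> \<le> wratio (word u i) * (C' * (h (state u i) * (y - x)) powr (1 / s))"
      using le w by simp
    also have "\<dots> = C' * ((wratio (word u i) powr s) powr (1 / s) * (h (state u i) * (y - x)) powr (1 / s))"
      using w s by (simp add: powr_powr)
    also have "\<dots> = C' * ((wratio (word u i) powr s * h (state u i)) * (y - x)) powr (1 / s)"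
      using h_pos[OF p(1)] xy by (simp add: powr_mult mult.assoc)
    finally show ?thesis unfolding wt_scale[OF u i] by (simp add: mult.assoc)
  qed
  have zoom: "q ^ n \<le> d / wt u i" if "u \<in> V" "i < length (\<tau> u)" "q ^ Suc n \<le> d" for u i d n
  proof -
    have "q ^ n * wt u i \<le> q ^ n * q" using wt[OF that(1,2)] q by (intro mult_left_mono) auto
    then show ?thesis using that(3) wt_pos[OF that(1,2)] by (simp add: field_simps)
  qed
  have left': "dist (curve u 0) (curve u b) \<le> C * (h u * b) powr (1 / s)"
    if "u \<in> V" "b \<le> 1" "q ^ n \<le> b" for n u b
    using that
  proof (induction n arbitrary: u b)
    case 0
    have "\<kappa> \<le> b" using 0 wt[OF 0(1) last_piece(1)[OF 0(1)]] q by simp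
    then show ?case using far[OF 0(1), of 0 b] 0 \<kappa> by simp
  next
    case (Suc n)
    have b0: "0 < b" using Suc.prems q by (meson less_le_trans zero_less_power)
    show ?case
    proof (cases "\<kappa> \<le> b")
      case True then show ?thesis using far[OF Suc.prems(1), of 0 b] Suc.prems b0 by simp
    next
      case False
      have l: "0 < length (\<tau> u)" using len[OF Suc.prems(1)] by linarith
      have w: "0 < wt u 0" "\<kappa> \<le> wt u 0" using wt[OF Suc.prems(1) l] wt_pos[OF Suc.prems(1) l] by auto
      have x: "0 \<le> b / wt u 0" "b / wt u 0 \<le> 1" using w b0 False by (auto simp: field_simps)
      have "dist (curve (state u 0) 0) (curve (state u 0) (b / wt u 0)) \<le> C * (h (state u 0) * (b / wt u 0 - 0)) powr (1 / s)"
        using Suc.IH[OF piece(1)[OF Suc.prems(1) l] x(2) zoom[OF Suc.prems(1) l Suc.prems(3)]] by simp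
      from scale[OF Suc.prems(1) l _ _ x(2) this] x show ?thesis using w by simp
    qed
  qed
  have left: "dist (curve u 0) (curve u b) \<le> C * (h u * b) powr (1 / s)" if "u \<in> V" "0 \<le> b" "b \<le> 1" for u b
  proof (cases "b = 0")
    case False
    then have "0 < b" using that by simp
    then obtain n where "q ^ n < b" using real_arch_pow_inv[of b q] q by blast
    then show ?thesis using left'[OF that(1,3), of n] by simp
  qed simp
  have right': "dist (curve u (1 - c)) (curve u 1) \<le> C * (h u * c) powr (1 / s)"
    if "u \<in> V" "c \<le> 1" "q ^ n \<le> c" for n u c
    using that
  proof (induction n arbitrary: u c)
    case 0
    have "\<kappa> \<le> c" using 0 wt[OF 0(1) last_piece(1)[OF 0(1)]] q by simp
    then show ?case using far[OF 0(1), of "1 - c" 1] 0 \<kappa> by simp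
  next
    case (Suc n)
    have c0: "0 < c" using Suc.prems q by (meson less_le_trans zero_less_power)
    show ?case
    proof (cases "\<kappa> \<le> c")
      case True then show ?thesis using far[OF Suc.prems(1), of "1 - c" 1] Suc.prems c0 by simp
    next
      case False
      define l where "l = length (\<tau> u) - 1"
      have l: "l < length (\<tau> u)" "1 = brk u l + wt u l * 1" using last_piece[OF Suc.prems(1)] by (auto simp: l_def)
      have w: "0 < wt u l" "\<kappa> \<le> wt u l" using wt[OF Suc.prems(1) l(1)] wt_pos[OF Suc.prems(1) l(1)] by auto
      have x: "0 \<le> c / wt u l" "c / wt u l \<le> 1" using w c0 False by (auto simp: field_simps)
      have "dist (curve (state u l) (1 - c / wt u l)) (curve (state u l) 1) \<le> C * (h (state u l) * (1 - (1 - c / wt u l))) powr (1 / s)"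
        using Suc.IH[OF piece(1)[OF Suc.prems(1) l(1)] x(2) zoom[OF Suc.prems(1) l(1) Suc.prems(3)]] by simp
      from scale[OF Suc.prems(1) l(1) _ _ _ this] x
      have "dist (curve u (brk u l + wt u l * (1 - c / wt u l))) (curve u (brk u l + wt u l * 1)) \<le> C * (h u * c) powr (1 / s)"
        using w by simp
      moreover have "brk u l + wt u l * (1 - c / wt u l) = 1 - c" using l(2) w by (simp add: algebra_simps)
      ultimately show ?thesis using l(2) by simp
    qed
  qed
  have right: "dist (curve u a) (curve u 1) \<le> C * (h u * (1 - a)) powr (1 / s)" if "u \<in> V" "0 \<le> a" "a \<le> 1" for u a
  proof (cases "a = 1")
    case False
    then have "0 < 1 - a" using that by simp
    then obtain n where "q ^ n < 1 - a" using real_arch_pow_inv[of "1 - a" q] q by blast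
    then show ?thesis using right'[OF that(1), of "1 - a" n] that by simp
  qed simp
  have both: "dist (curve u a) (curve u b) \<le> (2 * C) * (h u * (b - a)) powr (1 / s)"
    if "u \<in> V" "0 \<le> a" "a \<le> b" "b \<le> 1" "q ^ n \<le> b - a" for n u a b
    using that
  proof (induction n arbitrary: u a b)
    case 0
    have "\<kappa> \<le> b - a" using 0 wt[OF 0(1) last_piece(1)[OF 0(1)]] q by simp
    then have "dist (curve u a) (curve u b) \<le> C * (h u * (b - a)) powr (1 / s)" using far[OF 0(1), of a b] 0 by simp
    moreover have "0 \<le> C * (h u * (b - a)) powr (1 / s)" using C by simp
    ultimately show ?case by linarith
  next
    case (Suc n)
    note u = Suc.prems(1)
    obtain i x j y where ix: "i < length (\<tau> u)" "0 \<le> x" "x \<le> 1" "a = brk u i + wt u i * x"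
      and jy: "j < length (\<tau> u)" "0 \<le> y" "y \<le> 1" "b = brk u j + wt u j * y" and ij: "i = j \<and> x \<le> y \<or> i < j"
      using decompose2[OF Suc.prems(1-4)] by metis
    consider "i = j" "x \<le> y" | "Suc i = j" | "Suc i < j" using ij by linarith
    then show ?case
    proof cases
      case 1
      then have ba: "b - a = wt u i * (y - x)" using ix jy by (simp add: algebra_simps)
      then have "y - x = (b - a) / wt u i" using wt_pos[OF u ix(1)] by simp
      then have "q ^ n \<le> y - x" using zoom[OF u ix(1) Suc.prems(5)] by simp
      from scale[OF u ix(1,2) 1(2) jy(3) Suc.IH[OF piece(1)[OF u ix(1)] ix(2) 1(2) jy(3) this]]
      show ?thesis using ba ix(4) jy(4) 1(1) by simp
    next
      case 2
      have mid: "brk u i + wt u i * 1 = brk u j" using 2 brk_Suc by force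
      have "dist (curve u a) (curve u (brk u j)) \<le> C * (h u * (wt u i * (1 - x))) powr (1 / s)"
        using scale[OF u ix(1-3) _ right[OF piece(1)[OF u ix(1)] ix(2,3)]] unfolding mid ix(4)[symmetric] by simp
      also have "\<dots> \<le> C * (h u * (b - a)) powr (1 / s)"
        using C s ix jy mid wt_pos[OF u ix(1)] wt_pos[OF u jy(1)] h_pos[OF u]
        by (intro mult_left_mono powr_mono2) (auto simp: algebra_simps)
      finally have 1: "dist (curve u a) (curve u (brk u j)) \<le> C * (h u * (b - a)) powr (1 / s)" .
      have "dist (curve u (brk u j + wt u j * 0)) (curve u b) \<le> C * (h u * (wt u j * (y - 0))) powr (1 / s)"
        using scale[OF u jy(1) _ jy(2,3), of C] left[OF piece(1)[OF u jy(1)] jy(2,3)] unfolding jy(4)[symmetric] by simp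
      also have "\<dots> \<le> C * (h u * (b - a)) powr (1 / s)"
      proof -
        have "wt u i * x \<le> wt u i * 1" using ix wt_pos[OF u ix(1)] by (intro mult_left_mono) auto
        then have "wt u j * y \<le> b - a" using ix(4) jy(4) mid by simp
        then show ?thesis using C s jy wt_pos[OF u jy(1)] h_pos[OF u]
          by (intro mult_left_mono powr_mono2) auto
      qed
      finally have "dist (curve u (brk u j)) (curve u b) \<le> C * (h u * (b - a)) powr (1 / s)" by simp
      then show ?thesis using 1 dist_triangle[of "curve u a" "curve u b" "curve u (brk u j)"] by simp
    next
      case 3
      have "brk u (Suc (Suc i)) \<le> brk u j" using 3 jy by (intro brk_mono[OF u]) auto
      then have "brk u (Suc i) + wt u (Suc i) \<le> b" using piece_time(1)[OF u jy(1-3)] jy(4) brk_Suc[of u "Suc i"] by linarith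
      moreover have "a \<le> brk u (Suc i)" using piece_time(2)[OF u ix(1-3)] ix(4) by simp
      moreover have "\<kappa> \<le> wt u (Suc i)" using wt[OF u, of "Suc i"] 3 jy by simp
      ultimately have "\<kappa> \<le> b - a" by linarith
      then have "dist (curve u a) (curve u b) \<le> C * (h u * (b - a)) powr (1 / s)" using far[OF u, of a b] Suc.prems by simp
      moreover have "0 \<le> C * (h u * (b - a)) powr (1 / s)" using C by simp
      ultimately show ?thesis by linarith
    qed
  qed
  have "dist (curve u a) (curve u b) \<le> (2 * C) * (h u * (b - a)) powr (1 / s)" if "u \<in> V" "0 \<le> a" "a \<le> b" "b \<le> 1" for u a b
  proof (cases "a = b")
    case False
    then have "0 < b - a" using that by simp
    then obtain n where "q ^ n < b - a" using real_arch_pow_inv[of "b - a" q] q by blast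
    then show ?thesis using both[OF that, of n] by simp
  qed simp
  then show ?thesis using C by (intro exI[of _ "2 * C"]) auto
qed

end

lemma hoelder_imp_continuous_on:
  fixes \<psi> :: "real \<Rightarrow> 'a::real_normed_vector"
  assumes s: "0 < s" and "0 < c'"
    and le: "\<And>x y. x \<in> {0..1} \<Longrightarrow> y \<in> {0..1} \<Longrightarrow> norm (\<psi> x - \<psi> y) \<le> c' * \<bar>x - y\<bar> powr (1 / s)"
  shows "continuous_on {0..1} \<psi>"
  unfolding continuous_on_iff
proof (intro ballI allI impI)
  fix x e :: real assume x: "x \<in> {0..1}" and e: "0 < e"
  define d where "d = (e / c') powr s"
  have d: "0 < d" using e assms by (simp add: d_def)
  have "dist (\<psi> y) (\<psi> x) < e" if y: "y \<in> {0..1}" "dist y x < d" for y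
  proof -
    have "\<bar>y - x\<bar> powr (1 / s) < d powr (1 / s)"
      using y s by (intro powr_less_mono2) (auto simp: dist_real_def)
    also have "\<dots> = e / c'" using s e assms by (simp add: d_def powr_powr)
    finally have "c' * \<bar>y - x\<bar> powr (1 / s) < e" using assms(2) by (simp add: field_simps)
    then show ?thesis using le[OF y(1) x] by (simp add: dist_norm)
  qed
  then show "\<exists>d>0. \<forall>x'\<in>{0..1}. dist x' x < d \<longrightarrow> dist (\<psi> x') (\<psi> x) < e" using d by blast
qed

context curve_system
begin

lemma measure_piece_le:
  assumes u: "u \<in> V" and i: "i < length (\<tau> u)" and c: "0 \<le> c"
    and le: "hausdorff_measure s (curve (state u i) ` X) \<le> ennreal (h (state u i) * c)"
  shows "hausdorff_measure s (word_map S (word u i) ` curve (state u i) ` X) \<le> ennreal (h u * (wt u i * c))"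
proof -
  note p = piece[OF u i]
  have "hausdorff_measure s (word_map S (word u i) ` curve (state u i) ` X)
      = ennreal (wratio (word u i) powr s) * hausdorff_measure s (curve (state u i) ` X)"
    using s by (intro hausdorff_measure_word_image p) auto
  also have "\<dots> \<le> ennreal (wratio (word u i) powr s) * ennreal (h (state u i) * c)"
    using le by (rule mult_left_mono) auto
  also have "\<dots> = ennreal ((wratio (word u i) powr s * h (state u i)) * c)"
    by (simp add: ennreal_mult'[symmetric] mult.assoc)
  finally show ?thesis unfolding wt_scale[OF u i] by (simp add: mult.assoc)
qed

lemma measure_curve_le_h: "u \<in> V \<Longrightarrow> hausdorff_measure s (curve u ` {0..1}) \<le> ennreal (h u)"
  using hausdorff_measure_mono[of "curve u ` {0..1}" "E u" s] curve_in_E[of u] hE[of u] by force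

lemma measure_same_piece:
  assumes u: "u \<in> V" and i: "i < length (\<tau> u)" and xy: "0 \<le> x" "x \<le> y" "y \<le> 1" and c: "0 \<le> c"
    and le: "hausdorff_measure s (curve (state u i) ` {x..y}) \<le> ennreal (h (state u i) * c)"
  shows "hausdorff_measure s (curve u ` {brk u i + wt u i * x..brk u i + wt u i * y}) \<le> ennreal (h u * (wt u i * c))"
proof -
  have w: "0 < wt u i" using wt_pos[OF u i] .
  have "curve u ` {brk u i + wt u i * x..brk u i + wt u i * y} \<subseteq> word_map S (word u i) ` curve (state u i) ` {x..y}"
  proof
    fix p assume "p \<in> curve u ` {brk u i + wt u i * x..brk u i + wt u i * y}"
    then obtain t where t: "p = curve u t" "brk u i + wt u i * x \<le> t" "t \<le> brk u i + wt u i * y" by auto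
    define z where "z = (t - brk u i) / wt u i"
    have z: "x \<le> z" "z \<le> y" "t = brk u i + wt u i * z" using t w by (auto simp: z_def field_simps)
    then have "p = word_map S (word u i) (curve (state u i) z)" using curve_piece[OF u i, of z] xy t by simp
    then show "p \<in> word_map S (word u i) ` curve (state u i) ` {x..y}" using z by auto
  qed
  from hausdorff_measure_mono[OF this] measure_piece_le[OF u i c le] show ?thesis by (rule order_trans)
qed

lemma measure_split:
  assumes u: "u \<in> V" and i: "i < j" and j: "j < length (\<tau> u)" and xy: "0 \<le> x" "x \<le> 1" "0 \<le> y" "y \<le> 1"
    and c: "0 \<le> c" "0 \<le> d"
    and le1: "hausdorff_measure s (curve (state u i) ` {x..1}) \<le> ennreal (h (state u i) * c)"
    and le2: "hausdorff_measure s (curve (state u j) ` {0..y}) \<le> ennreal (h (state u j) * d)"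
  shows "hausdorff_measure s (curve u ` {brk u i + wt u i * x..brk u j + wt u j * y})
    \<le> ennreal (h u * (wt u i * c + (brk u j - brk u (Suc i)) + wt u j * d))"
proof -
  have i': "i < length (\<tau> u)" using i j by simp
  let ?P = "\<lambda>k X. word_map S (word u k) ` curve (state u k) ` X"
  let ?M = "\<Union>k\<in>{i<..<j}. ?P k {0..1}"
  have cover: "curve u ` {brk u i + wt u i * x..brk u j + wt u j * y} \<subseteq> ?P i {x..1} \<union> (?M \<union> ?P j {0..y})"
  proof
    fix p assume "p \<in> curve u ` {brk u i + wt u i * x..brk u j + wt u j * y}"
    then obtain t where t: "p = curve u t" "brk u i + wt u i * x \<le> t" "t \<le> brk u j + wt u j * y" by auto
    have t01: "0 \<le> t" "t \<le> 1" using t piece_time[OF u i' xy(1,2)] piece_time[OF u j xy(3,4)] by auto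
    obtain k z where k: "k < length (\<tau> u)" and z: "0 \<le> z" "z \<le> 1" and tk: "t = brk u k + wt u k * z"
      using decompose[OF u t01] .
    have pk: "p = word_map S (word u k) (curve (state u k) z)" using curve_piece[OF u k z] tk t by simp
    consider "k < i" | "k = i" | "i < k" "k < j" | "k = j" | "j < k" by linarith
    then show "p \<in> ?P i {x..1} \<union> (?M \<union> ?P j {0..y})"
    proof cases
      case 1
      then have "brk u (Suc k) \<le> brk u i" using i' by (intro brk_mono[OF u]) auto
      then have "t = brk u i + wt u i * x" using piece_time(2)[OF u k z] tk t piece_time(1)[OF u i' xy(1,2)] by linarith
      then have "p = word_map S (word u i) (curve (state u i) x)" using curve_piece[OF u i' xy(1,2)] t by simp
      then show ?thesis using xy by auto
    next
      case 2
      then have "wt u i * x \<le> wt u i * z" using t tk by simp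
      then have "x \<le> z" using wt_pos[OF u i'] by simp
      then show ?thesis using pk 2 z by auto
    next
      case 3
      have "k \<in> {i<..<j}" using 3 by simp
      moreover have "p \<in> ?P k {0..1}" using pk z by auto
      ultimately have "p \<in> ?M" by (rule UN_I)
      then show ?thesis by (intro UnI2[of p] UnI1[of p])
    next
      case 4
      then have "wt u j * z \<le> wt u j * y" using t tk by simp
      then have "z \<le> y" using wt_pos[OF u j] by simp
      then show ?thesis using pk 4 z by auto
    next
      case 5
      then have "brk u (Suc j) \<le> brk u k" using k by (intro brk_mono[OF u]) auto
      then have "t = brk u j + wt u j * y" using piece_time(1)[OF u k z] tk t piece_time(2)[OF u j xy(3,4)] by linarith
      then have "p = word_map S (word u j) (curve (state u j) y)" using curve_piece[OF u j xy(3,4)] t by simp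
      then show ?thesis using xy by auto
    qed
  qed
  have M: "hausdorff_measure s ?M \<le> ennreal (h u * (brk u j - brk u (Suc i)))"
  proof -
    have "hausdorff_measure s ?M \<le> (\<Sum>k\<in>{i<..<j}. hausdorff_measure s (?P k {0..1}))"
      by (rule hausdorff_measure_finite_UN_le) simp
    also have "\<dots> \<le> (\<Sum>k\<in>{i<..<j}. ennreal (h u * (wt u k * 1)))"
    proof (rule sum_mono)
      fix k assume "k \<in> {i<..<j}"
      then have k: "k < length (\<tau> u)" using j by simp
      show "hausdorff_measure s (?P k {0..1}) \<le> ennreal (h u * (wt u k * 1))"
        using measure_curve_le_h[OF piece(1)[OF u k]] by (intro measure_piece_le[OF u k]) auto
    qed
    also have "\<dots> = ennreal (\<Sum>k\<in>{i<..<j}. h u * (wt u k * 1))"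
      using j by (intro sum_ennreal) (auto intro!: mult_nonneg_nonneg less_imp_le[OF h_pos[OF u]] less_imp_le[OF wt_pos[OF u]])
    also have "(\<Sum>k\<in>{i<..<j}. h u * (wt u k * 1)) = h u * (brk u j - brk u (Suc i))"
    proof -
      have "{..<j} = {..<Suc i} \<union> {i<..<j}" using i by auto
      then have "brk u j = sum (wt u) ({..<Suc i} \<union> {i<..<j})" unfolding brk_def by (rule arg_cong)
      also have "\<dots> = brk u (Suc i) + sum (wt u) {i<..<j}"
        unfolding brk_def by (rule sum.union_disjoint) auto
      finally show ?thesis unfolding mult_1_right sum_distrib_left[symmetric] by simp
    qed
    finally show ?thesis .
  qed
  have nn: "0 \<le> h u * (wt u i * c)" "0 \<le> h u * (brk u j - brk u (Suc i))" "0 \<le> h u * (wt u j * d)"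
    using h_pos[OF u] wt_pos[OF u i'] wt_pos[OF u j] c brk_mono[OF u, of "Suc i" j] i j by auto
  have "hausdorff_measure s (curve u ` {brk u i + wt u i * x..brk u j + wt u j * y})
      \<le> hausdorff_measure s (?P i {x..1} \<union> (?M \<union> ?P j {0..y}))" using cover by (rule hausdorff_measure_mono)
  also have "\<dots> \<le> hausdorff_measure s (?P i {x..1}) + (hausdorff_measure s ?M + hausdorff_measure s (?P j {0..y}))"
    by (rule order_trans[OF hausdorff_measure_Un_le add_left_mono[OF hausdorff_measure_Un_le]])
  also have "\<dots> \<le> ennreal (h u * (wt u i * c)) + (ennreal (h u * (brk u j - brk u (Suc i))) + ennreal (h u * (wt u j * d)))"
    by (rule add_mono[OF measure_piece_le[OF u i' c(1) le1] add_mono[OF M measure_piece_le[OF u j c(2) le2]]])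
  also have "\<dots> = ennreal (h u * (wt u i * c + (brk u j - brk u (Suc i)) + wt u j * d))"
    using nn by (simp add: ennreal_plus[symmetric] algebra_simps del: ennreal_plus)
  finally show ?thesis .
qed

text \<open>The inequality is proved up to an error \<open>q ^ n\<close>, where \<open>q < 1\<close> bounds the weights. The
  pieces that are traversed completely between \<open>a\<close> and \<open>b\<close> contribute their masses exactly, so the
  error only comes from the pieces that contain \<open>a\<close> and \<open>b\<close>, in which it is scaled down. As for
  the Hoelder inequality, the cases \<open>a = 0\<close> and \<open>b = 1\<close> come first and are freed from the error
  before they are used at a splitting; otherwise two errors would arise there.\<close>

lemma curve_measure_le:
  assumes "u \<in> V" "0 \<le> a" "a \<le> b" "b \<le> 1"
  shows "hausdorff_measure s (curve u ` {a..b}) \<le> ennreal (h u * (b - a))"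
proof -
  obtain q where q: "0 < q" "q < 1" and wtq: "\<And>u i. u \<in> V \<Longrightarrow> i < length (\<tau> u) \<Longrightarrow> wt u i \<le> q"
    using uniform_bounds by metis
  have limit: "hausdorff_measure s X \<le> ennreal (h u * c)"
    if u: "u \<in> V" and c: "0 \<le> c" and le: "\<And>n. hausdorff_measure s X \<le> ennreal (h u * (c + q ^ n))" for u c and X :: "'a set"
  proof (rule ennreal_le_epsilon)
    fix e :: real assume e: "0 < e"
    obtain n where n: "q ^ n < e / h u" using real_arch_pow_inv[of "e / h u" q] q e h_pos[OF u] by auto
    have "hausdorff_measure s X \<le> ennreal (h u * (c + q ^ n))" by (rule le)
    also have "\<dots> \<le> ennreal (h u * c + e)" using n h_pos[OF u] by (intro ennreal_leI) (simp add: field_simps)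
    also have "\<dots> = ennreal (h u * c) + ennreal e" using e c h_pos[OF u] by (intro ennreal_plus) auto
    finally show "hausdorff_measure s X \<le> ennreal (h u * c) + ennreal e" .
  qed
  have weaken: "hausdorff_measure s X \<le> ennreal (h u * d)"
    if "u \<in> V" "hausdorff_measure s X \<le> ennreal (h u * c)" "c \<le> d" for u c d and X :: "'a set"
    using that h_pos[OF that(1)] by (meson ennreal_leI mult_left_mono less_imp_le order_trans)
  have full: "hausdorff_measure s (curve u ` {0..1}) \<le> ennreal (h u * 1)" if "u \<in> V" for u
    using measure_curve_le_h[OF that] by simp
  have wq: "wt u i * q ^ n \<le> q ^ Suc n" if "u \<in> V" "i < length (\<tau> u)" for u i n
    using wtq[OF that] q by simp
  have base: "hausdorff_measure s (curve u ` {a..b}) \<le> ennreal (h u * (c + q ^ 0))"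
    if "u \<in> V" "0 \<le> a" "b \<le> 1" "0 \<le> c" for u a b c
  proof -
    have "hausdorff_measure s (curve u ` {a..b}) \<le> hausdorff_measure s (curve u ` {0..1})"
      using that by (intro hausdorff_measure_mono image_mono) auto
    then show ?thesis using weaken[OF that(1) order_trans[OF _ full[OF that(1)]]] that by simp
  qed
  have left': "hausdorff_measure s (curve u ` {0..b}) \<le> ennreal (h u * (b + q ^ n))"
    if "u \<in> V" "0 \<le> b" "b \<le> 1" for n u b
    using that
  proof (induction n arbitrary: u b)
    case 0 then show ?case by (intro base) auto
  next
    case (Suc n)
    note u = Suc.prems(1)
    obtain j y where j: "j < length (\<tau> u)" and y: "0 \<le> y" "y \<le> 1" and b: "b = brk u j + wt u j * y"
      using decompose[OF Suc.prems] .
    note IH = Suc.IH[OF piece(1)[OF u j] y]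
    have nn: "0 \<le> y + q ^ n" using y q by simp
    show ?case
    proof (cases "j = 0")
      case True
      have "hausdorff_measure s (curve u ` {0..b}) \<le> ennreal (h u * (wt u j * (y + q ^ n)))"
        using measure_same_piece[OF u j order_refl y nn IH] b True by simp
      moreover have "wt u j * (y + q ^ n) \<le> b + q ^ Suc n"
        using wq[OF u j, of n] b True by (simp add: algebra_simps)
      ultimately show ?thesis by (rule weaken[OF u])
    next
      case False
      then have l: "0 < j" "0 < length (\<tau> u)" using j by auto
      have "hausdorff_measure s (curve u ` {brk u 0 + wt u 0 * 0..brk u j + wt u j * y})
        \<le> ennreal (h u * (wt u 0 * 1 + (brk u j - brk u (Suc 0)) + wt u j * (y + q ^ n)))"
        by (rule measure_split[OF u l(1) j order_refl _ y _ nn full[OF piece(1)[OF u l(2)]] IH]) auto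
      then have "hausdorff_measure s (curve u ` {0..b})
        \<le> ennreal (h u * (wt u 0 * 1 + (brk u j - brk u (Suc 0)) + wt u j * (y + q ^ n)))"
        using b by simp
      moreover have "wt u 0 * 1 + (brk u j - brk u (Suc 0)) + wt u j * (y + q ^ n) \<le> b + q ^ Suc n"
        using wq[OF u j, of n] b by (simp add: algebra_simps brk_Suc)
      ultimately show ?thesis by (rule weaken[OF u])
    qed
  qed
  have left: "hausdorff_measure s (curve u ` {0..b}) \<le> ennreal (h u * b)" if "u \<in> V" "0 \<le> b" "b \<le> 1" for u b
    using limit[OF that(1,2) left'[OF that]] .
  have right': "hausdorff_measure s (curve u ` {a..1}) \<le> ennreal (h u * ((1 - a) + q ^ n))"
    if "u \<in> V" "0 \<le> a" "a \<le> 1" for n u a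
    using that
  proof (induction n arbitrary: u a)
    case 0 then show ?case by (intro base) auto
  next
    case (Suc n)
    note u = Suc.prems(1)
    obtain i x where i: "i < length (\<tau> u)" and x: "0 \<le> x" "x \<le> 1" and a: "a = brk u i + wt u i * x"
      using decompose[OF Suc.prems] .
    define l where "l = length (\<tau> u) - 1"
    have l: "l < length (\<tau> u)" "1 = brk u l + wt u l * 1" using last_piece[OF u] by (auto simp: l_def)
    note IH = Suc.IH[OF piece(1)[OF u i] x]
    have nn: "0 \<le> (1 - x) + q ^ n" using x q by simp
    show ?case
    proof (cases "i = l")
      case True
      have "hausdorff_measure s (curve u ` {a..1}) \<le> ennreal (h u * (wt u i * ((1 - x) + q ^ n)))"
        using measure_same_piece[OF u i x order_refl nn IH] a True l(2) by simp
      moreover have "wt u i * ((1 - x) + q ^ n) \<le> (1 - a) + q ^ Suc n"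
        using wq[OF u i, of n] a l(2) True by (simp add: algebra_simps)
      ultimately show ?thesis by (rule weaken[OF u])
    next
      case False
      then have il: "i < l" using i by (simp add: l_def)
      have "hausdorff_measure s (curve u ` {brk u i + wt u i * x..brk u l + wt u l * 1})
        \<le> ennreal (h u * (wt u i * ((1 - x) + q ^ n) + (brk u l - brk u (Suc i)) + wt u l * 1))"
        by (rule measure_split[OF u il l(1) x _ order_refl nn _ IH full[OF piece(1)[OF u l(1)]]]) auto
      then have "hausdorff_measure s (curve u ` {a..1})
        \<le> ennreal (h u * (wt u i * ((1 - x) + q ^ n) + (brk u l - brk u (Suc i)) + wt u l * 1))"
        using a l(2) by simp
      moreover have "wt u i * ((1 - x) + q ^ n) + (brk u l - brk u (Suc i)) + wt u l * 1 \<le> (1 - a) + q ^ Suc n"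
        using wq[OF u i, of n] a l(2) by (simp add: algebra_simps brk_Suc)
      ultimately show ?thesis by (rule weaken[OF u])
    qed
  qed
  have right: "hausdorff_measure s (curve u ` {a..1}) \<le> ennreal (h u * (1 - a))" if "u \<in> V" "0 \<le> a" "a \<le> 1" for u a
    by (rule limit[OF that(1)]) (use that right'[OF that] in auto)
  have both: "hausdorff_measure s (curve u ` {a..b}) \<le> ennreal (h u * ((b - a) + q ^ n))"
    if "u \<in> V" "0 \<le> a" "a \<le> b" "b \<le> 1" for n u a b
    using that
  proof (induction n arbitrary: u a b)
    case 0 then show ?case by (intro base) auto
  next
    case (Suc n)
    note u = Suc.prems(1)
    obtain i x j y where ix: "i < length (\<tau> u)" "0 \<le> x" "x \<le> 1" "a = brk u i + wt u i * x"
      and jy: "j < length (\<tau> u)" "0 \<le> y" "y \<le> 1" "b = brk u j + wt u j * y" and ij: "i = j \<and> x \<le> y \<or> i < j"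
      using decompose2[OF Suc.prems] by metis
    from ij show ?case
    proof
      assume 1: "i = j \<and> x \<le> y"
      then have nn: "0 \<le> (y - x) + q ^ n" using q by simp
      have xy: "x \<le> y" using 1 by simp
      have "hausdorff_measure s (curve u ` {a..b}) \<le> ennreal (h u * (wt u i * ((y - x) + q ^ n)))"
        using measure_same_piece[OF u ix(1,2) xy jy(3) nn Suc.IH[OF piece(1)[OF u ix(1)] ix(2) xy jy(3)]] ix jy 1 by simp
      moreover have "wt u i * ((y - x) + q ^ n) \<le> (b - a) + q ^ Suc n"
        using wq[OF u ix(1), of n] ix jy 1 by (simp add: algebra_simps)
      ultimately show ?thesis by (rule weaken[OF u])
    next
      assume 2: "i < j"
      have "hausdorff_measure s (curve u ` {a..b}) \<le> ennreal (h u * (wt u i * (1 - x) + (brk u j - brk u (Suc i)) + wt u j * y))"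
        unfolding ix(4) jy(4)
        by (rule measure_split[OF u 2 jy(1) ix(2,3) jy(2,3) _ jy(2)
              right[OF piece(1)[OF u ix(1)] ix(2,3)] left[OF piece(1)[OF u jy(1)] jy(2,3)]]) (use ix in simp)
      moreover have "wt u i * (1 - x) + (brk u j - brk u (Suc i)) + wt u j * y \<le> (b - a) + q ^ Suc n"
        using ix jy q by (simp add: algebra_simps brk_Suc)
      ultimately show ?thesis by (rule weaken[OF u])
    qed
  qed
  show ?thesis by (rule limit[OF assms(1)]) (use assms both[OF assms] in auto)
qed

lemma curve_hoelder_norm:
  "\<exists>C>0. \<forall>u\<in>V. \<forall>x\<in>{0..1}. \<forall>y\<in>{0..1}. norm (curve u x - curve u y) \<le> C * \<bar>x - y\<bar> powr (1 / s)"
proof -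
  obtain C where C: "0 < C" "\<And>u a b. u \<in> V \<Longrightarrow> 0 \<le> a \<Longrightarrow> a \<le> b \<Longrightarrow> b \<le> 1 \<Longrightarrow>
      dist (curve u a) (curve u b) \<le> C * (h u * (b - a)) powr (1 / s)"
    using curve_hoelder by blast
  define B where "B = (\<Sum>u\<in>V. h u powr (1 / s)) + 1"
  have B: "h u powr (1 / s) \<le> B" if "u \<in> V" for u
    using member_le_sum[OF that, of "\<lambda>u. h u powr (1 / s)"] V by (simp add: B_def)
  have B0: "0 < B" using sum_nonneg[of V "\<lambda>u. h u powr (1 / s)"] by (simp add: B_def)
  have *: "norm (curve u x - curve u y) \<le> (C * B) * \<bar>x - y\<bar> powr (1 / s)"
    if "u \<in> V" "0 \<le> x" "x \<le> y" "y \<le> 1" for u x y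
  proof -
    have "norm (curve u x - curve u y) \<le> C * (h u * (y - x)) powr (1 / s)"
      using C(2)[OF that] by (simp add: dist_norm)
    also have "\<dots> = C * (h u powr (1 / s) * (y - x) powr (1 / s))"
      using h_pos[OF that(1)] that by (simp add: powr_mult)
    also have "\<dots> \<le> C * (B * (y - x) powr (1 / s))"
      using B[OF that(1)] C(1) by (intro mult_left_mono mult_right_mono) auto
    finally show ?thesis using that by (simp add: mult.assoc)
  qed
  have "norm (curve u x - curve u y) \<le> (C * B) * \<bar>x - y\<bar> powr (1 / s)" if "u \<in> V" "x \<in> {0..1}" "y \<in> {0..1}" for u x y
    using *[OF that(1), of x y] *[OF that(1), of y x] that by (cases "x \<le> y") (auto simp: norm_minus_commute abs_minus_commute)
  then show ?thesis using C B0 by (intro exI[of _ "C * B"]) auto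
qed

lemma curve_continuous: "u \<in> V \<Longrightarrow> continuous_on {0..1} (curve u)"
  using curve_hoelder_norm s by (metis hoelder_imp_continuous_on)

text \<open>The images of the curves form an invariant family as well, so \<open>fixed_family_subset\<close>
  applies.\<close>

lemma curve_onto: assumes u: "u \<in> V" shows "curve u ` {0..1} = E u"
proof (rule antisym)
  show "curve u ` {0..1} \<subseteq> E u" using curve_in_E[OF u] by auto
  show "E u \<subseteq> curve u ` {0..1}"
  proof (rule fixed_family_subset[where V = V and \<tau> = "\<lambda>u. set (\<tau> u)" and E = "\<lambda>u. curve u ` {0..1}"])
    fix v assume v: "v \<in> V"
    show "bounded (E v) \<and> E v \<subseteq> (\<Union>(v, I)\<in>set (\<tau> v). word_map S I ` E v)"
      using E[OF v] compact_imp_bounded by blast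
    have "compact (curve v ` {0..1})" using curve_continuous[OF v] by (rule compact_continuous_image) simp
    moreover have "(\<Union>(v, I)\<in>set (\<tau> v). word_map S I ` curve v ` {0..1}) \<subseteq> curve v ` {0..1}"
    proof clarify
      fix w I x assume w: "(w, I) \<in> set (\<tau> v)" and x: "x \<in> {0..1::real}"
      then obtain i where i: "i < length (\<tau> v)" "\<tau> v ! i = (w, I)" by (auto simp: in_set_conv_nth)
      have "curve v (brk v i + wt v i * x) = word_map S I (curve w x)"
        using curve_piece[OF v i(1), of x] x i by (simp add: state_def word_def)
      moreover have "brk v i + wt v i * x \<in> {0..1}" using piece_time(3,4)[OF v i(1), of x] x by simp
      ultimately show "word_map S I (curve w x) \<in> curve v ` {0..1}" by (metis imageI)
    qed
    ultimately show "compact (curve v ` {0..1}) \<and> curve v ` {0..1} \<noteq> {} \<and>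
        (\<Union>(v, I)\<in>set (\<tau> v). word_map S I ` curve v ` {0..1}) \<subseteq> curve v ` {0..1}" by auto
  qed (use V u subst in auto)
qed

lemma curve_unit_speed: assumes u: "u \<in> V" shows "unit_speed_curve s (E u) (curve u) (h u)"
  by (rule unit_speed_curve.intro)
    (use h_pos[OF u] hE[OF u] curve_continuous[OF u] curve_onto[OF u] curve_measure_le[OF u] in auto)

lemma curve_optimal: assumes u: "u \<in> V" shows "optimal_parametrization s (E u) (curve u)"
proof -
  obtain C where "C > 0" "\<forall>u\<in>V. \<forall>x\<in>{0..1}. \<forall>y\<in>{0..1}. norm (curve u x - curve u y) \<le> C * \<bar>x - y\<bar> powr (1 / s)"
    using curve_hoelder_norm by blast
  then show ?thesis using u by (intro unit_speed_curve.optimal_parametrization_of_hoelder[OF curve_unit_speed[OF u], of C]) auto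
qed

end

context unit_speed_curve
begin

lemma null_iff_negligible:
  assumes "B \<in> sets borel" "B \<subseteq> F"
  shows "hausdorff_measure s B = 0 \<longleftrightarrow> negligible {t\<in>{0..1}. \<psi> t \<in> B}"
proof -
  have "{t\<in>{0..1}. \<psi> t \<in> B} \<in> lmeasurable" using assms by (intro lmeasurable_unit vimage_borel) auto
  then show ?thesis
    unfolding hausdorff_measure_borel[OF assms] using c
    by (simp add: negligible_iff_measure ennreal_eq_0_iff mult_le_0_iff measure_le_0_iff)
qed

text \<open>On the range of the curve, additivity is inherited from Lebesgue measure on the times.\<close>

lemma hausdorff_measure_UN_eq:
  assumes A: "finite A" and B: "\<And>a. a \<in> A \<Longrightarrow> B a \<in> sets borel \<and> B a \<subseteq> F"
    and null: "\<And>a b. a \<in> A \<Longrightarrow> b \<in> A \<Longrightarrow> a \<noteq> b \<Longrightarrow> hausdorff_measure s (B a \<inter> B b) = 0"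
  shows "hausdorff_measure s (\<Union>a\<in>A. B a) = (\<Sum>a\<in>A. hausdorff_measure s (B a))"
proof -
  let ?Y = "\<lambda>a. {t\<in>{0..1}. \<psi> t \<in> B a}"
  have Y: "?Y a \<in> lmeasurable" if "a \<in> A" for a using B[OF that] by (intro lmeasurable_unit vimage_borel) auto
  have eq: "{t\<in>{0..1}. \<psi> t \<in> (\<Union>a\<in>A. B a)} = \<Union>(?Y ` A)" by auto
  have "measure lebesgue (\<Union>(?Y ` A)) = (\<Sum>a\<in>A. measure lebesgue (?Y a))"
  proof (rule measure_negligible_finite_Union_image[OF A Y])
    show "pairwise (\<lambda>a b. negligible (?Y a \<inter> ?Y b)) A"
    proof (rule pairwiseI)
      fix a b assume ab: "a \<in> A" "b \<in> A" "a \<noteq> b"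
      have "negligible {t\<in>{0..1}. \<psi> t \<in> B a \<inter> B b}"
        using null[OF ab] B[OF ab(1)] B[OF ab(2)] by (subst null_iff_negligible[symmetric]) auto
      then show "negligible (?Y a \<inter> ?Y b)" by (rule negligible_subset) auto
    qed
  qed
  moreover have "hausdorff_measure s (\<Union>a\<in>A. B a) = ennreal (c * measure lebesgue {t\<in>{0..1}. \<psi> t \<in> (\<Union>a\<in>A. B a)})"
    using A B by (intro hausdorff_measure_borel) (auto intro!: sets.finite_UN)
  ultimately have "hausdorff_measure s (\<Union>a\<in>A. B a) = ennreal (c * (\<Sum>a\<in>A. measure lebesgue (?Y a)))"
    unfolding eq by (simp only:)
  also have "\<dots> = (\<Sum>a\<in>A. ennreal (c * measure lebesgue (?Y a)))"
    using c by (simp add: sum_distrib_left sum_ennreal)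
  also have "\<dots> = (\<Sum>a\<in>A. hausdorff_measure s (B a))"
    using B by (intro sum.cong refl) (simp add: hausdorff_measure_borel)
  finally show ?thesis .
qed

end

context curve_system
begin

text \<open>By its mass, the \<open>k\<close>-th piece is visited during a set of times of measure \<open>wt u k\<close>. The
  interval \<open>J k\<close> allotted to it already has this length, so up to null sets two pieces are visited
  at disjoint times.\<close>

lemma pieces_null_overlap:
  assumes u: "u \<in> V" and ij: "i < length (\<tau> u)" "j < length (\<tau> u)" "i \<noteq> j"
  shows "hausdorff_measure s (word_map S (word u i) ` E (state u i) \<inter> word_map S (word u j) ` E (state u j)) = 0"
proof -
  interpret unit_speed_curve s "E u" "curve u" "h u" by (rule curve_unit_speed[OF u])
  define B where "B k = word_map S (word u k) ` E (state u k)" for k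
  define Y where "Y k = {t\<in>{0..1}. curve u t \<in> B k}" for k
  define J where "J k = {brk u k..brk u (Suc k)}" for k
  have B: "B k \<in> sets borel" "B k \<subseteq> E u" if k: "k < length (\<tau> u)" for k
  proof -
    note p = piece[OF u k]
    have "compact (B k)" unfolding B_def
      using E[OF p(1)] continuous_word_map[OF p(3)] by (intro compact_continuous_image) auto
    then show "B k \<in> sets borel" by (rule borel_compact)
    have "(state u k, word u k) \<in> set (\<tau> u)" using k by (simp add: state_def word_def)
    moreover have "E u = (\<Union>(v, I)\<in>set (\<tau> u). word_map S I ` E v)" using E[OF u] by blast
    ultimately show "B k \<subseteq> E u" unfolding B_def by blast
  qed
  have Y: "Y k \<in> lmeasurable" if k: "k < length (\<tau> u)" for k
    unfolding Y_def using B[OF k] by (intro lmeasurable_unit vimage_borel) auto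
  have neg: "negligible (Y k - J k)" if k: "k < length (\<tau> u)" for k
  proof -
    note p = piece[OF u k]
    have "J k \<subseteq> Y k"
    proof
      fix t assume t: "t \<in> J k"
      define x where "x = (t - brk u k) / wt u k"
      have x: "0 \<le> x" "x \<le> 1" "t = brk u k + wt u k * x"
        using t wt_pos[OF u k] by (auto simp: J_def x_def brk_Suc)
      have "curve u t \<in> B k" unfolding B_def x(3) curve_piece[OF u k x(1,2)]
        using curve_in_E[OF p(1) x(1,2)] by blast
      then show "t \<in> Y k" using piece_time(3,4)[OF u k x(1,2)] x(3) by (simp add: Y_def)
    qed
    moreover have "measure lebesgue (Y k) = wt u k"
    proof -
      have "ennreal (h u * measure lebesgue (Y k)) = hausdorff_measure s (B k)"
        unfolding Y_def using B[OF k] by (rule hausdorff_measure_borel[symmetric])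
      also have "\<dots> = ennreal (wratio (word u k) powr s * h (state u k))"
        unfolding B_def using s by (simp add: hausdorff_measure_word_image[OF p(3)] hE[OF p(1)] ennreal_mult')
      also have "\<dots> = ennreal (h u * wt u k)" by (simp add: wt_scale[OF u k])
      finally have "h u * measure lebesgue (Y k) = h u * wt u k"
        using h_pos[OF u] wt_pos[OF u k] by (subst (asm) ennreal_inj) auto
      then show ?thesis using h_pos[OF u] by simp
    qed
    moreover have "measure lebesgue (J k) = wt u k" using wt_pos[OF u k] by (simp add: J_def brk_Suc)
    moreover have "measure lebesgue (Y k - J k) = measure lebesgue (Y k) - measure lebesgue (J k)"
      using Y[OF k] \<open>J k \<subseteq> Y k\<close> by (intro measurable_measure_Diff) (auto simp: J_def)
    ultimately show ?thesis using Y[OF k] by (simp add: negligible_iff_measure J_def fmeasurable_Diff)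
  qed
  have JJ: "J i' \<inter> J j' \<subseteq> {brk u j'}" if "i' < j'" "j' < length (\<tau> u)" for i' j'
    using brk_mono[OF u, of "Suc i'" j'] that by (auto simp: J_def)
  have "negligible (J i \<inter> J j)"
  proof (cases "i < j")
    case True then show ?thesis using JJ[of i j] ij by (meson negligible_sing negligible_subset)
  next
    case False
    then have "J i \<inter> J j \<subseteq> {brk u i}" using JJ[of j i] ij by auto
    then show ?thesis by (meson negligible_sing negligible_subset)
  qed
  then have "negligible ((Y i - J i) \<union> (Y j - J j) \<union> (J i \<inter> J j))"
    using neg ij by (intro negligible_Un) auto
  then have "negligible {t\<in>{0..1}. curve u t \<in> B i \<inter> B j}"
    by (rule negligible_subset) (auto simp: Y_def)
  then show ?thesis
    using null_iff_negligible[of "B i \<inter> B j"] B ij unfolding B_def by blast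
qed

end

section \<open>Concatenation\<close>

text \<open>The assumption \<open>total\<close> expresses that the sets \<open>E i\<close> overlap in null sets only.\<close>

locale curve_list =
  fixes s :: real and k :: nat and E :: "nat \<Rightarrow> 'a::euclidean_space set" and \<phi> :: "nat \<Rightarrow> real \<Rightarrow> 'a"
    and h :: "nat \<Rightarrow> real" and C :: real
  assumes s: "0 < s" and k: "0 < k" and C: "0 < C"
    and speed: "i < k \<Longrightarrow> unit_speed_curve s (E i) (\<phi> i) (h i)"
    and hoelder: "i < k \<Longrightarrow> x \<in> {0..1} \<Longrightarrow> y \<in> {0..1} \<Longrightarrow> norm (\<phi> i x - \<phi> i y) \<le> C * \<bar>x - y\<bar> powr (1 / s)"
    and joined: "Suc i < k \<Longrightarrow> \<phi> i 1 = \<phi> (Suc i) 0"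
    and total: "hausdorff_measure s (\<Union>i<k. E i) = ennreal (\<Sum>i<k. h i)"
begin

definition mass :: real where "mass = (\<Sum>i<k. h i)"
definition len :: "nat \<Rightarrow> real" where "len i = h i / mass"
definition pos :: "nat \<Rightarrow> real" where "pos i = (\<Sum>j<i. len j)"
definition joint :: "real \<Rightarrow> 'a" where "joint = concat_curves (map (\<lambda>i. (len i, \<phi> i)) [0..<k])"

lemma h_pos: "i < k \<Longrightarrow> 0 < h i" using unit_speed_curve.c[OF speed] .
lemma mass_pos: "0 < mass" unfolding mass_def using k h_pos by (intro sum_pos) auto
lemma len_pos: "i < k \<Longrightarrow> 0 < len i" using h_pos mass_pos by (simp add: len_def)
lemma h_len: "h i = mass * len i" using mass_pos by (simp add: len_def)
lemma pos_0 [simp]: "pos 0 = 0" by (simp add: pos_def)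
lemma pos_Suc: "pos (Suc i) = pos i + len i" by (simp add: pos_def)
lemma pos_k: "pos k = 1" using mass_pos unfolding pos_def len_def sum_divide_distrib[symmetric] mass_def[symmetric] by simp
lemma pos_mono: "i \<le> j \<Longrightarrow> j \<le> k \<Longrightarrow> pos i \<le> pos j"
  unfolding pos_def by (rule sum_mono2) (auto intro!: less_imp_le[OF len_pos])

text \<open>For \<open>x = 0\<close> the time is a joint, where \<open>concat_curves\<close> still follows the previous curve,
  which ends at the same point.\<close>

lemma joint_piece_aux:
  assumes "\<And>i. i < length ps \<Longrightarrow> 0 < fst (ps ! i)"
    and "\<And>i. Suc i < length ps \<Longrightarrow> snd (ps ! i) 1 = snd (ps ! Suc i) 0"
    and "i < length ps" "0 \<le> x" "x \<le> 1"
  shows "concat_curves ps ((\<Sum>j<i. fst (ps ! j)) + fst (ps ! i) * x) = snd (ps ! i) x"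
  using assms
proof (induction ps arbitrary: i x)
  case (Cons p ps)
  obtain l f where p: "p = (l, f)" by (cases p)
  have l: "0 < l" using Cons.prems(1)[of 0] p by simp
  show ?case
  proof (cases i)
    case 0
    have "l * x \<le> l" using l Cons.prems(5) by (simp add: mult_left_le)
    then show ?thesis using 0 p l by simp
  next
    case (Suc n)
    define t where "t = (\<Sum>j<n. fst (ps ! j)) + fst (ps ! n) * x"
    have pos: "0 < fst (ps ! j)" if "j < length ps" for j using Cons.prems(1)[of "Suc j"] that by simp
    have n: "n < length ps" using Cons.prems(3) Suc by simp
    have IH: "concat_curves ps t = snd (ps ! n) x"
      unfolding t_def
    proof (rule Cons.IH[OF pos _ n Cons.prems(4,5)])
      fix j assume "Suc j < length ps"
      then show "snd (ps ! j) 1 = snd (ps ! Suc j) 0" using Cons.prems(2)[of "Suc j"] by simp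
    qed
    have eq: "(\<Sum>j<i. fst ((p # ps) ! j)) + fst ((p # ps) ! i) * x = l + t"
      unfolding Suc sum.lessThan_Suc_shift t_def using p by simp
    have sum0: "0 \<le> (\<Sum>j<n. fst (ps ! j))" using n by (intro sum_nonneg less_imp_le pos) auto
    have fx: "0 \<le> fst (ps ! n) * x" using pos[OF n] Cons.prems(4) by simp
    show ?thesis
    proof (cases "t \<le> 0")
      case False
      then show ?thesis unfolding eq using p Suc IH by simp
    next
      case True
      then have "fst (ps ! n) * x = 0" and t0: "t = 0" using sum0 fx unfolding t_def by linarith+
      then have x0: "x = 0" using pos[OF n] by simp
      have n0: "n = 0"
      proof (rule ccontr)
        assume "n \<noteq> 0"
        then have "0 < (\<Sum>j<n. fst (ps ! j))" using n by (intro sum_pos pos) auto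
        then show False using t0 fx by (simp add: t_def)
      qed
      have "f 1 = snd (ps ! 0) 0" using Cons.prems(2)[of 0] p n n0 by simp
      then show ?thesis unfolding eq using p l Suc n0 x0 t0 by simp
    qed
  qed
qed simp

lemma joint_piece: assumes "i < k" "0 \<le> x" "x \<le> 1" shows "joint (pos i + len i * x) = \<phi> i x"
  using joint_piece_aux[of "map (\<lambda>i. (len i, \<phi> i)) [0..<k]" i x] assms len_pos joined
  by (simp add: joint_def pos_def)

lemma piece_of: assumes t: "0 \<le> t" "t \<le> 1"
  obtains i x where "i < k" "0 \<le> x" "x \<le> 1" "t = pos i + len i * x"
proof -
  define i where "i = (LEAST i. t \<le> pos (Suc i))"
  have ex: "t \<le> pos (Suc (k - 1))" using t pos_k k by simp
  have 1: "t \<le> pos (Suc i)" unfolding i_def using ex by (rule LeastI[where P = "\<lambda>i. t \<le> pos (Suc i)"])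
  have "i \<le> k - 1" unfolding i_def using ex by (rule Least_le[where P = "\<lambda>i. t \<le> pos (Suc i)"])
  then have i: "i < k" using k by simp
  have 2: "pos i \<le> t"
  proof (cases i)
    case (Suc j)
    then have "\<not> t \<le> pos (Suc j)" unfolding i_def using not_less_Least[of j "\<lambda>i. t \<le> pos (Suc i)"] by simp
    then show ?thesis using Suc by simp
  qed (use t in simp)
  show ?thesis
    by (rule that[OF i, of "(t - pos i) / len i"]) (use 1 2 len_pos[OF i] in \<open>auto simp: pos_Suc\<close>)
qed

lemma joint_onto: "joint ` {0..1} = (\<Union>i<k. E i)"
proof (intro antisym subsetI)
  fix p assume "p \<in> joint ` {0..1}"
  then obtain t where t: "p = joint t" "0 \<le> t" "t \<le> 1" by auto
  obtain i x where "i < k" "0 \<le> x" "x \<le> 1" "t = pos i + len i * x" using piece_of[OF t(2,3)] .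
  then show "p \<in> (\<Union>i<k. E i)" using joint_piece[of i x] t unit_speed_curve.onto[OF speed[of i]] by auto
next
  fix p assume "p \<in> (\<Union>i<k. E i)"
  then obtain i x where i: "i < k" "x \<in> {0..1}" "p = \<phi> i x" using unit_speed_curve.onto[OF speed] by blast
  have "pos i + len i * x \<le> pos (Suc i)" using i len_pos[OF i(1)] by (simp add: pos_Suc mult_left_le)
  also have "\<dots> \<le> 1" using pos_mono[of "Suc i" k] i pos_k by simp
  finally have "pos i + len i * x \<in> {0..1}" using i len_pos[OF i(1)] pos_mono[of 0 i] by auto
  then show "p \<in> joint ` {0..1}" using joint_piece[of i x] i by (intro image_eqI[of _ _ "pos i + len i * x"]) auto
qed

text \<open>Clamping the breakpoints to \<open>[a, b]\<close> turns the sum over the pieces that meet \<open>[a, b]\<close> into a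
  telescoping sum over all pieces.\<close>

definition clamp_to :: "real \<Rightarrow> real \<Rightarrow> real \<Rightarrow> real" where "clamp_to a b t = min b (max a t)"

lemma clamp_sum: assumes "0 \<le> a" "a \<le> b" "b \<le> 1"
  shows "(\<Sum>i<k. clamp_to a b (pos (Suc i)) - clamp_to a b (pos i)) = b - a"
  using assms pos_k sum_lessThan_telescope[of "\<lambda>i. clamp_to a b (pos i)" k] by (simp add: clamp_to_def)

lemma clamp_mono: "t \<le> t' \<Longrightarrow> clamp_to a b t \<le> clamp_to a b t'" by (auto simp: clamp_to_def)

lemma joint_measure_le:
  assumes ab: "0 \<le> a" "a \<le> b" "b \<le> 1"
  shows "hausdorff_measure s (joint ` {a..b}) \<le> ennreal (mass * (b - a))"
proof -
  let ?g = "clamp_to a b"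
  let ?X = "\<lambda>i. {x\<in>{0..1}. a \<le> pos i + len i * x \<and> pos i + len i * x \<le> b}"
  have "joint ` {a..b} \<subseteq> (\<Union>i<k. \<phi> i ` ?X i)"
  proof
    fix p assume "p \<in> joint ` {a..b}"
    then obtain t where t: "p = joint t" "a \<le> t" "t \<le> b" by auto
    obtain i x where "i < k" "0 \<le> x" "x \<le> 1" "t = pos i + len i * x" using piece_of[of t] t ab by auto
    then show "p \<in> (\<Union>i<k. \<phi> i ` ?X i)" using joint_piece[of i x] t by auto
  qed
  then have "hausdorff_measure s (joint ` {a..b}) \<le> hausdorff_measure s (\<Union>i<k. \<phi> i ` ?X i)"
    by (rule hausdorff_measure_mono)
  also have "\<dots> \<le> (\<Sum>i<k. hausdorff_measure s (\<phi> i ` ?X i))" by (rule hausdorff_measure_finite_UN_le) simp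
  also have "\<dots> \<le> (\<Sum>i<k. ennreal (mass * (?g (pos (Suc i)) - ?g (pos i))))"
  proof (rule sum_mono)
    fix i assume "i \<in> {..<k}"
    then have i: "i < k" by simp
    have l: "0 < len i" using len_pos[OF i] .
    show "hausdorff_measure s (\<phi> i ` ?X i) \<le> ennreal (mass * (?g (pos (Suc i)) - ?g (pos i)))"
    proof (cases "?X i = {}")
      case False
      then obtain x where x: "0 \<le> x" "x \<le> 1" "a \<le> pos i + len i * x" "pos i + len i * x \<le> b" by auto
      have lx: "0 \<le> len i * x" "len i * x \<le> len i" using x l by (auto simp: mult_left_le)
      define \<alpha> where "\<alpha> = (?g (pos i) - pos i) / len i"
      define \<gamma> where "\<gamma> = (?g (pos (Suc i)) - pos i) / len i"
      have "pos i \<le> b" "a \<le> pos (Suc i)" using x lx unfolding pos_Suc by linarith+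
      then have g: "pos i \<le> ?g (pos i)" "?g (pos i) \<le> ?g (pos (Suc i))" "?g (pos (Suc i)) \<le> pos (Suc i)"
        using ab l by (auto simp: clamp_to_def pos_Suc)
      have \<alpha>: "0 \<le> \<alpha>" "\<alpha> \<le> \<gamma>" "\<gamma> \<le> 1" using g l by (auto simp: \<alpha>_def \<gamma>_def pos_Suc divide_right_mono)
      have "?X i \<subseteq> {\<alpha>..\<gamma>}"
      proof
        fix y assume y: "y \<in> ?X i"
        then have "?g (pos i + len i * y) = pos i + len i * y" by (auto simp: clamp_to_def)
        moreover have "pos i \<le> pos i + len i * y" "pos i + len i * y \<le> pos (Suc i)"
          using y l by (auto simp: pos_Suc mult_left_le)
        ultimately have "?g (pos i) \<le> pos i + len i * y" "pos i + len i * y \<le> ?g (pos (Suc i))"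
          using clamp_mono by metis+
        then show "y \<in> {\<alpha>..\<gamma>}" using l by (simp add: \<alpha>_def \<gamma>_def field_simps)
      qed
      then have "hausdorff_measure s (\<phi> i ` ?X i) \<le> hausdorff_measure s (\<phi> i ` {\<alpha>..\<gamma>})"
        by (intro hausdorff_measure_mono image_mono)
      also have "\<dots> \<le> ennreal (h i * (\<gamma> - \<alpha>))" using unit_speed_curve.bound[OF speed[OF i]] \<alpha> by simp
      also have "h i * (\<gamma> - \<alpha>) = mass * (?g (pos (Suc i)) - ?g (pos i))"
        using l by (simp add: h_len[of i] \<alpha>_def \<gamma>_def diff_divide_distrib[symmetric])
      finally show ?thesis .
    qed (simp only: image_empty hausdorff_measure_empty zero_le)
  qed
  also have "\<dots> = ennreal (\<Sum>i<k. mass * (?g (pos (Suc i)) - ?g (pos i)))"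
    using mass_pos len_pos by (intro sum_ennreal mult_nonneg_nonneg) (auto intro!: clamp_mono simp: pos_Suc less_imp_le)
  also have "\<dots> = ennreal (mass * (b - a))" by (simp only: sum_distrib_left[symmetric] clamp_sum[OF ab])
  finally show ?thesis .
qed

lemma joint_hoelder: "\<exists>C'>0. \<forall>x\<in>{0..1}. \<forall>y\<in>{0..1}. norm (joint x - joint y) \<le> C' * \<bar>x - y\<bar> powr (1 / s)"
proof -
  define C' where "C' = (\<Sum>i<k. C * (1 / len i) powr (1 / s))"
  have "0 < C * (1 / len i) powr (1 / s)" if "i < k" for i using C len_pos[OF that] by simp
  then have C': "0 < C'" unfolding C'_def using k by (intro sum_pos) auto
  have *: "norm (joint a - joint b) \<le> C' * (b - a) powr (1 / s)" if ab: "0 \<le> a" "a \<le> b" "b \<le> 1" for a b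
  proof -
    let ?g = "clamp_to a b"
    have "joint b - joint a = (\<Sum>i<k. joint (?g (pos (Suc i))) - joint (?g (pos i)))"
      using ab pos_k sum_lessThan_telescope[of "\<lambda>i. joint (?g (pos i))" k] by (simp add: clamp_to_def)
    then have "norm (joint a - joint b) \<le> (\<Sum>i<k. norm (joint (?g (pos (Suc i))) - joint (?g (pos i))))"
      unfolding norm_minus_commute[of "joint a"] by (simp only: norm_sum)
    also have "\<dots> \<le> (\<Sum>i<k. C * (1 / len i) powr (1 / s) * (b - a) powr (1 / s))"
    proof (rule sum_mono)
      fix i assume "i \<in> {..<k}"
      then have i: "i < k" by simp
      have l: "0 < len i" using len_pos[OF i] .
      have Cn: "0 \<le> C * (1 / len i) powr (1 / s) * (b - a) powr (1 / s)" using C by simp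
      show "norm (joint (?g (pos (Suc i))) - joint (?g (pos i))) \<le> C * (1 / len i) powr (1 / s) * (b - a) powr (1 / s)"
      proof (cases "?g (pos (Suc i)) = ?g (pos i)")
        case True then show ?thesis using Cn by simp
      next
        case False
        then have g: "pos i \<le> ?g (pos i)" "?g (pos i) \<le> ?g (pos (Suc i))" "?g (pos (Suc i)) \<le> pos (Suc i)"
          "?g (pos (Suc i)) - ?g (pos i) \<le> b - a"
          using ab l by (auto simp: clamp_to_def pos_Suc min_def max_def split: if_splits)
        define \<alpha> where "\<alpha> = (?g (pos i) - pos i) / len i"
        define \<gamma> where "\<gamma> = (?g (pos (Suc i)) - pos i) / len i"
        have \<alpha>: "0 \<le> \<alpha>" "\<alpha> \<le> \<gamma>" "\<gamma> \<le> 1" using g l by (auto simp: \<alpha>_def \<gamma>_def pos_Suc divide_right_mono)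
        have "pos i + len i * \<alpha> = ?g (pos i)" "pos i + len i * \<gamma> = ?g (pos (Suc i))"
          using l by (simp_all add: \<alpha>_def \<gamma>_def)
        moreover have "\<alpha> \<le> 1" "0 \<le> \<gamma>" using \<alpha> by linarith+
        ultimately have "joint (?g (pos i)) = \<phi> i \<alpha>" "joint (?g (pos (Suc i))) = \<phi> i \<gamma>"
          using joint_piece[OF i, of \<alpha>] joint_piece[OF i, of \<gamma>] \<alpha> by metis+
        then have "norm (joint (?g (pos (Suc i))) - joint (?g (pos i))) \<le> C * \<bar>\<gamma> - \<alpha>\<bar> powr (1 / s)"
          using hoelder[OF i, of \<gamma> \<alpha>] \<alpha> by simp
        also have "\<bar>\<gamma> - \<alpha>\<bar> = (1 / len i) * (?g (pos (Suc i)) - ?g (pos i))"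
          using g(2) l by (simp add: \<alpha>_def \<gamma>_def diff_divide_distrib[symmetric])
        also have "C * ((1 / len i) * (?g (pos (Suc i)) - ?g (pos i))) powr (1 / s) \<le> C * ((1 / len i) * (b - a)) powr (1 / s)"
          using C g l s by (intro mult_left_mono powr_mono2) (auto simp: divide_right_mono)
        also have "\<dots> = C * (1 / len i) powr (1 / s) * (b - a) powr (1 / s)"
          using l ab by (simp only: powr_mult mult.assoc) 
        finally show ?thesis .
      qed
    qed
    also have "\<dots> = C' * (b - a) powr (1 / s)" by (simp add: C'_def sum_distrib_right)
    finally show ?thesis .
  qed
  have "norm (joint x - joint y) \<le> C' * \<bar>x - y\<bar> powr (1 / s)" if "x \<in> {0..1}" "y \<in> {0..1}" for x y
    using *[of x y] *[of y x] that by (cases "x \<le> y") (auto simp: norm_minus_commute abs_minus_commute)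
  then show ?thesis using C' by blast
qed

lemma joint_optimal: "optimal_parametrization s (\<Union>i<k. E i) joint"
proof -
  obtain C' where C': "C' > 0" "\<And>x y. x \<in> {0..1} \<Longrightarrow> y \<in> {0..1} \<Longrightarrow> norm (joint x - joint y) \<le> C' * \<bar>x - y\<bar> powr (1 / s)"
    using joint_hoelder by blast
  have "unit_speed_curve s (\<Union>i<k. E i) joint mass"
    by (rule unit_speed_curve.intro)
      (use mass_pos total joint_onto hoelder_imp_continuous_on[OF s C'] joint_measure_le in \<open>auto simp: mass_def\<close>)
  from unit_speed_curve.optimal_parametrization_of_hoelder[OF this C'] show ?thesis .
qed

end

section \<open>Existence of invariant families, and zippers\<close>

context ifs_attractor
begin

text \<open>The sets are decreasing intersections of iterates that start from \<open>K\<close>. A point of \<open>E u\<close> lies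
  in some piece at every generation; as there are finitely many pieces and the iterates decrease,
  one piece contains it at all generations.\<close>

lemma fixed_family_exists:
  fixes \<tau> :: "'u \<Rightarrow> ('u \<times> nat list) set"
  assumes \<tau>: "\<And>u v I. u \<in> V \<Longrightarrow> (v, I) \<in> \<tau> u \<Longrightarrow> v \<in> V \<and> set I \<subseteq> {1..N}"
    and fin: "\<And>u. u \<in> V \<Longrightarrow> finite (\<tau> u) \<and> \<tau> u \<noteq> {}"
  shows "\<exists>E. \<forall>u\<in>V. compact (E u) \<and> E u \<noteq> {} \<and> E u \<subseteq> K \<and> E u = (\<Union>(v, I)\<in>\<tau> u. word_map S I ` E v)"
proof -
  define X where "X = rec_nat (\<lambda>u. K) (\<lambda>_ Y u. \<Union>(v, I)\<in>\<tau> u. word_map S I ` Y v)"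
  have X0: "X 0 u = K" and XS: "X (Suc n) u = (\<Union>(v, I)\<in>\<tau> u. word_map S I ` X n v)" for n u
    by (simp_all add: X_def)
  have ne: "compact (X n u) \<and> X n u \<noteq> {} \<and> X n u \<subseteq> K" if "u \<in> V" for n u
    using that
  proof (induction n arbitrary: u)
    case 0 then show ?case using K(1,2) X0 by simp
  next
    case (Suc n)
    have piece: "compact (word_map S I ` X n v) \<and> word_map S I ` X n v \<noteq> {} \<and> word_map S I ` X n v \<subseteq> K"
      if "(v, I) \<in> \<tau> u" for v I
    proof -
      have vI: "v \<in> V" "set I \<subseteq> {1..N}" using \<tau>[OF Suc.prems that] by auto
      then show ?thesis using Suc.IH[OF vI(1)] word_map_K_subset[OF vI(2)]
        by (auto intro!: compact_continuous_image continuous_word_map)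
    qed
    then have "compact (X (Suc n) u)" unfolding XS using fin[OF Suc.prems] by (intro compact_UN) auto
    then show ?case using piece fin[OF Suc.prems] unfolding XS by fastforce
  qed
  have step: "X (Suc n) u \<subseteq> X n u" if "u \<in> V" for n u
    using that
  proof (induction n arbitrary: u)
    case 0 then show ?case using ne[of u 1] X0 by simp
  next
    case (Suc n)
    have sub: "word_map S I ` X (Suc n) v \<subseteq> word_map S I ` X n v" if "(v, I) \<in> \<tau> u" for v I
      using Suc.IH[of v] \<tau>[OF Suc.prems that] by blast
    have "(\<Union>(v, I)\<in>\<tau> u. word_map S I ` X (Suc n) v) \<subseteq> (\<Union>(v, I)\<in>\<tau> u. word_map S I ` X n v)"
    proof (intro UN_mono subset_refl)
      fix p assume p: "p \<in> \<tau> u"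
      obtain v I where vI: "p = (v, I)" by (cases p)
      show "(case p of (v, I) \<Rightarrow> word_map S I ` X (Suc n) v) \<subseteq> (case p of (v, I) \<Rightarrow> word_map S I ` X n v)"
        using sub[OF p[unfolded vI]] unfolding vI prod.case .
    qed
    then show ?case using XS[of "Suc n" u] XS[of n u] by simp
  qed
  have anti: "X n u \<subseteq> X m u" if "u \<in> V" "m \<le> n" for m n u
    using lift_Suc_antimono_le[of "\<lambda>n. X n u" m n] step[OF that(1)] that(2) by blast
  define E where "E u = (\<Inter>n. X n u)" for u
  have "compact (E u) \<and> E u \<noteq> {} \<and> E u \<subseteq> K \<and> E u = (\<Union>(v, I)\<in>\<tau> u. word_map S I ` E v)" if u: "u \<in> V" for u
  proof (intro conjI)
    show "compact (E u)" unfolding E_def using ne[OF u] by (intro compact_Inter) auto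
    show "E u \<noteq> {}" unfolding E_def by (rule compact_nest) (use ne[OF u] anti[OF u] in auto)
    show "E u \<subseteq> K" using X0 by (force simp: E_def)
    show "E u = (\<Union>(v, I)\<in>\<tau> u. word_map S I ` E v)"
    proof (intro antisym subsetI)
      fix x assume x: "x \<in> E u"
      have "\<exists>(v, I)\<in>\<tau> u. \<forall>n. x \<in> word_map S I ` X n v"
      proof (rule ccontr)
        assume "\<not> ?thesis"
        then have "\<forall>p\<in>\<tau> u. \<exists>n. x \<notin> word_map S (snd p) ` X n (fst p)" by fastforce
        then obtain f where f: "\<And>p. p \<in> \<tau> u \<Longrightarrow> x \<notin> word_map S (snd p) ` X (f p) (fst p)" by metis
        define M where "M = Max (f ` \<tau> u)"
        have "x \<in> X (Suc M) u" using x by (auto simp: E_def)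
        then obtain v I where vI: "(v, I) \<in> \<tau> u" "x \<in> word_map S I ` X M v" unfolding XS by auto
        have "f (v, I) \<le> M" unfolding M_def using vI fin[OF u] by (intro Max_ge) auto
        then have "X M v \<subseteq> X (f (v, I)) v" using \<tau>[OF u vI(1)] by (intro anti) auto
        then show False using f[OF vI(1)] vI(2) by auto
      qed
      then obtain v I where vI: "(v, I) \<in> \<tau> u" "\<And>n. x \<in> word_map S I ` X n v" by blast
      have I: "set I \<subseteq> {1..N}" using \<tau>[OF u vI(1)] by simp
      obtain y where y: "x = word_map S I y" using vI(2)[of 0] by blast
      have "y \<in> X n v" for n using vI(2)[of n] y word_map_eq_iff[OF I] by auto
      then show "x \<in> (\<Union>(v, I)\<in>\<tau> u. word_map S I ` E v)" using vI y by (auto simp: E_def)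
    next
      fix x assume "x \<in> (\<Union>(v, I)\<in>\<tau> u. word_map S I ` E v)"
      then obtain v I y where vI: "(v, I) \<in> \<tau> u" "y \<in> E v" "x = word_map S I y" by auto
      have S: "x \<in> X (Suc n) u" for n unfolding XS using vI by (force simp: E_def)
      have "x \<in> X n u" for n using S[of n] step[OF u, of n] by blast
      then show "x \<in> E u" by (simp add: E_def)
    qed
  qed
  then show ?thesis by blast
qed

end

context osc_attractor
begin

lemma hausdorff_measure_K_real: "hausdorff_measure sdim K = ennreal (enn2real (hausdorff_measure sdim K))"
    "0 < enn2real (hausdorff_measure sdim K)"
  using hausdorff_measure_K_pos hausdorff_measure_K_finite by (auto simp: enn2real_positive_iff)

text \<open>The two states stand for \<open>K\<close> traversed from \<open>x 0\<close> to \<open>x N\<close> and backwards. All masses are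
  equal to that of \<open>K\<close>, and the condition on the masses is the defining equation of the similarity
  dimension.\<close>

lemma zipper_parametrization:
  assumes \<sigma>: "\<sigma> permutes {1..N}" and zip: "self_similar_zipper N (\<lambda>j. S (\<sigma> j))"
  shows "\<exists>\<psi>. optimal_parametrization (hausdorff_dim K) K \<psi>"
proof -
  obtain x :: "nat \<Rightarrow> 'a" and \<beta> :: "nat \<Rightarrow> int" where z: "\<And>j. j \<in> {1..N} \<Longrightarrow> \<beta> j \<in> {-1, 1} \<and>
        (\<beta> j = 1 \<longrightarrow> S (\<sigma> j) (x 0) = x (j - 1) \<and> S (\<sigma> j) (x N) = x j) \<and>
        (\<beta> j = -1 \<longrightarrow> S (\<sigma> j) (x 0) = x j \<and> S (\<sigma> j) (x N) = x (j - 1))"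
    using zip unfolding self_similar_zipper_def by blast
  define c where "c = enn2real (hausdorff_measure sdim K)"
  define \<tau> where "\<tau> b = (if b then map (\<lambda>j. (\<beta> j = 1, [\<sigma> j])) [1..<Suc N]
      else map (\<lambda>j. (\<beta> j \<noteq> 1, [\<sigma> j])) (rev [1..<Suc N]))" for b
  define org where "org b = (if b then x 0 else x N)" for b
  define ter where "ter b = (if b then x N else x 0)" for b
  have \<sigma>in: "\<sigma> j \<in> {1..N}" if "j \<in> {1..N}" for j using permutes_in_image[OF \<sigma>] that by blast
  have \<sigma>im: "\<sigma> ` {1..N} = {1..N}" using \<sigma> by (rule permutes_image)
  have len: "length (\<tau> b) = N" for b by (simp add: \<tau>_def)
  have nthT: "\<tau> True ! i = (\<beta> (Suc i) = 1, [\<sigma> (Suc i)])" if "i < N" for i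
    using that by (simp add: \<tau>_def nth_append del: upt_Suc)
  have nthF: "\<tau> False ! i = (\<beta> (N - i) \<noteq> 1, [\<sigma> (N - i)])" if "i < N" for i
    using that by (simp add: \<tau>_def rev_nth Suc_diff_Suc del: upt_Suc)
  have set: "set (\<tau> True) = (\<lambda>j. (\<beta> j = 1, [\<sigma> j])) ` {1..N}" "set (\<tau> False) = (\<lambda>j. (\<beta> j \<noteq> 1, [\<sigma> j])) ` {1..N}"
    by (auto simp: \<tau>_def simp del: upt_Suc)
  have ends: "S (\<sigma> j) (org (\<beta> j = 1)) = x (j - 1)" "S (\<sigma> j) (ter (\<beta> j = 1)) = x j"
      "S (\<sigma> j) (org (\<beta> j \<noteq> 1)) = x j" "S (\<sigma> j) (ter (\<beta> j \<noteq> 1)) = x (j - 1)" if "j \<in> {1..N}" for j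
    using z[OF that] by (auto simp: org_def ter_def)
  have KU: "K = (\<Union>j\<in>{1..N}. S (\<sigma> j) ` K)"
  proof -
    have "(\<Union>j\<in>{1..N}. S (\<sigma> j) ` K) = (\<Union>j\<in>\<sigma> ` {1..N}. S j ` K)" by simp
    then show ?thesis unfolding \<sigma>im using K(3) by simp
  qed
  have ne: "\<tau> b \<noteq> []" for b using len[of b] N_ge_2 by auto
  interpret curve_system N S sdim UNIV \<tau> "\<lambda>_. K" "\<lambda>_. c" org ter
  proof unfold_locales
    show "0 < sdim" by (rule sdim)
    show "v \<in> UNIV \<and> I \<noteq> [] \<and> set I \<subseteq> {1..N}" if "(v, I) \<in> set (\<tau> u)" for u v I
      using that set \<sigma>in by (cases u) auto
    show "2 \<le> length (\<tau> u)" for u using len N_ge_2 by simp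
    show "compact K \<and> K \<noteq> {} \<and> K = (\<Union>(v, I)\<in>set (\<tau> u). word_map S I ` K)" for u
    proof (intro conjI)
      have "(\<Union>(v, I)\<in>set (\<tau> u). word_map S I ` K) = (\<Union>j\<in>{1..N}. S (\<sigma> j) ` K)"
        by (cases u) (simp_all add: set)
      then show "K = (\<Union>(v, I)\<in>set (\<tau> u). word_map S I ` K)" using KU by simp
    qed (use K in auto)
    show "hausdorff_measure sdim K = ennreal c" "0 < c"
      unfolding c_def by (fact hausdorff_measure_K_real)+
    show "c = (\<Sum>(v, I)\<leftarrow>\<tau> u. wratio I powr sdim * c)" for u
    proof -
      have "(\<Sum>j=1..N. ratio (\<sigma> j) powr sdim) = 1"
        using sum.permute[OF \<sigma>, of "\<lambda>j. ratio j powr sdim"] sdim(2) by (simp add: o_def)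
      then have 1: "(\<Sum>j=1..N. ratio (\<sigma> j) powr sdim * c) = c" by (simp add: sum_distrib_right[symmetric])
      have 2: "(\<Sum>j\<leftarrow>[1..<Suc N]. ratio (\<sigma> j) powr sdim * c) = (\<Sum>j=1..N. ratio (\<sigma> j) powr sdim * c)"
        by (subst sum_list_distinct_conv_sum_set) (simp_all add: atLeastLessThanSuc_atLeastAtMost del: upt_Suc)
      have "(\<Sum>(v, I)\<leftarrow>\<tau> u. wratio I powr sdim * c) = (\<Sum>j\<leftarrow>[1..<Suc N]. ratio (\<sigma> j) powr sdim * c)"
        by (cases u) (simp_all add: \<tau>_def o_def rev_map[symmetric] sum_list_rev del: upt_Suc)
      then show ?thesis using 1 2 by simp
    qed
    show "word_map S (snd (hd (\<tau> u))) (org (fst (hd (\<tau> u)))) = org u" for u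
    proof -
      have "hd (\<tau> u) = \<tau> u ! 0" using ne by (simp add: hd_conv_nth)
      then show ?thesis using nthT[of 0] nthF[of 0] N_ge_2 ends(1)[of 1] ends(3)[of N]
        by (cases u) (auto simp: org_def)
    qed
    show "word_map S (snd (last (\<tau> u))) (ter (fst (last (\<tau> u)))) = ter u" for u
    proof -
      have "last (\<tau> u) = \<tau> u ! (N - 1)" using ne len by (simp add: last_conv_nth)
      then show ?thesis using nthT[of "N - 1"] nthF[of "N - 1"] N_ge_2 ends(2)[of N] ends(4)[of 1]
        by (cases u) (auto simp: ter_def)
    qed
    show "word_map S (snd (\<tau> u ! i)) (ter (fst (\<tau> u ! i))) = word_map S (snd (\<tau> u ! Suc i)) (org (fst (\<tau> u ! Suc i)))"
      if "Suc i < length (\<tau> u)" for u i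
    proof (cases u)
      case True
      then show ?thesis using that len nthT[of i] nthT[of "Suc i"] ends(2)[of "Suc i"] ends(1)[of "Suc (Suc i)"] by simp
    next
      case False
      have "N - i \<in> {1..N}" "N - Suc i \<in> {1..N}" "N - i - 1 = N - Suc i" using that len[of u] by auto
      then show ?thesis using False that len nthF[of i] nthF[of "Suc i"] ends(4)[of "N - i"] ends(3)[of "N - Suc i"] by simp
    qed
  qed auto
  show ?thesis using curve_optimal[of True] hausdorff_dim_K_eq by auto
qed

end

section \<open>Euler partitions\<close>

context contracting_ifs
begin

definition src :: "'a list \<Rightarrow> fedge \<times> nat list \<Rightarrow> 'a" where "src as a = word_map S (snd a) (origin as (fst a))"
definition dst :: "'a list \<Rightarrow> fedge \<times> nat list \<Rightarrow> 'a" where "dst as a = word_map S (snd a) (terminus as (fst a))"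

text \<open>Walks of placed edges, which need no vertex set, replace the awalks of a digraph in the
  combinatorial part.\<close>

primrec walk :: "'a list \<Rightarrow> 'a \<Rightarrow> (fedge \<times> nat list) list \<Rightarrow> 'a \<Rightarrow> bool" where
  "walk as x [] y \<longleftrightarrow> x = y"
| "walk as x (a # p) y \<longleftrightarrow> src as a = x \<and> walk as (dst as a) p y"

lemma walk_append: "walk as x (p @ q) z \<longleftrightarrow> (\<exists>y. walk as x p y \<and> walk as y q z)"
  by (induction p arbitrary: x) auto

definition rev_arc :: "fedge \<times> nat list \<Rightarrow> fedge \<times> nat list" where "rev_arc a = (rev_edge (fst a), snd a)"

lemma rev_edge_rev_edge [simp]: "rev_edge (rev_edge e) = e" by (cases e) auto
lemma rev_arc_rev_arc [simp]: "rev_arc (rev_arc a) = a" by (simp add: rev_arc_def)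
lemma src_rev_arc [simp]: "src as (rev_arc a) = dst as a" by (simp add: rev_arc_def src_def dst_def terminus_def)
lemma dst_rev_arc [simp]: "dst as (rev_arc a) = src as a" by (simp add: rev_arc_def src_def dst_def terminus_def)

lemma walk_rev: "walk as x p y \<Longrightarrow> walk as y (map rev_arc (rev p)) x"
  by (induction p arbitrary: x) (auto simp: walk_append)

lemma walk_hd: "walk as x p y \<Longrightarrow> p \<noteq> [] \<Longrightarrow> src as (hd p) = x" by (cases p) auto
lemma walk_last: "walk as x p y \<Longrightarrow> p \<noteq> [] \<Longrightarrow> dst as (last p) = y"
  by (induction p arbitrary: x) (auto split: if_splits)
lemma walk_nth: "walk as x p y \<Longrightarrow> Suc i < length p \<Longrightarrow> dst as (p ! i) = src as (p ! Suc i)"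
proof (induction p arbitrary: x i)
  case (Cons a p)
  show ?case
  proof (cases i)
    case 0
    then show ?thesis using Cons.prems walk_hd[of as "dst as a" p y] by (cases p) auto
  next
    case (Suc k)
    then show ?thesis using Cons.IH[of "dst as a" k] Cons.prems by simp
  qed
qed simp

lemma edge_to_trail_Bwd: "edge_to_trail Ps (Bwd j) = map rev_arc (rev (Ps ! j))"
  by (simp add: rev_arc_def case_prod_beta')

lemma cas_euler_graph: "pre_digraph.cas (euler_graph N S n as \<beta>) x p y \<longleftrightarrow> walk as x p y"
proof (induction p arbitrary: x)
  case Nil then show ?case by (simp add: pre_digraph.cas.simps)
next
  case (Cons a p)
  then show ?case by (simp add: pre_digraph.cas.simps euler_graph_def src_def dst_def case_prod_beta)
qed

lemma awalk_verts_euler_graph: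
  "set (pre_digraph.awalk_verts (euler_graph N S n as \<beta>) x p) = insert (if p = [] then x else src as (hd p)) (dst as ` set p)"
  if "walk as x p y"
  using that
proof (induction p arbitrary: x)
  case Nil then show ?case by (simp add: pre_digraph.awalk_verts.simps)
next
  case (Cons a p)
  have "walk as (dst as a) p y" using Cons.prems by simp
  from Cons.IH[OF this] walk_hd[OF this]
  show ?case by (auto simp: pre_digraph.awalk_verts.simps euler_graph_def src_def dst_def case_prod_beta)
qed

definition cell_edges :: "'a list \<Rightarrow> int \<Rightarrow> nat list \<Rightarrow> (fedge \<times> nat list) set" where
  "cell_edges as b I = (\<lambda>e. (e, I)) ` set (Lambda_pow as b)"

lemma set_Lambda_pow: "set (Lambda_pow as b) = (if b = 1 then Fwd else Bwd) ` {..<length as}"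
  by (auto simp: Lambda_pow_def Lambda_def image_image atLeast0LessThan)

text \<open>\<open>as\<close> is the enumeration used in the cells, \<open>as'\<close> the one whose edges are subdivided.\<close>

definition euler_partition ::
    "nat \<Rightarrow> 'a list \<Rightarrow> 'a list \<Rightarrow> (nat list \<Rightarrow> int) \<Rightarrow> (fedge \<times> nat list) list list \<Rightarrow> bool" where
  "euler_partition n as as' \<beta> Ps \<longleftrightarrow>
     length Ps = length as' \<and> distinct (concat Ps) \<and> set (concat Ps) = (\<Union>I\<in>words N n. cell_edges as (\<beta> I) I) \<and>
     (\<forall>j<length as'. walk as (as' ! j) (Ps ! j) (as' ! (Suc j mod length as')))"

lemma walk_concat:
  assumes "j \<le> length Ps" "\<And>i. i < length Ps \<Longrightarrow> walk as (f i) (Ps ! i) (f (Suc i))"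
  shows "walk as (f 0) (concat (take j Ps)) (f j)"
  using assms(1)
proof (induction j)
  case (Suc j)
  then have "take (Suc j) Ps = take j Ps @ [Ps ! j]" by (simp add: take_Suc_conv_app_nth)
  then show ?case using Suc assms(2)[of j] by (auto simp: walk_append)
qed simp

text \<open>Every vertex of the graph is an end of an arc, so the membership conditions of trails and
  Euler trails follow from the walks.\<close>

lemma euler_partition_imp_consistent:
  assumes "euler_partition n as as \<beta> Ps" "as \<noteq> []" and ne: "\<And>j. j < length as \<Longrightarrow> Ps ! j \<noteq> []"
  shows "consistent_euler_partition N S n as \<beta> Ps"
proof -
  let ?G = "euler_graph N S n as \<beta>"
  let ?m = "length as"
  have P: "length Ps = ?m" "distinct (concat Ps)" "set (concat Ps) = (\<Union>I\<in>words N n. cell_edges as (\<beta> I) I)"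
    "\<And>j. j < ?m \<Longrightarrow> walk as (as ! j) (Ps ! j) (as ! (Suc j mod ?m))"
    using assms(1) unfolding euler_partition_def by auto
  have m: "0 < ?m" using assms(2) by simp
  have arcs: "arcs ?G = set (concat Ps)" unfolding P(3) by (auto simp: euler_graph_def cell_edges_def)
  have origin_in: "origin as e \<in> set as" if "e \<in> set (Lambda_pow as b)" for e b
    using that m by (auto simp: set_Lambda_pow split: if_splits)
  have src_in: "src as a \<in> verts ?G" if "a \<in> set (concat Ps)" for a
    using that origin_in unfolding P(3) by (fastforce simp: euler_graph_def cell_edges_def src_def)
  have rev_in: "terminus as e \<in> set as" if "e \<in> set (Lambda_pow as b)" for e b
    using that m by (auto simp: set_Lambda_pow terminus_def split: if_splits)
  have dst_in: "dst as a \<in> verts ?G" if "a \<in> set (concat Ps)" for a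
    using that rev_in unfolding P(3) by (fastforce simp: euler_graph_def cell_edges_def dst_def)
  have walk: "walk as (as ! 0) (concat Ps) (as ! 0)"
  proof -
    have "walk as (as ! (0 mod ?m)) (concat (take ?m Ps)) (as ! (?m mod ?m))"
      by (rule walk_concat) (use P in auto)
    then show ?thesis using P(1) by simp
  qed
  have head: "\<exists>a\<in>set (concat Ps). v = src as a \<or> v = dst as a" if v: "v \<in> verts ?G" for v
  proof -
    obtain I j where I: "I \<in> words N n" "j < ?m" "v = word_map S I (as ! j)"
      using v by (auto simp: euler_graph_def in_set_conv_nth)
    let ?e = "if \<beta> I = 1 then Fwd j else Bwd j"
    have "(?e, I) \<in> set (concat Ps)" unfolding P(3) using I by (auto simp: cell_edges_def set_Lambda_pow)
    moreover have "v = src as (?e, I) \<or> v = dst as (?e, I)" using I by (auto simp: src_def dst_def terminus_def)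
    ultimately show ?thesis by blast
  qed
  have cne: "concat Ps \<noteq> []" using ne[OF m] P(1) m by (metis concat_eq_Nil_conv nth_mem)
  have "pre_digraph.euler_trail ?G (as ! 0) (concat Ps) (as ! 0)"
    unfolding pre_digraph.euler_trail_def pre_digraph.trail_def pre_digraph.awalk_def cas_euler_graph
  proof (intro conjI)
    have h: "src as (hd (concat Ps)) = as ! 0" using walk_hd[OF walk cne] .
    show "as ! 0 \<in> verts ?G" using src_in[of "hd (concat Ps)"] cne h by (metis hd_in_set)
    have "set (pre_digraph.awalk_verts ?G (as ! 0) (concat Ps)) = insert (as ! 0) (dst as ` set (concat Ps))"
      unfolding awalk_verts_euler_graph[OF walk] using h cne by simp
    also have "\<dots> = verts ?G"
    proof (intro antisym subsetI)
      fix v assume "v \<in> insert (as ! 0) (dst as ` set (concat Ps))"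
      then show "v \<in> verts ?G" using \<open>as ! 0 \<in> verts ?G\<close> dst_in by auto
    next
      fix v assume "v \<in> verts ?G"
      then obtain a where a: "a \<in> set (concat Ps)" "v = src as a \<or> v = dst as a" using head by blast
      have "src as a \<in> insert (as ! 0) (dst as ` set (concat Ps))"
      proof -
        obtain i where i: "i < length (concat Ps)" "a = concat Ps ! i" using a by (metis in_set_conv_nth)
        show ?thesis
        proof (cases i)
          case 0
          then show ?thesis using i h cne by (simp add: hd_conv_nth)
        next
          case (Suc k)
          then have "src as a = dst as (concat Ps ! k)" using walk_nth[OF walk, of k] i by simp
          moreover have "concat Ps ! k \<in> set (concat Ps)" by (rule nth_mem) (use Suc i in simp)
          ultimately show ?thesis by blast
        qed
      qed
      then show "v \<in> insert (as ! 0) (dst as ` set (concat Ps))" using a by blast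
    qed
    finally show "set (pre_digraph.awalk_verts ?G (as ! 0) (concat Ps)) = verts ?G" .
  qed (use walk arcs P in auto)
  moreover have "pre_digraph.trail ?G (origin as (Fwd j)) (Ps ! j) (terminus as (Fwd j))" if j: "j < ?m" for j
    unfolding pre_digraph.trail_def pre_digraph.awalk_def cas_euler_graph
  proof (intro conjI)
    have Pj: "Ps ! j \<in> set Ps" using j P(1) by simp
    then have sub: "set (Ps ! j) \<subseteq> set (concat Ps)" by auto
    show "set (Ps ! j) \<subseteq> arcs ?G" using sub arcs by simp
    show "distinct (Ps ! j)" using P(2) Pj by (simp add: distinct_concat_iff)
    show w: "walk as (origin as (Fwd j)) (Ps ! j) (terminus as (Fwd j))" using P(4)[OF j] by (simp add: terminus_def)
    show "origin as (Fwd j) \<in> verts ?G"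
      using walk_hd[OF w ne[OF j]] src_in sub ne[OF j] by (metis hd_in_set subsetD)
  qed
  ultimately show ?thesis unfolding consistent_euler_partition_def using P(1) by blast
qed

end

section \<open>Pure Euler-partitions lead to space-filling curves\<close>

lemma sum_list_ennreal:
  "(\<And>x. x \<in> set xs \<Longrightarrow> 0 \<le> f x) \<Longrightarrow> (\<Sum>x\<leftarrow>xs. ennreal (f x)) = ennreal (\<Sum>x\<leftarrow>xs. f x)"
proof (induction xs)
  case (Cons x xs)
  have "0 \<le> sum_list (map f xs)" using Cons.prems by (intro sum_list_nonneg) auto
  then show ?case using Cons by simp
qed simp

lemma sum_list_concat_nth:
  "(\<Sum>j<length Ps. \<Sum>a\<leftarrow>Ps ! j. g a) = (\<Sum>a\<leftarrow>concat Ps. g a)" for g :: "'b \<Rightarrow> real"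
proof -
  have "(\<Sum>j<length Ps. \<Sum>a\<leftarrow>Ps ! j. g a) = (\<Sum>p\<leftarrow>Ps. \<Sum>a\<leftarrow>p. g a)"
    by (simp add: sum_list_sum_nth atLeast0LessThan)
  also have "\<dots> = (\<Sum>a\<leftarrow>concat Ps. g a)" by (induction Ps) auto
  finally show ?thesis .
qed

text \<open>By the assumption \<open>pure\<close>, every trail contains all edges of a cell, so that every \<open>E u\<close>
  contains a copy of \<open>K\<close>. Without this, some \<open>E u\<close> might be null sets.\<close>

locale euler_system = osc_attractor +
  fixes as :: "'a list" and n :: nat and \<beta> :: "nat list \<Rightarrow> int" and Ps :: "(fedge \<times> nat list) list list"
  assumes n: "1 \<le> n" and as: "distinct as" "2 \<le> length as"
    and P: "euler_partition n as as \<beta> Ps"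
    and pure: "\<And>j. j < length as \<Longrightarrow> \<exists>I\<in>words N n. cell_edges as (\<beta> I) I \<subseteq> set (Ps ! j)"
begin

abbreviation m :: nat where "m \<equiv> length as"
abbreviation \<tau> :: "fedge \<Rightarrow> (fedge \<times> nat list) list" where "\<tau> \<equiv> edge_to_trail Ps"
definition V :: "fedge set" where "V = Fwd ` {..<m} \<union> Bwd ` {..<m}"

lemma Ps: "length Ps = m" "distinct (concat Ps)" "set (concat Ps) = (\<Union>I\<in>words N n. cell_edges as (\<beta> I) I)"
    "j < m \<Longrightarrow> walk as (as ! j) (Ps ! j) (as ! (Suc j mod m))"
  using P unfolding euler_partition_def by auto

lemma Ps_nth: "j < m \<Longrightarrow> distinct (Ps ! j)" "j < m \<Longrightarrow> set (Ps ! j) \<subseteq> set (concat Ps)"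
proof -
  assume "j < m"
  then have "Ps ! j \<in> set Ps" using Ps(1) by simp
  then show "distinct (Ps ! j)" "set (Ps ! j) \<subseteq> set (concat Ps)" using Ps(2) by (auto simp: distinct_concat_iff)
qed

lemma V_cases: assumes "u \<in> V" obtains j where "j < m" "u = Fwd j" | j where "j < m" "u = Bwd j"
  using assms by (auto simp: V_def)

lemma rev_V: "u \<in> V \<Longrightarrow> rev_edge u \<in> V" by (auto simp: V_def)

lemma Lambda_pow_V: "e \<in> set (Lambda_pow as b) \<Longrightarrow> e \<in> V" by (auto simp: set_Lambda_pow V_def split: if_splits)

lemma \<tau>_rev: "set (\<tau> (rev_edge u)) = rev_arc ` set (\<tau> u)"
  by (cases u) (simp_all add: edge_to_trail_Bwd image_image del: edge_to_trail.simps(2))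

lemma \<tau>_mem_Fwd: "j < m \<Longrightarrow> (v, I) \<in> set (Ps ! j) \<Longrightarrow> v \<in> V \<and> I \<in> words N n"
  using Ps_nth(2)[of j] Lambda_pow_V unfolding Ps(3) by (fastforce simp: cell_edges_def)

lemma \<tau>_mem: assumes "u \<in> V" "(v, I) \<in> set (\<tau> u)" shows "v \<in> V" "I \<in> words N n"
proof -
  have "v \<in> V \<and> I \<in> words N n"
    using assms(1)
  proof (cases rule: V_cases)
    case (1 j) then show ?thesis using \<tau>_mem_Fwd assms(2) by auto
  next
    case (2 j)
    then have "(v, I) \<in> rev_arc ` set (Ps ! j)" using assms(2) \<tau>_rev[of "Fwd j"] by simp
    then obtain w where "(w, I) \<in> set (Ps ! j)" "v = rev_edge w" by (auto simp: rev_arc_def)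
    then show ?thesis using \<tau>_mem_Fwd[OF 2(1)] rev_V by auto
  qed
  then show "v \<in> V" "I \<in> words N n" by auto
qed

lemma words_props: "I \<in> words N n \<Longrightarrow> set I \<subseteq> {1..N} \<and> I \<noteq> []" using n by (auto simp: words_def)

lemma card_cell_edges: "card (cell_edges as b I) = m"
  by (simp add: cell_edges_def set_Lambda_pow card_image inj_on_def)

lemma length_Ps: "j < m \<Longrightarrow> 2 \<le> length (Ps ! j)"
proof -
  assume j: "j < m"
  obtain I where "cell_edges as (\<beta> I) I \<subseteq> set (Ps ! j)" using pure[OF j] by blast
  then have "m \<le> card (set (Ps ! j))" using card_cell_edges card_mono by (metis List.finite_set)
  then show ?thesis using as(2) card_length[of "Ps ! j"] by linarith
qed

lemma length_\<tau>: "u \<in> V \<Longrightarrow> 2 \<le> length (\<tau> u)"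
  by (erule V_cases) (auto simp: length_Ps)

lemma finite_V: "finite V" by (simp add: V_def)

definition E :: "fedge \<Rightarrow> 'a set" where
  "E = (SOME E. \<forall>u\<in>V. compact (E u) \<and> E u \<noteq> {} \<and> E u \<subseteq> K \<and> E u = (\<Union>(v, I)\<in>set (\<tau> u). word_map S I ` E v))"

lemma E: "u \<in> V \<Longrightarrow> compact (E u) \<and> E u \<noteq> {} \<and> E u \<subseteq> K \<and> E u = (\<Union>(v, I)\<in>set (\<tau> u). word_map S I ` E v)"
proof -
  have "\<exists>E. \<forall>u\<in>V. compact (E u) \<and> E u \<noteq> {} \<and> E u \<subseteq> K \<and> E u = (\<Union>(v, I)\<in>set (\<tau> u). word_map S I ` E v)"
  proof (rule fixed_family_exists)
    fix u v I assume "u \<in> V" "(v, I) \<in> set (\<tau> u)"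
    then show "v \<in> V \<and> set I \<subseteq> {1..N}" using \<tau>_mem words_props by blast
  next
    fix u assume "u \<in> V"
    then show "finite (set (\<tau> u)) \<and> set (\<tau> u) \<noteq> {}" using length_\<tau>[of u] by auto
  qed
  from someI_ex[OF this, folded E_def] show "u \<in> V \<Longrightarrow> ?thesis" by blast
qed

lemma E_compact: "u \<in> V \<Longrightarrow> compact (E u)" and E_nonempty: "u \<in> V \<Longrightarrow> E u \<noteq> {}" and E_subset: "u \<in> V \<Longrightarrow> E u \<subseteq> K"
  using E by blast+

lemma as_nonempty: "as \<noteq> []" using as(2) by auto

lemma \<tau>_nonempty: "u \<in> V \<Longrightarrow> \<tau> u \<noteq> []"
  using length_\<tau>[of u] by (metis list.size(3) not_numeral_le_zero)

text \<open>The substitution commutes with reversal, so the sets of the reversed edges satisfy the same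
  equations.\<close>

lemma E_rev: assumes "u \<in> V" shows "E (rev_edge u) = E u"
proof -
  have sub: "E (rev_edge u) \<subseteq> E u" if "u \<in> V" for u
  proof (rule fixed_family_subset[where V = V and \<tau> = "\<lambda>u. set (\<tau> u)" and F = "\<lambda>u. E (rev_edge u)" and E = E])
    fix u assume u: "u \<in> V"
    have "E (rev_edge u) = (\<Union>(v, I)\<in>rev_arc ` set (\<tau> u). word_map S I ` E v)"
      using E[OF rev_V[OF u]] unfolding \<tau>_rev by (elim conjE)
    also have "\<dots> = (\<Union>(v, I)\<in>set (\<tau> u). word_map S I ` E (rev_edge v))"
      by (auto simp: rev_arc_def)
    finally show "bounded (E (rev_edge u)) \<and> E (rev_edge u) \<subseteq> (\<Union>(v, I)\<in>set (\<tau> u). word_map S I ` E (rev_edge v))"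
      using E[OF rev_V[OF u]] compact_imp_bounded by (metis subset_refl)
    show "compact (E u) \<and> E u \<noteq> {} \<and> (\<Union>(v, I)\<in>set (\<tau> u). word_map S I ` E v) \<subseteq> E u" using E[OF u] by blast
  next
    fix u v I assume "u \<in> V" "(v, I) \<in> set (\<tau> u)"
    then show "v \<in> V \<and> I \<noteq> [] \<and> set I \<subseteq> {1..N}" using \<tau>_mem words_props by blast
  qed (fact that finite_V)+
  show ?thesis using sub[OF assms] sub[OF rev_V[OF assms]] by simp
qed

lemma E_Bwd: "j < m \<Longrightarrow> E (Bwd j) = E (Fwd j)" using E_rev[of "Fwd j"] by (simp add: V_def)

lemma Fwd_V: "j < m \<Longrightarrow> Fwd j \<in> V" by (simp add: V_def)

lemma UN_Lambda_pow: "(\<Union>e\<in>set (Lambda_pow as b). E e) = (\<Union>j<m. E (Fwd j))"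
  by (auto simp: set_Lambda_pow E_Bwd)

lemma UN_E_subdivide: "(\<Union>j<m. E (Fwd j)) = (\<Union>I\<in>words N n. word_map S I ` (\<Union>j<m. E (Fwd j)))"
proof -
  have "(\<Union>j<m. E (Fwd j)) = (\<Union>j<m. \<Union>(v, I)\<in>set (Ps ! j). word_map S I ` E v)"
    using E[OF Fwd_V] by (intro SUP_cong refl) (metis edge_to_trail.simps(1) lessThan_iff)
  also have "\<dots> = (\<Union>(v, I)\<in>set (concat Ps). word_map S I ` E v)"
    using Ps(1) by (auto simp: set_conv_nth[of Ps])
  also have "\<dots> = (\<Union>I\<in>words N n. word_map S I ` (\<Union>e\<in>set (Lambda_pow as (\<beta> I)). E e))"
    unfolding Ps(3) cell_edges_def by blast
  finally show ?thesis unfolding UN_Lambda_pow .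
qed

lemma K_eq_UN_E: "K = (\<Union>j<m. E (Fwd j))"
proof -
  define Q where "Q = (\<Union>j<m. E (Fwd j))"
  have Q: "compact Q" "Q \<noteq> {}" unfolding Q_def using as_nonempty
    by (auto intro!: compact_UN E_compact Fwd_V simp: E_nonempty[OF Fwd_V])
  define \<tau>0 where "\<tau>0 = (\<lambda>_::unit. (\<lambda>I. ((), I)) ` words N n)"
  have UN: "(\<Union>(v, I)\<in>\<tau>0 u. word_map S I ` X) = (\<Union>I\<in>words N n. word_map S I ` X)" for u X
    by (auto simp: \<tau>0_def)
  have \<tau>0: "v \<in> UNIV \<and> I \<noteq> [] \<and> set I \<subseteq> {1..N}" if "(v, I) \<in> \<tau>0 u" for u v I
    using that words_props by (auto simp: \<tau>0_def)
  have "K \<subseteq> Q"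
    by (rule fixed_family_subset[where V = UNIV and \<tau> = \<tau>0 and F = "\<lambda>_. K" and E = "\<lambda>_. Q" and u = "()"])
      (use Q \<tau>0 K(1) K_words[of n] UN_E_subdivide in \<open>auto simp: UN Q_def[symmetric] compact_imp_bounded\<close>)
  moreover have "Q \<subseteq> K" unfolding Q_def using E_subset[OF Fwd_V] by blast
  ultimately show ?thesis unfolding Q_def by blast
qed

definition h :: "fedge \<Rightarrow> real" where "h u = enn2real (hausdorff_measure sdim (E u))"

lemma hE: "u \<in> V \<Longrightarrow> hausdorff_measure sdim (E u) = ennreal (h u)"
proof -
  assume u: "u \<in> V"
  have "hausdorff_measure sdim (E u) \<le> hausdorff_measure sdim K" using E[OF u] by (intro hausdorff_measure_mono) auto
  then show ?thesis using hausdorff_measure_K_finite by (auto simp: h_def)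
qed

lemma h_nonneg: "0 \<le> h u" by (simp add: h_def)
lemma h_Bwd: "j < m \<Longrightarrow> h (Bwd j) = h (Fwd j)" by (simp add: h_def E_Bwd)

lemma h_rev: "u \<in> V \<Longrightarrow> h (rev_edge u) = h u" by (simp add: h_def E_rev)

lemma h_le: assumes u: "u \<in> V" shows "h u \<le> (\<Sum>a\<leftarrow>\<tau> u. wratio (snd a) powr sdim * h (fst a))"
proof -
  have "E u = (\<Union>a\<in>set (\<tau> u). word_map S (snd a) ` E (fst a))" using E[OF u] by (simp add: case_prod_beta')
  then have "ennreal (h u) \<le> (\<Sum>a\<leftarrow>\<tau> u. hausdorff_measure sdim (word_map S (snd a) ` E (fst a)))"
    using hausdorff_measure_list_UN_le[of sdim "\<lambda>a. word_map S (snd a) ` E (fst a)" "\<tau> u"] hE[OF u] by simp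
  also have "map (\<lambda>a. hausdorff_measure sdim (word_map S (snd a) ` E (fst a))) (\<tau> u)
      = map (\<lambda>a. ennreal (wratio (snd a) powr sdim * h (fst a))) (\<tau> u)"
  proof (rule map_cong[OF refl])
    fix a assume "a \<in> set (\<tau> u)"
    then have "fst a \<in> V" "set (snd a) \<subseteq> {1..N}" using \<tau>_mem[OF u, of "fst a" "snd a"] words_props by auto
    then show "hausdorff_measure sdim (word_map S (snd a) ` E (fst a)) = ennreal (wratio (snd a) powr sdim * h (fst a))"
      using sdim(1) by (simp add: hausdorff_measure_word_image hE ennreal_mult')
  qed
  also have "(\<Sum>a\<leftarrow>\<tau> u. ennreal (wratio (snd a) powr sdim * h (fst a))) = ennreal (\<Sum>a\<leftarrow>\<tau> u. wratio (snd a) powr sdim * h (fst a))"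
    by (rule sum_list_ennreal) (simp add: h_nonneg)
  finally show ?thesis by (subst (asm) ennreal_le_iff) (auto intro!: sum_list_nonneg simp: h_nonneg)
qed

text \<open>A cell contains every edge once, in one of the two directions, which have equal masses; and
  the weights of the words of length \<open>n\<close> add up to \<open>1\<close>.\<close>

lemma total_eq: "(\<Sum>j<m. \<Sum>a\<leftarrow>Ps ! j. wratio (snd a) powr sdim * h (fst a)) = (\<Sum>j<m. h (Fwd j))"
proof -
  let ?g = "\<lambda>a. wratio (snd a) powr sdim * h (fst a)"
  have "(\<Sum>j<m. \<Sum>a\<leftarrow>Ps ! j. ?g a) = (\<Sum>a\<leftarrow>concat Ps. ?g a)"
    using sum_list_concat_nth[of ?g Ps] Ps(1) by simp
  also have "\<dots> = (\<Sum>a\<in>set (concat Ps). ?g a)" using Ps(2) by (rule sum_list_distinct_conv_sum_set)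
  also have "\<dots> = (\<Sum>I\<in>words N n. \<Sum>a\<in>cell_edges as (\<beta> I) I. ?g a)"
    unfolding Ps(3) by (rule sum.UNION_disjoint) (auto simp: cell_edges_def)
  also have "\<dots> = (\<Sum>I\<in>words N n. wratio I powr sdim * (\<Sum>j<m. h (Fwd j)))"
  proof (rule sum.cong[OF refl])
    fix I
    have "(\<Sum>a\<in>cell_edges as (\<beta> I) I. ?g a) = (\<Sum>e\<in>set (Lambda_pow as (\<beta> I)). wratio I powr sdim * h e)"
      unfolding cell_edges_def by (subst sum.reindex) (auto simp: inj_on_def)
    also have "\<dots> = wratio I powr sdim * (\<Sum>e\<in>set (Lambda_pow as (\<beta> I)). h e)" by (simp add: sum_distrib_left)
    also have "(\<Sum>e\<in>set (Lambda_pow as (\<beta> I)). h e) = (\<Sum>j<m. h (Fwd j))"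
      unfolding set_Lambda_pow by (simp add: sum.reindex inj_on_def h_Bwd)
    finally show "(\<Sum>a\<in>cell_edges as (\<beta> I) I. ?g a) = wratio I powr sdim * (\<Sum>j<m. h (Fwd j))" .
  qed
  also have "\<dots> = (\<Sum>j<m. h (Fwd j))" by (simp add: sum_distrib_right[symmetric] sum_wratio_sdim)
  finally show ?thesis .
qed

text \<open>Inequalities between the terms of two equal sums are equalities.\<close>

lemma h_eq_Fwd: assumes j: "j < m" shows "h (Fwd j) = (\<Sum>a\<leftarrow>Ps ! j. wratio (snd a) powr sdim * h (fst a))"
  by (rule sum_mono_inv[OF total_eq[symmetric]]) (use j h_le[OF Fwd_V] in auto)

lemma h_eq: assumes u: "u \<in> V" shows "h u = (\<Sum>a\<leftarrow>\<tau> u. wratio (snd a) powr sdim * h (fst a))"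
  using u
proof (cases rule: V_cases)
  case (1 j) then show ?thesis using h_eq_Fwd by simp
next
  case (2 j)
  have "(\<Sum>a\<leftarrow>\<tau> (Bwd j). wratio (snd a) powr sdim * h (fst a))
      = (\<Sum>a\<leftarrow>rev (Ps ! j). wratio (snd a) powr sdim * h (rev_edge (fst a)))"
    unfolding edge_to_trail_Bwd by (simp add: o_def rev_arc_def)
  also have "\<dots> = (\<Sum>a\<leftarrow>Ps ! j. wratio (snd a) powr sdim * h (rev_edge (fst a)))"
    by (simp add: rev_map[symmetric] sum_list_rev)
  also have "\<dots> = (\<Sum>a\<leftarrow>Ps ! j. wratio (snd a) powr sdim * h (fst a))"
    using \<tau>_mem_Fwd[OF 2(1)] by (intro arg_cong[of _ _ sum_list] map_cong refl) (auto simp: h_rev)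
  finally show ?thesis using 2 h_eq_Fwd h_Bwd by simp
qed

lemma h_Fwd_pos: assumes j: "j < m" shows "0 < h (Fwd j)"
proof -
  have "\<exists>k<m. 0 < h (Fwd k)"
  proof (rule ccontr)
    assume "\<not> ?thesis"
    then have "hausdorff_measure sdim (E (Fwd k)) = 0" if "k < m" for k
      using hE[OF Fwd_V[OF that]] h_nonneg[of "Fwd k"] that by force
    then have "hausdorff_measure sdim K \<le> 0"
      using hausdorff_measure_finite_UN_le[of "{..<m}" sdim "\<lambda>j. E (Fwd j)"] K_eq_UN_E by simp
    then show False using hausdorff_measure_K_pos by simp
  qed
  then obtain k where k: "k < m" "0 < h (Fwd k)" by blast
  obtain I where I: "I \<in> words N n" "cell_edges as (\<beta> I) I \<subseteq> set (Ps ! j)" using pure[OF j] by blast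
  define e where "e = (if \<beta> I = 1 then Fwd k else Bwd k)"
  have e: "(e, I) \<in> set (Ps ! j)" "h e = h (Fwd k)"
    using I k h_Bwd by (auto simp: cell_edges_def set_Lambda_pow e_def)
  have "0 < wratio I" using wratio_pos words_props[OF I(1)] by blast
  then have "0 < wratio I powr sdim * h e" using e k by simp
  also have "\<dots> \<le> (\<Sum>a\<in>set (Ps ! j). wratio (snd a) powr sdim * h (fst a))"
    using member_le_sum[OF e(1), of "\<lambda>a. wratio (snd a) powr sdim * h (fst a)"] h_nonneg by simp
  also have "\<dots> = h (Fwd j)"
    unfolding h_eq_Fwd[OF j] using Ps_nth(1)[OF j] by (rule sum_list_distinct_conv_sum_set[symmetric])
  finally show ?thesis .
qed

lemma walk_\<tau>: "u \<in> V \<Longrightarrow> walk as (origin as u) (\<tau> u) (terminus as u)"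
proof (erule V_cases)
  fix j assume j: "j < m"
  have w: "walk as (origin as (Fwd j)) (Ps ! j) (terminus as (Fwd j))" using Ps(4)[OF j] by (simp add: terminus_def)
  then show "u = Fwd j \<Longrightarrow> ?thesis" by simp
  show ?thesis if "u = Bwd j"
    unfolding that edge_to_trail_Bwd using walk_rev[OF w] by (simp add: terminus_def)
qed

lemma curve_system: "curve_system N S sdim V \<tau> E h (origin as) (terminus as)"
proof (unfold_locales, goal_cases)
  case 1 then show ?case by (rule sdim)
next
  case 2 then show ?case by (rule finite_V)
next
  case 3 then show ?case using Fwd_V as(2) by fastforce
next
  case (4 u v I) then show ?case using \<tau>_mem words_props by blast
next
  case (5 u) then show ?case by (rule length_\<tau>)
next
  case (6 u) then show ?case using E by blast
next
  case (7 u) then show ?case by (rule hE)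
next
  case (8 u) then show ?case by (erule_tac V_cases) (auto simp: h_Fwd_pos h_Bwd)
next
  case (9 u) then show ?case using h_eq by (simp add: case_prod_beta')
next
  case (10 u)
  then show ?case using walk_hd[OF walk_\<tau>[OF 10] \<tau>_nonempty[OF 10]] by (auto simp: src_def)
next
  case (11 u)
  then show ?case using walk_last[OF walk_\<tau>[OF 11] \<tau>_nonempty[OF 11]] by (auto simp: dst_def)
next
  case (12 u i)
  then show ?case using walk_nth[OF walk_\<tau>[OF 12(1)] 12(2)] by (simp add: src_def dst_def)
qed

sublocale cs: curve_system N S sdim V \<tau> E h "origin as" "terminus as"
  by (rule curve_system)

lemma pure_cell:
  obtains I where "I \<in> words N n" "cell_edges as (\<beta> I) I \<subseteq> set (Ps ! 0)"
  using pure[of 0] as(2) by (metis less_le_trans pos2)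

text \<open>The images of both sets under the map of a complete cell are different pieces of
  \<open>E (Fwd 0)\<close>, and the pieces of a curve do not overlap.\<close>

lemma E_null_overlap:
  assumes "k < m" "l < m" "k \<noteq> l"
  shows "hausdorff_measure sdim (E (Fwd k) \<inter> E (Fwd l)) = 0"
proof -
  obtain I where I: "I \<in> words N n" "cell_edges as (\<beta> I) I \<subseteq> set (Ps ! 0)" using pure_cell .
  have I': "set I \<subseteq> {1..N}" using words_props[OF I(1)] by simp
  define e where "e k = (if \<beta> I = 1 then Fwd k else Bwd k)" for k
  have e: "(e k, I) \<in> set (Ps ! 0)" "E (e k) = E (Fwd k)" if "k < m" for k
    using I that E_Bwd by (auto simp: cell_edges_def set_Lambda_pow e_def)
  obtain p where p: "p < length (Ps ! 0)" "Ps ! 0 ! p = (e k, I)" using e(1)[OF assms(1)] by (auto simp: in_set_conv_nth)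
  obtain q where q: "q < length (Ps ! 0)" "Ps ! 0 ! q = (e l, I)" using e(1)[OF assms(2)] by (auto simp: in_set_conv_nth)
  have "p \<noteq> q" using p q assms(3) by (auto simp: e_def split: if_splits)
  moreover have "Fwd 0 \<in> V" using as(2) by (intro Fwd_V) auto
  ultimately have "hausdorff_measure sdim (word_map S I ` E (e k) \<inter> word_map S I ` E (e l)) = 0"
    using cs.pieces_null_overlap[of "Fwd 0" p q] p q by (simp add: cs.word_def cs.state_def)
  then have "hausdorff_measure sdim (word_map S I ` (E (Fwd k) \<inter> E (Fwd l))) = 0"
    using e(2) assms inj_word_map[OF I'] by (simp add: image_Int)
  then show ?thesis
    using hausdorff_measure_word_image[OF I', of sdim "E (Fwd k) \<inter> E (Fwd l)"] sdim(1) wratio_pos[OF I']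
    by (auto simp: ennreal_eq_0_iff)
qed

text \<open>The image of \<open>K\<close> under the map of a complete cell lies in \<open>E (Fwd 0)\<close>, where the Hausdorff
  measure is additive.\<close>

lemma hausdorff_measure_K_eq_sum: "hausdorff_measure sdim K = ennreal (\<Sum>j<m. h (Fwd j))"
proof -
  obtain I where I: "I \<in> words N n" "cell_edges as (\<beta> I) I \<subseteq> set (Ps ! 0)" using pure_cell .
  have I': "set I \<subseteq> {1..N}" using words_props[OF I(1)] by simp
  have 0: "Fwd 0 \<in> V" using as(2) by (intro Fwd_V) auto
  interpret c0: unit_speed_curve sdim "E (Fwd 0)" "cs.curve (Fwd 0)" "h (Fwd 0)" by (rule cs.curve_unit_speed[OF 0])
  define B where "B k = word_map S I ` E (Fwd k)" for k
  have HB: "hausdorff_measure sdim (word_map S I ` X) = ennreal (wratio I powr sdim) * hausdorff_measure sdim X" for X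
    using sdim(1) by (intro hausdorff_measure_word_image[OF I']) auto
  have "hausdorff_measure sdim (\<Union>k\<in>{..<m}. B k) = (\<Sum>k<m. hausdorff_measure sdim (B k))"
  proof (rule c0.hausdorff_measure_UN_eq)
    fix k assume "k \<in> {..<m}"
    then have k: "k < m" by simp
    have "compact (B k)" unfolding B_def using E[OF Fwd_V[OF k]] continuous_word_map[OF I']
      by (intro compact_continuous_image) auto
    then have "B k \<in> sets borel" by (rule borel_compact)
    moreover have "B k \<subseteq> E (Fwd 0)"
    proof -
      define e where "e = (if \<beta> I = 1 then Fwd k else Bwd k)"
      have e: "(e, I) \<in> set (Ps ! 0)" "E e = E (Fwd k)"
        using I k E_Bwd by (auto simp: cell_edges_def set_Lambda_pow e_def)
      have "E (Fwd 0) = (\<Union>(v, I)\<in>set (Ps ! 0). word_map S I ` E v)" using E[OF 0] by simp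
      then show ?thesis using e unfolding B_def by blast
    qed
    ultimately show "B k \<in> sets borel \<and> B k \<subseteq> E (Fwd 0)" ..
  next
    fix k l assume kl: "k \<in> {..<m}" "l \<in> {..<m}" "k \<noteq> l"
    have "B k \<inter> B l = word_map S I ` (E (Fwd k) \<inter> E (Fwd l))"
      unfolding B_def using inj_word_map[OF I'] by (simp add: image_Int)
    then show "hausdorff_measure sdim (B k \<inter> B l) = 0" using E_null_overlap[of k l] kl by (simp add: HB)
  qed simp
  moreover have "(\<Union>k\<in>{..<m}. B k) = word_map S I ` K"
    unfolding B_def image_UN[symmetric] by (rule arg_cong[OF K_eq_UN_E[symmetric]])
  ultimately have "ennreal (wratio I powr sdim) * hausdorff_measure sdim K
      = (\<Sum>k<m. ennreal (wratio I powr sdim) * ennreal (h (Fwd k)))"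
    using hE[OF Fwd_V] by (simp add: B_def HB)
  also have "\<dots> = ennreal (wratio I powr sdim) * ennreal (\<Sum>k<m. h (Fwd k))"
    by (simp add: sum_distrib_left[symmetric] sum_ennreal h_nonneg)
  finally show ?thesis
    using wratio_pos[OF I'] by (subst (asm) ennreal_mult_cancel_left) (auto simp: ennreal_eq_0_iff)
qed

lemma Lambda_trail: "pre_digraph.trail (edge_graph as) (as ! 0) (Lambda as) (as ! 0)"
proof -
  have "pre_digraph.cas (edge_graph as) (as ! (i mod m)) (map Fwd [i..<m]) (as ! 0)" if "i \<le> m" for i
    using that
  proof (induction "m - i" arbitrary: i)
    case 0 then show ?case using as_nonempty by (simp add: pre_digraph.cas.simps)
  next
    case (Suc d)
    then have i: "i < m" "d = m - Suc i" by auto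
    then have "pre_digraph.cas (edge_graph as) (as ! (Suc i mod m)) (map Fwd [Suc i..<m]) (as ! 0)"
      using Suc.hyps(1)[of "Suc i"] by simp
    moreover have "[i..<m] = i # [Suc i..<m]" using i by (simp add: upt_conv_Cons)
    ultimately show ?case using i by (simp add: pre_digraph.cas.simps edge_graph_def terminus_def)
  qed
  from this[of 0] show ?thesis using as_nonempty
    by (auto simp: pre_digraph.trail_def pre_digraph.awalk_def Lambda_def distinct_map inj_on_def edge_graph_def
        intro!: nth_mem)
qed

lemma leads_to_curve: "leads_to_space_filling_curve S K as \<tau>"
    "\<exists>\<psi>. optimal_parametrization (hausdorff_dim K) K \<psi>"
proof -
  obtain C where C: "0 < C" "\<forall>u\<in>V. \<forall>x\<in>{0..1}. \<forall>y\<in>{0..1}. norm (cs.curve u x - cs.curve u y) \<le> C * \<bar>x - y\<bar> powr (1 / sdim)"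
    using cs.curve_hoelder_norm by blast
  interpret cl: curve_list sdim m "\<lambda>i. E (Fwd i)" "\<lambda>i. cs.curve (Fwd i)" "\<lambda>i. h (Fwd i)" C
  proof (rule curve_list.intro)
    show "0 < sdim" by (rule sdim)
    show "0 < m" using as_nonempty by simp
    show "0 < C" by (rule C)
    show "unit_speed_curve sdim (E (Fwd i)) (cs.curve (Fwd i)) (h (Fwd i))" if "i < m" for i
      by (rule cs.curve_unit_speed[OF Fwd_V[OF that]])
    show "norm (cs.curve (Fwd i) x - cs.curve (Fwd i) y) \<le> C * \<bar>x - y\<bar> powr (1 / sdim)"
      if "i < m" "x \<in> {0..1}" "y \<in> {0..1}" for i x y using C(2) Fwd_V that by blast
    show "cs.curve (Fwd i) 1 = cs.curve (Fwd (Suc i)) 0" if "Suc i < m" for i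
      using that by (simp add: cs.curve_1 cs.curve_0 Fwd_V terminus_def)
    show "hausdorff_measure sdim (\<Union>i<m. E (Fwd i)) = ennreal (\<Sum>i<m. h (Fwd i))"
      using hausdorff_measure_K_eq_sum K_eq_UN_E by simp
  qed
  have opt: "optimal_parametrization sdim K cl.joint" using cl.joint_optimal K_eq_UN_E by simp
  then show "\<exists>\<psi>. optimal_parametrization (hausdorff_dim K) K \<psi>" unfolding hausdorff_dim_K_eq by blast
  define ws where "ws = Lambda as"
  have ws: "length ws = m" "\<And>i. i < m \<Longrightarrow> ws ! i = Fwd i" by (auto simp: ws_def Lambda_def)
  have arcs: "arcs (edge_graph as) = V" by (simp add: edge_graph_def V_def)
  have quot: "enn2real (hausdorff_measure sdim (E (ws ! i)) / hausdorff_measure sdim K) = cl.len i" if "i < m" for i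
    unfolding ws(2)[OF that] hE[OF Fwd_V[OF that]] hausdorff_measure_K_eq_sum cl.len_def cl.mass_def
    using h_nonneg cl.mass_pos[unfolded cl.mass_def] by (simp add: divide_ennreal)
  have joint: "cl.joint = concat_curves (map (\<lambda>i. (enn2real (hausdorff_measure sdim (E (ws ! i)) / hausdorff_measure sdim K),
      cs.curve (ws ! i))) [0..<length ws])"
    unfolding cl.joint_def ws(1) using quot ws(2) by (intro arg_cong[of _ _ concat_curves] map_cong) auto
  show "leads_to_space_filling_curve S K as \<tau>"
    unfolding leads_to_space_filling_curve_def Let_def hausdorff_dim_K_eq
  proof (intro exI[of _ E] exI[of _ ws] exI[of _ "as ! 0"] exI[of _ "\<lambda>i. cs.curve (ws ! i)"] conjI)
    show "invariant_sets S (arcs (edge_graph as)) \<tau> E"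
      unfolding invariant_sets_def arcs using E by blast
    show "pre_digraph.trail (edge_graph as) (as ! 0) ws (as ! 0)" unfolding ws_def by (rule Lambda_trail)
    show "K = (\<Union>i<length ws. E (ws ! i))" using K_eq_UN_E ws by simp
    show "\<forall>i<length ws. \<forall>j<length ws. i \<noteq> j \<longrightarrow> hausdorff_measure sdim (E (ws ! i) \<inter> E (ws ! j)) = 0"
      using ws E_null_overlap by simp
    show "\<forall>i<length ws. optimal_parametrization sdim (E (ws ! i)) (cs.curve (ws ! i)) \<and>
        cs.curve (ws ! i) 0 = origin as (ws ! i) \<and> cs.curve (ws ! i) 1 = terminus as (ws ! i)"
      using ws cs.curve_optimal cs.curve_0 cs.curve_1 Fwd_V by simp
    show "optimal_parametrization sdim K (concat_curves (map (\<lambda>i. (enn2real (hausdorff_measure sdim (E (ws ! i)) / hausdorff_measure sdim K),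
      cs.curve (ws ! i))) [0..<length ws]))" using opt unfolding joint .
  qed
qed

end

section \<open>Connectedness by cuts\<close>

text \<open>For symmetric \<open>R\<close> this is connectedness by paths. In the form with cuts it passes to unions
  and products without any path being constructed.\<close>

definition cut_connected :: "('v \<Rightarrow> 'v \<Rightarrow> bool) \<Rightarrow> 'v set \<Rightarrow> bool" where
  "cut_connected R V \<longleftrightarrow> V \<noteq> {} \<and> (\<forall>U. U \<subset> V \<longrightarrow> U \<noteq> {} \<longrightarrow> (\<exists>x\<in>U. \<exists>y\<in>V - U. R x y))"

definition noncut :: "('v \<Rightarrow> 'v \<Rightarrow> bool) \<Rightarrow> 'v set \<Rightarrow> 'v set" where
  "noncut R V = {x\<in>V. cut_connected R (V - {x})}"

lemma cut_connectedD: "cut_connected R V \<Longrightarrow> U \<subseteq> V \<Longrightarrow> U \<noteq> V \<Longrightarrow> U \<noteq> {} \<Longrightarrow> \<exists>x\<in>U. \<exists>y\<in>V - U. R x y"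
  unfolding cut_connected_def by (meson psubsetI)

lemma cut_connected_image:
  assumes V: "cut_connected R V" and f: "\<And>x y. R x y \<Longrightarrow> R' (f x) (f y)"
  shows "cut_connected R' (f ` V)"
  unfolding cut_connected_def
proof (intro conjI allI impI)
  show "f ` V \<noteq> {}" using V by (simp add: cut_connected_def)
  fix U assume U: "U \<subset> f ` V" "U \<noteq> {}"
  let ?W = "{x\<in>V. f x \<in> U}"
  have "?W \<noteq> {}" "?W \<noteq> V" using U by blast+
  then obtain x y where "x \<in> ?W" "y \<in> V - ?W" "R x y" using cut_connectedD[OF V, of ?W] by blast
  then have "f x \<in> U" "f y \<in> f ` V - U" "R' (f x) (f y)" using f by auto
  then show "\<exists>x\<in>U. \<exists>y\<in>f ` V - U. R' x y" by blast
qed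

lemma cut_connected_Un:
  assumes sym: "\<And>x y. R x y \<Longrightarrow> R y x"
    and X: "cut_connected R X" and Y: "cut_connected R Y" and xy: "x \<in> X" "y \<in> Y" "R x y"
  shows "cut_connected R (X \<union> Y)"
  unfolding cut_connected_def
proof (intro conjI allI impI)
  show "X \<union> Y \<noteq> {}" using xy by auto
  fix U assume U: "U \<subset> X \<union> Y" "U \<noteq> {}"
  consider "U \<inter> X \<noteq> {}" "U \<inter> X \<noteq> X" | "U \<inter> Y \<noteq> {}" "U \<inter> Y \<noteq> Y"
    | "U \<inter> X = X" "U \<inter> Y = {}" | "U \<inter> X = {}" "U \<inter> Y = Y"
    using U by blast
  then show "\<exists>x\<in>U. \<exists>y\<in>X \<union> Y - U. R x y"
  proof cases
    case 1 then show ?thesis using cut_connectedD[OF X, of "U \<inter> X"] by blast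
  next
    case 2 then show ?thesis using cut_connectedD[OF Y, of "U \<inter> Y"] by blast
  next
    case 3 then show ?thesis using xy by blast
  next
    case 4 then show ?thesis using xy sym by blast
  qed
qed

lemma cut_connected_singleton: "cut_connected R {x}"
  unfolding cut_connected_def by blast

text \<open>On the side of a cut that does not contain \<open>u\<close>, an element with minimal \<open>d\<close> has its parent
  on the other side.\<close>

lemma cut_connected_parent:
  fixes d :: "'v \<Rightarrow> nat"
  assumes sym: "\<And>x y. R x y \<Longrightarrow> R y x" and u: "u \<in> V"
    and par: "\<And>v. v \<in> V \<Longrightarrow> v \<noteq> u \<Longrightarrow> par v \<in> V \<and> R (par v) v \<and> d (par v) < d v"
  shows "cut_connected R V"
  unfolding cut_connected_def
proof (intro conjI allI impI)
  show "V \<noteq> {}" using u by auto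
  fix U assume U: "U \<subset> V" "U \<noteq> {}"
  have minimal: "\<exists>v\<in>W. \<forall>w\<in>W. d v \<le> d w" if "W \<noteq> {}" for W
    using that arg_min_nat_lemma[of "\<lambda>v. v \<in> W" _ d] by blast
  show "\<exists>x\<in>U. \<exists>y\<in>V - U. R x y"
  proof (cases "u \<in> U")
    case True
    obtain v where v: "v \<in> V - U" "\<forall>w\<in>V - U. d v \<le> d w" using minimal[of "V - U"] U by blast
    have "v \<in> V" "v \<noteq> u" using v True by auto
    note p = par[OF this]
    have "par v \<notin> V - U" using v(2) p by (meson not_le)
    then show ?thesis using p v by blast
  next
    case False
    obtain v where v: "v \<in> U" "\<forall>w\<in>U. d v \<le> d w" using minimal[OF U(2)] by blast
    have "v \<in> V" "v \<noteq> u" using v False U by auto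
    note p = par[OF this]
    have "par v \<notin> U" using v(2) p by (meson not_le)
    then show ?thesis using p v sym by blast
  qed
qed

text \<open>Breadth-first search from \<open>u\<close>: \<open>B k\<close> is the ball of radius \<open>k\<close>, and every vertex chooses a
  neighbour that is closer to \<open>u\<close> as its parent.\<close>

lemma distance_exists:
  assumes V: "cut_connected R V" and u: "u \<in> V"
  shows "\<exists>d :: 'v \<Rightarrow> nat. \<exists>par. d u = 0 \<and>
    (\<forall>v\<in>V. v \<noteq> u \<longrightarrow> par v \<in> V \<and> R (par v) v \<and> d v = Suc (d (par v))) \<and>
    (\<forall>v\<in>V. \<forall>w\<in>V. R w v \<longrightarrow> d v \<le> Suc (d w))"
proof -
  define B where "B = rec_nat {u} (\<lambda>_ X. X \<union> {v\<in>V. \<exists>w\<in>X. R w v})"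
  have B0: "B 0 = {u}" and BS: "B (Suc k) = B k \<union> {v\<in>V. \<exists>w\<in>B k. R w v}" for k by (simp_all add: B_def)
  have BV: "B k \<subseteq> V" for k
  proof (induction k)
    case 0 show ?case unfolding B0 using u by simp
  next
    case (Suc k) then show ?case unfolding BS by blast
  qed
  have reach: "\<exists>k. v \<in> B k" if "v \<in> V" for v
  proof (rule ccontr)
    assume "\<not> ?thesis"
    then have ne: "(\<Union>k. B k) \<noteq> V" using that by blast
    obtain x y where "x \<in> (\<Union>k. B k)" "y \<in> V - (\<Union>k. B k)" "R x y"
    proof -
      have "(\<Union>k. B k) \<subseteq> V" using BV by (rule UN_least)
      moreover have "u \<in> (\<Union>k. B k)" using B0 by (intro UN_I[of 0]) auto
      ultimately show thesis using cut_connectedD[OF V _ ne] that by blast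
    qed
    then obtain k where "x \<in> B k" by blast
    then have "y \<in> B (Suc k)" using \<open>y \<in> V - _\<close> \<open>R x y\<close> unfolding BS by blast
    then show False using \<open>y \<in> V - _\<close> by blast
  qed
  define d where "d v = (LEAST k. v \<in> B k)" for v
  have dB: "v \<in> B (d v)" if "v \<in> V" for v
    unfolding d_def using reach[OF that] by (rule LeastI_ex)
  have d_le: "d v \<le> k" if "v \<in> B k" for v k unfolding d_def using that by (rule Least_le)
  have "\<exists>w\<in>V. R w v \<and> d v = Suc (d w)" if v: "v \<in> V" "v \<noteq> u" for v
  proof -
    have "d v \<noteq> 0" using dB[OF v(1)] v(2) B0 by (metis singletonD)
    then obtain k where k: "d v = Suc k" by (cases "d v") auto
    have "v \<notin> B k" using d_le[of v k] k by auto
    then obtain w where w: "w \<in> B k" "R w v" using dB[OF v(1)] unfolding k BS by blast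
    have "w \<in> V" using w(1) BV by (rule subsetD[rotated])
    from dB[OF this] have "v \<in> B (Suc (d w))" using w(2) v(1) unfolding BS by blast
    then have "d v \<le> Suc (d w)" by (rule d_le)
    moreover have "d w \<le> k" using w by (intro d_le)
    ultimately show ?thesis using k w BV by (intro bexI[of _ w]) auto
  qed
  then obtain par where par: "\<And>v. v \<in> V \<Longrightarrow> v \<noteq> u \<Longrightarrow> par v \<in> V \<and> R (par v) v \<and> d v = Suc (d (par v))" by metis
  have "d v \<le> Suc (d w)" if "v \<in> V" "w \<in> V" "R w v" for v w
  proof (rule d_le)
    show "v \<in> B (Suc (d w))" using dB[OF that(2)] that unfolding BS by blast
  qed
  moreover have "d u = 0" using d_le[of u 0] B0 by simp
  ultimately show ?thesis using par by blast
qed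

text \<open>No remaining vertex has lost its way to \<open>u\<close>.\<close>

lemma non_parent_noncut:
  fixes d :: "'v \<Rightarrow> nat"
  assumes sym: "\<And>x y. R x y \<Longrightarrow> R y x" and u: "u \<in> V"
    and par: "\<And>v. v \<in> V \<Longrightarrow> v \<noteq> u \<Longrightarrow> par v \<in> V \<and> R (par v) v \<and> d v = Suc (d (par v))"
    and x: "x \<in> V" "x \<noteq> u" "x \<notin> par ` (V - {u})"
  shows "x \<in> noncut R V"
proof -
  have "cut_connected R (V - {x})"
    by (rule cut_connected_parent[where u = u and par = par and d = d]) (use sym u par x in \<open>auto simp: less_Suc_eq\<close>)
  then show ?thesis using x by (simp add: noncut_def)
qed

text \<open>A vertex of maximal distance from \<open>u\<close> is nobody's parent.\<close>

lemma noncut_other_exists: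
  assumes sym: "\<And>x y. R x y \<Longrightarrow> R y x" and V: "cut_connected R V" "finite V" "2 \<le> card V" and u: "u \<in> V"
  shows "\<exists>x\<in>noncut R V. x \<noteq> u"
proof -
  obtain d :: "'a \<Rightarrow> nat" and par where d: "d u = 0"
    and par: "\<And>v. v \<in> V \<Longrightarrow> v \<noteq> u \<Longrightarrow> par v \<in> V \<and> R (par v) v \<and> d v = Suc (d (par v))"
    using distance_exists[OF V(1) u] by blast
  have "\<not> V \<subseteq> {u}" using V card_mono[of "{u}" V] by auto
  then obtain v where v: "v \<in> V" "v \<noteq> u" by blast
  have "finite (d ` V)" "d ` V \<noteq> {}" using V u by auto
  from Max_in[OF this] obtain x where x: "x \<in> V" "d x = Max (d ` V)" by auto
  then have max: "d w \<le> d x" if "w \<in> V" for w using V that by simp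
  have "x \<noteq> u" using max[OF v(1)] par[OF v] d by auto
  moreover have "x \<notin> par ` (V - {u})" using max par by fastforce
  ultimately show ?thesis
    using non_parent_noncut[where R = R and V = V and u = u and par = par and d = d and x = x] sym u par x(1) by blast
qed

lemma card_noncut_ge_2:
  assumes sym: "\<And>x y. R x y \<Longrightarrow> R y x" and V: "cut_connected R V" "finite V" "2 \<le> card V"
  shows "2 \<le> card (noncut R V)"
proof -
  obtain u where u: "u \<in> V" using V by (auto simp: cut_connected_def)
  obtain x where x: "x \<in> noncut R V" "x \<noteq> u" using noncut_other_exists[OF sym V u] by blast
  then have "x \<in> V" by (simp add: noncut_def)
  then obtain y where y: "y \<in> noncut R V" "y \<noteq> x" using noncut_other_exists[OF sym V] by blast
  have "finite (noncut R V)" using V by (simp add: noncut_def)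
  then have "card {x, y} \<le> card (noncut R V)" using x y by (intro card_mono) auto
  then show ?thesis using y by simp
qed

text \<open>In the search from one of the two non-cut vertices, only the other one can fail to be a
  parent. So the parent map is injective by counting, and there is exactly one vertex at each
  distance.\<close>

lemma path_order:
  assumes sym: "\<And>x y. R x y \<Longrightarrow> R y x" and V: "cut_connected R V" "finite V" "2 \<le> card V"
    and two: "card (noncut R V) = 2"
  shows "\<exists>d. bij_betw d V {..<card V} \<and>
    (\<forall>x\<in>V. \<forall>y\<in>V. R x y \<longrightarrow> x \<noteq> y \<longrightarrow> d x = Suc (d y) \<or> d y = Suc (d x)) \<and>
    (\<forall>x\<in>V. \<forall>y\<in>V. d y = Suc (d x) \<longrightarrow> R x y) \<and>
    noncut R V = {x\<in>V. d x = 0 \<or> Suc (d x) = card V}"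
proof -
  obtain a b where ab: "noncut R V = {a, b}" "a \<noteq> b" using two by (auto simp: card_2_iff)
  have aV: "a \<in> V" "b \<in> V" using ab by (auto simp: noncut_def)
  obtain d :: "'a \<Rightarrow> nat" and par where d: "d a = 0"
    and par: "\<And>v. v \<in> V \<Longrightarrow> v \<noteq> a \<Longrightarrow> par v \<in> V \<and> R (par v) v \<and> d v = Suc (d (par v))"
    and lip: "\<And>v w. v \<in> V \<Longrightarrow> w \<in> V \<Longrightarrow> R w v \<Longrightarrow> d v \<le> Suc (d w)"
    using distance_exists[OF V(1) aV(1)] by blast
  have "V - {b} \<subseteq> par ` (V - {a})"
  proof
    fix x assume x: "x \<in> V - {b}"
    show "x \<in> par ` (V - {a})"
    proof (cases "x = a")
      case False
      show ?thesis
      proof (rule ccontr)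
        assume "\<not> ?thesis"
        then have "x \<in> noncut R V"
          using non_parent_noncut[where R = R and V = V and u = a and par = par and d = d and x = x] sym aV(1) par x False
          by blast
        then show False using x ab False by blast
      qed
    next
      case True
      obtain v where v: "v \<in> V - {a}" "\<forall>w\<in>V - {a}. d v \<le> d w"
        using arg_min_nat_lemma[of "\<lambda>v. v \<in> V - {a}" b d] aV ab by blast
      have p: "par v \<in> V" "d v = Suc (d (par v))" using par v by auto
      have "par v \<notin> V - {a}"
      proof
        assume "par v \<in> V - {a}"
        then have "d v \<le> d (par v)" using v(2) by blast
        then show False using p(2) by simp
      qed
      then have "par v = a" using p(1) by blast
      then show ?thesis using True v by blast
    qed
  qed
  moreover have "card (V - {b}) = card (V - {a})" using V aV by simp
  ultimately have inj: "inj_on par (V - {a})"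
    using V by (metis card_image_le card_mono eq_card_imp_inj_on finite_Diff finite_imageI le_antisym)
  have im: "par ` (V - {a}) = V - {b}"
  proof -
    have "card (par ` (V - {a})) = card (V - {b})" using card_image[OF inj] V aV by simp
    then show ?thesis using \<open>V - {b} \<subseteq> _\<close> V by (metis card_subset_eq finite_Diff finite_imageI)
  qed
  have d_inj: "\<forall>x\<in>V. \<forall>y\<in>V. d x = n \<longrightarrow> d y = n \<longrightarrow> x = y" for n
  proof (induction n)
    case 0
    then show ?case using par by (metis nat.distinct(1))
  next
    case (Suc n)
    show ?case
    proof (intro ballI impI)
      fix x y assume xy: "x \<in> V" "y \<in> V" "d x = Suc n" "d y = Suc n"
      then have ne: "x \<noteq> a" "y \<noteq> a" using d by auto
      have "par x = par y" using Suc par[OF xy(1) ne(1)] par[OF xy(2) ne(2)] xy by simp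
      then show "x = y" using inj ne xy by (simp add: inj_on_def)
    qed
  qed
  then have injd: "inj_on d V" by (auto intro!: inj_onI)
  have down: "n \<in> d ` V" if "m \<in> d ` V" "n \<le> m" for n m
    using that
  proof (induction "m - n" arbitrary: m)
    case (Suc k)
    obtain x where x: "x \<in> V" "m = d x" using Suc by auto
    have "x \<noteq> a" using Suc x d by auto
    then have p: "par x \<in> V" "d x = Suc (d (par x))" using par x by auto
    have "n \<in> d ` V"
    proof (rule Suc.hyps(1)[of "d (par x)"])
      show "k = d (par x) - n" "d (par x) \<in> d ` V" "n \<le> d (par x)" using Suc.hyps(2) p x Suc.prems by auto
    qed
    then show ?case .
  qed simp
  have imd: "d ` V = {..<card V}"
  proof -
    have fin: "finite (d ` V)" "d ` V \<noteq> {}" using V aV by auto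
    have eq: "d ` V = {..Max (d ` V)}" using down Max_in[OF fin] Max_ge[OF fin(1)] by auto
    then have "card (d ` V) = Suc (Max (d ` V))" by (metis card_atMost)
    then have "Suc (Max (d ` V)) = card V" using card_image[OF injd] by simp
    then show ?thesis using eq by (metis lessThan_Suc_atMost)
  qed
  have consec: "R x y" if "x \<in> V" "y \<in> V" "d y = Suc (d x)" for x y
  proof -
    have "y \<noteq> a" using that d by auto
    then have "par y \<in> V" "R (par y) y" "d (par y) = d x" using par that by auto
    then show ?thesis using d_inj that by blast
  qed
  have db: "Suc (d b) = card V"
  proof (rule ccontr)
    assume "Suc (d b) \<noteq> card V"
    moreover have "d b < card V" using imd aV by auto
    ultimately have "Suc (d b) \<in> d ` V" using imd by auto
    then obtain y where y: "y \<in> V" "d y = Suc (d b)" by auto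
    have "y \<noteq> a" using y d by auto
    then have "par y \<in> V" "d (par y) = d b" using par y by auto
    then have "par y = b" using d_inj aV by blast
    then show False using im y \<open>y \<noteq> a\<close> by blast
  qed
  have "noncut R V = {x\<in>V. d x = 0 \<or> Suc (d x) = card V}"
    unfolding ab
  proof (intro antisym subsetI)
    fix x assume "x \<in> {x\<in>V. d x = 0 \<or> Suc (d x) = card V}"
    then have "x \<in> V" "d x = d a \<or> d x = d b" using d db by auto
    then show "x \<in> {a, b}" using d_inj aV by blast
  qed (use aV d db in auto)
  moreover have "d x = Suc (d y) \<or> d y = Suc (d x)" if xy: "x \<in> V" "y \<in> V" "R x y" "x \<noteq> y" for x y
  proof -
    have "d x \<noteq> d y" using d_inj xy by blast
    moreover have "d y \<le> Suc (d x)" "d x \<le> Suc (d y)" using lip xy sym by blast+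
    ultimately show ?thesis by linarith
  qed
  ultimately show ?thesis using injd imd consec unfolding bij_betw_def by blast
qed

section \<open>Hata graphs of the iterated systems\<close>

locale skeleton_ifs = ifs_attractor +
  fixes A :: "'a set"
  assumes skel: "skeleton N S K A"
begin

lemma A: "finite A" "A \<subseteq> K" "A \<subseteq> (\<Union>j\<in>{1..N}. S j ` A)"
  using skel by (auto simp: skeleton_def)

definition meets :: "nat list \<Rightarrow> nat list \<Rightarrow> bool" where
  "meets I J \<longleftrightarrow> word_map S I ` A \<inter> word_map S J ` A \<noteq> {}"

definition covers :: "nat list set \<Rightarrow> bool" where
  "covers V \<longleftrightarrow> A \<subseteq> (\<Union>I\<in>V. word_map S I ` A)"

abbreviation "connected_cells V \<equiv> cut_connected meets V"

lemma meets_sym: "meets I J \<Longrightarrow> meets J I" by (auto simp: meets_def)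

lemma meetsI: "x \<in> word_map S I ` A \<Longrightarrow> x \<in> word_map S J ` A \<Longrightarrow> meets I J" by (auto simp: meets_def)

lemma meets_append: "meets I J \<Longrightarrow> meets (L @ I) (L @ J)"
  by (auto simp: meets_def word_map_append)

lemma letters_connected: "cut_connected (\<lambda>i j. meets [i] [j]) {1..N}"
  unfolding cut_connected_def
proof (intro conjI allI impI)
  show "{1..N} \<noteq> {}" using N_ge_2 by auto
  fix U assume U: "U \<subset> {1..N}" "U \<noteq> {}"
  define G where "G = with_proj (hata_graph N S A)"
  have "connected G" using skel by (simp add: skeleton_def G_def)
  then have sc: "strongly_connected (with_proj (mk_symmetric G))" by (simp add: connected_def)
  have verts: "verts (with_proj (mk_symmetric G)) = {1..N}" by (simp add: mk_symmetric_def G_def hata_graph_def)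
  obtain u v where uv: "u \<in> U" "v \<in> {1..N} - U" using U by blast
  show "\<exists>x\<in>U. \<exists>y\<in>{1..N} - U. meets [x] [y]"
  proof (rule ccontr)
    assume no: "\<not> ?thesis"
    have "u \<rightarrow>\<^sup>*\<^bsub>with_proj (mk_symmetric G)\<^esub> v" using sc uv U verts by (auto simp: strongly_connected_def)
    then have "v \<in> U"
      unfolding reachable_def
    proof (induction rule: rtrancl_on_induct)
      case base then show ?case using uv by simp
    next
      case (step y z)
      then have "(y, z) \<in> parcs (hata_graph N S A) \<or> (z, y) \<in> parcs (hata_graph N S A)"
        by (auto simp: mk_symmetric_def G_def arcs_ends_def arc_to_ends_def)
      then have "meets [y] [z]" "z \<in> {1..N}" by (auto simp: hata_graph_def meets_def)
      then show ?case using step no by blast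
    qed
    then show False using uv by blast
  qed
qed

lemma words_1: "words N (Suc 0) = (\<lambda>i. [i]) ` {1..N}" by (auto simp: words_Suc)

lemma covers_product:
  assumes "covers V" "\<And>J. J \<in> V \<Longrightarrow> covers (W J)"
  shows "covers (\<Union>J\<in>V. (@) J ` W J)"
  unfolding covers_def
proof
  fix a assume "a \<in> A"
  then obtain J b where J: "J \<in> V" "b \<in> A" "a = word_map S J b" using assms(1) by (auto simp: covers_def)
  then obtain I c where I: "I \<in> W J" "c \<in> A" "b = word_map S I c" using assms(2)[OF J(1)] by (auto simp: covers_def)
  have "a \<in> word_map S (J @ I) ` A" using J I by (auto simp: word_map_append)
  then show "a \<in> (\<Union>I\<in>\<Union>J\<in>V. (@) J ` W J. word_map S I ` A)" using J I by blast
qed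

text \<open>A cut that divides a block \<open>J\<close> is crossed inside this block. Any other cut separates blocks
  and is crossed at a point where two blocks meet. This point is the image of points of \<open>A\<close>, which
  lie in cells of the two blocks because the blocks cover \<open>A\<close>.\<close>

lemma connected_product:
  assumes V: "connected_cells V" and W: "\<And>J. J \<in> V \<Longrightarrow> connected_cells (W J) \<and> covers (W J)"
  shows "connected_cells (\<Union>J\<in>V. (@) J ` W J)"
  unfolding cut_connected_def
proof (intro conjI allI impI)
  let ?X = "\<Union>J\<in>V. (@) J ` W J"
  show "?X \<noteq> {}" using V W by (auto simp: cut_connected_def)
  fix U assume U: "U \<subset> ?X" "U \<noteq> {}"
  have blocks: "connected_cells ((@) J ` W J)" if "J \<in> V" for J
    using W[OF that] meets_append by (blast intro: cut_connected_image)
  show "\<exists>x\<in>U. \<exists>y\<in>?X - U. meets x y"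
  proof (cases "\<exists>J\<in>V. U \<inter> (@) J ` W J \<noteq> {} \<and> U \<inter> (@) J ` W J \<noteq> (@) J ` W J")
    case True
    then obtain J where J: "J \<in> V" "U \<inter> (@) J ` W J \<noteq> {}" "U \<inter> (@) J ` W J \<noteq> (@) J ` W J" by blast
    from cut_connectedD[OF blocks[OF J(1)] _ J(3,2)] show ?thesis using J(1) by blast
  next
    case False
    define U0 where "U0 = {J\<in>V. U \<inter> (@) J ` W J = (@) J ` W J}"
    have out: "U \<inter> (@) J ` W J = {}" if "J \<in> V - U0" for J using False that by (auto simp: U0_def)
    have ne: "(@) J ` W J \<noteq> {}" if "J \<in> V" for J using W[OF that] by (auto simp: cut_connected_def)
    have "U0 \<noteq> {}"
    proof
      assume "U0 = {}"
      then have "U \<inter> ?X = {}" using out by blast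
      then show False using U by blast
    qed
    moreover have "U0 \<noteq> V"
    proof
      assume "U0 = V"
      then have "?X \<subseteq> U" by (auto simp: U0_def)
      then show False using U by blast
    qed
    moreover have "U0 \<subseteq> V" by (auto simp: U0_def)
    ultimately obtain J J' where J: "J \<in> U0" "J' \<in> V - U0" "meets J J'" using cut_connectedD[OF V] by blast
    then obtain a b where ab: "a \<in> A" "b \<in> A" "word_map S J a = word_map S J' b" by (auto simp: meets_def)
    have JV: "J \<in> V" "J' \<in> V" using J by (auto simp: U0_def)
    obtain I c where I: "I \<in> W J" "c \<in> A" "a = word_map S I c" using W[OF JV(1)] ab by (auto simp: covers_def)
    obtain I' c' where I': "I' \<in> W J'" "c' \<in> A" "b = word_map S I' c'" using W[OF JV(2)] ab by (auto simp: covers_def)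
    have "meets (J @ I) (J' @ I')"
    proof (rule meetsI)
      show "word_map S J a \<in> word_map S (J @ I) ` A" using I by (auto simp: word_map_append)
      show "word_map S J a \<in> word_map S (J' @ I') ` A" unfolding ab(3) using I' by (auto simp: word_map_append)
    qed
    moreover have "J @ I \<in> U" using J(1) I(1) by (auto simp: U0_def)
    moreover have "J' @ I' \<in> ?X - U" using out[OF J(2)] I'(1) JV(2) by blast
    ultimately show ?thesis by blast
  qed
qed

lemma words_product: "words N (k + n) = (\<Union>J\<in>words N k. (@) J ` words N n)"
  unfolding words_append by auto

lemma words_connected_covers: "connected_cells (words N n) \<and> covers (words N n)"
proof (induction n)
  case 0 then show ?case by (auto simp: cut_connected_singleton covers_def)
next
  case (Suc n)
  have "connected_cells (words N (Suc 0))"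
    unfolding words_1 by (rule cut_connected_image[OF letters_connected])
  moreover have "covers (words N (Suc 0))" using A(3) by (simp add: covers_def words_1)
  moreover have "words N (Suc n) = (\<Union>J\<in>words N (Suc 0). (@) J ` words N n)"
    using words_product[of "Suc 0" n] by simp
  ultimately show ?case
    using Suc connected_product[of "words N (Suc 0)" "\<lambda>_. words N n"] covers_product[of "words N (Suc 0)" "\<lambda>_. words N n"]
    by simp
qed

lemma card_words: "card (words N n) = N ^ n"
proof (induction n)
  case (Suc n)
  have "card (words N (Suc n)) = (\<Sum>i=1..N. card ((#) i ` words N n))"
    unfolding words_Suc by (rule card_UN_disjoint) auto
  then show ?case using Suc by (simp add: card_image)
qed simp

lemma card_words_ge_2: "1 \<le> n \<Longrightarrow> 2 \<le> card (words N n)"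
  using N_ge_2 self_le_power[of N n] unfolding card_words by simp

text \<open>A tour through all points of the skeleton can be built without a removable cell, which is
  then free to be inserted as a complete loop in one place.\<close>

definition removable :: "nat \<Rightarrow> nat list \<Rightarrow> bool" where
  "removable n I \<longleftrightarrow> I \<in> words N n \<and> connected_cells (words N n - {I}) \<and> covers (words N n - {I})"

lemma removable_deeper:
  assumes I: "removable n I" and J: "J \<in> words N k"
  shows "removable (k + n) (J @ I)"
proof -
  define W where "W L = (if L = J then words N n - {I} else words N n)" for L
  have "words N (k + n) - {J @ I} = (\<Union>L\<in>words N k. (@) L ` W L)"
  proof (intro antisym subsetI)
    fix x assume x: "x \<in> words N (k + n) - {J @ I}"
    then obtain L M where "L \<in> words N k" "M \<in> words N n" "x = L @ M" unfolding words_product by blast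
    moreover from this have "M \<in> W L" using x by (auto simp: W_def)
    ultimately show "x \<in> (\<Union>L\<in>words N k. (@) L ` W L)" by blast
  next
    fix x assume "x \<in> (\<Union>L\<in>words N k. (@) L ` W L)"
    then obtain L M where LM: "L \<in> words N k" "M \<in> W L" "x = L @ M" by blast
    then have "M \<in> words N n" by (auto simp: W_def split: if_splits)
    moreover have "x \<noteq> J @ I" using LM J by (auto simp: W_def words_def split: if_splits)
    ultimately show "x \<in> words N (k + n) - {J @ I}" using LM unfolding words_product by blast
  qed
  moreover have "connected_cells (W L) \<and> covers (W L)" if "L \<in> words N k" for L
    using I words_connected_covers by (auto simp: W_def removable_def)
  ultimately show ?thesis
    using words_connected_covers[of k] I J connected_product[of "words N k" W] covers_product[of "words N k" W]
    by (auto simp: removable_def words_product)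
qed

text \<open>Owning a point is what can prevent a cell whose removal leaves the others connected from
  being removable.\<close>

definition owns :: "nat \<Rightarrow> nat list \<Rightarrow> 'a \<Rightarrow> bool" where
  "owns n I a \<longleftrightarrow> a \<in> A \<and> (\<forall>J\<in>words N n - {I}. a \<notin> word_map S J ` A)"

lemma owns_mem: "owns n I a \<Longrightarrow> a \<in> word_map S I ` A"
  using words_connected_covers[of n] by (fastforce simp: owns_def covers_def)

lemma owns_unique: "I \<in> words N n \<Longrightarrow> owns n I a \<Longrightarrow> owns n J a \<Longrightarrow> I = J"
  using owns_mem[of n I a] by (auto simp: owns_def)

abbreviation "leaves n \<equiv> noncut meets (words N n)"

lemma finite_leaves: "finite (leaves n)" by (simp add: noncut_def)

text \<open>The contact of \<open>J\<close> and \<open>J'\<close> at the image of \<open>c\<close> survives the removal of \<open>J @ I\<close>, because \<open>c\<close>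
  belongs to some other cell \<open>I'\<close> as well.\<close>

lemma cells_meet_after_removal:
  assumes "c \<in> A" "word_map S J c \<in> word_map S J' ` A" "\<not> owns n I c"
  obtains I' I'' where "I' \<in> words N n - {I}" "I'' \<in> words N n" "meets (J' @ I'') (J @ I')"
proof -
  obtain I' where I': "I' \<in> words N n - {I}" "c \<in> word_map S I' ` A" using assms by (auto simp: owns_def)
  obtain b where b: "b \<in> A" "word_map S J c = word_map S J' b" using assms(2) by blast
  obtain I'' where I'': "I'' \<in> words N n" "b \<in> word_map S I'' ` A"
    using words_connected_covers[of n] b(1) by (fastforce simp: covers_def)
  have "meets (J' @ I'') (J @ I')"
  proof (rule meetsI)
    show "word_map S J c \<in> word_map S (J @ I') ` A" using I'(2) by (auto simp: word_map_append)
    show "word_map S J c \<in> word_map S (J' @ I'') ` A" unfolding b(2) using I''(2) by (auto simp: word_map_append)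
  qed
  then show ?thesis using that I'(1) I''(1) by blast
qed

lemma noncut_deeper:
  assumes J: "J \<in> leaves k" and I: "I \<in> words N n" "connected_cells (words N n - {I})"
    and c: "c \<in> A" "J' \<in> words N k - {J}" "word_map S J c \<in> word_map S J' ` A" "\<not> owns n I c"
  shows "J @ I \<in> leaves (k + n)"
proof -
  let ?X = "\<Union>L\<in>words N k - {J}. (@) L ` words N n"
  let ?Y = "(@) J ` (words N n - {I})"
  have Jw: "J \<in> words N k" "connected_cells (words N k - {J})" using J by (auto simp: noncut_def)
  have X: "connected_cells ?X" using Jw words_connected_covers by (intro connected_product) auto
  have Y: "connected_cells ?Y" by (rule cut_connected_image[OF I(2)]) (rule meets_append)
  obtain I' I'' where I': "I' \<in> words N n - {I}" "I'' \<in> words N n" and m: "meets (J' @ I'') (J @ I')"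
    using cells_meet_after_removal[OF c(1,3,4)] .
  have "connected_cells (?X \<union> ?Y)"
    by (rule cut_connected_Un[OF meets_sym X Y _ _ m]) (use c(2) I' in auto)
  moreover have "words N (k + n) - {J @ I} = ?X \<union> ?Y"
  proof (intro antisym subsetI)
    fix x assume x: "x \<in> words N (k + n) - {J @ I}"
    then obtain L M where "L \<in> words N k" "M \<in> words N n" "x = L @ M" unfolding words_product by blast
    then show "x \<in> ?X \<union> ?Y" using x by (cases "L = J") auto
  next
    fix x assume "x \<in> ?X \<union> ?Y"
    then obtain L M where LM: "L \<in> words N k" "M \<in> words N n" "x = L @ M" "L \<noteq> J \<or> M \<noteq> I" using Jw(1) by blast
    then have "x \<noteq> J @ I" using Jw(1) by (auto simp: words_def)
    then show "x \<in> words N (k + n) - {J @ I}" using LM unfolding words_product by blast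
  qed
  moreover have "J @ I \<in> words N (k + n)" using Jw(1) I(1) by (simp add: words_def)
  ultimately show ?thesis by (simp add: noncut_def)
qed

lemma contact_exists:
  assumes "J \<in> words N k" "1 \<le> k"
  shows "\<exists>c\<in>A. \<exists>J'\<in>words N k - {J}. word_map S J c \<in> word_map S J' ` A"
proof -
  have "{J} \<noteq> words N k"
  proof
    assume "{J} = words N k"
    from arg_cong[OF this, of card] show False using card_words_ge_2[OF assms(2)] by simp
  qed
  then obtain x y where "x \<in> {J}" "y \<in> words N k - {J}" "meets x y"
    using cut_connectedD[of meets "words N k" "{J}"] words_connected_covers assms(1) by blast
  then show ?thesis unfolding meets_def by blast
qed

lemma card_leaves_ge_2: "1 \<le> n \<Longrightarrow> 2 \<le> card (leaves n)"
  by (rule card_noncut_ge_2[OF meets_sym]) (use words_connected_covers card_words_ge_2 in auto)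

text \<open>For every leaf \<open>J\<close> of level \<open>k\<close> fix a point \<open>f J\<close> at which it touches another cell. At most
  one leaf of level \<open>n\<close> owns this point, and \<open>J @ I\<close> is a leaf for every other leaf \<open>I\<close>.\<close>

lemma card_leaves_mult: assumes k: "1 \<le> k" "1 \<le> n" shows "card (leaves k) * (card (leaves n) - 1) \<le> card (leaves (k + n))"
proof -
  obtain f J' where f: "\<And>J. J \<in> leaves k \<Longrightarrow> f J \<in> A \<and> J' J \<in> words N k - {J} \<and> word_map S J (f J) \<in> word_map S (J' J) ` A"
    using contact_exists[OF _ k(1)] unfolding noncut_def by (metis (no_types, lifting) mem_Collect_eq)
  define G where "G J = {I\<in>leaves n. \<not> owns n I (f J)}" for J
  have Gc: "card (leaves n) - 1 \<le> card (G J)" for J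
  proof (cases "\<exists>I0\<in>leaves n. owns n I0 (f J)")
    case True
    then obtain I0 where I0: "I0 \<in> leaves n" "owns n I0 (f J)" by blast
    have "leaves n - {I0} \<subseteq> G J" using owns_unique I0 by (auto simp: G_def noncut_def)
    moreover have "finite (G J)" using finite_leaves by (simp add: G_def)
    ultimately have "card (leaves n - {I0}) \<le> card (G J)" by (rule card_mono[rotated])
    then show ?thesis using I0(1) by (simp add: card_Diff_singleton)
  next
    case False
    then have "G J = leaves n" by (auto simp: G_def)
    then show ?thesis by simp
  qed
  have sub: "(\<Union>J\<in>leaves k. (@) J ` G J) \<subseteq> leaves (k + n)"
  proof clarify
    fix J I assume J: "J \<in> leaves k" "I \<in> G J"
    then have "I \<in> words N n" "connected_cells (words N n - {I})" "\<not> owns n I (f J)" by (auto simp: G_def noncut_def)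
    then show "J @ I \<in> leaves (k + n)" using noncut_deeper[OF J(1), of I n "f J" "J' J"] f[OF J(1)] by blast
  qed
  have "card (leaves k) * (card (leaves n) - 1) \<le> (\<Sum>J\<in>leaves k. card (G J))"
    using Gc sum_mono[of "leaves k" "\<lambda>_. card (leaves n) - 1" "\<lambda>J. card (G J)"] by simp
  also have "\<dots> = (\<Sum>J\<in>leaves k. card ((@) J ` G J))" by (simp add: card_image inj_on_def)
  also have "\<dots> = card (\<Union>J\<in>leaves k. (@) J ` G J)"
  proof (rule card_UN_disjoint[symmetric])
    show "\<forall>J\<in>leaves k. \<forall>L\<in>leaves k. J \<noteq> L \<longrightarrow> (@) J ` G J \<inter> (@) L ` G L = {}"
      by (auto simp: noncut_def words_def)
  qed (auto simp: finite_leaves G_def)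
  also have "\<dots> \<le> card (leaves (k + n))" using sub finite_leaves by (intro card_mono)
  finally show ?thesis .
qed

lemma leaves_owns: assumes "\<not> removable n I" "I \<in> leaves n" shows "\<exists>a. owns n I a"
  using assms by (auto simp: removable_def noncut_def covers_def owns_def)

lemma card_leaves_le:
  assumes "\<And>I. \<not> removable n I" shows "card (leaves n) \<le> card A"
proof -
  obtain f where f: "\<And>I. I \<in> leaves n \<Longrightarrow> owns n I (f I)" using leaves_owns assms by metis
  have "inj_on f (leaves n)" using owns_unique f by (intro inj_onI) (metis (no_types, lifting) mem_Collect_eq noncut_def)
  moreover have "f ` leaves n \<subseteq> A" using f by (auto simp: owns_def)
  ultimately show ?thesis using A(1) by (rule card_inj_on_le)
qed

text \<open>Three leaves give at least twice as many at the double level, and so on, without bound.\<close>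

lemma card_leaves_eq_2:
  assumes NR: "\<And>n I. 1 \<le> n \<Longrightarrow> \<not> removable n I" and n: "1 \<le> n"
  shows "card (leaves n) = 2"
proof (rule ccontr)
  assume "card (leaves n) \<noteq> 2"
  then have 3: "3 \<le> card (leaves n)" using card_leaves_ge_2[OF n] by simp
  have "\<exists>k\<ge>1. 2 ^ i * 3 \<le> card (leaves k)" for i :: nat
  proof (induction i)
    case 0 then show ?case using 3 n by auto
  next
    case (Suc i)
    then obtain k where k: "1 \<le> k" "2 ^ i * 3 \<le> card (leaves k)" by blast
    have "1 \<le> (2::nat) ^ i" by simp
    then have "2 \<le> card (leaves k) - 1" using k(2) by linarith
    then have "2 ^ i * 3 * 2 \<le> card (leaves k) * (card (leaves k) - 1)" using k by (intro mult_mono) auto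
    also have "\<dots> \<le> card (leaves (k + k))" using k by (intro card_leaves_mult)
    finally show ?case using k(1) by (intro exI[of _ "k + k"]) (auto simp: mult.commute mult.left_commute)
  qed
  from this[of "card A"] obtain k where k: "1 \<le> k" "2 ^ card A * 3 \<le> card (leaves k)" by blast
  have "card A < 2 ^ card A" by (rule less_exp)
  then show False using k card_leaves_le[OF NR[OF k(1)]] by linarith
qed

lemma small_cells_exist:
  assumes "0 < \<epsilon>"
  shows "\<exists>n0. \<forall>n\<ge>n0. \<forall>I\<in>words N n. \<forall>x\<in>word_map S I ` K. \<forall>y\<in>word_map S I ` K. dist x y < \<epsilon>"
proof -
  obtain n0 where n0: "\<And>n. n0 \<le> n \<Longrightarrow> max_ratio ^ n * diameter K < \<epsilon>" using max_ratio_power_less[OF assms] by blast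
  have "dist x y < \<epsilon>" if n: "n0 \<le> n" "I \<in> words N n" and xy: "x \<in> word_map S I ` K" "y \<in> word_map S I ` K" for n I x y
  proof -
    have I: "set I \<subseteq> {1..N}" "length I = n" using n by (auto simp: words_def)
    obtain a b where ab: "a \<in> K" "b \<in> K" "x = word_map S I a" "y = word_map S I b" using xy by blast
    have "dist a b \<le> diameter K" using ab compact_imp_bounded[OF K(1)] by (intro diameter_bounded_bound)
    then have "dist x y \<le> max_ratio ^ n * diameter K"
      unfolding ab(3,4) dist_word_map[OF I(1)] using wratio_le_power[OF I(1)] I(2) max_ratio by (intro mult_mono) auto
    then show ?thesis using n0[OF n(1)] by simp
  qed
  then show ?thesis by blast
qed

lemma separated_points: "\<exists>\<epsilon>>0. \<forall>a\<in>A. \<forall>b\<in>A. a \<noteq> b \<longrightarrow> \<epsilon> \<le> dist a b"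
proof -
  define D where "D = (\<lambda>(a, b). dist a b) ` {p \<in> A \<times> A. fst p \<noteq> snd p}"
  have D: "finite D" "\<And>x. x \<in> D \<Longrightarrow> 0 < x" using A(1) by (auto simp: D_def)
  have "dist a b \<in> D" if "a \<in> A" "b \<in> A" "a \<noteq> b" for a b using that by (force simp: D_def)
  then have *: "Min (insert 1 D) \<le> dist a b" if "a \<in> A" "b \<in> A" "a \<noteq> b" for a b using that D(1) by simp
  have "0 < Min (insert 1 D)" using D by auto
  then show ?thesis using * by blast
qed

text \<open>The points of \<open>A\<close> have a positive minimal distance, and the cells of deep levels are
  smaller.\<close>

lemma leaf_levels:
  assumes NR: "\<And>n I. 1 \<le> n \<Longrightarrow> \<not> removable n I"
  obtains n I1 I2 e f where "1 \<le> n" "leaves n = {I1, I2}" "I1 \<noteq> I2" "e \<noteq> f" "owns n I1 e" "owns n I2 f"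
    "\<And>I a b. I \<in> words N n \<Longrightarrow> a \<in> A \<inter> word_map S I ` K \<Longrightarrow> b \<in> A \<inter> word_map S I ` K \<Longrightarrow> a = b"
proof -
  obtain \<epsilon> where \<epsilon>: "0 < \<epsilon>" "\<And>a b. a \<in> A \<Longrightarrow> b \<in> A \<Longrightarrow> a \<noteq> b \<Longrightarrow> \<epsilon> \<le> dist a b" using separated_points by blast
  obtain n0 where n0: "\<And>n I x y. n0 \<le> n \<Longrightarrow> I \<in> words N n \<Longrightarrow> x \<in> word_map S I ` K \<Longrightarrow> y \<in> word_map S I ` K \<Longrightarrow> dist x y < \<epsilon>"
    using small_cells_exist[OF \<epsilon>(1)] by blast
  define n where "n = max 1 n0"
  have n: "1 \<le> n" "n0 \<le> n" by (auto simp: n_def)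
  have one: "a = b" if I: "I \<in> words N n" "a \<in> A \<inter> word_map S I ` K" "b \<in> A \<inter> word_map S I ` K" for I a b
    using n0[OF n(2) I(1), of a b] \<epsilon>(2)[of a b] I by fastforce
  obtain I1 I2 where I: "leaves n = {I1, I2}" "I1 \<noteq> I2" using card_leaves_eq_2[OF NR n(1)] by (auto simp: card_2_iff)
  obtain e f where ef: "owns n I1 e" "owns n I2 f" using leaves_owns[OF NR[OF n(1)]] I by (metis insertCI)
  have "I1 \<in> words N n" using I by (auto simp: noncut_def)
  then have "e \<noteq> f" using owns_unique[of I1 n e I2] ef I(2) by blast
  then show ?thesis using that n(1) I ef one by blast
qed

end

section \<open>Systems without removable cells are zippers\<close>

context skeleton_ifs
begin

text \<open>Choose a level \<open>n\<close> at which every cell contains at most one point of \<open>A\<close>. Its two leaves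
  \<open>I1\<close> and \<open>I2\<close> own points \<open>e\<close> and \<open>f\<close>. The cells of level \<open>1\<close> form a path, and level \<open>1 + n\<close> has
  only two leaves, one in each end of the path. If some cell \<open>i\<close> touched its neighbours at other
  points than the images of \<open>e\<close> and \<open>f\<close>, then removing \<open>[i] @ I1\<close> or \<open>[i] @ I2\<close> would leave the
  other cells connected, which would give additional leaves. Hence an inner cell touches one
  neighbour in the image of \<open>e\<close> and the other one in the image of \<open>f\<close>, and an end cell touches its
  neighbour in one of them. The other one of the two images is then an end of the zipper. Grouping
  the words of length \<open>1 + n\<close> by their first \<open>n\<close> letters instead of the first one shows that it is
  \<open>e\<close> or \<open>f\<close> itself.\<close>

lemma zipper_of_no_removable:
  assumes NR: "\<And>n I. 1 \<le> n \<Longrightarrow> \<not> removable n I"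
  shows "\<exists>\<sigma>. \<sigma> permutes {1..N} \<and> self_similar_zipper N (\<lambda>j. S (\<sigma> j))"
proof -
  obtain n I1 I2 e f where n: "1 \<le> n" and leaves_n: "leaves n = {I1, I2}" "I1 \<noteq> I2" and ef: "e \<noteq> f" "owns n I1 e" "owns n I2 f"
    and small: "\<And>I a b. I \<in> words N n \<Longrightarrow> a \<in> A \<inter> word_map S I ` K \<Longrightarrow> b \<in> A \<inter> word_map S I ` K \<Longrightarrow> a = b"
    using leaf_levels[OF NR] by blast
  define P where "P = {(I1, e), (I2, f)}"
  have Pw: "I \<in> words N n" "connected_cells (words N n - {I})" "owns n I g" "I \<in> leaves n" if "(I, g) \<in> P" for I g
    using that leaves_n ef by (auto simp: P_def noncut_def)
  have in_cell: "a = g" if "(I, g) \<in> P" "a \<in> A" "a \<in> word_map S I ` K" for I g a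
  proof -
    have "g \<in> A" "g \<in> word_map S I ` K" using owns_mem[OF Pw(3)[OF that(1)]] Pw(3)[OF that(1)] A(2) by (auto simp: owns_def)
    then show ?thesis using small[OF Pw(1)[OF that(1)], of a g] that by blast
  qed
  \<comment> \<open>So a subcell \<open>[i] @ I\<close> can only be indispensable for the contacts of \<open>i\<close> at the image of
    \<open>g\<close>.\<close>
  have not_own: "\<not> owns n I c" if "(I, g) \<in> P" "c \<noteq> g" for I g c
    using in_cell[OF that(1), of c] that(2) owns_mem[of n I c] A(2) by (auto simp: owns_def)
  let ?L = "leaves (Suc 0 + n)"
  have cardL: "card ?L = 2" using card_leaves_eq_2[OF NR, of "Suc 0 + n"] by simp
  have card1: "card (words N (Suc 0)) = N" by (simp add: card_words)
  obtain d0 where d0: "bij_betw d0 (words N (Suc 0)) {..<N}"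
      "\<And>x y. x \<in> words N (Suc 0) \<Longrightarrow> y \<in> words N (Suc 0) \<Longrightarrow> meets x y \<Longrightarrow> x \<noteq> y \<Longrightarrow> d0 x = Suc (d0 y) \<or> d0 y = Suc (d0 x)"
      "\<And>x y. x \<in> words N (Suc 0) \<Longrightarrow> y \<in> words N (Suc 0) \<Longrightarrow> d0 y = Suc (d0 x) \<Longrightarrow> meets x y"
      "leaves (Suc 0) = {x\<in>words N (Suc 0). d0 x = 0 \<or> Suc (d0 x) = N}"
    using path_order[where R = meets and V = "words N (Suc 0)", OF meets_sym] words_connected_covers[of "Suc 0"] card_leaves_eq_2[OF NR, of "Suc 0"]
      card_words_ge_2[of "Suc 0"] unfolding card1 by auto
  define d where "d i = d0 [i]" for i
  have w1: "[i] \<in> words N (Suc 0) \<longleftrightarrow> i \<in> {1..N}" for i by (auto simp: words_1)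
  have inj_d: "inj_on d {1..N}"
    using d0(1) w1 unfolding bij_betw_def inj_on_def d_def by blast
  have im_d: "d ` {1..N} = {..<N}"
    using d0(1) unfolding bij_betw_def words_1 image_image d_def by simp
  have adj: "d i = Suc (d j) \<or> d j = Suc (d i)" if "i \<in> {1..N}" "j \<in> {1..N}" "meets [i] [j]" "i \<noteq> j" for i j
    using d0(2)[of "[i]" "[j]"] that w1 unfolding d_def by blast
  have consec: "meets [i] [j]" if "i \<in> {1..N}" "j \<in> {1..N}" "d j = Suc (d i)" for i j
    using d0(3)[of "[i]" "[j]"] that w1 unfolding d_def by blast
  have leaf1: "[i] \<in> leaves (Suc 0) \<longleftrightarrow> i \<in> {1..N} \<and> (d i = 0 \<or> Suc (d i) = N)" for i
    unfolding d0(4) d_def using w1 by blast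
  have ex_d: "\<exists>i\<in>{1..N}. d i = k" if "k < N" for k using im_d that by (metis imageE lessThan_iff)
  have d_less: "d i < N" if "i \<in> {1..N}" for i using im_d that by blast
  obtain i0 iN where i0: "i0 \<in> {1..N}" "d i0 = 0" and iN: "iN \<in> {1..N}" "Suc (d iN) = N"
    using ex_d[of 0] ex_d[of "N - 1"] N_ge_2 by (metis Suc_diff_1 diff_less less_le_trans zero_less_numeral zero_less_one)
  have i0N: "i0 \<noteq> iN" using i0 iN N_ge_2 by auto
  \<comment> \<open>The points at which the cell \<open>i\<close> touches other cells, earlier cells and later cells of the
    path, pulled back to \<open>A\<close>.\<close>
  define C where "C i = {c\<in>A. \<exists>j\<in>{1..N} - {i}. S i c \<in> S j ` A}" for i
  define Cm where "Cm i = {c\<in>A. \<exists>j\<in>{1..N}. d j < d i \<and> S i c \<in> S j ` A}" for i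
  define Cp where "Cp i = {c\<in>A. \<exists>j\<in>{1..N}. d i < d j \<and> S i c \<in> S j ` A}" for i
  have C_split: "C i = Cm i \<union> Cp i" if i: "i \<in> {1..N}" for i
  proof -
    have "d j < d i \<or> d i < d j" if "j \<in> {1..N} - {i}" for j
      using inj_d i that unfolding inj_on_def by (metis DiffE insertI1 linorder_neqE_nat)
    then show ?thesis unfolding C_def Cm_def Cp_def by blast
  qed
  have Cm_ne: "Cm i \<noteq> {}" if i: "i \<in> {1..N}" "0 < d i" for i
  proof -
    have "d i - 1 < N" using d_less[OF i(1)] by simp
    then obtain j where j: "j \<in> {1..N}" "d j = d i - 1" using ex_d by blast
    then have "meets [j] [i]" using i by (intro consec) auto
    then obtain a b where "a \<in> A" "b \<in> A" "S j a = S i b" by (auto simp: meets_def)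
    then have "b \<in> Cm i" unfolding Cm_def using j i by (auto intro!: bexI[of _ j] image_eqI[of _ _ a])
    then show ?thesis by blast
  qed
  have Cp_ne: "Cp i \<noteq> {}" if i: "i \<in> {1..N}" "Suc (d i) < N" for i
  proof -
    obtain j where j: "j \<in> {1..N}" "d j = Suc (d i)" using ex_d[OF i(2)] by blast
    then have "meets [i] [j]" using i by (intro consec) auto
    then obtain a b where "a \<in> A" "b \<in> A" "S i a = S j b" by (auto simp: meets_def)
    then have "a \<in> Cp i" unfolding Cp_def using j i by (auto intro!: bexI[of _ j] image_eqI[of _ _ b])
    then show ?thesis by blast
  qed
  \<comment> \<open>For a cell at an end of the path, one contact away from \<open>g\<close> suffices, since the other cells
    are connected without it.\<close>
  have end_leaf: "[i] @ I \<in> ?L" if i: "[i] \<in> leaves (Suc 0)" and c: "c \<in> C i" and I: "(I, g) \<in> P" "c \<noteq> g" for i c I g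
  proof -
    obtain j where j: "j \<in> {1..N} - {i}" "S i c \<in> S j ` A" "c \<in> A" using c unfolding C_def by blast
    have jw: "[j] \<in> words N (Suc 0) - {[i]}" "word_map S [i] c \<in> word_map S [j] ` A" using j w1[of j] by simp_all
    show ?thesis by (rule noncut_deeper[OF i Pw(1,2)[OF I(1)] j(3) jw not_own[OF I]])
  qed
  have ends: "[i0] \<in> leaves (Suc 0)" "[iN] \<in> leaves (Suc 0)" using leaf1 i0 iN by auto
  have C_ne: "C i \<noteq> {}" if "i \<in> {1..N}" for i
  proof (cases "d i = 0")
    case True
    then show ?thesis using Cp_ne[OF that] C_split[OF that] N_ge_2 by auto
  next
    case False
    then show ?thesis using Cm_ne[OF that] C_split[OF that] by auto
  qed
  have some_leaf: "\<exists>I. [i] @ I \<in> ?L" if "[i] \<in> leaves (Suc 0)" for i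
  proof -
    have "C i \<noteq> {}" using C_ne leaf1 that by blast
    then obtain c where c: "c \<in> C i" by blast
    then show ?thesis using end_leaf[OF that c, of I1 e] end_leaf[OF that c, of I2 f] ef(1) by (auto simp: P_def)
  qed
  \<comment> \<open>Two leaves in one end and at least one in the other end would be three.\<close>
  have not_both: "\<not> ([i] @ I1 \<in> ?L \<and> [i] @ I2 \<in> ?L)" if i: "i = i0 \<or> i = iN" for i
  proof
    assume both: "[i] @ I1 \<in> ?L \<and> [i] @ I2 \<in> ?L"
    define i' where "i' = (if i = i0 then iN else i0)"
    have i': "[i'] \<in> leaves (Suc 0)" "i' \<noteq> i" using ends i i0N by (auto simp: i'_def)
    obtain I where "[i'] @ I \<in> ?L" using some_leaf[OF i'(1)] by blast
    then have "card {[i] @ I1, [i] @ I2, [i'] @ I} \<le> card ?L" using both finite_leaves by (intro card_mono) auto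
    then show False using cardL leaves_n(2) i'(2) by simp
  qed
  have end_contact: "\<exists>g g' I'. ((g, g') = (e, f) \<or> (g, g') = (f, e)) \<and> C i = {g} \<and> (I', g') \<in> P \<and> [i] @ I' \<in> ?L"
    if i: "i = i0 \<or> i = iN" for i
  proof -
    have il: "[i] \<in> leaves (Suc 0)" "i \<in> {1..N}" using ends i i0 iN by auto
    have c_ef: "c = e \<or> c = f" if "c \<in> C i" for c
      using end_leaf[OF il(1) that, of I1 e] end_leaf[OF il(1) that, of I2 f] not_both[OF i] by (auto simp: P_def)
    have not_ef: "\<not> (e \<in> C i \<and> f \<in> C i)"
      using end_leaf[OF il(1), of f I1 e] end_leaf[OF il(1), of e I2 f] not_both[OF i] ef(1) by (auto simp: P_def)
    have "C i = {e} \<or> C i = {f}" using C_ne[OF il(2)] c_ef not_ef by blast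
    then show ?thesis
    proof
      assume Ci: "C i = {e}"
      then have "[i] @ I2 \<in> ?L" using end_leaf[OF il(1), of e I2 f] ef(1) by (simp add: P_def)
      then show ?thesis using Ci by (intro exI[of _ e] exI[of _ f] exI[of _ I2]) (simp add: P_def)
    next
      assume Ci: "C i = {f}"
      then have "[i] @ I1 \<in> ?L" using end_leaf[OF il(1), of f I1 e] ef(1) by (simp add: P_def)
      then show ?thesis using Ci by (intro exI[of _ f] exI[of _ e] exI[of _ I1]) (simp add: P_def)
    qed
  qed
  obtain J0 JN where J0N: "[i0] @ J0 \<in> ?L" "[iN] @ JN \<in> ?L" using some_leaf ends by blast
  have L_eq: "?L = {[i0] @ J0, [iN] @ JN}"
  proof (rule card_subset_eq[symmetric])
    show "card {[i0] @ J0, [iN] @ JN} = card ?L" using cardL i0N by simp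
  qed (use finite_leaves J0N in auto)
  have left_conn: "connected_cells {[j] | j. j \<in> {1..N} \<and> d j < k}" if k: "0 < k" "k \<le> N" for k
  proof (rule cut_connected_parent[where u = "[i0]" and d = d0 and par = "\<lambda>x. [SOME j. j \<in> {1..N} \<and> d j = d0 x - 1]"])
    show "[i0] \<in> {[j] | j. j \<in> {1..N} \<and> d j < k}" using i0 k by auto
    fix v assume v: "v \<in> {[j] | j. j \<in> {1..N} \<and> d j < k}" "v \<noteq> [i0]"
    then obtain j where j: "v = [j]" "j \<in> {1..N}" "d j < k" by blast
    have "d j \<noteq> 0" using v j i0 inj_d unfolding inj_on_def by metis
    then have dj: "d j - 1 < N" "0 < d j" using j k by auto
    define l where "l = (SOME l. l \<in> {1..N} \<and> d l = d0 v - 1)"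
    have dv: "d0 v = d j" using j(1) by (simp add: d_def)
    then have "\<exists>l. l \<in> {1..N} \<and> d l = d0 v - 1" using ex_d[OF dj(1)] by auto
    from someI_ex[OF this, folded l_def] have l: "l \<in> {1..N}" "d l = d j - 1" using dv by auto
    have "meets [l] v" unfolding j(1) using l j dj by (intro consec) auto
    moreover have "d0 [l] < d0 v" using l(2) dj j(1) unfolding d_def by simp
    moreover have "[l] \<in> {[j] | j. j \<in> {1..N} \<and> d j < k}" using l j dj by auto
    ultimately show "[SOME j. j \<in> {1..N} \<and> d j = d0 v - 1] \<in> {[j] | j. j \<in> {1..N} \<and> d j < k} \<and>
        meets [SOME j. j \<in> {1..N} \<and> d j = d0 v - 1] v \<and> d0 [SOME j. j \<in> {1..N} \<and> d j = d0 v - 1] < d0 v"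
      unfolding l_def by blast
  qed (rule meets_sym)
  have right_conn: "connected_cells {[j] | j. j \<in> {1..N} \<and> k < d j}" if k: "Suc k < N" for k
  proof (rule cut_connected_parent[where u = "[iN]" and d = "\<lambda>x. N - d0 x" and par = "\<lambda>x. [SOME j. j \<in> {1..N} \<and> d j = Suc (d0 x)]"])
    show "[iN] \<in> {[j] | j. j \<in> {1..N} \<and> k < d j}" using iN k by auto
    fix v assume v: "v \<in> {[j] | j. j \<in> {1..N} \<and> k < d j}" "v \<noteq> [iN]"
    then obtain j where j: "v = [j]" "j \<in> {1..N}" "k < d j" by blast
    have "d j \<noteq> d iN" using v j iN inj_d unfolding inj_on_def by metis
    then have dj: "Suc (d j) < N" using d_less[OF j(2)] iN by linarith
    define l where "l = (SOME l. l \<in> {1..N} \<and> d l = Suc (d0 v))"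
    have dv: "d0 v = d j" using j(1) by (simp add: d_def)
    then have "\<exists>l. l \<in> {1..N} \<and> d l = Suc (d0 v)" using ex_d[OF dj] by auto
    from someI_ex[OF this, folded l_def] have l: "l \<in> {1..N}" "d l = Suc (d j)" using dv by auto
    have "meets v [l]" unfolding j(1) using l j by (intro consec) auto
    moreover have "N - d0 [l] < N - d0 v" using l(2) dj j(1) unfolding d_def by simp
    moreover have "[l] \<in> {[j] | j. j \<in> {1..N} \<and> k < d j}" using l j dj by auto
    ultimately show "[SOME j. j \<in> {1..N} \<and> d j = Suc (d0 v)] \<in> {[j] | j. j \<in> {1..N} \<and> k < d j} \<and>
        meets [SOME j. j \<in> {1..N} \<and> d j = Suc (d0 v)] v \<and> N - d0 [SOME j. j \<in> {1..N} \<and> d j = Suc (d0 v)] < N - d0 v"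
      unfolding l_def using meets_sym by blast
  qed (rule meets_sym)
  \<comment> \<open>With contacts away from \<open>g\<close> on both sides, \<open>[i] @ I\<close> would be a third leaf, in the interior
    of the path.\<close>
  have interior: "(\<forall>c\<in>Cm i. c = g) \<or> (\<forall>c\<in>Cp i. c = g)" if i: "i \<in> {1..N}" "0 < d i" "Suc (d i) < N" and I: "(I, g) \<in> P" for i I g
  proof (rule ccontr)
    assume "\<not> ?thesis"
    then obtain c c' where c: "c \<in> Cm i" "c \<noteq> g" and c': "c' \<in> Cp i" "c' \<noteq> g" by blast
    obtain j where j: "j \<in> {1..N}" "d j < d i" "S i c \<in> S j ` A" "c \<in> A" using c by (auto simp: Cm_def)
    obtain j' where j': "j' \<in> {1..N}" "d i < d j'" "S i c' \<in> S j' ` A" "c' \<in> A" using c' by (auto simp: Cp_def)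
    let ?B = "\<lambda>M. \<Union>J\<in>M. (@) J ` words N n"
    let ?X = "{[j] | j. j \<in> {1..N} \<and> d j < d i}" and ?Z = "{[j] | j. j \<in> {1..N} \<and> d i < d j}"
    let ?Y = "(@) [i] ` (words N n - {I})"
    have X: "connected_cells (?B ?X)" using left_conn[OF i(2)] d_less[OF i(1)] words_connected_covers by (intro connected_product) auto
    have Z: "connected_cells (?B ?Z)" using right_conn[OF i(3)] words_connected_covers by (intro connected_product) auto
    have Y: "connected_cells ?Y" by (rule cut_connected_image[OF Pw(2)[OF I]]) (rule meets_append)
    obtain M1 M2 where M: "M1 \<in> words N n - {I}" "M2 \<in> words N n" "meets ([j] @ M2) ([i] @ M1)"
      using cells_meet_after_removal[of c "[i]" "[j]" n I] j not_own[OF I c(2)] by auto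
    obtain M3 M4 where M': "M3 \<in> words N n - {I}" "M4 \<in> words N n" "meets ([j'] @ M4) ([i] @ M3)"
      using cells_meet_after_removal[of c' "[i]" "[j']" n I] j' not_own[OF I c'(2)] by auto
    have XY: "connected_cells (?B ?X \<union> ?Y)"
      by (rule cut_connected_Un[OF meets_sym X Y _ _ M(3)]) (use M j in blast)+
    have "connected_cells (?B ?Z \<union> (?B ?X \<union> ?Y))"
      by (rule cut_connected_Un[OF meets_sym Z XY _ _ M'(3)]) (use M' j' in blast)+
    moreover have "words N (Suc 0 + n) - {[i] @ I} = ?B ?Z \<union> (?B ?X \<union> ?Y)"
    proof (intro antisym subsetI)
      fix x assume x: "x \<in> words N (Suc 0 + n) - {[i] @ I}"
      then obtain l M where lM: "l \<in> {1..N}" "M \<in> words N n" "x = [l] @ M" unfolding words_product words_1 by blast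
      then have "l = i \<or> d l < d i \<or> d i < d l" using inj_d i(1) unfolding inj_on_def by (metis linorder_neqE_nat)
      then show "x \<in> ?B ?Z \<union> (?B ?X \<union> ?Y)" using x lM by blast
    next
      fix x assume "x \<in> ?B ?Z \<union> (?B ?X \<union> ?Y)"
      then obtain l M where lM: "l \<in> {1..N}" "M \<in> words N n" "x = [l] @ M" "l \<noteq> i \<or> M \<noteq> I" using i(1) by blast
      then have "x \<in> words N (Suc 0 + n)" unfolding words_product words_1 by blast
      then show "x \<in> words N (Suc 0 + n) - {[i] @ I}" using lM by simp
    qed
    moreover have "[i] @ I \<in> words N (Suc 0 + n)" using Pw(1)[OF I] i(1) unfolding words_product words_1 by blast
    ultimately have "[i] @ I \<in> ?L" by (simp add: noncut_def)
    then have "[i] @ I = [i0] @ J0 \<or> [i] @ I = [iN] @ JN" unfolding L_eq by blast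
    moreover have "i \<noteq> i0" "i \<noteq> iN" using i(2,3) i0(2) iN(2) by auto
    ultimately show False by simp
  qed
  have interior_contacts: "(Cm i = {e} \<and> Cp i = {f}) \<or> (Cm i = {f} \<and> Cp i = {e})"
    if i: "i \<in> {1..N}" "0 < d i" "Suc (d i) < N" for i
  proof -
    have "(I1, e) \<in> P" "(I2, f) \<in> P" by (auto simp: P_def)
    then have *: "(\<forall>c\<in>Cm i. c = g) \<or> (\<forall>c\<in>Cp i. c = g)" if "g = e \<or> g = f" for g
      using interior[OF i, of I1 e] interior[OF i, of I2 f] that by blast
    have ne: "Cm i \<noteq> {}" "Cp i \<noteq> {}" using Cm_ne[OF i(1,2)] Cp_ne[OF i(1,3)] .
    have sing: "X = {g}" if "X \<noteq> {}" "\<forall>c\<in>X. c = g" for X and g :: 'a using that by auto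
    have "Cm i = {g} \<or> Cp i = {g}" if "g = e \<or> g = f" for g
      using *[OF that] sing[OF ne(1)] sing[OF ne(2)] by blast
    from this[of e] this[of f] show ?thesis using ef(1) by auto
  qed
  \<comment> \<open>The same count with the factors exchanged: both leaves of level \<open>n\<close> are extended by a
    letter.\<close>
  have L_prefix: "\<exists>I g j. (I, g) \<in> P \<and> x = I @ [j]" if "x \<in> ?L" for x
  proof -
    have "\<exists>j. I @ [j] \<in> ?L" if I: "(I, g) \<in> P" for I g
    proof -
      obtain c J' where c: "c \<in> A" "J' \<in> words N n - {I}" "word_map S I c \<in> word_map S J' ` A"
        using contact_exists[OF Pw(1)[OF I] n] by blast
      have w: "[i0] \<in> words N (Suc 0)" "[iN] \<in> words N (Suc 0)" using w1 i0 iN by auto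
      have "\<not> owns (Suc 0) [i0] c \<or> \<not> owns (Suc 0) [iN] c" using owns_unique[OF w(1), of c "[iN]"] i0N by auto
      then obtain j where j: "[j] \<in> leaves (Suc 0)" "\<not> owns (Suc 0) [j] c" using ends by blast
      have "I @ [j] \<in> leaves (n + Suc 0)"
        using j(1) by (intro noncut_deeper[OF Pw(4)[OF I] _ _ c j(2)]) (auto simp: noncut_def)
      then show ?thesis by (auto simp: add.commute)
    qed
    from this[of I1 e] this[of I2 f] obtain j1 j2 where j: "I1 @ [j1] \<in> ?L" "I2 @ [j2] \<in> ?L" unfolding P_def by blast
    have "{I1 @ [j1], I2 @ [j2]} = ?L"
      by (rule card_subset_eq) (use finite_leaves j cardL leaves_n(2) in auto)
    then show ?thesis using that unfolding P_def by blast
  qed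
  \<comment> \<open>The point of \<open>A\<close> owned by the leaf \<open>[i] @ I'\<close> is \<open>S i g'\<close> by the first decomposition of the
    word, and it is \<open>e\<close> or \<open>f\<close> by the second one.\<close>
  have outer: "S i g' \<in> {e, f} \<and> owns (Suc 0 + n) ([i] @ I') (S i g')" if i: "i \<in> {1..N}" and I: "(I', g') \<in> P" "[i] @ I' \<in> ?L" for i I' g'
  proof -
    obtain p where p: "owns (Suc 0 + n) ([i] @ I') p" using leaves_owns[OF NR I(2)] by auto
    have pA: "p \<in> A" using p by (simp add: owns_def)
    obtain j a where ja: "j \<in> {1..N}" "a \<in> A" "p = S j a" using A(3) pA by blast
    obtain I'' where I'': "I'' \<in> words N n" "a \<in> word_map S I'' ` A"
      using words_connected_covers[of n] ja(2) by (fastforce simp: covers_def)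
    have "p \<in> word_map S ([j] @ I'') ` A" using I''(2) ja(3) by auto
    moreover have "[j] @ I'' \<in> words N (Suc 0 + n)" using I''(1) ja(1) unfolding words_product words_1 by blast
    ultimately have "[j] @ I'' = [i] @ I'" using p unfolding owns_def by blast
    then have "j = i" "a \<in> word_map S I' ` K" using I''(2) A(2) by auto
    then have pS: "p = S i g'" using in_cell[OF I(1) ja(2)] ja(3) by simp
    obtain I g l where l: "(I, g) \<in> P" "[i] @ I' = I @ [l]" using L_prefix[OF I(2)] by blast
    have "p \<in> word_map S (I @ [l]) ` A" using owns_mem[OF p] unfolding l(2) .
    moreover have "set [l] \<subseteq> {1..N}"
    proof -
      have "set ([i] @ I') \<subseteq> {1..N}" using i Pw(1)[OF I(1)] by (simp add: words_def)
      then show ?thesis unfolding l(2) by simp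
    qed
    ultimately have "p \<in> word_map S I ` K" using word_map_K_subset[of "[l]"] A(2) by (fastforce simp: word_map_append)
    then have "p = g" using in_cell[OF l(1) pA] by simp
    then show ?thesis using pS p l(1) by (auto simp: P_def)
  qed
  obtain g0 g0' I0' where E0: "(g0, g0') = (e, f) \<or> (g0, g0') = (f, e)" "C i0 = {g0}" "(I0', g0') \<in> P" "[i0] @ I0' \<in> ?L"
    using end_contact[of i0] by blast
  obtain gN gN' IN' where EN: "(gN, gN') = (e, f) \<or> (gN, gN') = (f, e)" "C iN = {gN}" "(IN', gN') \<in> P" "[iN] @ IN' \<in> ?L"
    using end_contact[of iN] by blast
  define p0 where "p0 = S i0 g0'"
  define pN where "pN = S iN gN'"
  have o0: "p0 \<in> {e, f}" "owns (Suc 0 + n) ([i0] @ I0') p0" using outer[OF i0(1) E0(3,4)] by (auto simp: p0_def)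
  have oN: "pN \<in> {e, f}" "owns (Suc 0 + n) ([iN] @ IN') pN" using outer[OF iN(1) EN(3,4)] by (auto simp: pN_def)
  have pne: "p0 \<noteq> pN"
    using owns_unique[of "[i0] @ I0'" "Suc 0 + n" p0 "[iN] @ IN'"] o0 oN i0N E0(4) by (auto simp: noncut_def)
  \<comment> \<open>\<open>lo\<close> and \<open>hi\<close> are the points at which the cell is entered from the previous one and left
    towards the next one.\<close>
  define ends where "ends i lo hi \<longleftrightarrow> ((lo, hi) = (p0, pN) \<or> (lo, hi) = (pN, p0)) \<and> (0 < d i \<longrightarrow> Cm i = {lo}) \<and>
      (d i = 0 \<longrightarrow> S i lo = p0) \<and> (Suc (d i) < N \<longrightarrow> Cp i = {hi}) \<and> (Suc (d i) = N \<longrightarrow> S i hi = pN)" for i lo hi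
  have "\<exists>lo hi. ends i lo hi" if i: "i \<in> {1..N}" for i
  proof -
    have pp: "(lo, hi) = (p0, pN) \<or> (lo, hi) = (pN, p0)" if "(lo, hi) = (e, f) \<or> (lo, hi) = (f, e)" for lo hi
      using that o0(1) oN(1) pne by auto
    consider "d i = 0" | "Suc (d i) = N" "0 < d i" | "0 < d i" "Suc (d i) < N" using d_less[OF i] by linarith
    then show ?thesis
    proof cases
      case 1
      then have "i = i0" using inj_d i i0 unfolding inj_on_def by metis
      have "Cm i = {}" using 1 by (simp add: Cm_def)
      then have "Cp i = {g0}" using C_split[OF i] E0(2) \<open>i = i0\<close> by simp
      moreover have "(g0', g0) = (p0, pN) \<or> (g0', g0) = (pN, p0)" by (rule pp) (use E0(1) in blast)
      moreover have "S i g0' = p0" by (simp add: p0_def \<open>i = i0\<close>)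
      moreover have "Suc (d i) \<noteq> N" using 1 N_ge_2 by simp
      ultimately show ?thesis unfolding ends_def using 1 by - (rule exI[of _ g0'], rule exI[of _ g0], simp)
    next
      case 2
      then have "i = iN" using inj_d i iN unfolding inj_on_def by (metis Suc_inject)
      have "Cp i = {}" using 2(1) d_less by (fastforce simp: Cp_def)
      then have "Cm i = {gN}" using C_split[OF i] EN(2) \<open>i = iN\<close> by simp
      moreover have "(gN, gN') = (p0, pN) \<or> (gN, gN') = (pN, p0)" by (rule pp) (use EN(1) in blast)
      moreover have "S i gN' = pN" by (simp add: pN_def \<open>i = iN\<close>)
      ultimately show ?thesis unfolding ends_def using 2 by - (rule exI[of _ gN], rule exI[of _ gN'], simp)
    next
      case 3
      have "(e, f) = (p0, pN) \<or> (e, f) = (pN, p0)" by (rule pp) simp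
      moreover have "(f, e) = (p0, pN) \<or> (f, e) = (pN, p0)" by (rule pp) simp
      moreover have "d i \<noteq> 0" "Suc (d i) \<noteq> N" using 3 by auto
      ultimately show ?thesis unfolding ends_def using interior_contacts[OF i 3] by (elim disjE conjE) fastforce+
    qed
  qed
  then obtain lo hi where "\<forall>i\<in>{1..N}. ends i (lo i) (hi i)" by metis
  note ends = bspec[OF this, unfolded ends_def]
  have lh: "(lo i, hi i) = (p0, pN) \<or> (lo i, hi i) = (pN, p0)" if "i \<in> {1..N}" for i using ends[OF that] by blast
  have Cm: "Cm i = {lo i}" if "i \<in> {1..N}" "0 < d i" for i using ends[OF that(1)] that(2) by blast
  have lo0: "S i (lo i) = p0" if "i \<in> {1..N}" "d i = 0" for i using ends[OF that(1)] that(2) by blast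
  have Cp: "Cp i = {hi i}" if "i \<in> {1..N}" "Suc (d i) < N" for i using ends[OF that(1)] that(2) by blast
  have hiN: "S i (hi i) = pN" if "i \<in> {1..N}" "Suc (d i) = N" for i using ends[OF that(1)] that(2) by blast
  define \<sigma> where "\<sigma> j = (if j \<in> {1..N} then inv_into {1..N} d (j - 1) else j)" for j
  have \<sigma>: "\<sigma> j \<in> {1..N}" "d (\<sigma> j) = j - 1" if "j \<in> {1..N}" for j
  proof -
    have "j - 1 \<in> d ` {1..N}" unfolding im_d using that by auto
    then show "\<sigma> j \<in> {1..N}" "d (\<sigma> j) = j - 1"
      using that inv_into_into[of "j - 1" d "{1..N}"] f_inv_into_f[of "j - 1" d "{1..N}"] by (auto simp: \<sigma>_def)
  qed
  have "\<sigma> permutes {1..N}"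
  proof (rule bij_imp_permutes)
    have "inj_on \<sigma> {1..N}"
    proof (rule inj_onI)
      fix x y assume "x \<in> {1..N}" "y \<in> {1..N}" "\<sigma> x = \<sigma> y"
      then show "x = y" using \<sigma>(2)[of x] \<sigma>(2)[of y] by auto
    qed
    moreover have "\<sigma> ` {1..N} \<subseteq> {1..N}" using \<sigma>(1) by blast
    ultimately show "bij_betw \<sigma> {1..N} {1..N}" by (simp add: bij_betw_def endo_inj_surj)
    show "\<sigma> x = x" if "x \<notin> {1..N}" for x unfolding \<sigma>_def using that by (rule if_not_P)
  qed
  moreover have "self_similar_zipper N (\<lambda>j. S (\<sigma> j))"
  proof -
    define x where "x j = (if j = 0 then p0 else S (\<sigma> j) (hi (\<sigma> j)))" for j
    have N1: "1 \<in> {1..N}" "N \<in> {1..N}" using N_ge_2 by auto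
    have xN: "x N = pN" using hiN[OF \<sigma>(1)[OF N1(2)]] \<sigma>(2)[OF N1(2)] N_ge_2 by (simp add: x_def)
    have lo: "S (\<sigma> j) (lo (\<sigma> j)) = x (j - 1)" if j: "j \<in> {1..N}" for j
    proof (cases "j = 1")
      case True
      then show ?thesis using lo0[OF \<sigma>(1)[OF j]] \<sigma>(2)[OF j] by (simp add: x_def)
    next
      case False
      define k where "k = j - 1"
      have k: "k \<in> {1..N}" "j = Suc k" "k \<noteq> 0" using j False by (auto simp: k_def)
      have "Suc (d (\<sigma> k)) < N" using \<sigma>(2)[OF k(1)] k j by simp
      then have "hi (\<sigma> k) \<in> Cp (\<sigma> k)" using Cp[OF \<sigma>(1)[OF k(1)]] by simp
      then obtain l b where l: "l \<in> {1..N}" "d (\<sigma> k) < d l" "b \<in> A" "S (\<sigma> k) (hi (\<sigma> k)) = S l b" "hi (\<sigma> k) \<in> A"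
        by (auto simp: Cp_def)
      have "meets [\<sigma> k] [l]" using l by (auto simp: meets_def)
      then have "d l = Suc (d (\<sigma> k))" using adj[OF \<sigma>(1)[OF k(1)] l(1)] l(2) by auto
      then have "d l = d (\<sigma> j)" using \<sigma>(2)[OF k(1)] \<sigma>(2)[OF j] k by simp
      then have "l = \<sigma> j" using inj_d l(1) \<sigma>(1)[OF j] unfolding inj_on_def by blast
      have "b \<in> Cm (\<sigma> j)"
        unfolding Cm_def using l \<open>l = \<sigma> j\<close> \<sigma>(1)[OF k(1)] by (auto intro!: bexI[of _ "\<sigma> k"] image_eqI[of _ _ "hi (\<sigma> k)"])
      moreover have "0 < d (\<sigma> j)" using \<sigma>(2)[OF j] k by simp
      ultimately have "b = lo (\<sigma> j)" using Cm[OF \<sigma>(1)[OF j]] by simp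
      then have "S (\<sigma> j) (lo (\<sigma> j)) = S (\<sigma> k) (hi (\<sigma> k))" using l(4) unfolding \<open>l = \<sigma> j\<close> by (metis)
      also have "\<dots> = x (j - 1)" unfolding x_def k_def[symmetric] using k(3) by (rule if_not_P[symmetric])
      finally show ?thesis .
    qed
    have hi: "S (\<sigma> j) (hi (\<sigma> j)) = x j" if "j \<in> {1..N}" for j using that by (simp add: x_def)
    define \<beta> :: "nat \<Rightarrow> int" where "\<beta> j = (if lo (\<sigma> j) = p0 then 1 else -1)" for j
    have x0: "x 0 = p0" by (simp add: x_def)
    show ?thesis unfolding self_similar_zipper_def
    proof (intro exI[of _ x] exI[of _ \<beta>] ballI)
      fix j assume j: "j \<in> {1..N}"
      show "\<beta> j \<in> {- 1, 1} \<and>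
         (\<beta> j = 1 \<longrightarrow> S (\<sigma> j) (x 0) = x (j - 1) \<and> S (\<sigma> j) (x N) = x j) \<and>
         (\<beta> j = - 1 \<longrightarrow> S (\<sigma> j) (x 0) = x j \<and> S (\<sigma> j) (x N) = x (j - 1))"
        using lh[OF \<sigma>(1)[OF j]] lo[OF j] hi[OF j] pne unfolding x0 xN \<beta>_def by auto
    qed
  qed
  ultimately show ?thesis by blast
qed

end

context contracting_ifs
begin

section \<open>Splitting a cell at two vertices\<close>

definition fwd_cycle :: "nat \<Rightarrow> nat \<Rightarrow> fedge list" where
  "fwd_cycle m p = map (\<lambda>i. Fwd ((p + i) mod m)) [0..<m]"

definition fwd_arc :: "nat \<Rightarrow> nat \<Rightarrow> nat \<Rightarrow> fedge list" where
  "fwd_arc m p k = map (\<lambda>i. Fwd ((p + i) mod m)) [0..<k]"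

definition place :: "nat list \<Rightarrow> fedge list \<Rightarrow> (fedge \<times> nat list) list" where
  "place I es = map (\<lambda>e. (e, I)) es"

lemma walk_fwd_arc:
  assumes "length as = m" "0 < m"
  shows "walk as (word_map S I (as ! (p mod m))) (place I (fwd_arc m p k)) (word_map S I (as ! ((p + k) mod m)))"
proof (induction k)
  case 0 then show ?case by (simp add: fwd_arc_def place_def)
next
  case (Suc k)
  have "place I (fwd_arc m p (Suc k)) = place I (fwd_arc m p k) @ [(Fwd ((p + k) mod m), I)]"
    by (simp add: fwd_arc_def place_def)
  then show ?case using Suc assms by (auto simp: walk_append src_def dst_def terminus_def mod_Suc_eq)
qed

lemma fwd_arc_append: "k \<le> m \<Longrightarrow> fwd_arc m p k @ fwd_arc m ((p + k) mod m) (m - k) = fwd_cycle m p"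
proof -
  assume k: "k \<le> m"
  have "[0..<m] = [0..<k] @ map (\<lambda>i. i + k) [0..<m - k]"
    using k by (metis add.commute le_add_diff_inverse2 map_add_upt upt_add_eq_append zero_le)
  then have "fwd_cycle m p = fwd_arc m p k @ map (\<lambda>i. Fwd ((p + (i + k)) mod m)) [0..<m - k]"
    by (simp add: fwd_cycle_def fwd_arc_def)
  also have "map (\<lambda>i. Fwd ((p + (i + k)) mod m)) [0..<m - k] = fwd_arc m ((p + k) mod m) (m - k)"
    unfolding fwd_arc_def by (rule map_cong[OF refl]) (simp add: mod_simps add.assoc add.commute add.left_commute)
  finally show ?thesis by simp
qed

lemma fwd_cycle_props:
  assumes "0 < m"
  shows "distinct (fwd_cycle m p)" "set (fwd_cycle m p) = Fwd ` {..<m}"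
proof -
  have inj: "inj_on (\<lambda>i. (p + i) mod m) {0..<m}"
  proof (rule inj_onI)
    fix i j assume ij: "i \<in> {0..<m}" "j \<in> {0..<m}" "(p + i) mod m = (p + j) mod m"
    have "i = j" if "i \<le> j" "j < m" "(p + i) mod m = (p + j) mod m" for i j
    proof -
      have "m dvd (p + j) - (p + i)" using that by (metis add_le_cancel_left mod_eq_dvd_iff_nat)
      then show ?thesis using that by (cases "j - i = 0") (auto dest: dvd_imp_le)
    qed
    then show "i = j" using ij by (metis atLeastLessThan_iff linear)
  qed
  have "inj_on (\<lambda>i. Fwd ((p + i) mod m)) {0..<m}" 
  proof (rule inj_onI)
    fix x y assume xy: "x \<in> {0..<m}" "y \<in> {0..<m}" "Fwd ((p + x) mod m) = Fwd ((p + y) mod m)"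
    from xy(3) have "(p + x) mod m = (p + y) mod m" by (rule fedge.inject(1)[THEN iffD1])
    then show "x = y" using inj_onD[OF inj] xy(1,2) by blast
  qed
  then show "distinct (fwd_cycle m p)" by (simp add: fwd_cycle_def distinct_map)
  have "(\<lambda>i. (p + i) mod m) ` {0..<m} = {..<m}"
  proof (rule card_subset_eq)
    show "(\<lambda>i. (p + i) mod m) ` {0..<m} \<subseteq> {..<m}" using assms by auto
    show "card ((\<lambda>i. (p + i) mod m) ` {0..<m}) = card {..<m}" using card_image[OF inj] by simp
  qed simp
  then have "Fwd ` (\<lambda>i. (p + i) mod m) ` {0..<m} = Fwd ` {..<m}" by simp
  then show "set (fwd_cycle m p) = Fwd ` {..<m}" unfolding image_image by (simp add: fwd_cycle_def)
qed

definition hits :: "nat \<Rightarrow> (fedge \<times> nat list) list \<Rightarrow> bool" where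
  "hits l p \<longleftrightarrow> (\<exists>I. (Fwd l, I) \<in> set p \<or> (Bwd l, I) \<in> set p)"

lemma hits_append [simp]: "hits l (p @ q) \<longleftrightarrow> hits l p \<or> hits l q" by (auto simp: hits_def)
lemma hits_Nil [simp]: "\<not> hits l []" by (simp add: hits_def)
lemma hits_rev_arc: "hits l (map rev_arc (rev p)) \<longleftrightarrow> hits l p"
proof -
  have "hits l (map rev_arc (rev p))" if "hits l p" for p using that by (force simp: hits_def rev_arc_def)
  from this[of p] this[of "map rev_arc (rev p)"] show ?thesis by (auto simp: rev_map comp_def)
qed

text \<open>The two vertices divide the cycle of the cell into two arcs. Reversing the orientation of
  the cell exchanges the arc from \<open>x\<close> to \<open>y\<close> with the one from \<open>y\<close> to \<open>x\<close>; so the edge \<open>l\<close>, in one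
  of its two directions, can be put on the way out or on the way back.\<close>

lemma cell_split:
  assumes as: "distinct as" "l < length as" and xy: "x \<in> word_map S I ` set as" "y \<in> word_map S I ` set as" "x \<noteq> y"
  obtains b \<alpha> \<gamma> where "b \<in> {-1, 1}" "walk as x \<alpha> y" "walk as y \<gamma> x" "distinct (\<alpha> @ \<gamma>)"
    "set (\<alpha> @ \<gamma>) = cell_edges as b I" "length \<alpha> \<le> length as" "length \<gamma> \<le> length as"
    "if want then hits l \<alpha> else hits l \<gamma>"
proof -
  define m where "m = length as"
  have m: "0 < m" using as by (auto simp: m_def)
  obtain p q where pq: "p < m" "q < m" "x = word_map S I (as ! p)" "y = word_map S I (as ! q)"
    using xy by (auto simp: in_set_conv_nth m_def)
  have "p \<noteq> q" using xy(3) pq by auto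
  define k where "k = (if p < q then q - p else q + m - p)"
  have k: "0 < k" "k < m" "(p + k) mod m = q" using pq \<open>p \<noteq> q\<close> by (auto simp: k_def)
  have wrap: "(q + (m - k)) mod m = p" using pq k \<open>p \<noteq> q\<close> by (auto simp: k_def split: if_splits)
  define \<alpha> where "\<alpha> = place I (fwd_arc m p k)"
  define \<gamma> where "\<gamma> = place I (fwd_arc m q (m - k))"
  have w: "walk as x \<alpha> y" "walk as y \<gamma> x"
    using walk_fwd_arc[of as m I p k] walk_fwd_arc[of as m I q "m - k"] m k wrap pq by (simp_all add: m_def \<alpha>_def \<gamma>_def)
  have "\<alpha> @ \<gamma> = place I (fwd_cycle m p)"
    using fwd_arc_append[of k m p] k by (simp add: \<alpha>_def \<gamma>_def place_def flip: map_append)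
  then have d: "distinct (\<alpha> @ \<gamma>)" and set: "set (\<alpha> @ \<gamma>) = (\<lambda>e. (e, I)) ` Fwd ` {..<m}"
    using fwd_cycle_props[OF m, of p] by (auto simp: place_def distinct_map inj_on_def)
  have len: "length \<alpha> \<le> m" "length \<gamma> \<le> m" using k by (auto simp: \<alpha>_def \<gamma>_def place_def fwd_arc_def)
  have fwd: "set (\<alpha> @ \<gamma>) = cell_edges as 1 I" unfolding set cell_edges_def set_Lambda_pow by (simp add: m_def)
  define \<alpha>' where "\<alpha>' = map rev_arc (rev \<gamma>)"
  define \<gamma>' where "\<gamma>' = map rev_arc (rev \<alpha>)"
  have w': "walk as x \<alpha>' y" "walk as y \<gamma>' x" using w walk_rev by (auto simp: \<alpha>'_def \<gamma>'_def)
  have app': "\<alpha>' @ \<gamma>' = map rev_arc (rev (\<alpha> @ \<gamma>))" by (simp add: \<alpha>'_def \<gamma>'_def)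
  have inj: "inj_on rev_arc X" for X by (rule inj_on_inverseI[of _ rev_arc]) simp
  have d': "distinct (\<alpha>' @ \<gamma>')" unfolding app' distinct_map distinct_rev using d inj by blast
  have bwd: "set (\<alpha>' @ \<gamma>') = cell_edges as (-1) I"
    unfolding app' set_map set_rev set cell_edges_def set_Lambda_pow by (simp add: image_image rev_arc_def m_def)
  have len': "length \<alpha>' \<le> m" "length \<gamma>' \<le> m" using len by (auto simp: \<alpha>'_def \<gamma>'_def)
  have "hits l (\<alpha> @ \<gamma>)" using as(2) unfolding hits_def set by (auto simp: m_def)
  then consider "hits l \<alpha>" | "hits l \<gamma>" by auto
  then show ?thesis
  proof cases
    case 1
    then have "hits l \<gamma>'" by (simp add: \<gamma>'_def hits_rev_arc)
    then show ?thesis using 1 that[of 1 \<alpha> \<gamma>] that[of "-1" \<alpha>' \<gamma>'] w w' d d' fwd bwd len len'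
      by (cases want) (auto simp: m_def)
  next
    case 2
    then have "hits l \<alpha>'" by (simp add: \<alpha>'_def hits_rev_arc)
    then show ?thesis using 2 that[of 1 \<alpha> \<gamma>] that[of "-1" \<alpha>' \<gamma>'] w w' d d' fwd bwd len len'
      by (cases want) (auto simp: m_def)
  qed
qed

lemma cell_loop:
  assumes as: "distinct as" "2 \<le> length as" and x: "x \<in> word_map S I ` set as" and I: "set I \<subseteq> {1..N}"
  obtains b L where "b \<in> {-1, 1}" "walk as x L x" "distinct L" "set L = cell_edges as b I"
proof -
  obtain a where a: "a \<in> set as" "x = word_map S I a" using x by blast
  have "card (set as) \<noteq> card {a}" using as distinct_card[OF as(1)] by simp
  then obtain c where c: "c \<in> set as" "c \<noteq> a" using a(1) by (metis insertI1 singletonD subsetI subset_antisym insertE subset_singletonD empty_iff)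
  have "x \<noteq> word_map S I c" using word_map_eq_iff[OF I] a c by auto
  moreover have "word_map S I c \<in> word_map S I ` set as" using c by blast
  moreover have "0 < length as" using as by linarith
  ultimately obtain b \<alpha> \<gamma> where "b \<in> {-1, 1}" "walk as x \<alpha> (word_map S I c)" "walk as (word_map S I c) \<gamma> x" "distinct (\<alpha> @ \<gamma>)"
    "set (\<alpha> @ \<gamma>) = cell_edges as b I" using cell_split[OF as(1) _ x, of 0 "word_map S I c" True] by metis
  then show ?thesis using that[of b "\<alpha> @ \<gamma>"] by (auto simp: walk_append)
qed

section \<open>Chains of cells, traversed out and back\<close>

text \<open>Every cell comes with the vertex at which it is left.\<close>

primrec chain :: "'a set \<Rightarrow> 'a \<Rightarrow> (nat list \<times> 'a) list \<Rightarrow> 'a \<Rightarrow> bool" where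
  "chain A x [] z \<longleftrightarrow> x = z"
| "chain A x (c # cs) z \<longleftrightarrow> x \<in> word_map S (fst c) ` A \<and> snd c \<in> word_map S (fst c) ` A \<and> x \<noteq> snd c \<and> chain A (snd c) cs z"

lemma chain_append: "chain A x (c @ d) z \<longleftrightarrow> (\<exists>y. chain A x c y \<and> chain A y d z)"
  by (induction c arbitrary: x) auto

text \<open>The gaps between occurrences of the edge \<open>l\<close> are bounded by \<open>B\<close>.\<close>

definition free_runs :: "nat \<Rightarrow> nat \<Rightarrow> (fedge \<times> nat list) list \<Rightarrow> bool" where
  "free_runs l B p \<longleftrightarrow> (\<forall>ys. sublist ys p \<longrightarrow> \<not> hits l ys \<longrightarrow> length ys \<le> B)"

text \<open>Every cell of the chain is split at the vertices where it is entered and left; one arc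
  serves on the way out, the other one on the way back. The edge \<open>l\<close> is put on the way out in
  every other cell and on the way back in the remaining ones, so that a gap extends over at most
  three arcs. The bounds for initial and final segments keep track of the parity in the
  induction.\<close>

lemma chain_loop:
  assumes as: "distinct as" "l < length as"
  shows "chain (set as) x c z \<Longrightarrow> distinct (map fst c) \<Longrightarrow>
    \<exists>L1 L2 \<beta>. walk as x L1 z \<and> walk as z L2 x \<and> distinct (L1 @ L2) \<and>
      set (L1 @ L2) = (\<Union>I\<in>fst ` set c. cell_edges as (\<beta> I) I) \<and> (\<forall>I. \<beta> I \<in> {-1, 1}) \<and>
      (c \<noteq> [] \<longrightarrow> hits l (L1 @ L2)) \<and>
      free_runs l (3 * length as) (L1 @ L2) \<and>
      (\<forall>ys. prefix ys (L1 @ L2) \<longrightarrow> \<not> hits l ys \<longrightarrow> length ys \<le> (if want then length as else 2 * length as)) \<and>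
      (\<forall>ys. suffix ys (L1 @ L2) \<longrightarrow> \<not> hits l ys \<longrightarrow> length ys \<le> (if want then 2 * length as else length as))"
proof (induction c arbitrary: x want)
  case Nil
  then show ?case by (intro exI[of _ "[]"] exI[of _ "\<lambda>_. 1"]) (simp add: free_runs_def)
next
  case (Cons c cs)
  define m where "m = length as"
  define I where "I = fst c"
  define y where "y = snd c"
  have c: "x \<in> word_map S I ` set as" "y \<in> word_map S I ` set as" "x \<noteq> y" "chain (set as) y cs z"
    using Cons.prems by (auto simp: I_def y_def)
  obtain b \<alpha> \<gamma> where b: "b \<in> {-1, 1}" and w: "walk as x \<alpha> y" "walk as y \<gamma> x" and d: "distinct (\<alpha> @ \<gamma>)"
    and set: "set (\<alpha> @ \<gamma>) = cell_edges as b I" and len: "length \<alpha> \<le> m" "length \<gamma> \<le> m"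
    and hit: "if want then hits l \<alpha> else hits l \<gamma>"
    using cell_split[OF as c(1-3), of want] unfolding m_def by metis
  have "distinct (map fst cs)" using Cons.prems by simp
  from Cons.IH[OF c(4) this, of "\<not> want"] obtain L1 L2 \<beta> where
    L: "walk as y L1 z" "walk as z L2 y" "distinct (L1 @ L2)" "set (L1 @ L2) = (\<Union>I\<in>fst ` set cs. cell_edges as (\<beta> I) I)"
      "\<forall>I. \<beta> I \<in> {-1, 1}" "cs \<noteq> [] \<longrightarrow> hits l (L1 @ L2)" and runs: "free_runs l (3 * m) (L1 @ L2)"
    and pre: "\<And>ys. prefix ys (L1 @ L2) \<Longrightarrow> \<not> hits l ys \<Longrightarrow> length ys \<le> (if want then 2 * m else m)"
    and suf: "\<And>ys. suffix ys (L1 @ L2) \<Longrightarrow> \<not> hits l ys \<Longrightarrow> length ys \<le> (if want then m else 2 * m)"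
    unfolding m_def by (auto split: if_splits)
  define L where "L = L1 @ L2"
  have emp: "L = []" if "\<not> hits l L"
  proof -
    have "cs = []" using that L(6) by (auto simp: L_def)
    then show ?thesis using L(4) by (simp add: L_def)
  qed
  note runs' = runs[folded L_def, unfolded free_runs_def] and pre' = pre[folded L_def] and suf' = suf[folded L_def]
  define \<beta>' where "\<beta>' = \<beta>(I := b)"
  have Inot: "I \<notin> fst ` set cs" using Cons.prems(2) by (simp add: I_def)
  have set': "set (\<alpha> @ L @ \<gamma>) = (\<Union>I\<in>fst ` set (c # cs). cell_edges as (\<beta>' I) I)"
  proof -
    have "(\<Union>J\<in>fst ` set cs. cell_edges as (\<beta>' J) J) = set L" unfolding L_def L(4) using Inot unfolding \<beta>'_def
      by (intro SUP_cong refl) auto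
    then show ?thesis using set by (auto simp: \<beta>'_def I_def)
  qed
  have disj: "set (\<alpha> @ \<gamma>) \<inter> set L = {}" unfolding L_def L(4) set using Inot by (auto simp: cell_edges_def)
  have prefix_bound: "length ys \<le> (if want then m else 2 * m)" if ys: "prefix ys (\<alpha> @ L @ \<gamma>)" "\<not> hits l ys" for ys
  proof -
    consider "prefix ys \<alpha>" | us where "ys = \<alpha> @ us" "prefix us L" | us where "ys = \<alpha> @ L @ us" "prefix us \<gamma>"
      using ys(1) by (auto simp: prefix_append)
    then show ?thesis
    proof cases
      case 1 then show ?thesis using prefix_length_le[OF 1] len by auto
    next
      case 2 then show ?thesis using ys(2) hit pre'[OF 2(2)] len by (auto split: if_splits)
    next
      case 3
      then have "L = []" using emp ys(2) by auto
      then show ?thesis using 3 ys(2) hit prefix_length_le[OF 3(2)] len by (auto split: if_splits)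
    qed
  qed
  have suffix_bound: "length ys \<le> (if want then 2 * m else m)" if ys: "suffix ys (\<alpha> @ L @ \<gamma>)" "\<not> hits l ys" for ys
  proof -
    consider "suffix ys \<gamma>" | us where "ys = us @ \<gamma>" "suffix us L" | us where "ys = us @ L @ \<gamma>" "suffix us \<alpha>"
      using ys(1) by (auto simp: suffix_append)
    then show ?thesis
    proof cases
      case 1 then show ?thesis using suffix_length_le[OF 1] len by auto
    next
      case 2 then show ?thesis using ys(2) hit suf'[OF 2(2)] len by (auto split: if_splits)
    next
      case 3
      then have "L = []" using emp ys(2) by auto
      then show ?thesis using 3 ys(2) hit suffix_length_le[OF 3(2)] len by (auto split: if_splits)
    qed
  qed
  have sublist_bound: "length ys \<le> 3 * m" if ys: "sublist ys (\<alpha> @ L @ \<gamma>)" "\<not> hits l ys" for ys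
  proof -
    consider "prefix ys (\<alpha> @ L @ \<gamma>)" | "suffix ys (\<alpha> @ L @ \<gamma>)" | "sublist ys \<alpha>" | "sublist ys L" | "sublist ys \<gamma>"
      | s p where "ys = s @ p" "suffix s \<alpha>" "prefix p L" | s p where "ys = s @ p" "suffix s L" "prefix p \<gamma>"
      | s p where "ys = s @ L @ p" "suffix s \<alpha>" "prefix p \<gamma>"
      using ys(1) unfolding sublist_append prefix_append by blast
    then show ?thesis
    proof cases
      case 1 then show ?thesis using prefix_bound ys(2) by (fastforce split: if_splits)
    next
      case 2 then show ?thesis using suffix_bound ys(2) by (fastforce split: if_splits)
    next
      case 3 then show ?thesis using sublist_length_le[OF 3] len by linarith
    next
      case 4 then show ?thesis using runs' ys(2) by blast
    next
      case 5 then show ?thesis using sublist_length_le[OF 5] len by linarith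
    next
      case 6 then show ?thesis using pre'[OF 6(3)] suffix_length_le[OF 6(2)] ys(2) len by (auto split: if_splits)
    next
      case 7 then show ?thesis using suf'[OF 7(2)] prefix_length_le[OF 7(3)] ys(2) len by (auto split: if_splits)
    next
      case 8
      then have "L = []" using emp ys(2) by auto
      then show ?thesis using 8 suffix_length_le[OF 8(2)] prefix_length_le[OF 8(3)] len by auto
    qed
  qed
  show ?case
  proof (rule exI[of _ "\<alpha> @ L1"], rule exI[of _ "L2 @ \<gamma>"], rule exI[of _ \<beta>'], intro conjI)
    have app: "(\<alpha> @ L1) @ L2 @ \<gamma> = \<alpha> @ L @ \<gamma>" by (simp add: L_def)
    show "walk as x (\<alpha> @ L1) z" using w L by (auto simp: walk_append)
    show "walk as z (L2 @ \<gamma>) x" using w L by (auto simp: walk_append)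
    show "distinct ((\<alpha> @ L1) @ L2 @ \<gamma>)" unfolding app using d disj L(3)[folded L_def] by auto
    show "set ((\<alpha> @ L1) @ L2 @ \<gamma>) = (\<Union>I\<in>fst ` set (c # cs). cell_edges as (\<beta>' I) I)" unfolding app by (rule set')
    show "\<forall>I. \<beta>' I \<in> {-1, 1}" using L(5) b by (simp add: \<beta>'_def)
    show "c # cs \<noteq> [] \<longrightarrow> hits l ((\<alpha> @ L1) @ L2 @ \<gamma>)" using hit by (auto split: if_splits)
    show "free_runs l (3 * length as) ((\<alpha> @ L1) @ L2 @ \<gamma>)" unfolding app free_runs_def using sublist_bound by (simp add: m_def)
    show "\<forall>ys. prefix ys ((\<alpha> @ L1) @ L2 @ \<gamma>) \<longrightarrow> \<not> hits l ys \<longrightarrow> length ys \<le> (if want then length as else 2 * length as)"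
      unfolding app m_def[symmetric] using prefix_bound by blast
    show "\<forall>ys. suffix ys ((\<alpha> @ L1) @ L2 @ \<gamma>) \<longrightarrow> \<not> hits l ys \<longrightarrow> length ys \<le> (if want then 2 * length as else length as)"
      unfolding app m_def[symmetric] using suffix_bound by blast
  qed
qed

text \<open>A segment without \<open>l\<close> that contains the whole of \<open>L\<close> consists of \<open>L\<close> and a segment of
  \<open>T1 @ T2\<close>.\<close>

lemma free_runs_insert:
  assumes "free_runs l B (T1 @ T2)" "free_runs l B' L"
  shows "free_runs l (B + B') (T1 @ L @ T2)"
  unfolding free_runs_def
proof (intro allI impI)
  fix ys assume ys: "sublist ys (T1 @ L @ T2)" "\<not> hits l ys"
  have T: "\<And>ys. sublist ys (T1 @ T2) \<Longrightarrow> \<not> hits l ys \<Longrightarrow> length ys \<le> B"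
    and L: "\<And>ys. sublist ys L \<Longrightarrow> \<not> hits l ys \<Longrightarrow> length ys \<le> B'"
    using assms unfolding free_runs_def by blast+
  consider "sublist ys T1" | "sublist ys L" | "sublist ys T2"
    | s p where "ys = s @ p" "suffix s L" "prefix p T2" | s p where "ys = s @ p" "suffix s T1" "prefix p L"
    | s p where "ys = s @ L @ p" "suffix s T1" "prefix p T2"
    using ys(1) unfolding sublist_append prefix_append by blast
  then show "length ys \<le> B + B'"
  proof cases
    case 1 then show ?thesis using T[of ys] ys(2) by (simp add: sublist_append)
  next
    case 2 then show ?thesis using L[of ys] ys(2) by simp
  next
    case 3 then show ?thesis using T[of ys] ys(2) by (simp add: sublist_append)
  next
    case 4
    have "sublist p (T1 @ T2)" using 4(3) by (simp add: sublist_append prefix_imp_sublist)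
    then show ?thesis using T[of p] L[of s] 4 ys(2) by (simp add: suffix_imp_sublist)
  next
    case 5
    have "sublist s (T1 @ T2)" using 5(2) by (simp add: sublist_append suffix_imp_sublist)
    then show ?thesis using T[of s] L[of p] 5 ys(2) by (simp add: prefix_imp_sublist)
  next
    case 6
    have "sublist (s @ p) (T1 @ T2)" using 6(2,3) unfolding sublist_append by blast
    then show ?thesis using T[of "s @ p"] L[of L] 6 ys(2) by simp
  qed
qed

section \<open>Cutting a closed walk at marked vertices\<close>

text \<open>Every marked vertex becomes a cut at its first visit.\<close>

lemma walk_cut:
  assumes "walk as x T z" "x \<in> D" "finite D" "D \<subseteq> insert x (dst as ` set T)"
  shows "\<exists>qs Ps. distinct qs \<and> set qs = D \<and> qs \<noteq> [] \<and> hd qs = x \<and> length Ps = length qs \<and> concat Ps = T \<and>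
    (\<forall>j<length qs. walk as (qs ! j) (Ps ! j) ((qs @ [z]) ! Suc j))"
  using assms
proof (induction T arbitrary: x D)
  case Nil
  then have "D = {x}" "x = z" by auto
  then show ?case by (intro exI[of _ "[x]"] exI[of _ "[[]]"]) auto
next
  case (Cons a T)
  define y where "y = dst as a"
  define D' where "D' = insert y (D - {x})"
  have w: "src as a = x" "walk as y T z" using Cons.prems(1) by (auto simp: y_def)
  obtain qs Ps where qs: "distinct qs" "set qs = D'" "qs \<noteq> []" "hd qs = y" "length Ps = length qs" "concat Ps = T"
    and walks: "\<And>j. j < length qs \<Longrightarrow> walk as (qs ! j) (Ps ! j) ((qs @ [z]) ! Suc j)"
    using Cons.IH[OF w(2), of D'] Cons.prems by (auto simp: D'_def y_def)
  obtain qs' where qs': "qs = y # qs'" using qs(3,4) by (cases qs) auto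
  obtain P Ps' where Ps': "Ps = P # Ps'" using qs(5) qs' by (cases Ps) auto
  have P: "walk as y P ((qs' @ [z]) ! 0)" using walks[of 0] by (simp add: qs' Ps')
  have tl: "walk as (qs' ! j) (Ps' ! j) ((qs' @ [z]) ! Suc j)" if "j < length qs'" for j
    using walks[of "Suc j"] that by (simp add: qs' Ps')
  show ?case
  proof (cases "y \<in> D - {x}")
    case True
    have "set (x # qs) = D" using qs(2) True Cons.prems(2) by (auto simp: D'_def)
    moreover have "distinct (x # qs)" using qs(1,2) True by (auto simp: D'_def)
    moreover have "walk as ((x # qs) ! j) (([a] # Ps) ! j) (((x # qs) @ [z]) ! Suc j)" if "j < length (x # qs)" for j
      using that walks w(1) by (cases j) (auto simp: qs' y_def)
    ultimately show ?thesis using qs by (intro exI[of _ "x # qs"] exI[of _ "[a] # Ps"]) auto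
  next
    case False
    have sq: "set qs' = D - {x}"
    proof (cases "y = x")
      case True
      then show ?thesis using qs(1,2) by (auto simp: qs' D'_def)
    next
      case False
      then have "y \<notin> D" using \<open>y \<notin> D - {x}\<close> by blast
      then show ?thesis using qs(1,2) by (auto simp: qs' D'_def)
    qed
    then have "set (x # qs') = D" "distinct (x # qs')" using Cons.prems(2) qs(1) by (auto simp: qs')
    moreover have "walk as ((x # qs') ! j) (((a # P) # Ps') ! j) (((x # qs') @ [z]) ! Suc j)" if "j < length (x # qs')" for j
      using that P tl w(1) by (cases j) (auto simp: y_def)
    ultimately show ?thesis using qs by (intro exI[of _ "x # qs'"] exI[of _ "(a # P) # Ps'"]) (auto simp: qs' Ps')
  qed
qed

end

section \<open>Tours and their parts\<close>

lemma all_pairs_less_Suc: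
  assumes "\<And>i j. P i j \<Longrightarrow> P j i"
  shows "(\<forall>i<Suc n. \<forall>j<Suc n. i \<noteq> j \<longrightarrow> P i j) \<longleftrightarrow> (\<forall>i<n. \<forall>j<n. i \<noteq> j \<longrightarrow> P i j) \<and> (\<forall>i<n. P i n)"
proof (intro iffI conjI allI impI)
  fix i j assume "(\<forall>i<n. \<forall>j<n. i \<noteq> j \<longrightarrow> P i j) \<and> (\<forall>i<n. P i n)" "i < Suc n" "j < Suc n" "i \<noteq> j"
  then show "P i j" using assms by (metis less_Suc_eq)
qed (metis less_Suc_eq less_irrefl)+

lemma distinct_concat_nth:
  "distinct (concat Ps) \<longleftrightarrow> (\<forall>j<length Ps. distinct (Ps ! j)) \<and>
     (\<forall>i<length Ps. \<forall>j<length Ps. i \<noteq> j \<longrightarrow> set (Ps ! i) \<inter> set (Ps ! j) = {})"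
proof (induction Ps rule: rev_induct)
  case (snoc p Ps)
  have "distinct (concat (Ps @ [p])) \<longleftrightarrow> distinct (concat Ps) \<and> distinct p \<and> (\<forall>i<length Ps. set (Ps ! i) \<inter> set p = {})"
    by (auto simp: set_conv_nth[of Ps])
  also have "\<dots> \<longleftrightarrow> (\<forall>j<length (Ps @ [p]). distinct ((Ps @ [p]) ! j)) \<and>
     (\<forall>i<length (Ps @ [p]). \<forall>j<length (Ps @ [p]). i \<noteq> j \<longrightarrow> set ((Ps @ [p]) ! i) \<inter> set ((Ps @ [p]) ! j) = {})"
    unfolding snoc.IH length_append_singleton
    by (subst all_pairs_less_Suc) (auto simp: nth_append All_less_Suc)
  finally show ?case .
qed simp

lemma set_concat_nth: "set (concat Ps) = (\<Union>j<length Ps. set (Ps ! j))"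
  by (auto simp: set_conv_nth[of Ps])

context contracting_ifs
begin

lemma cell_edges_ends:
  assumes "a \<in> cell_edges as b I"
  shows "src as a \<in> word_map S I ` set as" "dst as a \<in> word_map S I ` set as"
  using assms by (auto simp: cell_edges_def set_Lambda_pow src_def dst_def terminus_def split: if_splits
      intro!: imageI nth_mem mod_less_divisor)

lemma cell_edge_at_vertex:
  assumes "x \<in> word_map S I ` set as"
  shows "\<exists>a\<in>cell_edges as b I. src as a = x"
proof -
  obtain p where p: "p < length as" "x = word_map S I (as ! p)" using assms by (auto simp: in_set_conv_nth)
  define q where "q = (if p = 0 then length as - 1 else p - 1)"
  have q: "q < length as" "Suc q mod length as = p" using p by (auto simp: q_def)
  define a where "a = (if b = 1 then Fwd p else Bwd q, I)"
  have "a \<in> cell_edges as b I" using p q by (auto simp: a_def cell_edges_def set_Lambda_pow)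
  moreover have "src as a = x" using p q by (simp add: a_def src_def)
  ultimately show ?thesis by blast
qed

lemma walk_src: "walk as x T z \<Longrightarrow> a \<in> set T \<Longrightarrow> src as a \<in> insert x (dst as ` set T)"
  by (induction T arbitrary: x) auto

lemma walk_split_at:
  assumes "walk as x T z" "y \<in> insert x (dst as ` set T)"
  obtains T1 T2 where "T = T1 @ T2" "walk as x T1 y" "walk as y T2 z"
proof (cases "y = x")
  case True
  then show ?thesis using assms(1) that[of "[]" T] by simp
next
  case False
  then obtain a where a: "a \<in> set T" "y = dst as a" using assms(2) by blast
  then obtain U V where "T = U @ a # V" by (meson split_list)
  then show ?thesis using assms(1) a(2) that[of "U @ [a]" V] by (auto simp: walk_append)
qed

definition tour :: "'a list \<Rightarrow> nat list set \<Rightarrow> (nat list \<Rightarrow> int) \<Rightarrow> (fedge \<times> nat list) list \<Rightarrow> 'a \<Rightarrow> bool" where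
  "tour as U \<beta> T x \<longleftrightarrow> walk as x T x \<and> distinct T \<and> set T = (\<Union>I\<in>U. cell_edges as (\<beta> I) I) \<and> (\<forall>I. \<beta> I \<in> {-1, 1})"

lemma tour_visits_cell:
  assumes "tour as U \<beta> T x" "I \<in> U"
  shows "word_map S I ` set as \<subseteq> insert x (dst as ` set T)"
proof
  fix y assume "y \<in> word_map S I ` set as"
  then obtain a where a: "a \<in> cell_edges as (\<beta> I) I" "src as a = y" using cell_edge_at_vertex by blast
  then have "a \<in> set T" using assms by (auto simp: tour_def)
  then show "y \<in> insert x (dst as ` set T)" using walk_src[of as x T x a] assms(1) a(2) by (simp add: tour_def)
qed

lemma tour_insert:
  assumes T: "tour as U \<beta> (T1 @ T2) x" "walk as x T1 y" "walk as y T2 x"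
    and L: "tour as U' \<beta>' L y" and disj: "U \<inter> U' = {}"
  shows "tour as (U \<union> U') (\<lambda>I. if I \<in> U' then \<beta>' I else \<beta> I) (T1 @ L @ T2) x"
  unfolding tour_def
proof (intro conjI)
  show "walk as x (T1 @ L @ T2) x" using T L by (auto simp: walk_append tour_def)
  have L': "set L = (\<Union>I\<in>U'. cell_edges as (\<beta>' I) I)" and T': "set (T1 @ T2) = (\<Union>I\<in>U. cell_edges as (\<beta> I) I)"
    using T L by (auto simp: tour_def)
  have "set (T1 @ T2) \<inter> set L = {}" unfolding L' T' using disj by (auto simp: cell_edges_def)
  moreover have "distinct (T1 @ T2)" "distinct L" using T(1) L by (simp_all only: tour_def)
  ultimately show "distinct (T1 @ L @ T2)" by auto
  have "set (T1 @ L @ T2) = set (T1 @ T2) \<union> set L" by auto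
  also have "\<dots> = (\<Union>I\<in>U \<union> U'. cell_edges as (if I \<in> U' then \<beta>' I else \<beta> I) I)"
    unfolding L' T' UN_Un using disj by (intro arg_cong2[of _ _ _ _ "(\<union>)"] SUP_cong refl) auto
  finally show "set (T1 @ L @ T2) = (\<Union>I\<in>U \<union> U'. cell_edges as (if I \<in> U' then \<beta>' I else \<beta> I) I)" .
qed (use T L in \<open>auto simp: tour_def\<close>)

text \<open>An Euler-partition of the cells in \<open>U\<close> only, with conditions on the single trails, as needed
  for inserting cells one after the other.\<close>

definition parts :: "'a list \<Rightarrow> 'a list \<Rightarrow> nat list set \<Rightarrow> (nat list \<Rightarrow> int) \<Rightarrow> (fedge \<times> nat list) list list \<Rightarrow> bool" where
  "parts as qs U \<beta> Ps \<longleftrightarrow> length Ps = length qs \<and> (\<forall>j<length qs. distinct (Ps ! j)) \<and>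
     (\<forall>i<length qs. \<forall>j<length qs. i \<noteq> j \<longrightarrow> set (Ps ! i) \<inter> set (Ps ! j) = {}) \<and>
     (\<Union>j<length qs. set (Ps ! j)) = (\<Union>I\<in>U. cell_edges as (\<beta> I) I) \<and> (\<forall>I. \<beta> I \<in> {-1, 1}) \<and>
     (\<forall>j<length qs. walk as (qs ! j) (Ps ! j) (qs ! (Suc j mod length qs)))"

lemma parts_imp_euler_partition: "parts as qs (words N n) \<beta> Ps \<Longrightarrow> euler_partition n as qs \<beta> Ps"
  by (simp only: parts_def euler_partition_def distinct_concat_nth set_concat_nth) auto

text \<open>The new cell is inserted as a loop at a vertex that it shares with a cell of \<open>U\<close>, hence
  completely into one trail.\<close>

lemma parts_insert:
  assumes as: "distinct as" "2 \<le> length as" and P: "parts as qs U \<beta> Ps"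
    and J: "set J \<subseteq> {1..N}" "J \<notin> U" and x: "I \<in> U" "x \<in> word_map S I ` set as" "x \<in> word_map S J ` set as"
  shows "\<exists>\<beta>' Ps' j. parts as qs (insert J U) \<beta>' Ps' \<and> (\<forall>i<length qs. set (Ps ! i) \<subseteq> set (Ps' ! i)) \<and>
     (\<forall>I\<in>U. \<beta>' I = \<beta> I) \<and> j < length qs \<and> cell_edges as (\<beta>' J) J \<subseteq> set (Ps' ! j)"
proof -
  let ?k = "length qs"
  from P[unfolded parts_def] have "length Ps = ?k" "\<forall>j<?k. distinct (Ps ! j)"
    "\<forall>i<?k. \<forall>j<?k. i \<noteq> j \<longrightarrow> set (Ps ! i) \<inter> set (Ps ! j) = {}" "(\<Union>j<?k. set (Ps ! j)) = (\<Union>I\<in>U. cell_edges as (\<beta> I) I)"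
    "\<forall>I. \<beta> I \<in> {-1, 1}" "\<forall>j<?k. walk as (qs ! j) (Ps ! j) (qs ! (Suc j mod ?k))"
    by - (elim conjE, assumption)+
  note P' = this[rule_format]
  obtain a where a: "a \<in> cell_edges as (\<beta> I) I" "src as a = x" using cell_edge_at_vertex[OF x(2)] by blast
  then have "a \<in> (\<Union>j<?k. set (Ps ! j))" unfolding P'(4) using x(1) by blast
  then obtain j where j: "j < ?k" "a \<in> set (Ps ! j)" by blast
  obtain P1 P2 where split: "Ps ! j = P1 @ a # P2" using split_list[OF j(2)] by blast
  have w: "walk as (qs ! j) P1 x" "walk as x (a # P2) (qs ! (Suc j mod ?k))"
    using P'(6)[OF j(1)] a(2) unfolding split by (auto simp: walk_append)
  obtain b L where L: "b \<in> {-1, 1}" "walk as x L x" "distinct L" "set L = cell_edges as b J"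
    using cell_loop[OF as x(3) J(1)] .
  define Q where "Q = P1 @ L @ a # P2"
  define Ps' where "Ps' = Ps[j := Q]"
  define \<beta>' where "\<beta>' = \<beta>(J := b)"
  have nth: "Ps' ! i = (if i = j then Q else Ps ! i)" if "i < ?k" for i using that P'(1) j by (simp add: Ps'_def nth_list_update)
  have Q: "set Q = set (Ps ! j) \<union> cell_edges as b J" unfolding Q_def split using L(4) by auto
  have fresh: "set (Ps ! i) \<inter> cell_edges as b J = {}" if "i < ?k" for i
  proof -
    have "set (Ps ! i) \<subseteq> (\<Union>I\<in>U. cell_edges as (\<beta> I) I)" using P'(4) that by blast
    then show ?thesis using J(2) by (fastforce simp: cell_edges_def)
  qed
  have "parts as qs (insert J U) \<beta>' Ps'"
    unfolding parts_def
  proof (intro conjI allI impI)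
    show "length Ps' = ?k" using P'(1) by (simp add: Ps'_def)
    show "distinct (Ps' ! i)" if i: "i < ?k" for i
    proof (cases "i = j")
      case True
      have "distinct Q" using P'(2)[OF j(1)] L(3,4) fresh[OF j(1)] unfolding Q_def split by auto
      then show ?thesis using True i nth by simp
    qed (use i nth P'(2) in simp)
    show "set (Ps' ! i) \<inter> set (Ps' ! i') = {}" if "i < ?k" "i' < ?k" "i \<noteq> i'" for i i'
      using that nth[OF that(1)] nth[OF that(2)] P'(3)[OF that] fresh[OF that(1)] fresh[OF that(2)] Q by auto
    have "(\<Union>i<?k. set (Ps' ! i)) = (\<Union>i<?k. set (Ps ! i)) \<union> cell_edges as b J"
    proof (intro antisym subsetI)
      fix y assume "y \<in> (\<Union>i<?k. set (Ps' ! i))"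
      then obtain i where "i < ?k" "y \<in> set (Ps' ! i)" by blast
      then show "y \<in> (\<Union>i<?k. set (Ps ! i)) \<union> cell_edges as b J" using nth Q by (auto split: if_splits)
    next
      fix y assume "y \<in> (\<Union>i<?k. set (Ps ! i)) \<union> cell_edges as b J"
      then consider i where "i < ?k" "y \<in> set (Ps ! i)" | "y \<in> cell_edges as b J" by blast
      then show "y \<in> (\<Union>i<?k. set (Ps' ! i))"
      proof cases
        case 1 then show ?thesis using nth[of i] Q by (intro UN_I[of i]) auto
      next
        case 2 then show ?thesis using nth[OF j(1)] Q j by (intro UN_I[of j]) auto
      qed
    qed
    also have "\<dots> = (\<Union>I\<in>insert J U. cell_edges as (\<beta>' I) I)" 
    proof -
      have "(\<Union>I\<in>U. cell_edges as (\<beta>' I) I) = (\<Union>I\<in>U. cell_edges as (\<beta> I) I)"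
        by (intro SUP_cong refl) (use J(2) in \<open>auto simp: \<beta>'_def\<close>)
      moreover have "\<beta>' J = b" by (simp add: \<beta>'_def)
      ultimately show ?thesis unfolding P'(4) UN_insert by (simp only: Un_commute)
    qed
    finally show "(\<Union>i<?k. set (Ps' ! i)) = (\<Union>I\<in>insert J U. cell_edges as (\<beta>' I) I)" .
    show "\<beta>' I \<in> {-1, 1}" for I using L(1) P'(5)[of I] by (simp add: \<beta>'_def)
    show "walk as (qs ! i) (Ps' ! i) (qs ! (Suc i mod ?k))" if i: "i < ?k" for i
    proof (cases "i = j")
      case True
      have "walk as (qs ! j) Q (qs ! (Suc j mod ?k))" unfolding Q_def using w L(2) by (auto simp: walk_append simp del: walk.simps)
      then show ?thesis using True i nth by simp
    qed (use i nth P'(6) in simp)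
  qed
  moreover have "\<forall>i<?k. set (Ps ! i) \<subseteq> set (Ps' ! i)" using nth Q by auto
  moreover have "\<forall>I\<in>U. \<beta>' I = \<beta> I" using J(2) by (auto simp: \<beta>'_def)
  moreover have "cell_edges as (\<beta>' J) J \<subseteq> set (Ps' ! j)" using nth[OF j(1)] Q by (simp add: \<beta>'_def)
  ultimately show ?thesis using j(1) by blast
qed

end

section \<open>Tours with prescribed edges in every part\<close>

context skeleton_ifs
begin

text \<open>Consider the vertices that can be reached from \<open>X\<close> by chains of different unused cells. With
  one vertex of a cell of \<open>W\<close> they include all of them: a chain that already uses the cell is cut
  off there, and any other one is prolonged by it. As \<open>W\<close> is connected and covers \<open>A\<close>, all of \<open>A\<close>
  is reached.\<close>

lemma chain_exists:
  assumes W: "connected_cells W" "covers W" and U: "\<And>I. I \<in> U \<Longrightarrow> word_map S I ` A \<subseteq> X" and x0: "x0 \<in> X" "x0 \<in> A" and a: "a \<in> A"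
  shows "\<exists>x\<in>X. \<exists>c. chain A x c a \<and> distinct (map fst c) \<and> fst ` set c \<subseteq> W - U"
proof -
  define Z where "Z = {z. \<exists>x\<in>X. \<exists>c. chain A x c z \<and> distinct (map fst c) \<and> fst ` set c \<subseteq> W - U}"
  have XZ: "X \<subseteq> Z"
  proof
    fix x assume "x \<in> X"
    then show "x \<in> Z" unfolding Z_def by (auto intro!: bexI[of _ x] exI[of _ "[]"])
  qed
  have closed: "y \<in> Z" if z: "z \<in> Z" "z \<in> word_map S J ` A" and y: "y \<in> word_map S J ` A" and J: "J \<in> W" for z y J
  proof (cases "J \<in> U \<or> y = z")
    case True then show ?thesis using U[of J] y XZ z by blast
  next
    case False
    have extend: "y \<in> Z" if c: "x \<in> X" "chain A x c v" "distinct (map fst c)" "fst ` set c \<subseteq> W - U" "J \<notin> fst ` set c" "v \<in> word_map S J ` A" for x c v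
    proof (cases "v = y")
      case True then show ?thesis using c unfolding Z_def by blast
    next
      case ne: False
      have "chain A x (c @ [(J, y)]) y" using c ne y by (auto simp: chain_append)
      moreover have "distinct (map fst (c @ [(J, y)]))" using c by auto
      moreover have "fst ` set (c @ [(J, y)]) \<subseteq> W - U" using c J False by auto
      ultimately show ?thesis using c(1) unfolding Z_def by blast
    qed
    obtain x c where c: "x \<in> X" "chain A x c z" "distinct (map fst c)" "fst ` set c \<subseteq> W - U" using z(1) by (auto simp: Z_def)
    show ?thesis
    proof (cases "J \<in> fst ` set c")
      case True
      then obtain w where "(J, w) \<in> set c" by auto
      then obtain c1 c2 where c12: "c = c1 @ (J, w) # c2" by (meson split_list)
      obtain v where v: "chain A x c1 v" "v \<in> word_map S J ` A" using c(2) unfolding c12 by (auto simp: chain_append)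
      show ?thesis by (rule extend[OF c(1) v(1) _ _ _ v(2)]) (use c c12 in auto)
    next
      case False
      show ?thesis by (rule extend[OF c False z(2)])
    qed
  qed
  define G where "G = {I\<in>W. word_map S I ` A \<inter> Z \<noteq> {}}"
  have GZ: "word_map S I ` A \<subseteq> Z" if "I \<in> G" for I using that closed unfolding G_def by blast
  have "G \<noteq> {}"
  proof -
    obtain I where "I \<in> W" "x0 \<in> word_map S I ` A" using W(2) x0(2) unfolding covers_def by blast
    then show ?thesis using x0(1) XZ unfolding G_def by blast
  qed
  have "G = W"
  proof (rule ccontr)
    assume "G \<noteq> W"
    then obtain I J where "I \<in> G" "J \<in> W - G" "meets I J" using cut_connectedD[OF W(1), of G] \<open>G \<noteq> {}\<close> unfolding G_def by blast
    then show False using GZ unfolding meets_def G_def by blast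
  qed
  then have "a \<in> Z" using W(2) a GZ unfolding covers_def by blast
  then show ?thesis unfolding Z_def by blast
qed

text \<open>For every further point of \<open>D\<close>, a chain of unused cells from the tour to this point is
  spliced in, out and back.\<close>

lemma tour_through:
  assumes as: "distinct as" "set as = A" "l < length as" and W: "connected_cells W" "covers W" and x0: "x0 \<in> A"
    and D: "finite D" "D \<subseteq> A"
  shows "\<exists>U \<beta> T. U \<subseteq> W \<and> tour as U \<beta> T x0 \<and> D \<subseteq> insert x0 (dst as ` set T) \<and> free_runs l (3 * length as * card D) T"
  using D
proof (induction D rule: finite_induct)
  case empty
  have "tour as {} (\<lambda>_. 1) [] x0" by (simp add: tour_def)
  then show ?case by (intro exI[of _ "{}"] exI[of _ "\<lambda>_. 1"] exI[of _ "[]"]) (simp add: free_runs_def)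
next
  case (insert a D)
  then obtain U \<beta> T where T: "U \<subseteq> W" "tour as U \<beta> T x0" "D \<subseteq> insert x0 (dst as ` set T)" "free_runs l (3 * length as * card D) T"
    by blast
  define X where "X = insert x0 (dst as ` set T)"
  have "word_map S I ` A \<subseteq> X" if "I \<in> U" for I using tour_visits_cell[OF T(2) that] as(2) by (simp add: X_def)
  then obtain x c where x: "x \<in> X" and c: "chain A x c a" "distinct (map fst c)" "fst ` set c \<subseteq> W - U"
    using chain_exists[OF W, of U X x0 a] x0 insert.prems by (auto simp: X_def)
  obtain L1 L2 \<beta>' where L: "walk as x L1 a" "walk as a L2 x" "distinct (L1 @ L2)"
      "set (L1 @ L2) = (\<Union>I\<in>fst ` set c. cell_edges as (\<beta>' I) I)" "\<forall>I. \<beta>' I \<in> {-1, 1}" "free_runs l (3 * length as) (L1 @ L2)"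
    using chain_loop[OF as(1,3), of x c a True] c(1,2) unfolding as(2) by blast
  obtain T1 T2 where T12: "T = T1 @ T2" "walk as x0 T1 x" "walk as x T2 x0"
    using walk_split_at[of as x0 T x0 x] T(2) x by (auto simp: tour_def X_def)
  have Lt: "tour as (fst ` set c) \<beta>' (L1 @ L2) x" using L by (auto simp: tour_def walk_append)
  define T' where "T' = T1 @ (L1 @ L2) @ T2"
  have tour': "tour as (U \<union> fst ` set c) (\<lambda>I. if I \<in> fst ` set c then \<beta>' I else \<beta> I) T' x0"
    unfolding T'_def by (rule tour_insert[OF T(2)[unfolded T12(1)] T12(2,3) Lt]) (use c(3) in auto)
  have runs: "free_runs l (3 * length as * card (insert a D)) T'"
    using free_runs_insert[OF T(4)[unfolded T12(1)] L(6)] insert.hyps unfolding T'_def by (simp add: algebra_simps)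
  have "a \<in> insert x0 (dst as ` set T')"
  proof -
    have "walk as x0 (T1 @ L1) a" using T12 L by (auto simp: walk_append)
    then have "a \<in> insert x0 (dst as ` set (T1 @ L1))"
    proof (cases "T1 @ L1 = []")
      case False
      then have "dst as (last (T1 @ L1)) = a" using walk_last[OF \<open>walk as x0 (T1 @ L1) a\<close>] by simp
      then show ?thesis using last_in_set[OF False] by blast
    qed simp
    then show ?thesis by (auto simp: T'_def)
  qed
  moreover have "insert x0 (dst as ` set T) \<subseteq> insert x0 (dst as ` set T')" by (auto simp: T'_def T12(1))
  ultimately have "insert a D \<subseteq> insert x0 (dst as ` set T')" using T(3) by blast
  moreover have "U \<union> fst ` set c \<subseteq> W" using T(1) c(3) by blast
  ultimately show ?case using tour' runs by blast
qed

text \<open>Some remaining cell always meets the cells that are already used, by connectedness.\<close>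

lemma fill_cells:
  assumes as: "distinct as" "set as = A" "2 \<le> length as" and P: "parts as qs U \<beta> Ps" and U: "U \<noteq> {}" "U \<subseteq> words N n"
  shows "\<exists>\<beta>' Ps'. parts as qs (words N n) \<beta>' Ps' \<and> (\<forall>i<length qs. set (Ps ! i) \<subseteq> set (Ps' ! i)) \<and> (\<forall>I\<in>U. \<beta>' I = \<beta> I) \<and>
     (\<forall>J\<in>words N n - U. \<exists>j<length qs. cell_edges as (\<beta>' J) J \<subseteq> set (Ps' ! j))"
  using P U
proof (induction "card (words N n - U)" arbitrary: U \<beta> Ps)
  case 0
  then have "U = words N n" by auto
  then show ?case using 0 by blast
next
  case (Suc k)
  have "U \<noteq> words N n" using Suc.hyps(2) by auto
  then obtain I J where IJ: "I \<in> U" "J \<in> words N n - U" "meets I J"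
    using cut_connectedD[of meets "words N n" U] words_connected_covers Suc.prems by blast
  obtain x where x: "x \<in> word_map S I ` set as" "x \<in> word_map S J ` set as" using IJ(3) unfolding meets_def as(2) by blast
  have J: "set J \<subseteq> {1..N}" "J \<notin> U" using IJ(2) by (auto simp: words_def)
  obtain \<beta>1 Ps1 j where 1: "parts as qs (insert J U) \<beta>1 Ps1" "\<forall>i<length qs. set (Ps ! i) \<subseteq> set (Ps1 ! i)"
      "\<forall>I\<in>U. \<beta>1 I = \<beta> I" "j < length qs" "cell_edges as (\<beta>1 J) J \<subseteq> set (Ps1 ! j)"
    using parts_insert[OF as(1,3) Suc.prems(1) J IJ(1) x] by blast
  have "words N n - insert J U = (words N n - U) - {J}" by auto
  then have "k = card (words N n - insert J U)" using Suc.hyps(2) IJ(2) by simp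
  from Suc.hyps(1)[OF this 1(1)] obtain \<beta>2 Ps2 where 2: "parts as qs (words N n) \<beta>2 Ps2"
      "\<forall>i<length qs. set (Ps1 ! i) \<subseteq> set (Ps2 ! i)" "\<forall>I\<in>insert J U. \<beta>2 I = \<beta>1 I"
      "\<forall>J'\<in>words N n - insert J U. \<exists>j<length qs. cell_edges as (\<beta>2 J') J' \<subseteq> set (Ps2 ! j)"
    using Suc.prems(3) IJ(2) by blast
  have "\<exists>j<length qs. cell_edges as (\<beta>2 J') J' \<subseteq> set (Ps2 ! j)" if "J' \<in> words N n - U" for J'
  proof (cases "J' = J")
    case True
    then show ?thesis using 1(4,5) 2(2,3) by (metis insertI1 subset_trans)
  next
    case False
    then show ?thesis using 2(4) that by blast
  qed
  moreover have "\<forall>i<length qs. set (Ps ! i) \<subseteq> set (Ps2 ! i)" using 1(2) 2(2) by (meson subset_trans)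
  moreover have "\<forall>I\<in>U. \<beta>2 I = \<beta> I" using 1(3) 2(3) by simp
  ultimately show ?case using 2(1) by blast
qed

lemma walk_dist_le:
  assumes "walk as x p y" "\<And>a. a \<in> set p \<Longrightarrow> dist (src as a) (dst as a) \<le> \<delta>"
  shows "dist x y \<le> real (length p) * \<delta>"
  using assms
proof (induction p arbitrary: x)
  case (Cons a p)
  have "dist x y \<le> dist x (dst as a) + dist (dst as a) y" by (rule dist_triangle)
  also have "dist x (dst as a) \<le> \<delta>" using Cons.prems(1) Cons.prems(2)[of a] by simp
  also have "dist (dst as a) y \<le> real (length p) * \<delta>" using Cons by auto
  finally show ?case by (simp add: algebra_simps)
qed simp

text \<open>At a level with a removable cell \<open>R\<close>, a tour through all points of \<open>A\<close> is made of other
  cells than \<open>R\<close> and cut at the points of \<open>A\<close>, before the unused cells are filled in; so \<open>R\<close> ends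
  up completely in one trail. A trail without the edge \<open>l\<close> would have at most \<open>B\<close> edges, too few
  to lead from one point of \<open>A\<close> to another one if the cells are small.\<close>

lemma hitting_partition:
  assumes as: "distinct as" "set as = A" "2 \<le> length as" and l: "l < length as"
    and rem: "removable n0 I0" "1 \<le> n0"
  shows "\<exists>n\<ge>1. \<exists>qs \<beta> Ps. distinct qs \<and> set qs = A \<and> euler_partition n as qs \<beta> Ps \<and> (\<forall>I. \<beta> I \<in> {-1, 1}) \<and>
     (\<exists>j<length as. \<exists>I\<in>words N n. cell_edges as (\<beta> I) I \<subseteq> set (Ps ! j)) \<and>
     (\<forall>j<length as. \<exists>I\<in>words N n. (Fwd l, I) \<in> set (Ps ! j) \<or> (Bwd l, I) \<in> set (Ps ! j))"
proof -
  define m where "m = length as"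
  have m: "2 \<le> m" "card A = m" using as distinct_card[OF as(1)] by (auto simp: m_def)
  obtain \<epsilon> where \<epsilon>: "0 < \<epsilon>" "\<And>a b. a \<in> A \<Longrightarrow> b \<in> A \<Longrightarrow> a \<noteq> b \<Longrightarrow> \<epsilon> \<le> dist a b" using separated_points by blast
  \<comment> \<open>Each of the \<open>m\<close> chains of the tour contributes at most \<open>3 * m\<close> to a gap.\<close>
  define B where "B = 3 * m * m"
  define \<delta> where "\<delta> = \<epsilon> / (real B + 1)"
  have \<delta>: "0 < \<delta>" "real B * \<delta> < \<epsilon>" using \<epsilon>(1) by (auto simp: \<delta>_def field_simps)
  obtain k where k: "\<And>n I x y. k \<le> n \<Longrightarrow> I \<in> words N n \<Longrightarrow> x \<in> word_map S I ` K \<Longrightarrow> y \<in> word_map S I ` K \<Longrightarrow> dist x y < \<delta>"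
    using small_cells_exist[OF \<delta>(1)] by blast
  obtain J0 where J0: "J0 \<in> words N k" using words_connected_covers[of k] by (auto simp: cut_connected_def)
  define n where "n = k + n0"
  define R where "R = J0 @ I0"
  have n: "1 \<le> n" "k \<le> n" using rem(2) by (auto simp: n_def)
  have R: "R \<in> words N n" "connected_cells (words N n - {R})" "covers (words N n - {R})"
    using removable_deeper[OF rem(1) J0] by (auto simp: removable_def n_def R_def)
  have step_small: "dist (src as a) (dst as a) \<le> \<delta>" if "a \<in> cell_edges as b I" "I \<in> words N n" for a b I
  proof -
    have "src as a \<in> word_map S I ` K" "dst as a \<in> word_map S I ` K" using cell_edges_ends[OF that(1)] A(2) as(2) by blast+
    then show ?thesis using k[OF n(2) that(2)] by (intro less_imp_le)
  qed
  define x0 where "x0 = as ! 0"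
  have x0: "x0 \<in> A" using m(1) unfolding as(2)[symmetric] x0_def m_def by (intro nth_mem) linarith
  obtain U \<beta> T where T: "U \<subseteq> words N n - {R}" "tour as U \<beta> T x0" "A \<subseteq> insert x0 (dst as ` set T)" "free_runs l B T"
    using tour_through[OF as(1,2) l R(2,3) x0 A(1) subset_refl] m by (auto simp: B_def m_def)
  have Tw: "walk as x0 T x0" "distinct T" "set T = (\<Union>I\<in>U. cell_edges as (\<beta> I) I)" "\<And>I. \<beta> I \<in> {-1, 1}"
    using T(2) by (auto simp: tour_def)
  obtain qs Ps where qs: "distinct qs" "set qs = A" "qs \<noteq> []" "hd qs = x0" "length Ps = length qs" "concat Ps = T"
    and walks: "\<And>j. j < length qs \<Longrightarrow> walk as (qs ! j) (Ps ! j) ((qs @ [x0]) ! Suc j)"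
    using walk_cut[OF Tw(1) x0 A(1) T(3)] by blast
  have qm: "length qs = m" using distinct_card[OF qs(1)] qs(2) m by simp
  have next_q: "(qs @ [x0]) ! Suc j = qs ! (Suc j mod m)" if "j < m" for j
    using that qm qs(3,4) by (cases "Suc j = m") (auto simp: nth_append hd_conv_nth)
  have Pm: "length Ps = m" using qs(5) qm by simp
  have P: "parts as qs U \<beta> Ps"
    unfolding parts_def qm
  proof (intro conjI)
    show "length Ps = m" by (rule Pm)
    have "distinct (concat Ps)" using qs(6) Tw(2) by simp
    from this[unfolded distinct_concat_nth Pm]
    show "\<forall>j<m. distinct (Ps ! j)" "\<forall>i<m. \<forall>j<m. i \<noteq> j \<longrightarrow> set (Ps ! i) \<inter> set (Ps ! j) = {}" by blast+
    show "(\<Union>j<m. set (Ps ! j)) = (\<Union>I\<in>U. cell_edges as (\<beta> I) I)"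
      using set_concat_nth[of Ps] qs(6) Tw(3) Pm by simp
    show "\<forall>I. \<beta> I \<in> {-1, 1}" using Tw(4) by simp
    show "\<forall>j<m. walk as (qs ! j) (Ps ! j) (qs ! (Suc j mod m))" using walks next_q qm by simp
  qed
  have hit: "hits l (Ps ! j)" if j: "j < m" for j
  proof (rule ccontr)
    assume no: "\<not> hits l (Ps ! j)"
    have "concat Ps = concat (take j Ps) @ Ps ! j @ concat (drop (Suc j) Ps)"
      using id_take_nth_drop[of j Ps] j Pm by (metis concat.simps(2) concat_append)
    then have "sublist (Ps ! j) T" using qs(6) unfolding sublist_def by metis
    then have "length (Ps ! j) \<le> B" using T(4) no by (simp add: free_runs_def)
    have w: "walk as (qs ! j) (Ps ! j) (qs ! (Suc j mod m))" using walks[of j] next_q[OF j] j qm by simp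
    have "set (Ps ! j) \<subseteq> set T" using qs(6) j Pm by (metis nth_mem set_concat Sup_upper UN_upper)
    then have "dist (qs ! j) (qs ! (Suc j mod m)) \<le> real (length (Ps ! j)) * \<delta>"
      using step_small T(1) Tw(3) by (intro walk_dist_le[OF w]) blast
    also have "\<dots> \<le> real B * \<delta>" using \<open>length (Ps ! j) \<le> B\<close> \<delta>(1) by (intro mult_right_mono) auto
    also have "\<dots> < \<epsilon>" by (rule \<delta>(2))
    finally have "dist (qs ! j) (qs ! (Suc j mod m)) < \<epsilon>" .
    moreover have "qs ! j \<noteq> qs ! (Suc j mod m)"
    proof -
      have "j \<noteq> Suc j mod m" using j m by (cases "Suc j = m") auto
      moreover have "Suc j mod m < m" using m by simp
      ultimately show ?thesis using nth_eq_iff_index_eq[OF qs(1), of j "Suc j mod m"] j qm by simp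
    qed
    moreover have "qs ! j \<in> A" "qs ! (Suc j mod m) \<in> A" using qs(2) qm j m by (metis nth_mem, metis nth_mem mod_less_divisor gr_zeroI not_numeral_le_zero)
    ultimately show False using \<epsilon>(2) by force
  qed
  have "U \<noteq> {}"
  proof
    assume "U = {}"
    then have "T = []" using Tw(3) by simp
    then have "A \<subseteq> {x0}" using T(3) by simp
    then have "card A \<le> 1" using card_mono[of "{x0}" A] by simp
    then show False using m by simp
  qed
  then obtain \<beta>' Ps' where F: "parts as qs (words N n) \<beta>' Ps'" "\<forall>i<m. set (Ps ! i) \<subseteq> set (Ps' ! i)"
      "\<forall>J\<in>words N n - U. \<exists>j<m. cell_edges as (\<beta>' J) J \<subseteq> set (Ps' ! j)"
    using fill_cells[OF as P, of n] T(1) unfolding qm by blast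
  have E: "euler_partition n as qs \<beta>' Ps'" using F(1) by (rule parts_imp_euler_partition)
  have arcs: "I \<in> words N n" if "(e, I) \<in> set (Ps' ! j)" "j < m" for e I j
  proof -
    have "(e, I) \<in> (\<Union>I\<in>words N n. cell_edges as (\<beta>' I) I)" using F(1) that unfolding parts_def qm by blast
    then show ?thesis by (auto simp: cell_edges_def)
  qed
  have hit': "\<exists>I\<in>words N n. (Fwd l, I) \<in> set (Ps' ! j) \<or> (Bwd l, I) \<in> set (Ps' ! j)" if j: "j < m" for j
    using hit[OF j] F(2) j arcs[OF _ j] unfolding hits_def by blast
  have pure: "\<exists>j<m. \<exists>I\<in>words N n. cell_edges as (\<beta>' I) I \<subseteq> set (Ps' ! j)" using F(3) R(1) T(1) by blast
  have "\<forall>I. \<beta>' I \<in> {-1, 1}" using F(1) by (simp add: parts_def)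
  then show ?thesis using n(1) qs(1,2) E hit' pure unfolding m_def by blast
qed

end

section \<open>Composition\<close>

text \<open>Otherwise \<open>R\<close> would be acyclic on a finite set and have a maximal element, which has no
  successor.\<close>

lemma transitive_serial_finite_reflexive_point:
  assumes fin: "finite X" and ne: "X \<noteq> {}" and trans: "\<And>x y z. x \<in> X \<Longrightarrow> y \<in> X \<Longrightarrow> z \<in> X \<Longrightarrow> R x y \<Longrightarrow> R y z \<Longrightarrow> R x z"
    and serial: "\<And>x. x \<in> X \<Longrightarrow> \<exists>y\<in>X. R x y"
  shows "\<exists>x\<in>X. R x x"
proof (rule ccontr)
  assume no: "\<not> ?thesis"
  define r where "r = {(x, y). x \<in> X \<and> y \<in> X \<and> R x y}"
  have "finite r" using finite_subset[of r "X \<times> X"] fin by (auto simp: r_def)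
  moreover have "Relation.trans r" using trans by (auto simp: r_def Relation.trans_def)
  then have "acyclic r" using no by (auto simp: acyclic_def trancl_id r_def)
  ultimately have "wf (r\<inverse>)" by (rule finite_acyclic_wf_converse)
  then obtain z where z: "z \<in> X" "\<And>y. (y, z) \<in> r\<inverse> \<Longrightarrow> y \<notin> X" using ne unfolding wf_eq_minimal by blast
  obtain y where "y \<in> X" "R z y" using serial[OF z(1)] by blast
  then have "(y, z) \<in> r\<inverse>" using z(1) by (simp add: r_def)
  then show False using z(2) \<open>y \<in> X\<close> by blast
qed

context contracting_ifs
begin

definition lift_arc :: "nat list \<Rightarrow> fedge \<times> nat list \<Rightarrow> fedge \<times> nat list" where
  "lift_arc J a = (fst a, J @ snd a)"

lemma inj_lift_arc: "inj (lift_arc J)" by (auto simp: inj_def lift_arc_def)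

lemma src_lift_arc: "src as (lift_arc J a) = word_map S J (src as a)"
  and dst_lift_arc: "dst as (lift_arc J a) = word_map S J (dst as a)"
  by (simp_all add: lift_arc_def src_def dst_def word_map_append)

lemma walk_lift: "walk as x p y \<Longrightarrow> walk as (word_map S J x) (map (lift_arc J) p) (word_map S J y)"
  by (induction p arbitrary: x) (auto simp: src_lift_arc dst_lift_arc)

text \<open>Every edge of a word \<open>p\<close> is replaced by its trail, placed in the cell of the edge.\<close>

definition refine :: "(fedge \<times> nat list) list list \<Rightarrow> (fedge \<times> nat list) list \<Rightarrow> (fedge \<times> nat list) list" where
  "refine Ps p = concat (map (\<lambda>a. map (lift_arc (snd a)) (edge_to_trail Ps (fst a))) p)"

lemma cell_edges_uminus: "b \<in> {-1, 1} \<Longrightarrow> cell_edges as (- b) I = rev_arc ` cell_edges as b I"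
  by (auto simp: cell_edges_def set_Lambda_pow image_image rev_arc_def)

lemma lift_cell_edges: "lift_arc J ` cell_edges as b I = cell_edges as b (J @ I)"
  by (auto simp: cell_edges_def lift_arc_def image_image)

text \<open>The edges of the second partition are replaced by the trails of the first one. In a cell \<open>J\<close>
  of the second one, all edges occur in the same direction, so each cell \<open>I\<close> of the first one
  occurs exactly once in it, with orientation multiplied by that of \<open>J\<close>. A cell that is complete
  in the \<open>k\<close>-th trail is carried along with every occurrence of the \<open>k\<close>-th edge.\<close>

lemma euler_partition_compose:
  assumes P1: "euler_partition n as as1 \<beta>1 Ps1" and P2: "euler_partition n2 as1 as2 \<beta>2 Ps2"
    and len: "length as2 = length as1" "0 < length as1"
    and \<beta>: "\<And>I. \<beta>1 I \<in> {-1, 1}" "\<And>I. \<beta>2 I \<in> {-1, 1}"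
  defines "\<beta> \<equiv> \<lambda>L. \<beta>2 (take n2 L) * \<beta>1 (drop n2 L)"
  shows "euler_partition (n2 + n) as as2 \<beta> (map (refine Ps1) Ps2)"
    and "\<And>I j J k. j < length as2 \<Longrightarrow> I \<in> words N n \<Longrightarrow> k < length as1 \<Longrightarrow> cell_edges as (\<beta>1 I) I \<subseteq> set (Ps1 ! k) \<Longrightarrow>
      (Fwd k, J) \<in> set (Ps2 ! j) \<or> (Bwd k, J) \<in> set (Ps2 ! j) \<Longrightarrow>
      J \<in> words N n2 \<and> cell_edges as (\<beta> (J @ I)) (J @ I) \<subseteq> set (map (refine Ps1) Ps2 ! j)"
proof -
  define m where "m = length as1"
  have L1: "length Ps1 = m" "distinct (concat Ps1)" "set (concat Ps1) = (\<Union>I\<in>words N n. cell_edges as (\<beta>1 I) I)"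
    "\<And>j. j < m \<Longrightarrow> walk as (as1 ! j) (Ps1 ! j) (as1 ! (Suc j mod m))"
    using P1 unfolding euler_partition_def m_def by auto
  have L2: "length Ps2 = m" "distinct (concat Ps2)" "set (concat Ps2) = (\<Union>I\<in>words N n2. cell_edges as1 (\<beta>2 I) I)"
    "\<And>j. j < m \<Longrightarrow> walk as1 (as2 ! j) (Ps2 ! j) (as2 ! (Suc j mod m))"
    using P2 len unfolding euler_partition_def m_def by auto
  let ?t = "edge_to_trail Ps1"
  let ?x = "\<lambda>a. map (lift_arc (snd a)) (?t (fst a))"
  have t_rev: "set (?t (rev_edge e)) = rev_arc ` set (?t e)" for e
    by (cases e) (simp_all add: edge_to_trail_Bwd image_image del: edge_to_trail.simps(2))
  have d1: "distinct (Ps1 ! j)" "i < m \<Longrightarrow> i \<noteq> j \<Longrightarrow> set (Ps1 ! i) \<inter> set (Ps1 ! j) = {}" if "j < m" for i j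
    using L1(2) that unfolding distinct_concat_nth L1(1) by blast+
  have inj_rev: "inj rev_arc" by (rule inj_on_inverseI[of _ rev_arc]) simp
  have arc2: "J \<in> words N n2 \<and> e \<in> (if \<beta>2 J = 1 then Fwd else Bwd) ` {..<m}" if "(e, J) \<in> set (concat Ps2)" for e J
    using that unfolding L2(3) cell_edges_def set_Lambda_pow m_def[symmetric] by auto
  have t_set: "(\<Union>e\<in>set (Lambda_pow as1 b). set (?t e)) = (\<Union>I\<in>words N n. cell_edges as (b * \<beta>1 I) I)" if b: "b \<in> {-1, 1}" for b
  proof -
    have F: "(\<Union>j<m. set (?t (Fwd j))) = (\<Union>I\<in>words N n. cell_edges as (\<beta>1 I) I)"
      using L1(3) set_concat_nth[of Ps1] L1(1) by simp
    show ?thesis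
    proof (cases "b = 1")
      case True then show ?thesis using F by (simp add: set_Lambda_pow m_def)
    next
      case False
      then have b1: "b = -1" using b by auto
      have "(\<Union>e\<in>set (Lambda_pow as1 b). set (?t e)) = (\<Union>j<m. rev_arc ` set (?t (Fwd j)))"
        using t_rev[of "Fwd _"] by (simp add: set_Lambda_pow m_def b1 del: edge_to_trail.simps)
      also have "\<dots> = rev_arc ` (\<Union>I\<in>words N n. cell_edges as (\<beta>1 I) I)" using F by (simp add: image_UN[symmetric])
      also have "\<dots> = (\<Union>I\<in>words N n. cell_edges as (- \<beta>1 I) I)" using cell_edges_uminus[OF \<beta>(1)] by (simp add: image_UN)
      finally show ?thesis by (simp add: b1)
    qed
  qed
  have \<beta>app: "\<beta> (J @ I) = \<beta>2 J * \<beta>1 I" if "J \<in> words N n2" for I J using that by (simp add: \<beta>_def words_def)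
  have set_refine: "set (refine Ps1 p) = (\<Union>a\<in>set p. lift_arc (snd a) ` set (?t (fst a)))" for p by (auto simp: refine_def)
  have t_distinct: "distinct (?t e)" if "e \<in> (if b then Fwd else Bwd) ` {..<m}" for e b
  proof -
    have inj': "inj_on rev_arc X" for X using inj_rev by (rule inj_on_subset) simp
    show ?thesis using that d1(1) inj'
      by (auto simp: edge_to_trail_Bwd distinct_map simp del: edge_to_trail.simps(2) split: if_splits)
  qed
  have t_disjoint: "set (?t e) \<inter> set (?t e') = {}" if e: "e \<in> (if b then Fwd else Bwd) ` {..<m}" "e' \<in> (if b then Fwd else Bwd) ` {..<m}" "e \<noteq> e'" for e e' b
  proof (cases b)
    case True
    then obtain i j where ij: "e = Fwd i" "e' = Fwd j" "i < m" "j < m" "i \<noteq> j" using e by auto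
    then show ?thesis using d1(2)[OF ij(4,3,5)] by simp
  next
    case False
    then obtain i j where ij: "e = rev_edge (Fwd i)" "e' = rev_edge (Fwd j)" "i < m" "j < m" "i \<noteq> j" using e by auto
    show ?thesis unfolding ij(1,2) t_rev using d1(2)[OF ij(4,3,5)] inj_rev
      by (simp add: image_Int[symmetric] del: edge_to_trail.simps(2))
  qed
  have UN_disjointI: "(\<Union>a\<in>X. f a) \<inter> (\<Union>b\<in>Y. f b) = {}" if "\<And>a b. a \<in> X \<Longrightarrow> b \<in> Y \<Longrightarrow> f a \<inter> f b = {}"
    for X Y :: "(fedge \<times> nat list) set" and f :: "fedge \<times> nat list \<Rightarrow> (fedge \<times> nat list) set" using that by blast
  have x_disjoint: "set (?x a) \<inter> set (?x b) = {}" if ab: "a \<in> set (concat Ps2)" "b \<in> set (concat Ps2)" "a \<noteq> b" for a b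
  proof (cases "snd a = snd b")
    case True
    have ne: "fst a \<noteq> fst b" using True ab(3) by (metis prod_eqI)
    have orient: "fst x \<in> (if \<beta>2 (snd x) = 1 then Fwd else Bwd) ` {..<m}" if "x \<in> set (concat Ps2)" for x
      using arc2[of "fst x" "snd x"] that unfolding prod.collapse by blast
    note same = orient[OF ab(1), unfolded True] orient[OF ab(2)]
    from t_disjoint[OF same ne] show ?thesis using True inj_lift_arc[of "snd b"] by (simp add: image_Int[symmetric])
  next
    case False
    have "length (snd a) = length (snd b)"
      using arc2[of "fst a" "snd a"] arc2[of "fst b" "snd b"] ab by (simp add: words_def)
    then show ?thesis using False by (auto simp: lift_arc_def)
  qed
  have dist2: "distinct (Ps2 ! j)" "i < m \<Longrightarrow> i \<noteq> j \<Longrightarrow> set (Ps2 ! i) \<inter> set (Ps2 ! j) = {}" if "j < m" for i j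
    using L2(2) that unfolding distinct_concat_nth L2(1) by blast+
  have sub2: "set (Ps2 ! j) \<subseteq> set (concat Ps2)" if "j < m" for j using that L2(1) unfolding set_concat_nth by blast
  have distinct_refine: "distinct (refine Ps1 p)" if "distinct p" "set p \<subseteq> set (concat Ps2)" for p
    using that
  proof (induction p)
    case Nil then show ?case by (simp add: refine_def)
  next
    case (Cons a p)
    have a: "a \<in> set (concat Ps2)" "a \<notin> set p" using Cons.prems by auto
    have "distinct (?t (fst a))" using arc2[of "fst a" "snd a"] a t_distinct[of "fst a" "\<beta>2 (snd a) = 1"] by simp
    moreover have "inj_on (lift_arc (snd a)) X" for X using inj_lift_arc by (rule inj_on_subset) simp
    ultimately have da: "distinct (?x a)" by (simp add: distinct_map)
    have "set (?x a) \<inter> set (?x b) = {}" if "b \<in> set p" for b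
      using x_disjoint[of a b] a that Cons.prems by auto
    then have "set (?x a) \<inter> set (refine Ps1 p) = {}" unfolding set_refine by auto
    then show ?case using da Cons by (simp add: refine_def)
  qed
  have walk_refine: "walk as x (refine Ps1 p) y" if "walk as1 x p y" "set p \<subseteq> set (concat Ps2)" for x y p
    using that
  proof (induction p arbitrary: x)
    case Nil then show ?case by (simp add: refine_def)
  next
    case (Cons a p)
    obtain e J where eJ: "a = (e, J)" by (cases a)
    have e: "e \<in> (if \<beta>2 J = 1 then Fwd else Bwd) ` {..<m}" using arc2[of e J] Cons.prems eJ by simp
    have F: "walk as (origin as1 (Fwd j)) (?t (Fwd j)) (terminus as1 (Fwd j))" if "j < m" for j
      using L1(4)[OF that] by (simp add: terminus_def m_def)
    have "walk as (origin as1 e) (?t e) (terminus as1 e)"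
    proof -
      from e obtain j where j: "j < m" "e = Fwd j \<or> e = Bwd j" by (auto split: if_splits)
      show ?thesis using j(2)
      proof
        assume "e = Fwd j" then show ?thesis using F[OF j(1)] by simp
      next
        assume "e = Bwd j"
        then show ?thesis using walk_rev[OF F[OF j(1)]] unfolding \<open>e = Bwd j\<close> edge_to_trail_Bwd by (simp add: terminus_def)
      qed
    qed
    from walk_lift[OF this, of J] have "walk as (src as1 a) (?x a) (dst as1 a)" by (simp add: eJ src_def dst_def)
    moreover have "walk as (dst as1 a) (refine Ps1 p) y" "src as1 a = x" using Cons by auto
    ultimately show ?case by (auto simp: refine_def walk_append)
  qed
  show "euler_partition (n2 + n) as as2 \<beta> (map (refine Ps1) Ps2)"
    unfolding euler_partition_def
  proof (intro conjI allI impI)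
    show "length (map (refine Ps1) Ps2) = length as2" using L2(1) len by (simp add: m_def)
    show "distinct (concat (map (refine Ps1) Ps2))"
      unfolding distinct_concat_nth length_map L2(1)
    proof (intro conjI allI impI)
      show "distinct (map (refine Ps1) Ps2 ! j)" if "j < m" for j
        using that L2(1) distinct_refine[OF dist2(1)[OF that] sub2[OF that]] by simp
      show "set (map (refine Ps1) Ps2 ! i) \<inter> set (map (refine Ps1) Ps2 ! j) = {}" if ij: "i < m" "j < m" "i \<noteq> j" for i j
      proof -
        have "set (?x a) \<inter> set (?x b) = {}" if "a \<in> set (Ps2 ! i)" "b \<in> set (Ps2 ! j)" for a b
          using x_disjoint[of a b] that sub2[OF ij(1)] sub2[OF ij(2)] dist2(2)[OF ij(2,1,3)] by blast
        then have "set (refine Ps1 (Ps2 ! i)) \<inter> set (refine Ps1 (Ps2 ! j)) = {}"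
          unfolding set_refine set_map by (rule UN_disjointI)
        then show ?thesis using ij L2(1) by simp
      qed
    qed
    have "set (concat (map (refine Ps1) Ps2)) = (\<Union>a\<in>set (concat Ps2). lift_arc (snd a) ` set (?t (fst a)))"
      using set_refine by auto
    also have "\<dots> = (\<Union>J\<in>words N n2. lift_arc J ` (\<Union>e\<in>set (Lambda_pow as1 (\<beta>2 J)). set (?t e)))"
      unfolding L2(3) cell_edges_def by fastforce
    also have "\<dots> = (\<Union>J\<in>words N n2. \<Union>I\<in>words N n. cell_edges as (\<beta>2 J * \<beta>1 I) (J @ I))"
      unfolding t_set[OF \<beta>(2)] image_UN lift_cell_edges ..
    also have "\<dots> = (\<Union>J\<in>words N n2. \<Union>I\<in>words N n. cell_edges as (\<beta> (J @ I)) (J @ I))"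
      using \<beta>app by simp
    also have "\<dots> = (\<Union>L\<in>words N (n2 + n). cell_edges as (\<beta> L) L)"
      unfolding words_append by auto
    finally show "set (concat (map (refine Ps1) Ps2)) = (\<Union>L\<in>words N (n2 + n). cell_edges as (\<beta> L) L)" .
    show "walk as (as2 ! j) (map (refine Ps1) Ps2 ! j) (as2 ! (Suc j mod length as2))" if "j < length as2" for j
      using walk_refine[OF L2(4) sub2] that len L2(1) by (simp add: m_def)
  qed
  show "J \<in> words N n2 \<and> cell_edges as (\<beta> (J @ I)) (J @ I) \<subseteq> set (map (refine Ps1) Ps2 ! j)"
    if j: "j < length as2" and I: "I \<in> words N n" and k: "k < length as1" and pure: "cell_edges as (\<beta>1 I) I \<subseteq> set (Ps1 ! k)"
      and mem: "(Fwd k, J) \<in> set (Ps2 ! j) \<or> (Bwd k, J) \<in> set (Ps2 ! j)" for I j J k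
  proof -
    have j': "j < m" using j len by (simp add: m_def)
    obtain e where e: "(e, J) \<in> set (Ps2 ! j)" "e = Fwd k \<or> e = Bwd k" using mem by blast
    have a: "J \<in> words N n2" "e \<in> (if \<beta>2 J = 1 then Fwd else Bwd) ` {..<m}" using arc2[of e J] subsetD[OF sub2[OF j'] e(1)] by blast+
    have "cell_edges as (\<beta>2 J * \<beta>1 I) I \<subseteq> set (?t e)"
      using e(2)
    proof
      assume ek: "e = Fwd k"
      then have "\<beta>2 J = 1" using a(2) by (auto split: if_splits)
      then show ?thesis using pure ek by simp
    next
      assume ek: "e = Bwd k"
      then have "\<beta>2 J \<noteq> 1" using a(2) by (auto split: if_splits)
      then have "\<beta>2 J = -1" using \<beta>(2)[of J] by auto
      moreover have "rev_arc ` cell_edges as (\<beta>1 I) I \<subseteq> rev_arc ` set (?t (Fwd k))" using pure by (intro image_mono) simp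
      ultimately show ?thesis using cell_edges_uminus[OF \<beta>(1), of as I I] t_rev[of "Fwd k"] ek
        by (simp del: edge_to_trail.simps)
    qed
    then have "lift_arc J ` cell_edges as (\<beta>2 J * \<beta>1 I) I \<subseteq> lift_arc J ` set (?t e)" by (rule image_mono)
    then have "cell_edges as (\<beta> (J @ I)) (J @ I) \<subseteq> lift_arc J ` set (?t e)"
      unfolding lift_cell_edges \<beta>app[OF a(1)] .
    also have "\<dots> \<subseteq> set (refine Ps1 (Ps2 ! j))" unfolding set_refine using e(1) by force
    finally show ?thesis using a(1) j' L2(1) by simp
  qed
qed

text \<open>The enumeration \<open>as\<close> is used in the cells, and the edges of \<open>as'\<close> are subdivided. An
  enumeration in this relation to itself gives a consistent Euler-partition.\<close>

definition pure_step :: "'a list \<Rightarrow> 'a list \<Rightarrow> bool" where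
  "pure_step as as' \<longleftrightarrow> (\<exists>n\<ge>1. \<exists>\<beta> Ps. euler_partition n as as' \<beta> Ps \<and> (\<forall>I. \<beta> I \<in> {-1, 1}) \<and>
     (\<forall>j<length as'. \<exists>I\<in>words N n. cell_edges as (\<beta> I) I \<subseteq> set (Ps ! j)))"

lemma cell_edges_0: "0 < length as \<Longrightarrow> (Fwd 0, I) \<in> cell_edges as b I \<or> (Bwd 0, I) \<in> cell_edges as b I"
  by (auto simp: cell_edges_def set_Lambda_pow)

lemma pm_one_mult: "(a::int) \<in> {-1, 1} \<Longrightarrow> b \<in> {-1, 1} \<Longrightarrow> a * b \<in> {-1, 1}" by auto

lemma append_words: "J \<in> words N k \<Longrightarrow> I \<in> words N n \<Longrightarrow> J @ I \<in> words N (k + n)" by (simp add: words_def)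

lemma pure_step_trans:
  assumes 1: "pure_step as as1" and 2: "pure_step as1 as2" and len: "length as2 = length as1" "0 < length as1"
  shows "pure_step as as2"
proof -
  obtain n \<beta>1 Ps1 where P1: "1 \<le> n" "euler_partition n as as1 \<beta>1 Ps1" "\<forall>I. \<beta>1 I \<in> {-1, 1}"
     "\<forall>j<length as1. \<exists>I\<in>words N n. cell_edges as (\<beta>1 I) I \<subseteq> set (Ps1 ! j)" using 1 unfolding pure_step_def by blast
  obtain n2 \<beta>2 Ps2 where P2: "1 \<le> n2" "euler_partition n2 as1 as2 \<beta>2 Ps2" "\<forall>I. \<beta>2 I \<in> {-1, 1}"
     "\<forall>j<length as2. \<exists>I\<in>words N n2. cell_edges as1 (\<beta>2 I) I \<subseteq> set (Ps2 ! j)" using 2 unfolding pure_step_def by blast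
  note C = euler_partition_compose[OF P1(2) P2(2) len P1(3)[rule_format] P2(3)[rule_format]]
  obtain I where I: "I \<in> words N n" "cell_edges as (\<beta>1 I) I \<subseteq> set (Ps1 ! 0)" using P1(4) len(2) by blast
  have "\<exists>L\<in>words N (n2 + n). cell_edges as (\<beta>2 (take n2 L) * \<beta>1 (drop n2 L)) L \<subseteq> set (map (refine Ps1) Ps2 ! j)" if j: "j < length as2" for j
  proof -
    obtain J where "cell_edges as1 (\<beta>2 J) J \<subseteq> set (Ps2 ! j)" using P2(4) j by blast
    then have "(Fwd 0, J) \<in> set (Ps2 ! j) \<or> (Bwd 0, J) \<in> set (Ps2 ! j)" using cell_edges_0[OF len(2), of J "\<beta>2 J"] by blast
    from C(2)[OF j I(1) len(2) I(2) this] show ?thesis using append_words I(1) by blast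
  qed
  moreover have "\<forall>L. \<beta>2 (take n2 L) * \<beta>1 (drop n2 L) \<in> {-1, 1}" using pm_one_mult P1(3) P2(3) by blast
  moreover have "1 \<le> n2 + n" using P1(1) by simp
  ultimately show ?thesis unfolding pure_step_def using C(1) by blast
qed

end

context skeleton_ifs
begin

text \<open>The trail that contains a complete cell in a first partition is known only after this
  partition is chosen; a second partition then meets the edge of this trail in all its trails.\<close>

lemma pure_step_exists:
  assumes as: "distinct as" "set as = A" "2 \<le> length as" and rem: "removable n0 I0" "1 \<le> n0"
  shows "\<exists>as2. distinct as2 \<and> set as2 = A \<and> pure_step as as2"
proof -
  have l0: "0 < length as" using as(3) by linarith
  have len_eq: "length bs = length as" if "distinct bs" "set bs = A" for bs
    using that as(1,2) distinct_card by metis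
  obtain n as1 \<beta>1 Ps1 where P1: "1 \<le> n" "distinct as1" "set as1 = A" "euler_partition n as as1 \<beta>1 Ps1" "\<forall>I. \<beta>1 I \<in> {-1, 1}"
     "\<exists>j<length as. \<exists>I\<in>words N n. cell_edges as (\<beta>1 I) I \<subseteq> set (Ps1 ! j)"
    using hitting_partition[OF as l0 rem] by blast
  obtain k I where k: "k < length as" "I \<in> words N n" "cell_edges as (\<beta>1 I) I \<subseteq> set (Ps1 ! k)" using P1(6) by blast
  have len1: "length as1 = length as" using len_eq P1(2,3) by blast
  obtain n2 as2 \<beta>2 Ps2 where P2: "1 \<le> n2" "distinct as2" "set as2 = A" "euler_partition n2 as1 as2 \<beta>2 Ps2" "\<forall>I. \<beta>2 I \<in> {-1, 1}"
     "\<forall>j<length as1. \<exists>I\<in>words N n2. (Fwd k, I) \<in> set (Ps2 ! j) \<or> (Bwd k, I) \<in> set (Ps2 ! j)"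
    using hitting_partition[OF P1(2,3) _ _ rem, of k] as(3) k(1) unfolding len1 by blast
  have len2: "length as2 = length as1" using len_eq P2(2,3) len1 by simp
  have k1: "k < length as1" "0 < length as1" using k(1) len1 by auto
  note C = euler_partition_compose[OF P1(4) P2(4) len2 k1(2) P1(5)[rule_format] P2(5)[rule_format]]
  have "\<exists>L\<in>words N (n2 + n). cell_edges as (\<beta>2 (take n2 L) * \<beta>1 (drop n2 L)) L \<subseteq> set (map (refine Ps1) Ps2 ! j)" if j: "j < length as2" for j
  proof -
    obtain J where "(Fwd k, J) \<in> set (Ps2 ! j) \<or> (Bwd k, J) \<in> set (Ps2 ! j)" using P2(6) j len2 by auto
    from C(2)[OF j k(2) k1(1) k(3) this] show ?thesis using append_words k(2) by blast
  qed
  moreover have "\<forall>L. \<beta>2 (take n2 L) * \<beta>1 (drop n2 L) \<in> {-1, 1}" using pm_one_mult P1(5) P2(5) by blast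
  moreover have "1 \<le> n2 + n" using P1(1) by simp
  ultimately have "pure_step as as2" unfolding pure_step_def using C(1) by blast
  then show ?thesis using P2(2,3) by blast
qed

lemma self_pure_step_exists:
  assumes card: "2 \<le> card A" and rem: "removable n0 I0" "1 \<le> n0"
  shows "\<exists>as. distinct as \<and> set as = A \<and> pure_step as as"
proof -
  define X where "X = {as. distinct as \<and> set as = A}"
  have len: "length as = card A" if "as \<in> X" for as using that distinct_card by (force simp: X_def)
  have "X \<subseteq> {as. set as \<subseteq> A \<and> length as = card A}" using len by (auto simp: X_def)
  then have "finite X" using finite_lists_length_eq[OF A(1)] finite_subset by blast
  moreover have "X \<noteq> {}" using finite_distinct_list[OF A(1)] by (auto simp: X_def)
  ultimately have "\<exists>as\<in>X. pure_step as as"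
  proof (rule transitive_serial_finite_reflexive_point[where R = pure_step])
    show "pure_step as as2" if "as \<in> X" "as1 \<in> X" "as2 \<in> X" "pure_step as as1" "pure_step as1 as2" for as as1 as2
      using pure_step_trans[OF that(4,5)] len that card by simp
    show "\<exists>as2\<in>X. pure_step as as2" if "as \<in> X" for as
      using pure_step_exists[of as n0 I0] that len[OF that] card rem unfolding X_def by simp
  qed
  then show ?thesis by (auto simp: X_def)
qed

text \<open>All cells contain the only point of \<open>A\<close>, which is therefore fixed by all maps; the zipper is
  constant.\<close>

lemma singleton_skeleton_zipper:
  assumes "card A \<le> 1"
  shows "self_similar_zipper N (\<lambda>j. S (id j))"
proof -
  have "N \<in> {1..N} - {1}" "1 \<in> {1..N}" using N_ge_2 by simp_all
  then have N1: "{1} \<subseteq> {1..N}" "{1} \<noteq> {1..N}" by blast+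
  obtain y where "meets [1] [y]" using cut_connectedD[OF letters_connected N1] by blast
  then have "A \<noteq> {}" by (auto simp: meets_def)
  then have "card A = 1" using assms A(1) by (metis card_0_eq le_antisym le_zero_eq less_one linorder_not_less)
  then obtain a where a: "A = {a}" by (auto simp: card_1_singleton_iff)
  obtain j where j: "j \<in> {1..N}" "a = S j a" using A(3) a by auto
  define U where "U = {i\<in>{1..N}. S i a = a}"
  have "U = {1..N}"
  proof (rule ccontr)
    assume "U \<noteq> {1..N}"
    moreover have "U \<subseteq> {1..N}" "U \<noteq> {}" using j by (auto simp: U_def)
    ultimately obtain x y where "x \<in> U" "y \<in> {1..N} - U" "meets [x] [y]" using cut_connectedD[OF letters_connected, of U] by blast
    moreover from \<open>meets [x] [y]\<close> have "word_map S [x] ` A \<inter> word_map S [y] ` A \<noteq> {}" unfolding meets_def .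
    ultimately show False by (auto simp: U_def a)
  qed
  then have "\<forall>j\<in>{1..N}. S j a = a" by (auto simp: U_def)
  then show ?thesis unfolding self_similar_zipper_def by (intro exI[of _ "\<lambda>_. a"] exI[of _ "\<lambda>_. 1"]) simp
qed

end

section \<open>The theorem\<close>

theorem theorem1p4:
  fixes S :: "nat \<Rightarrow> 'a::euclidean_space \<Rightarrow> 'a" and N :: nat and K :: "'a set"
  assumes "ifs N S"
    and "invariant_set N S K"
    and "\<exists>A. skeleton N S K A"
    and "open_set_condition N S"
  shows "(\<exists>\<psi>. optimal_parametrization (hausdorff_dim K) K \<psi>) \<and>
         ((\<exists>\<sigma>. \<sigma> permutes {1..N} \<and> self_similar_zipper N (\<lambda>j. S (\<sigma> j))) \<or>
          euler_tour_space_filling N S K)"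
proof -
  obtain A where A: "skeleton N S K A" using assms(3) by blast
  interpret osc: osc_attractor N S K by unfold_locales (use assms in auto)
  interpret sk: skeleton_ifs N S K A by unfold_locales (use A in auto)
  have zipper: ?thesis if "\<exists>\<sigma>. \<sigma> permutes {1..N} \<and> self_similar_zipper N (\<lambda>j. S (\<sigma> j))"
    using osc.zipper_parametrization that by blast
  show ?thesis
  proof (cases "2 \<le> card A")
    case False
    then have "self_similar_zipper N (\<lambda>j. S (id j))" by (intro sk.singleton_skeleton_zipper) auto
    then show ?thesis using zipper permutes_id by blast
  next
    case True
    show ?thesis
    proof (cases "\<exists>n I. 1 \<le> n \<and> sk.removable n I")
      case False
      then show ?thesis using zipper sk.zipper_of_no_removable by blast
    next
      case rem: True
      then obtain as where as: "distinct as" "set as = A" "osc.pure_step as as"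
        using sk.self_pure_step_exists[OF True] by blast
      obtain n \<beta> Ps where P: "1 \<le> n" "osc.euler_partition n as as \<beta> Ps" "\<forall>I. \<beta> I \<in> {-1, 1}"
        "\<forall>j<length as. \<exists>I\<in>words N n. osc.cell_edges as (\<beta> I) I \<subseteq> set (Ps ! j)"
        using as(3) unfolding osc.pure_step_def by blast
      have len: "2 \<le> length as" using True as distinct_card by metis
      interpret es: euler_system N S K as n \<beta> Ps by unfold_locales (use P as len in auto)
      have "consistent_euler_partition N S n as \<beta> Ps"
      proof (rule osc.euler_partition_imp_consistent[OF P(2)])
        show "as \<noteq> []" by (rule es.as_nonempty)
        show "Ps ! j \<noteq> []" if "j < length as" for j using es.length_Ps[OF that] by auto
      qed
      then have "euler_tour_space_filling N S K"
        unfolding euler_tour_space_filling_def using as A P(1,3) es.leads_to_curve(1)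
        by (intro exI[of _ as] exI[of _ n] exI[of _ \<beta>] exI[of _ Ps]) auto
      then show ?thesis using es.leads_to_curve(2) by blast
    qed
  qed
qed

end
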